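(* Consider a punctured spin triangulated surface with edge signs $s(e)$. Let $v$ be an inner vertex and let $\sigma_0,\dots,\sigma_{N-1}$ be the triangles containing $v$, ordered counterclockwise around $v$ starting with an arbitrary triangle $\sigma_0$; for $i\in\mathbb Z_N$ let $e_{i,i+1}=\sigma_i\cap\sigma_{i+1}$ be the common edge and $s_{i,i+1}=s(e_{i,i+1})$. Let $D$ be the number of $i\in\mathbb Z_N$ with $d^2_0(\sigma_i)=e_{i-1,i}$, and let $K$ be the number of edges $e_{i,i+1}$ pointing away from $v$. Then the spin structure extends to $v$ if and only if $$\prod_{i\in\mathbb Z_N}s_{i,i+1}=(-1)^{D+K+1}.$$
   Context: **Spin structures.** Surfaces are oriented smooth 2-manifolds, possibly with boundary; maps between surfaces are smooth and orientation preserving. $GL_2^+$ denotes the real $2\times2$ matrices with positive determinant, acting on the upper half plane $\mathbb H$ by Möbius transformations $g.z$. $\widetilde{GL}$ is the group of pairs $(g,\epsilon)$ with $g=\begin{pmatrix}a&b\\c&d\end{pmatrix}\in GL_2^+$ and $\epsilon:\mathbb H\to\mathbb C$ holomorphic with $\epsilon(z)^2=cz+d$, with product $(g_1,\epsilon_1)(g_2,\epsilon_2)=(g_1g_2,\,z\mapsto\epsilon_1(g_2.z)\epsilon_2(z))$; $p_{GL}:(g,\epsilon)\mapsto g$ is the nontrivial double cover of $GL_2^+$. Regard $\mathbb C^\times\subset GL_2^+$ via $z\mapsto\begin{pmatrix}\mathrm{Re}\,z&-\mathrm{Im}\,z\\ \mathrm{Im}\,z&\mathrm{Re}\,z\end{pmatrix}$,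 and let $\delta:\mathbb C^\times\to\widetilde{GL}$ be the homomorphism $\delta(z)=(z^2,\epsilon_z)$ with $\epsilon_z(i)=z$. A spin structure on a surface $\Sigma$ is a principal $\widetilde{GL}$-bundle $P\to\Sigma$ with a map $p$ over $\Sigma$ from $P$ to the bundle of oriented frames, compatible with the right actions via $p_{GL}$. A spin lift of a map $f$ between surfaces with spin structure is a map of $\widetilde{GL}$-bundles lying over the map of frame bundles induced by $df$. $\mathbb C^{NS}$ is $\mathbb C\times\widetilde{GL}$ over $\mathbb C$ with $p(z,g)=(z,p_{GL}(g))$; $\mathbb C^R$ is $\mathbb C^\times\times\widetilde{GL}$ over $\mathbb C^\times$ with $p(z,g)=(z,z\,p_{GL}(g))$ (frames are identified with matrices via columns). **$\widetilde{QR}$-decomposition.** Each $g\in\widetilde{GL}$ is uniquely $g=\tilde{\mathbf Q}(g)\tilde{\mathbf R}(g)$ with $\tilde{\mathbf Q}(g)\in\delta(\{|z|=1\})$ and $\tilde{\mathbf R}(g)\in\{(\begin{pmatrix}a&b\\0&c\end{pmatrix},\sqrt c): a,c>0\}$. For $|\alpha|=1$ set $\tilde{\mathbf Q}_\alpha(g)=\tilde{\mathbf Q}(\tilde\alpha^{-1}g\tilde\alpha)$, $\tilde\alpha\in\widetilde{GL}$ any lift of $\alpha$. **Marked triangulated surfaces.** Let $\zeta=e^{2\pi i/3}$. The standard triangle $\underline\Delta\subset\mathbb C$ is the convex hull of $1,\zeta,\zeta^2$; its edges $0,1,2$ are $\{1,\zeta\},\{\zeta,\zeta^2\},\{\zeta^2,1\}$.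 A surface with parametrised boundary is a compact surface $\Sigma$ with orientation preserving embeddings $\varphi_i:U_i\to\Sigma$ ($i=1,\dots,B$), $U_i=\{1\le|z|<R_i\}$, with disjoint images and such that the $\varphi_i(S^1)$ are the boundary components. A triangulated surface is such a $(\Sigma,\varphi_i)$ with: a finite oriented simplicial complex $\mathcal C$ with $|\mathcal C|$ a 2-manifold (vertices $\mathcal C_0$); simplicial embeddings $f_i:\partial\underline\Delta\to\partial\mathcal C$ with $\partial\mathcal C=\bigsqcup_i f_i(\partial\underline\Delta)$, sending the counterclockwise orientation of $\partial\underline\Delta$ to the opposite of the boundary orientation induced by the adjacent triangles; and an orientation preserving homeomorphism $\varphi:|\mathcal C|\to\Sigma$, a smooth embedding on each simplex, with $\varphi\circ f_i=\varphi_i\circ(z\mapsto z/|z|)$. A marking is a choice, for each edge $e$, of an orientation (from $d^1_0(e)$ to $d^1_1(e)$), and, for each triangle $\sigma$, of a preferred edge $d^2_0(\sigma)$; $d^2_1(\sigma),d^2_2(\sigma)$ are the following edges in counterclockwise order; boundary edges must be oriented so that the adjacent triangle is to their right. $\chi_\sigma:\underline\Delta\to\Sigma$ is $\varphi$ composed with the orientation preserving affine isomorphism $\underline\Delta\to\sigma$ sending edge $0$ to $d^2_0(\sigma)$. A vertex is inner if it does not lie on the boundary. **Punctured spin triangulated surfaces.** Let $\Sigma^+$ be $\Sigma$ with collars $\{r<|z|\le1\}$ ($0<r<1$ fixed) attached along the $\varphi_i$. A punctured spin triangulated surface is a marked triangulated surface together with: a type $\delta_i\in\{NS,R\}$ for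 each $i$; a spin structure on $\Sigma^+\setminus\varphi(\mathcal C_0)$ which on the $i$-th attached collar minus $\{1,\zeta,\zeta^2\}$ equals the restriction of $\mathbb C^{\delta_i}$ (giving a tautological spin lift $\tilde\varphi_i$ of $\varphi_i$ there); and a spin lift $\tilde\chi_\sigma$, defined on $\mathbb C^{NS}|_{\underline\Delta\setminus\{1,\zeta,\zeta^2\}}$, of $\chi_\sigma$ for each triangle $\sigma$. The spin structure extends to a vertex $v$ if it is the restriction of a spin structure on $(\Sigma^+\setminus\varphi(\mathcal C_0))\cup\{v\}$. **Edge signs.** For an inner edge $e$ let $\sigma_L,\sigma_R$ be the triangles to its left and right and $e=d^2_{k_L}(\sigma_L)=d^2_{k_R}(\sigma_R)$; put $\alpha=e^{2\pi i(k_R/3+5/12)}$. For a non-vertex point $p$ on the $k_R$-th edge of $\underline\Delta$ write $\tilde\chi_{\sigma_L}^{-1}\tilde\chi_{\sigma_R}(p,g)=(p',g_p g)$; then $s(e)\in\{\pm1\}$ is defined by $\delta(s(e))=\tilde{\mathbf Q}_\alpha(g_p)\,\delta(e^{-\pi i(k_L/3-k_R/3+1/2)})$ (independent of $p$). (All edges at an inner vertex are inner.) *)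

theory Defs
  imports "HOL-Analysis.Analysis" "HOL-Algebra.Group"
begin

section \<open>Smooth maps between subsets of the plane\<close>

text \<open>The plane is the type \<^typ>\<open>complex\<close>, regarded as a real vector space. \<open>Ck_on\<close> is meant
  for open sets; on an arbitrary set, smooth means locally extendable to a smooth map on an open
  set, as is usual for manifolds with boundary or corners.\<close>

primrec Ck_on :: "nat \<Rightarrow> complex set \<Rightarrow> (complex \<Rightarrow> complex) \<Rightarrow> bool" where
  "Ck_on 0 S f \<longleftrightarrow> continuous_on S f"
| "Ck_on (Suc k) S f \<longleftrightarrow> (\<forall>x\<in>S. f differentiable (at x)) \<and>
     (\<forall>v. Ck_on k S (\<lambda>x. frechet_derivative f (at x) v))"

definition smooth_map_on :: "complex set \<Rightarrow> (complex \<Rightarrow> complex) \<Rightarrow> bool" where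
  "smooth_map_on S f \<longleftrightarrow>
     (\<forall>x\<in>S. \<exists>W g. open W \<and> x \<in> W \<and> (\<forall>k. Ck_on k W g) \<and> (\<forall>y\<in>S \<inter> W. g y = f y))"

text \<open>The Jacobian matrix at a point of a set \<open>S\<close>. It is only used for sets that are
  contained in the closure of their interior and locally convex (up to diffeomorphism), where
  the derivative within \<open>S\<close> is unique.\<close>

definition jac :: "(complex \<Rightarrow> complex) \<Rightarrow> complex set \<Rightarrow> complex \<Rightarrow> real^2^2" where
  "jac f S z = (let L = frechet_derivative f (at z within S)
     in vector [vector [Re (L 1), Re (L \<i>)], vector [Im (L 1), Im (L \<i>)]])"


section \<open>Oriented smooth surfaces with boundary\<close>

text \<open>A surface is given by an oriented atlas. A chart is a pair of its domain and the coordinate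
  map, whose values outside the domain are irrelevant.\<close>

type_synonym 'a chart = "'a set \<times> ('a \<Rightarrow> complex)"

definition surf_carrier :: "'a chart set \<Rightarrow> 'a set" where
  "surf_carrier A = (\<Union>c\<in>A. fst c)"

definition surf_top :: "'a chart set \<Rightarrow> 'a topology" where
  "surf_top A = topology_generated_by {fst c \<inter> snd c -` V | c V. c \<in> A \<and> open V}"

definition transition :: "'a chart \<Rightarrow> 'a chart \<Rightarrow> complex \<Rightarrow> complex" where
  "transition c c' z = snd c' (inv_into (fst c) (snd c) z)"

definition overlap :: "'a chart \<Rightarrow> 'a chart \<Rightarrow> complex set" where
  "overlap c c' = snd c ` (fst c \<inter> fst c')"

definition closed_half_plane :: "complex set" where
  "closed_half_plane = {z. 0 \<le> Im z}"

definition oriented_surface :: "'a chart set \<Rightarrow> bool" where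
  "oriented_surface A \<longleftrightarrow>
     (\<forall>c\<in>A. inj_on (snd c) (fst c) \<and>
        (open (snd c ` fst c) \<or> openin (top_of_set closed_half_plane) (snd c ` fst c))) \<and>
     (\<forall>c\<in>A. \<forall>c'\<in>A. openin (top_of_set (snd c ` fst c)) (overlap c c') \<and>
        smooth_map_on (overlap c c') (transition c c') \<and>
        (\<forall>z\<in>overlap c c'. 0 < det (jac (transition c c') (overlap c c') z))) \<and>
     Hausdorff_space (surf_top A) \<and> second_countable (surf_top A)"

definition surf_boundary :: "'a chart set \<Rightarrow> 'a set" where
  "surf_boundary A = {x. \<exists>c\<in>A. x \<in> fst c \<and> snd c x \<notin> interior (snd c ` fst c)}"

definition oriented_smooth_embedding ::
    "complex set \<Rightarrow> 'a chart set \<Rightarrow> (complex \<Rightarrow> 'a) \<Rightarrow> bool" where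
  "oriented_smooth_embedding D A f \<longleftrightarrow>
     embedding_map (top_of_set D) (surf_top A) f \<and>
     (\<forall>c\<in>A. smooth_map_on {z \<in> D. f z \<in> fst c} (snd c \<circ> f) \<and>
        (\<forall>z\<in>D. f z \<in> fst c \<longrightarrow> 0 < det (jac (snd c \<circ> f) D z)))"

text \<open>An oriented frame at \<open>x\<close> is given by its coordinate matrices (the columns are the frame
  vectors) in all charts at \<open>x\<close>; the value 0 at the other charts makes this unique.\<close>

definition oriented_frame :: "'a chart set \<Rightarrow> 'a \<Rightarrow> ('a chart \<Rightarrow> real^2^2) \<Rightarrow> bool" where
  "oriented_frame A x F \<longleftrightarrow>
     (\<forall>c\<in>A. x \<in> fst c \<longrightarrow> 0 < det (F c)) \<and>
     (\<forall>c\<in>A. \<forall>c'\<in>A. x \<in> fst c \<and> x \<in> fst c' \<longrightarrow>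
        F c' = jac (transition c c') (overlap c c') (snd c x) ** F c) \<and>
     (\<forall>c. \<not> (c \<in> A \<and> x \<in> fst c) \<longrightarrow> F c = 0)"

text \<open>The image under the differential of \<open>f\<close> of the frame of the plane with matrix \<open>M\<close> at \<open>z\<close>.\<close>

definition push_frame ::
    "'a chart set \<Rightarrow> complex set \<Rightarrow> (complex \<Rightarrow> 'a) \<Rightarrow> complex \<Rightarrow> real^2^2 \<Rightarrow> 'a chart \<Rightarrow> real^2^2" where
  "push_frame A D f z M c = (if c \<in> A \<and> f z \<in> fst c then jac (snd c \<circ> f) D z ** M else 0)"


section \<open>The double cover of \<open>GL\<^sub>2\<^sup>+\<close>\<close>

definition upper_half_plane :: "complex set" where
  "upper_half_plane = {z. 0 < Im z}"

definition aut_factor :: "real^2^2 \<Rightarrow> complex \<Rightarrow> complex" where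
  "aut_factor g z = of_real (g $ 2 $ 1) * z + of_real (g $ 2 $ 2)"

definition moebius_act :: "real^2^2 \<Rightarrow> complex \<Rightarrow> complex" where
  "moebius_act g z = (of_real (g $ 1 $ 1) * z + of_real (g $ 1 $ 2)) / aut_factor g z"

type_synonym gl = "(real^2^2) \<times> (complex \<Rightarrow> complex)"

text \<open>Functions on the upper half plane are represented by extensional functions.\<close>

definition GLt :: "gl monoid" where
  "GLt = \<lparr> carrier = {(g, e). 0 < det g \<and> e \<in> extensional upper_half_plane \<and>
              e holomorphic_on upper_half_plane \<and> (\<forall>z\<in>upper_half_plane. (e z)\<^sup>2 = aut_factor g z)},
           mult = (\<lambda>(g1, e1) (g2, e2).
              (g1 ** g2, \<lambda>z\<in>upper_half_plane. e1 (moebius_act g2 z) * e2 z)),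
           one = (mat 1, \<lambda>z\<in>upper_half_plane. 1) \<rparr>"

lemma aut_factor_nonzero: assumes "det g > 0" "z \<in> upper_half_plane" shows "aut_factor g z \<noteq> 0"
  using assms by (auto simp: aut_factor_def upper_half_plane_def det_2 complex_eq_iff)

lemma aut_factor_mult: assumes "det g2 > 0" "z \<in> upper_half_plane"
  shows "aut_factor (g1 ** g2) z = aut_factor g1 (moebius_act g2 z) * aut_factor g2 z"
  using aut_factor_nonzero[OF assms] unfolding moebius_act_def aut_factor_def
  by (simp add: matrix_matrix_mult_def sum_2 field_simps)

lemma moebius_act_mult: assumes "det g1 > 0" "det g2 > 0" "z \<in> upper_half_plane" "moebius_act g2 z \<in> upper_half_plane"
  shows "moebius_act (g1 ** g2) z = moebius_act g1 (moebius_act g2 z)"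
  using aut_factor_nonzero[OF assms(2,3)] aut_factor_nonzero[OF assms(1,4)] aut_factor_mult[OF assms(2,3), of g1]
  unfolding moebius_act_def[of "g1**g2"] moebius_act_def[of g1]
  by (simp add: matrix_matrix_mult_def sum_2 field_simps moebius_act_def[of g2])
    (simp add: aut_factor_def field_simps)

lemma moebius_act_in: assumes "det g > 0" "z \<in> upper_half_plane" shows "moebius_act g z \<in> upper_half_plane"
proof -
  let ?a = "g$1$1" and ?b = "g$1$2" and ?c = "g$2$1" and ?d = "g$2$2"
  have "Im (moebius_act g z) = (det g * Im z) / (cmod (aut_factor g z))^2"
    by (simp add: moebius_act_def Im_divide cmod_power2 det_2) (simp add: aut_factor_def algebra_simps)
  then show ?thesis using aut_factor_nonzero[OF assms] assms by (simp add: upper_half_plane_def)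
qed

lemma moebius_act_holomorphic: assumes "det g > 0" shows "moebius_act g holomorphic_on upper_half_plane"
  using aut_factor_nonzero[OF assms] unfolding moebius_act_def aut_factor_def by (intro holomorphic_intros) auto

lemma GLt_mult_closed: assumes "x \<in> carrier GLt" "y \<in> carrier GLt" shows "x \<otimes>\<^bsub>GLt\<^esub> y \<in> carrier GLt"
proof -
  obtain g1 e1 g2 e2 where xy: "x = (g1,e1)" "y = (g2,e2)" by force
  have h: "(\<lambda>z. e1 (moebius_act g2 z) * e2 z) holomorphic_on upper_half_plane"
    using assms moebius_act_holomorphic[of g2] moebius_act_in[of g2] unfolding xy GLt_def
    by (intro holomorphic_intros holomorphic_on_compose_gen[of "moebius_act g2" _ e1, unfolded o_def]) auto
  then have "(\<lambda>z\<in>upper_half_plane. e1 (moebius_act g2 z) * e2 z) holomorphic_on upper_half_plane"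
    by (rule holomorphic_transform) simp
  then show ?thesis using assms moebius_act_in[of g2] unfolding xy GLt_def
    by (auto simp: det_mul aut_factor_mult power_mult_distrib)
qed

lemma moebius_act_id: "moebius_act (mat 1) z = z" by (simp add: moebius_act_def aut_factor_def mat_def)

lemma GLt_inv: assumes "x \<in> carrier GLt" shows "\<exists>y\<in>carrier GLt. y \<otimes>\<^bsub>GLt\<^esub> x = \<one>\<^bsub>GLt\<^esub>"
proof -
  obtain g e where x: "x = (g,e)" by force
  have dg: "det g > 0" and e: "e \<in> extensional upper_half_plane" "e holomorphic_on upper_half_plane"
     "\<And>z. z \<in> upper_half_plane \<Longrightarrow> (e z)\<^sup>2 = aut_factor g z" using assms by (auto simp: x GLt_def)
  have "invertible g" using dg by (simp add: invertible_det_nz)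
  then obtain h where hg: "h ** g = mat 1" "g ** h = mat 1" unfolding invertible_def by blast
  have "det h * det g = 1" using hg(1) by (metis det_I det_mul)
  then have dh: "det h > 0" using dg by (metis zero_less_mult_pos2 zero_less_one)
  define f where "f = (\<lambda>z\<in>upper_half_plane. inverse (e (moebius_act h z)))"
  have enz: "e z \<noteq> 0" if "z \<in> upper_half_plane" for z using e(3)[OF that] aut_factor_nonzero[OF dg that] by auto
  have "(\<lambda>z. inverse (e (moebius_act h z))) holomorphic_on upper_half_plane"
    using e moebius_act_holomorphic[OF dh] moebius_act_in[OF dh] enz
    by (intro holomorphic_intros holomorphic_on_compose_gen[of "moebius_act h" _ e, unfolded o_def]) auto
  then have fh: "f holomorphic_on upper_half_plane" unfolding f_def by (rule holomorphic_transform) simp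
  have "(f z)^2 = aut_factor h z" if z: "z \<in> upper_half_plane" for z
  proof -
    have "aut_factor g (moebius_act h z) * aut_factor h z = 1"
      using aut_factor_mult[OF dh z, of g] hg by (simp add: aut_factor_def mat_def)
    then show ?thesis using z moebius_act_in[OF dh z] e(3) by (simp add: f_def power_inverse inverse_eq_iff_eq inverse_unique)
  qed
  then have fc: "(h,f) \<in> carrier GLt" using dh fh by (auto simp: GLt_def f_def)
  have "f (moebius_act g z) * e z = 1" if z: "z \<in> upper_half_plane" for z
    using moebius_act_in[OF dg z] enz[OF z] moebius_act_mult[OF dh dg z moebius_act_in[OF dg z]] hg moebius_act_id by (simp add: f_def)
  then have "(h,f) \<otimes>\<^bsub>GLt\<^esub> x = \<one>\<^bsub>GLt\<^esub>" by (auto simp: GLt_def x hg intro!: restrict_ext)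
  then show ?thesis using fc by blast
qed

lemma group_GLt: "group GLt"
proof (rule groupI)
  show "\<one>\<^bsub>GLt\<^esub> \<in> carrier GLt" 
  proof -
    have "(\<lambda>z\<in>upper_half_plane. 1::complex) holomorphic_on upper_half_plane"
      by (rule holomorphic_transform[of "\<lambda>_. 1"]) auto
    then show ?thesis by (auto simp: GLt_def aut_factor_def mat_def det_2)
  qed
  fix x y z assume "x \<in> carrier GLt" "y \<in> carrier GLt" "z \<in> carrier GLt"
  then show "x \<otimes>\<^bsub>GLt\<^esub> y \<otimes>\<^bsub>GLt\<^esub> z = x \<otimes>\<^bsub>GLt\<^esub> (y \<otimes>\<^bsub>GLt\<^esub> z)"
    using moebius_act_in by (auto simp: GLt_def matrix_mul_assoc moebius_act_mult fun_eq_iff)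
next
  fix x assume "x \<in> carrier GLt"
  then show "\<one>\<^bsub>GLt\<^esub> \<otimes>\<^bsub>GLt\<^esub> x = x"
    using moebius_act_in by (auto simp: GLt_def fun_eq_iff extensional_def)
qed (auto intro: GLt_mult_closed GLt_inv)

abbreviation p_GL :: "gl \<Rightarrow> real^2^2" where
  "p_GL \<equiv> fst"

text \<open>Since \<open>e\<close> is determined by \<open>g\<close> and \<open>e \<i>\<close>, this is the topology for which \<open>p_GL\<close> is a
  double covering.\<close>

definition GLt_top :: "gl topology" where
  "GLt_top = pullback_topology (carrier GLt) (\<lambda>(g, e). (g, e \<i>)) euclidean"

definition cmat :: "complex \<Rightarrow> real^2^2" where
  "cmat z = vector [vector [Re z, - Im z], vector [Im z, Re z]]"

definition \<delta> :: "complex \<Rightarrow> gl" where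
  "\<delta> z = (THE h. h \<in> carrier GLt \<and> fst h = cmat (z\<^sup>2) \<and> snd h \<i> = z)"

definition R_part :: "gl set" where
  "R_part = {(vector [vector [a, b], vector [0, c]],
              \<lambda>z\<in>upper_half_plane. of_real (sqrt c)) | a b c. 0 < a \<and> 0 < c}"

definition Qt :: "gl \<Rightarrow> gl" where
  "Qt g = (THE q. q \<in> \<delta> ` sphere 0 1 \<and> (\<exists>r\<in>R_part. g = q \<otimes>\<^bsub>GLt\<^esub> r))"

text \<open>The choice of the lift does not matter, as two lifts differ by a central element.\<close>

definition Qt_at :: "complex \<Rightarrow> gl \<Rightarrow> gl" where
  "Qt_at \<alpha> g = (let l = (SOME l. l \<in> carrier GLt \<and> p_GL l = cmat \<alpha>)
     in Qt (inv\<^bsub>GLt\<^esub> l \<otimes>\<^bsub>GLt\<^esub> g \<otimes>\<^bsub>GLt\<^esub> l))"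


section \<open>Spin structures\<close>

text \<open>The component \<open>framing\<close> is the map \<open>p\<close> to the frame bundle.\<close>

record ('p, 'a) spin_bundle =
  total_space :: "'p topology"
  proj :: "'p \<Rightarrow> 'a"
  act :: "'p \<Rightarrow> gl \<Rightarrow> 'p"
  framing :: "'p \<Rightarrow> 'a chart \<Rightarrow> real^2^2"

definition principal_GLt_bundle :: "'a topology \<Rightarrow> ('p, 'a) spin_bundle \<Rightarrow> bool" where
  "principal_GLt_bundle X P \<longleftrightarrow>
     continuous_map (total_space P) X (proj P) \<and>
     continuous_map (prod_topology (total_space P) GLt_top) (total_space P) (\<lambda>(u, g). act P u g) \<and>
     (\<forall>u\<in>topspace (total_space P). act P u \<one>\<^bsub>GLt\<^esub> = u \<and>
        (\<forall>g\<in>carrier GLt. proj P (act P u g) = proj P u \<and>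
           (\<forall>h\<in>carrier GLt. act P (act P u g) h = act P u (g \<otimes>\<^bsub>GLt\<^esub> h)))) \<and>
     (\<forall>x\<in>topspace X. \<exists>U \<tau>. openin X U \<and> x \<in> U \<and>
        homeomorphic_map (prod_topology (subtopology X U) GLt_top)
          (subtopology (total_space P) {u. proj P u \<in> U}) \<tau> \<and>
        (\<forall>y\<in>U. \<forall>g\<in>carrier GLt. proj P (\<tau> (y, g)) = y \<and>
           (\<forall>h\<in>carrier GLt. \<tau> (y, g \<otimes>\<^bsub>GLt\<^esub> h) = act P (\<tau> (y, g)) h)))"

text \<open>A spin structure on the open subset \<open>S\<close> of the surface with atlas \<open>A\<close>. Continuity of
  \<open>framing\<close> is expressed in the trivialisations of the frame bundle given by the charts.\<close>

definition spin_structure :: "'a chart set \<Rightarrow> 'a set \<Rightarrow> ('p, 'a) spin_bundle \<Rightarrow> bool" where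
  "spin_structure A S P \<longleftrightarrow>
     principal_GLt_bundle (subtopology (surf_top A) S) P \<and>
     (\<forall>u\<in>topspace (total_space P). oriented_frame A (proj P u) (framing P u) \<and>
        (\<forall>g\<in>carrier GLt. framing P (act P u g) =
           (\<lambda>c. framing P u c ** p_GL g))) \<and>
     (\<forall>c\<in>A. continuous_map (subtopology (total_space P) {u. proj P u \<in> fst c}) euclidean
        (\<lambda>u. framing P u c))"

text \<open>\<open>P\<close> is, up to isomorphism of spin structures, the restriction of \<open>Q\<close> to \<open>S\<close>.\<close>

definition spin_restriction ::
    "('p, 'a) spin_bundle \<Rightarrow> ('q, 'a) spin_bundle \<Rightarrow> 'a set \<Rightarrow> bool" where
  "spin_restriction P Q S \<longleftrightarrow>
     (\<exists>h. homeomorphic_map (total_space P) (subtopology (total_space Q) {u. proj Q u \<in> S}) h \<and>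
        (\<forall>u\<in>topspace (total_space P). proj Q (h u) = proj P u \<and> framing Q (h u) = framing P u \<and>
           (\<forall>g\<in>carrier GLt. h (act P u g) = act Q (h u) g)))"

text \<open>A spin structure on \<open>S\<close> extends to the point \<open>x\<close>. The total space of an extension consists
  of that of \<open>P\<close> and one more fibre, a torsor over \<open>GLt\<close>; so the type of the extended total
  space below is no restriction.\<close>

definition spin_extends_to :: "'a chart set \<Rightarrow> 'a set \<Rightarrow> ('p, 'a) spin_bundle \<Rightarrow> 'a \<Rightarrow> bool" where
  "spin_extends_to A S P x \<longleftrightarrow>
     (\<exists>Q :: ('p + gl, 'a) spin_bundle. spin_structure A (insert x S) Q \<and> spin_restriction P Q S)"

datatype spin_type = NS_type | R_type

text \<open>The map \<open>p\<close> of the spin structures \<open>\<complex>\<^sup>N\<^sup>S\<close> and \<open>\<complex>\<^sup>R\<close>, whose total spaces are the products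
  of \<open>\<complex>\<close> and of \<open>\<complex> - {0}\<close> with \<open>GLt\<close>.\<close>

fun model_frame :: "spin_type \<Rightarrow> complex \<Rightarrow> gl \<Rightarrow> real^2^2" where
  "model_frame NS_type z g = p_GL g"
| "model_frame R_type z g = cmat z ** p_GL g"

text \<open>\<open>ft\<close>, defined on the restriction of the model spin structure to \<open>D\<close>, is a spin lift of \<open>f\<close>.\<close>

definition spin_lift ::
    "'a chart set \<Rightarrow> ('p, 'a) spin_bundle \<Rightarrow> spin_type \<Rightarrow> complex set \<Rightarrow> (complex \<Rightarrow> 'a) \<Rightarrow>
     (complex \<times> gl \<Rightarrow> 'p) \<Rightarrow> bool" where
  "spin_lift A P t D f ft \<longleftrightarrow>
     continuous_map (prod_topology (top_of_set D) GLt_top) (total_space P) ft \<and>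
     (\<forall>z\<in>D. \<forall>g\<in>carrier GLt. proj P (ft (z, g)) = f z \<and>
        (\<forall>h\<in>carrier GLt. ft (z, g \<otimes>\<^bsub>GLt\<^esub> h) = act P (ft (z, g)) h) \<and>
        framing P (ft (z, g)) = push_frame A D f z (model_frame t z g))"


section \<open>Surfaces with parametrised boundary\<close>

text \<open>The boundary components are indexed by \<open>i < ncomp\<close>.\<close>

record 'a bordered_surface =
  atlas :: "'a chart set"
  ncomp :: nat
  outer_radius :: "nat \<Rightarrow> real"
  bparam :: "nat \<Rightarrow> complex \<Rightarrow> 'a"

definition half_annulus :: "real \<Rightarrow> complex set" where
  "half_annulus \<rho> = {z. 1 \<le> cmod z \<and> cmod z < \<rho>}"

definition surface_with_parametrised_boundary :: "('a, 'z) bordered_surface_scheme \<Rightarrow> bool" where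
  "surface_with_parametrised_boundary T \<longleftrightarrow>
     oriented_surface (atlas T) \<and> compact_space (surf_top (atlas T)) \<and>
     (\<forall>i<ncomp T. 1 < outer_radius T i \<and>
        oriented_smooth_embedding (half_annulus (outer_radius T i)) (atlas T) (bparam T i)) \<and>
     disjoint_family_on (\<lambda>i. bparam T i ` half_annulus (outer_radius T i)) {..<ncomp T} \<and>
     connected_components_of (subtopology (surf_top (atlas T)) (surf_boundary (atlas T))) =
       (\<lambda>i. bparam T i ` sphere 0 1) ` {..<ncomp T}"


section \<open>Triangulated surfaces\<close>

definition \<zeta> :: complex where
  "\<zeta> = cis (2 * pi / 3)"

definition std_triangle :: "complex set" where
  "std_triangle = convex hull {1, \<zeta>, \<zeta>\<^sup>2}"

text \<open>The \<open>k\<close>-th barycentric coordinate, i.e. the affine function with value 1 at \<open>\<zeta> ^ k\<close> and 0 at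
  the other two vertices of the standard triangle.\<close>

definition bary :: "nat \<Rightarrow> complex \<Rightarrow> real" where
  "bary k z = (1 + 2 * Re (z * cnj (\<zeta> ^ k))) / 3"

text \<open>The simplicial complex is abstract, with \<open>simplices\<close> the vertex sets of its simplices;
  points of its realisation are given by their barycentric coordinates. The orientation of a
  triangle \<open>s\<close> is the cyclic permutation \<open>nxt s\<close> of its vertices, counterclockwise. The \<open>i\<close>-th
  simplicial embedding of the boundary of the standard triangle sends \<open>\<zeta> ^ k\<close> to \<open>bvert i k\<close>,
  \<open>k < 3\<close>.\<close>

record ('a, 'v) triangulated_surface = "'a bordered_surface" +
  simplices :: "'v set set"
  nxt :: "'v set \<Rightarrow> 'v \<Rightarrow> 'v"
  bvert :: "nat \<Rightarrow> nat \<Rightarrow> 'v"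
  homeo :: "('v \<Rightarrow> real) \<Rightarrow> 'a"

definition vertices :: "('a, 'v, 'z) triangulated_surface_scheme \<Rightarrow> 'v set" where
  "vertices T = \<Union> (simplices T)"

definition edges :: "('a, 'v, 'z) triangulated_surface_scheme \<Rightarrow> 'v set set" where
  "edges T = {e \<in> simplices T. card e = 2}"

definition triangles :: "('a, 'v, 'z) triangulated_surface_scheme \<Rightarrow> 'v set set" where
  "triangles T = {s \<in> simplices T. card s = 3}"

definition boundary_edges :: "('a, 'v, 'z) triangulated_surface_scheme \<Rightarrow> 'v set set" where
  "boundary_edges T = {e \<in> edges T. \<exists>!s. s \<in> triangles T \<and> e \<subseteq> s}"

definition inner_vertices :: "('a, 'v, 'z) triangulated_surface_scheme \<Rightarrow> 'v set" where
  "inner_vertices T = vertices T - \<Union> (boundary_edges T)"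

definition realisation :: "('a, 'v, 'z) triangulated_surface_scheme \<Rightarrow> ('v \<Rightarrow> real) set" where
  "realisation T = {x. (\<forall>w. 0 \<le> x w) \<and> {w. x w \<noteq> 0} \<in> simplices T \<and> sum x {w. x w \<noteq> 0} = 1}"

definition vertex_point :: "'v \<Rightarrow> 'v \<Rightarrow> real" where
  "vertex_point v w = (if w = v then 1 else 0)"

definition topological_2_manifold :: "'b topology \<Rightarrow> bool" where
  "topological_2_manifold X \<longleftrightarrow> Hausdorff_space X \<and> second_countable X \<and>
     (\<forall>x\<in>topspace X. \<exists>U V. openin X U \<and> x \<in> U \<and> openin (top_of_set closed_half_plane) V \<and>
        subtopology X U homeomorphic_space top_of_set V)"

text \<open>That every simplex is a face of a triangle is forced by the realisation being a 2-manifold,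
  but included for convenience.\<close>

definition oriented_2_complex :: "('a, 'v, 'z) triangulated_surface_scheme \<Rightarrow> bool" where
  "oriented_2_complex T \<longleftrightarrow>
     finite (simplices T) \<and>
     (\<forall>s\<in>simplices T. finite s \<and> s \<noteq> {} \<and> (\<forall>t. t \<subseteq> s \<and> t \<noteq> {} \<longrightarrow> t \<in> simplices T)) \<and>
     (\<forall>s\<in>simplices T. \<exists>t\<in>triangles T. s \<subseteq> t) \<and>
     (\<forall>s\<in>triangles T. \<forall>a\<in>s. s = {a, nxt T s a, nxt T s (nxt T s a)} \<and>
        nxt T s (nxt T s (nxt T s a)) = a) \<and>
     (\<forall>s\<in>triangles T. \<forall>t\<in>triangles T. \<forall>a\<in>s. s \<noteq> t \<and> {a, nxt T s a} \<subseteq> t \<longrightarrow>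
        nxt T t (nxt T s a) = a) \<and>
     topological_2_manifold (top_of_set (realisation T))"

text \<open>The orientation preserving affine isomorphism of the standard triangle onto the triangle \<open>s\<close>
  sending 1 to the vertex \<open>a\<close>.\<close>

definition affine_triangle ::
    "('a, 'v, 'z) triangulated_surface_scheme \<Rightarrow> 'v set \<Rightarrow> 'v \<Rightarrow> complex \<Rightarrow> 'v \<Rightarrow> real" where
  "affine_triangle T s a z w =
     (\<Sum>k<3. bary k z * vertex_point ((nxt T s ^^ k) a) w)"

text \<open>The affine extension of the \<open>i\<close>-th boundary embedding, on the boundary of the standard
  triangle.\<close>

definition bmap :: "('a, 'v, 'z) triangulated_surface_scheme \<Rightarrow> nat \<Rightarrow> complex \<Rightarrow> 'v \<Rightarrow> real" where
  "bmap T i z w = (\<Sum>k<3. bary k z * vertex_point (bvert T i k) w)"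

text \<open>The orientation of a triangle \<open>s\<close> induces on its edges the direction from \<open>a\<close> to \<open>nxt s a\<close>.
  The last two clauses say that \<open>homeo\<close> is an orientation preserving homeomorphism, a smooth
  embedding on each simplex, that restricts to the given parametrisations on the boundary.\<close>

definition triangulated_surface :: "('a, 'v, 'z) triangulated_surface_scheme \<Rightarrow> bool" where
  "triangulated_surface T \<longleftrightarrow>
     surface_with_parametrised_boundary T \<and> oriented_2_complex T \<and>
     (\<forall>i<ncomp T. inj_on (bvert T i) {..<3}) \<and>
     disjoint_family_on (\<lambda>i. bvert T i ` {..<3}) {..<ncomp T} \<and>
     boundary_edges T =
       {{bvert T i k, bvert T i (Suc k mod 3)} | i k. i < ncomp T \<and> k < 3} \<and>
     (\<forall>i<ncomp T. \<forall>k<3. \<forall>s\<in>triangles T. {bvert T i k, bvert T i (Suc k mod 3)} \<subseteq> s \<longrightarrow>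
        nxt T s (bvert T i (Suc k mod 3)) = bvert T i k) \<and>
     homeomorphic_map (top_of_set (realisation T)) (surf_top (atlas T)) (homeo T) \<and>
     (\<forall>s\<in>triangles T. \<forall>a\<in>s.
        oriented_smooth_embedding std_triangle (atlas T) (homeo T \<circ> affine_triangle T s a)) \<and>
     (\<forall>i<ncomp T. \<forall>z\<in>frontier std_triangle.
        homeo T (bmap T i z) = bparam T i (z / of_real (cmod z)))"


section \<open>Markings\<close>

text \<open>The edge \<open>e\<close> is oriented from \<open>edge_start e\<close> to \<open>edge_end e\<close>.\<close>

record ('a, 'v) marked_surface = "('a, 'v) triangulated_surface" +
  edge_start :: "'v set \<Rightarrow> 'v"
  edge_end :: "'v set \<Rightarrow> 'v"
  preferred :: "'v set \<Rightarrow> 'v set"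

definition on_left :: "('a, 'v, 'z) marked_surface_scheme \<Rightarrow> 'v set \<Rightarrow> 'v set \<Rightarrow> bool" where
  "on_left T e s \<longleftrightarrow> s \<in> triangles T \<and> e \<subseteq> s \<and> nxt T s (edge_start T e) = edge_end T e"

definition on_right :: "('a, 'v, 'z) marked_surface_scheme \<Rightarrow> 'v set \<Rightarrow> 'v set \<Rightarrow> bool" where
  "on_right T e s \<longleftrightarrow> s \<in> triangles T \<and> e \<subseteq> s \<and> nxt T s (edge_end T e) = edge_start T e"

definition marked_triangulated_surface :: "('a, 'v, 'z) marked_surface_scheme \<Rightarrow> bool" where
  "marked_triangulated_surface T \<longleftrightarrow>
     triangulated_surface T \<and>
     (\<forall>e\<in>edges T. e = {edge_start T e, edge_end T e}) \<and>
     (\<forall>s\<in>triangles T. preferred T s \<in> edges T \<and> preferred T s \<subseteq> s) \<and>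
     (\<forall>e\<in>boundary_edges T. \<forall>s\<in>triangles T. e \<subseteq> s \<longrightarrow> on_right T e s)"

text \<open>The vertex of \<open>s\<close> at which the preferred edge starts, in counterclockwise direction.\<close>

definition corner :: "('a, 'v, 'z) marked_surface_scheme \<Rightarrow> 'v set \<Rightarrow> 'v" where
  "corner T s = (THE a. a \<in> s \<and> preferred T s = {a, nxt T s a})"

definition d2 :: "('a, 'v, 'z) marked_surface_scheme \<Rightarrow> nat \<Rightarrow> 'v set \<Rightarrow> 'v set" where
  "d2 T k s = {(nxt T s ^^ k) (corner T s), (nxt T s ^^ Suc k) (corner T s)}"

definition tri_param :: "('a, 'v, 'z) marked_surface_scheme \<Rightarrow> 'v set \<Rightarrow> complex \<Rightarrow> 'a" where
  "tri_param T s = homeo T \<circ> affine_triangle T s (corner T s)"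


section \<open>Punctured spin triangulated surfaces\<close>

record ('a, 'v, 'p) spin_surface = "('a, 'v) marked_surface" +
  collar_radius :: real
  btype :: "nat \<Rightarrow> spin_type"
  spin :: "('p, 'a + nat \<times> complex) spin_bundle"
  collar_lift :: "nat \<Rightarrow> complex \<times> gl \<Rightarrow> 'p"
  tri_lift :: "'v set \<Rightarrow> complex \<times> gl \<Rightarrow> 'p"

text \<open>In the surface with attached collars, \<open>Inr (i, z)\<close> with \<open>collar_radius < cmod z < 1\<close> is the point
  \<open>z\<close> of the \<open>i\<close>-th collar; the points of the collar with \<open>cmod z = 1\<close> are identified with points
  of the given surface. The map below is the inclusion of the collar, extended by \<open>bparam i\<close>; its
  inverse is a chart of the extended surface.\<close>

definition collar_map ::
    "('a, 'v, 'p, 'z) spin_surface_scheme \<Rightarrow> nat \<Rightarrow> complex \<Rightarrow> 'a + nat \<times> complex" where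
  "collar_map T i z = (if cmod z < 1 then Inr (i, z) else Inl (bparam T i z))"

definition full_annulus :: "('a, 'v, 'p, 'z) spin_surface_scheme \<Rightarrow> nat \<Rightarrow> complex set" where
  "full_annulus T i = {z. collar_radius T < cmod z \<and> cmod z < outer_radius T i}"

definition plus_atlas ::
    "('a, 'v, 'p, 'z) spin_surface_scheme \<Rightarrow> ('a + nat \<times> complex) chart set" where
  "plus_atlas T =
     (\<lambda>c. (Inl ` (fst c - surf_boundary (atlas T)), snd c \<circ> projl)) ` atlas T \<union>
     (\<lambda>i. (collar_map T i ` full_annulus T i, inv_into (full_annulus T i) (collar_map T i)))
       ` {..<ncomp T}"

definition plus_vertex ::
    "('a, 'v, 'p, 'z) spin_surface_scheme \<Rightarrow> 'v \<Rightarrow> 'a + nat \<times> complex" where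
  "plus_vertex T v = Inl (homeo T (vertex_point v))"

definition punctured_plus ::
    "('a, 'v, 'p, 'z) spin_surface_scheme \<Rightarrow> ('a + nat \<times> complex) set" where
  "punctured_plus T = surf_carrier (plus_atlas T) - plus_vertex T ` vertices T"

text \<open>That the spin structure equals the model on a collar is expressed by the identification
  \<open>collar_lift\<close>, which is part of the structure.\<close>

definition punctured_spin_triangulated_surface ::
    "('a, 'v, 'p, 'z) spin_surface_scheme \<Rightarrow> bool" where
  "punctured_spin_triangulated_surface T \<longleftrightarrow>
     marked_triangulated_surface T \<and> 0 < collar_radius T \<and> collar_radius T < 1 \<and>
     spin_structure (plus_atlas T) (punctured_plus T) (spin T) \<and>
     (\<forall>i<ncomp T. spin_lift (plus_atlas T) (spin T) (btype T i)
        ({z. collar_radius T < cmod z \<and> cmod z \<le> 1} - {1, \<zeta>, \<zeta>\<^sup>2}) (collar_map T i) (collar_lift T i)) \<and>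
     (\<forall>s\<in>triangles T. spin_lift (plus_atlas T) (spin T) NS_type
        (std_triangle - {1, \<zeta>, \<zeta>\<^sup>2}) (Inl \<circ> tri_param T s) (tri_lift T s))"

definition extends_to_vertex :: "('a, 'v, 'p, 'z) spin_surface_scheme \<Rightarrow> 'v \<Rightarrow> bool" where
  "extends_to_vertex T v \<longleftrightarrow>
     spin_extends_to (plus_atlas T) (punctured_plus T) (spin T) (plus_vertex T v)"

text \<open>The sign of an inner edge. The equation \<open>tri_lift sR (p, 1) = tri_lift sL (p', g)\<close> says that \<open>g\<close> is
  the element \<open>g\<^sub>p\<close> with \<open>tri_lift sL\<inverse> (tri_lift sR (p, h)) = (p', g\<^sub>p h)\<close>.\<close>

definition edge_sign :: "('a, 'v, 'p, 'z) spin_surface_scheme \<Rightarrow> 'v set \<Rightarrow> int" where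
  "edge_sign T e =
     (let sL = (THE s. on_left T e s); sR = (THE s. on_right T e s);
          kL = (THE k. k < 3 \<and> d2 T k sL = e); kR = (THE k. k < 3 \<and> d2 T k sR = e);
          \<alpha> = cis (2 * pi * (real kR / 3 + 5 / 12))
      in THE \<epsilon>. \<epsilon> \<in> {1, -1} \<and>
           (\<forall>p\<in>open_segment (\<zeta> ^ kR) (\<zeta> ^ Suc kR). \<forall>p'\<in>std_triangle - {1, \<zeta>, \<zeta>\<^sup>2}.
              \<forall>g\<in>carrier GLt. tri_lift T sR (p, \<one>\<^bsub>GLt\<^esub>) = tri_lift T sL (p', g) \<longrightarrow>
                \<delta> (of_int \<epsilon>) =
                  Qt_at \<alpha> g \<otimes>\<^bsub>GLt\<^esub> \<delta> (cis (- pi * (real kL / 3 - real kR / 3 + 1 / 2)))))"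

text \<open>\<open>\<sigma> 0, \<dots>, \<sigma> (N - 1)\<close> are the triangles containing \<open>v\<close>, in counterclockwise order around \<open>v\<close>:
  the edge of \<open>\<sigma> i\<close> that ends at \<open>v\<close> is the edge of \<open>\<sigma> (i + 1)\<close> that starts at \<open>v\<close>, with respect
  to the orientations of the triangles.\<close>

definition ccw_star ::
    "('a, 'v, 'z) triangulated_surface_scheme \<Rightarrow> 'v \<Rightarrow> (nat \<Rightarrow> 'v set) \<Rightarrow> nat \<Rightarrow> bool" where
  "ccw_star T v \<sigma> N \<longleftrightarrow>
     bij_betw \<sigma> {..<N} {s \<in> triangles T. v \<in> s} \<and>
     (\<forall>i<N. nxt T (\<sigma> (Suc i mod N)) v = nxt T (\<sigma> i) (nxt T (\<sigma> i) v))"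

end

theory Submission
  imports Defs
begin

text \<open>The spin structure extends to \<open>v\<close> if and only if, on a punctured chart disc around \<open>v\<close>, the
  spin bundle has a section that lies over the constant coordinate frame. On the triangle \<open>\<sigma> i\<close>
  such a section is unique up to sign: it is \<open>tri_lift\<close>, translated by the inverse of a lift \<open>H i\<close>
  of the Jacobian of the triangle's parametrisation to the double cover. Along the edge from
  \<open>\<sigma> i\<close> to \<open>\<sigma> (i + 1)\<close> two consecutive local sections differ by \<open>wsgn i * \<rho> i\<close>. Here \<open>wsgn i\<close>
  is the edge sign, changed once if the edge points away from \<open>v\<close> and once if the preferred edge of
  \<open>\<sigma> i\<close> starts at \<open>v\<close>, and \<open>\<rho> i\<close> compares the values of \<open>H i\<close> and \<open>H (i + 1)\<close> on a square root of
  the edge direction. So the local sections fit together if and only if the product of all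
  \<open>wsgn i * \<rho> i\<close> is 1. The directions of the edges at \<open>v\<close> bound disjoint cones and hence go around \<open>v\<close>
  exactly once, so their square roots change sign, and the product of all \<open>\<rho> i\<close> is \<open>-1\<close>.\<close>

text \<open>The edge sign is defined through the Q-part of the QR-decomposition, which is not
  multiplicative, whereas going around \<open>v\<close> composes many elements of the double cover.
  The way out is that the Q-part of a conjugate by a lift of \<alpha> records how the element moves
  a square root of \<alpha>. This is \<open>spin_act\<close>, a genuine action of \<open>GLt\<close>
  on the nonzero complex numbers (\<open>Qt_at_eq\<close>, \<open>spin_act_mult\<close>), and every
  sign below becomes a quotient of two square roots of one vector. The base points are the roots
  \<open>\<beta> k\<close> of the edge directions of the standard triangle. The first edge vector
  \<open>\<zeta> - 1\<close> has argument 5 pi / 6, which is the origin of the constant 5/12. A root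
  cannot be chosen with period 3 in \<open>k\<close>, and this defect is what the number D counts.
  The spin bundle is not defined at \<open>v\<close>, but the Jacobians and their lifts
  \<open>H i\<close> are. Hence \<open>\<rho> i\<close>, constant along its edge, can be evaluated
  at \<open>v\<close> itself, where all triangles share one tangent plane; what remains is a
  statement about finitely many vectors in the plane.\<close>

text \<open>The quotient of the two functions takes only the values 1 and -1, so it is constant on a
  connected set. This settles the sign ambiguity of square roots on the upper half plane, along
  edges and on sectors.\<close>

lemma square_eq_connected:
  fixes f g :: "'a::topological_space \<Rightarrow> complex"
  assumes "connected S" "continuous_on S f" "continuous_on S g"
    and "\<And>x. x \<in> S \<Longrightarrow> (f x)\<^sup>2 = (g x)\<^sup>2" "\<And>x. x \<in> S \<Longrightarrow> g x \<noteq> 0"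
  shows "(\<forall>x\<in>S. f x = g x) \<or> (\<forall>x\<in>S. f x = - g x)"
proof -
  have r: "f x / g x = 1 \<or> f x / g x = -1" if "x \<in> S" for x
    using assms(4,5)[OF that] unfolding power2_eq_iff by (metis divide_self minus_divide_left)
  have "connected ((\<lambda>x. f x / g x) ` S)"
    using assms by (intro connected_continuous_image continuous_intros) auto
  moreover have fin: "(\<lambda>x. f x / g x) ` S \<subseteq> {1, -1}" by (rule image_subsetI) (use r in blast)
  ultimately have "(\<lambda>x. f x / g x) ` S = {} \<or> (\<exists>c. (\<lambda>x. f x / g x) ` S = {c})"
    using connected_finite_iff_sing finite_subset[OF fin] by blast
  then consider "S = {}" | c where "c \<in> {1,-1}" "\<And>x. x \<in> S \<Longrightarrow> f x / g x = c"
    using fin by blast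
  then show ?thesis
  proof cases
    case 2 then show ?thesis using assms(5) by (fastforce simp: divide_simps)
  qed auto
qed

subsection \<open>Coordinates on the double cover\<close>

definition gl_lin :: "real^2^2 \<Rightarrow> complex \<Rightarrow> complex" where
  "gl_lin g z = Complex (g$1$1 * Re z + g$1$2 * Im z) (g$2$1 * Re z + g$2$2 * Im z)"

definition wc :: "gl \<Rightarrow> complex" where "wc h = snd h \<i>"

text \<open>The element with coordinates \<open>g\<close> and \<open>w\<close>. The quotient under
  the root is 1 at \<i> and avoids the branch cut on the upper half plane, so that the principal
  root is a holomorphic branch there.\<close>

definition mkGL :: "real^2^2 \<Rightarrow> complex \<Rightarrow> gl" where
  "mkGL g w = (g, \<lambda>z\<in>upper_half_plane. w * csqrt (aut_factor g z / aut_factor g \<i>))"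

lemma i_in_uhp [simp]: "\<i> \<in> upper_half_plane" by (simp add: upper_half_plane_def)

lemma aut_factor_i: "aut_factor g \<i> = Complex (g$2$2) (g$2$1)"
  by (simp add: aut_factor_def complex_eq_iff)

text \<open>Write c and d for the lower row of \<open>g\<close>. If c is nonzero, c z + d and c \<i>
  + d lie strictly on the same side of the real axis, so their quotient is not a nonpositive real;
  if c = 0, the quotient is 1.\<close>

lemma aut_ratio_slit:
  assumes "0 < det g" "z \<in> upper_half_plane"
  shows "aut_factor g z / aut_factor g \<i> \<notin> \<real>\<^sub>\<le>\<^sub>0"
proof
  assume "aut_factor g z / aut_factor g \<i> \<in> \<real>\<^sub>\<le>\<^sub>0"
  then obtain r where r: "r \<le> 0" "aut_factor g z / aut_factor g \<i> = of_real r"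
    by (auto elim: nonpos_Reals_cases)
  have nz: "aut_factor g \<i> \<noteq> 0" using aut_factor_nonzero[OF assms(1)] by simp
  have e: "aut_factor g z = of_real r * aut_factor g \<i>" using r(2) nz by (simp add: field_simps)
  then have "g$2$1 * Im z = r * g$2$1" by (auto simp: aut_factor_def complex_eq_iff)
  then have "g$2$1 * (Im z - r) = 0" by (simp add: algebra_simps)
  moreover have "Im z - r > 0" using assms(2) r(1) by (simp add: upper_half_plane_def)
  ultimately have c: "g$2$1 = 0" by simp
  with e have "g$2$2 * (1 - r) = 0" by (auto simp: aut_factor_def complex_eq_iff algebra_simps)
  then have "g$2$2 = 0" using r(1) by auto
  with c show False using assms(1) by (simp add: det_2)
qed

lemma Re_csqrt_pos:
  assumes "z \<notin> \<real>\<^sub>\<le>\<^sub>0" shows "0 < Re (csqrt z)"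
proof (rule ccontr)
  assume "\<not> 0 < Re (csqrt z)"
  then have "Re (csqrt z) = 0" using csqrt_principal[of z] by auto
  then have "csqrt z = \<i> * of_real (Im (csqrt z))" by (simp add: complex_eq_iff)
  then have "(csqrt z)\<^sup>2 = of_real (- (Im (csqrt z))\<^sup>2)"
    by (metis (no_types, lifting) power_mult_distrib power2_i of_real_power of_real_minus mult_minus1)
  then have "z = of_real (- (Im (csqrt z))\<^sup>2)" by (simp only: power2_csqrt)
  then have "z \<in> \<real>\<^sub>\<le>\<^sub>0" by (metis nonpos_Reals_of_real_iff neg_le_0_iff_le zero_le_power2)
  with assms show False by simp
qed

lemma wc_square: "h \<in> carrier GLt \<Longrightarrow> (wc h)\<^sup>2 = aut_factor (fst h) \<i>"
  by (auto simp: GLt_def wc_def)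

lemma GLt_det: "h \<in> carrier GLt \<Longrightarrow> 0 < det (fst h)"
  by (auto simp: GLt_def)

lemma wc_nonzero: "h \<in> carrier GLt \<Longrightarrow> wc h \<noteq> 0"
  using wc_square[of h] aut_factor_nonzero[OF GLt_det i_in_uhp, of h] by auto

lemma fst_mkGL [simp]: "fst (mkGL g w) = g" by (simp add: mkGL_def)

lemma wc_mkGL [simp]: "0 < det g \<Longrightarrow> wc (mkGL g w) = w"
  using aut_factor_nonzero[OF _ i_in_uhp, of g] by (simp add: mkGL_def wc_def)

lemma holomorphic_on_aut_factor: "aut_factor g holomorphic_on S"
  unfolding aut_factor_def by (intro holomorphic_intros)

lemma mkGL_in:
  assumes "0 < det g" "w\<^sup>2 = aut_factor g \<i>"
  shows "mkGL g w \<in> carrier GLt"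
proof -
  have "(\<lambda>z. w * csqrt (aut_factor g z / aut_factor g \<i>)) holomorphic_on upper_half_plane"
    using aut_ratio_slit[OF assms(1)] aut_factor_nonzero[OF assms(1) i_in_uhp]
    by (intro holomorphic_intros holomorphic_on_aut_factor)
  then have "(\<lambda>z\<in>upper_half_plane. w * csqrt (aut_factor g z / aut_factor g \<i>)) holomorphic_on upper_half_plane"
    by (rule holomorphic_transform) simp
  then show ?thesis using assms aut_factor_nonzero[OF assms(1) i_in_uhp]
    by (auto simp: GLt_def mkGL_def power_mult_distrib)
qed

lemma connected_uhp: "connected upper_half_plane"
  unfolding upper_half_plane_def using convex_connected convex_halfspace_Im_gt by blast

lemma GLt_eq_mkGL:
  assumes "h \<in> carrier GLt" shows "h = mkGL (fst h) (wc h)"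
proof -
  let ?k = "mkGL (fst h) (wc h)"
  have k: "?k \<in> carrier GLt" using assms GLt_det wc_square mkGL_in by blast
  have "(\<forall>z\<in>upper_half_plane. snd h z = snd ?k z) \<or> (\<forall>z\<in>upper_half_plane. snd h z = - snd ?k z)"
  proof (rule square_eq_connected[OF connected_uhp])
    show "continuous_on upper_half_plane (snd h)" "continuous_on upper_half_plane (snd ?k)"
      using assms k by (auto simp: GLt_def intro: holomorphic_on_imp_continuous_on)
    fix z assume z: "z \<in> upper_half_plane"
    have s: "(snd h z)\<^sup>2 = aut_factor (fst h) z" "(snd ?k z)\<^sup>2 = aut_factor (fst h) z"
      using assms k z by (auto simp: GLt_def mkGL_def)
    then show "(snd h z)\<^sup>2 = (snd ?k z)\<^sup>2" "snd ?k z \<noteq> 0"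
      using aut_factor_nonzero[OF GLt_det[OF assms] z] by auto
  qed
  moreover have "snd h \<i> = snd ?k \<i>" "snd ?k \<i> \<noteq> 0"
    using wc_mkGL[OF GLt_det[OF assms], of "wc h"] wc_nonzero[OF assms] by (auto simp: wc_def)
  ultimately have "\<forall>z\<in>upper_half_plane. snd h z = snd ?k z"
    using i_in_uhp by force
  moreover have "snd h \<in> extensional upper_half_plane" "snd ?k \<in> extensional upper_half_plane"
    using assms k by (auto simp: GLt_def)
  ultimately have "snd h = snd ?k" by (auto intro: extensionalityI)
  then show ?thesis by (metis fst_mkGL prod.collapse)
qed

lemma GLt_eqI: "\<lbrakk>h \<in> carrier GLt; k \<in> carrier GLt; fst h = fst k; wc h = wc k\<rbrakk> \<Longrightarrow> h = k"
  using GLt_eq_mkGL by metis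

lemma snd_GLt:
  assumes "h \<in> carrier GLt" "z \<in> upper_half_plane"
  shows "snd h z = wc h * csqrt (aut_factor (fst h) z / aut_factor (fst h) \<i>)"
  using arg_cong[OF GLt_eq_mkGL[OF assms(1)], of snd] assms(2) by (simp add: mkGL_def)

lemma fst_mult [simp]: "fst (h \<otimes>\<^bsub>GLt\<^esub> k) = fst h ** fst k"
  by (cases h; cases k) (simp add: GLt_def)

lemma fst_one [simp]: "fst \<one>\<^bsub>GLt\<^esub> = mat 1" by (simp add: GLt_def)

lemma wc_one [simp]: "wc \<one>\<^bsub>GLt\<^esub> = 1" by (simp add: GLt_def wc_def)

text \<open>The price of evaluating at \<i> only: \<open>wc\<close> is multiplicative up to the
  factor in the middle. By \<open>aut_ratio_slit\<close> this factor has positive real part, and it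
  is 1 whenever \<open>fst k\<close> fixes \<i>.\<close>

lemma wc_mult:
  assumes "h \<in> carrier GLt" "k \<in> carrier GLt"
  shows "wc (h \<otimes>\<^bsub>GLt\<^esub> k) = wc h * csqrt (aut_factor (fst h) (moebius_act (fst k) \<i>) / aut_factor (fst h) \<i>) * wc k"
proof -
  have "wc (h \<otimes>\<^bsub>GLt\<^esub> k) = snd h (moebius_act (fst k) \<i>) * wc k"
    by (cases h; cases k) (simp add: GLt_def wc_def)
  then show ?thesis using snd_GLt[OF assms(1) moebius_act_in[OF GLt_det[OF assms(2)] i_in_uhp]] by simp
qed

interpretation GLt: group GLt by (rule group_GLt)

subsection \<open>The topology of the double cover\<close>

lemma topspace_GLt_top [simp]: "topspace GLt_top = carrier GLt"
  by (simp add: GLt_top_def topspace_pullback_topology)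

lemma continuous_map_pair_euclidean:
  fixes f :: "'a \<Rightarrow> 'b::topological_space" and g :: "'a \<Rightarrow> 'c::topological_space"
  shows "continuous_map X euclidean (\<lambda>x. (f x, g x)) \<longleftrightarrow> continuous_map X euclidean f \<and> continuous_map X euclidean g"
  using continuous_map_pairwise[of X euclidean euclidean "\<lambda>x. (f x, g x)"]
  by (simp add: o_def euclidean_product_topology)

lemma continuous_map_GLt_top:
  "continuous_map X GLt_top f \<longleftrightarrow> f \<in> topspace X \<rightarrow> carrier GLt \<and>
     continuous_map X euclidean (\<lambda>x. fst (f x)) \<and> continuous_map X euclidean (\<lambda>x. wc (f x))"
proof -
  have e: "(\<lambda>(g, e). (g, e \<i>)) \<circ> f = (\<lambda>x. (fst (f x), wc (f x)))"
    by (auto simp: wc_def split: prod.splits)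
  have "continuous_map X GLt_top f \<longleftrightarrow> f \<in> topspace X \<rightarrow> carrier GLt \<and> continuous_map X euclidean ((\<lambda>(g, e). (g, e \<i>)) \<circ> f)"
  proof
    assume c: "continuous_map X GLt_top f"
    have "continuous_map GLt_top euclidean (\<lambda>(g, e). (g, e \<i>))"
      unfolding GLt_top_def using continuous_map_pullback[of euclidean euclidean id] by (simp add: o_def)
    with c show "f \<in> topspace X \<rightarrow> carrier GLt \<and> continuous_map X euclidean ((\<lambda>(g, e). (g, e \<i>)) \<circ> f)"
      using continuous_map_compose continuous_map_funspace by fastforce
  next
    assume "f \<in> topspace X \<rightarrow> carrier GLt \<and> continuous_map X euclidean ((\<lambda>(g, e). (g, e \<i>)) \<circ> f)"
    then show "continuous_map X GLt_top f" unfolding GLt_top_def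
      by (intro continuous_map_pullback') auto
  qed
  then show ?thesis unfolding e continuous_map_pair_euclidean .
qed

lemma continuous_on_matrix2:
  fixes f :: "'a::topological_space \<Rightarrow> real^2^2"
  assumes "\<And>i j. continuous_on S (\<lambda>x. f x $ i $ j)" shows "continuous_on S f"
proof -
  have "continuous_on S (\<lambda>x. \<chi> i. \<chi> j. f x $ i $ j)"
    by (intro continuous_on_vec_lambda assms)
  then show ?thesis by (simp add: vec_lambda_eta)
qed

lemma continuous_map_compose_on:
  assumes "continuous_map X euclidean f" "f \<in> topspace X \<rightarrow> S" "continuous_on S h"
  shows "continuous_map X euclidean (\<lambda>x. h (f x))"
  using continuous_map_compose[of X "top_of_set S" f euclidean h] assms
  by (simp add: o_def continuous_map_in_subtopology image_subset_iff_funcset)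


lemma continuous_map_GLt_fst: "continuous_map X GLt_top f \<Longrightarrow> continuous_map X euclidean (\<lambda>x. fst (f x))"
  and continuous_map_GLt_wc: "continuous_map X GLt_top f \<Longrightarrow> continuous_map X euclidean (\<lambda>x. wc (f x))"
  and continuous_map_GLt_in: "continuous_map X GLt_top f \<Longrightarrow> x \<in> topspace X \<Longrightarrow> f x \<in> carrier GLt"
  by (auto simp: continuous_map_GLt_top)

lemma continuous_on_det2 [continuous_intros]:
  fixes f :: "'a::topological_space \<Rightarrow> real^2^2"
  shows "continuous_on S f \<Longrightarrow> continuous_on S (\<lambda>x. det (f x))"
  unfolding det_2 by (intro continuous_intros)

lemma continuous_on_matrix_mult [continuous_intros]:
  fixes f g :: "'a::topological_space \<Rightarrow> real^2^2"
  assumes "continuous_on S f" "continuous_on S g"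
  shows "continuous_on S (\<lambda>x. f x ** g x)"
  unfolding matrix_matrix_mult_def by (intro continuous_on_vec_lambda continuous_intros assms)

lemma continuous_on_aut_factor [continuous_intros]:
  "continuous_on S M \<Longrightarrow> continuous_on S f \<Longrightarrow> continuous_on S (\<lambda>x. aut_factor (M x) (f x))"
  unfolding aut_factor_def by (intro continuous_intros)

lemma continuous_on_moebius_act [continuous_intros]:
  assumes "continuous_on S M" "continuous_on S f" "\<And>x. x \<in> S \<Longrightarrow> aut_factor (M x) (f x) \<noteq> 0"
  shows "continuous_on S (\<lambda>x. moebius_act (M x) (f x))"
  unfolding moebius_act_def using assms by (intro continuous_intros) auto

lemma continuous_on_csqrt_slit [continuous_intros]:
  assumes "continuous_on S f" "\<And>x. x \<in> S \<Longrightarrow> f x \<notin> \<real>\<^sub>\<le>\<^sub>0"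
  shows "continuous_on S (\<lambda>x. csqrt (f x))"
  by (rule continuous_on_compose2[OF continuous_on_csqrt assms(1)]) (use assms(2) in auto)

text \<open>In the coordinates \<open>fst\<close> and \<open>wc\<close> the product is an explicit
  formula. Its delicate ingredient is \<open>csqrt\<close>, whose argument stays off the branch cut
  by \<open>aut_ratio_slit\<close>.\<close>

lemma continuous_GLt_mult:
  assumes f: "continuous_map X GLt_top f" and g: "continuous_map X GLt_top g"
  shows "continuous_map X GLt_top (\<lambda>x. f x \<otimes>\<^bsub>GLt\<^esub> g x)"
proof -
  note in_f = continuous_map_GLt_in[OF f] and in_g = continuous_map_GLt_in[OF g]
  define F where "F = (\<lambda>x. ((fst (f x), wc (f x)), (fst (g x), wc (g x))))"
  define S where "S = {((a::real^2^2, u::complex), (b::real^2^2, v::complex)). 0 < det a \<and> 0 < det b}"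
  have F: "continuous_map X euclidean F"
    unfolding F_def continuous_map_pair_euclidean using f g by (auto simp: continuous_map_GLt_top)
  have FS: "F \<in> topspace X \<rightarrow> S"
    using in_f in_g by (auto simp: F_def S_def GLt_det)
  define \<Phi> where "\<Phi> = (\<lambda>((a::real^2^2, u), (b, v)). u * csqrt (aut_factor a (moebius_act b \<i>) / aut_factor a \<i>) * v)"
  have "continuous_on S \<Phi>"
  proof -
    have s: "aut_factor (fst (fst p)) (moebius_act (fst (snd p)) \<i>) / aut_factor (fst (fst p)) \<i> \<notin> \<real>\<^sub>\<le>\<^sub>0"
      and n: "aut_factor (fst (fst p)) \<i> \<noteq> 0" "aut_factor (fst (snd p)) \<i> \<noteq> 0" if "p \<in> S" for p
      using that by (auto simp: S_def aut_ratio_slit aut_factor_nonzero moebius_act_in)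
    have "continuous_on S (\<lambda>p. snd (fst p) * csqrt (aut_factor (fst (fst p)) (moebius_act (fst (snd p)) \<i>) / aut_factor (fst (fst p)) \<i>) * snd (snd p))"
      using s n by (intro continuous_intros ballI)
    then show ?thesis unfolding \<Phi>_def by (simp add: case_prod_unfold)
  qed
  then have "continuous_map X euclidean (\<lambda>x. \<Phi> (F x))"
    by (rule continuous_map_compose_on[OF F FS])
  then have w: "continuous_map X euclidean (\<lambda>x. wc (f x \<otimes>\<^bsub>GLt\<^esub> g x))"
    by (rule continuous_map_eq) (simp add: \<Phi>_def F_def wc_mult in_f in_g)
  have "continuous_on S (\<lambda>p. fst (fst p) ** fst (snd p))" by (intro continuous_intros)
  then have "continuous_map X euclidean (\<lambda>x. fst (fst (F x)) ** fst (snd (F x)))"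
    by (rule continuous_map_compose_on[OF F FS])
  then have "continuous_map X euclidean (\<lambda>x. fst (f x \<otimes>\<^bsub>GLt\<^esub> g x))" by (simp add: F_def)
  with w in_f in_g show ?thesis by (simp add: continuous_map_GLt_top Pi_iff)
qed

text \<open>Cramer's formula, from which continuity in the entries can be read off.\<close>

definition minv :: "real^2^2 \<Rightarrow> real^2^2" where
  "minv g = vector [vector [g$2$2 / det g, - g$1$2 / det g], vector [- g$2$1 / det g, g$1$1 / det g]]"

lemma matrix2_eqI:
  fixes a b :: "real^2^2"
  shows "a$1$1 = b$1$1 \<Longrightarrow> a$1$2 = b$1$2 \<Longrightarrow> a$2$1 = b$2$1 \<Longrightarrow> a$2$2 = b$2$2 \<Longrightarrow> a = b"
  by (simp add: vec_eq_iff forall_2)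

lemma matrix_mult_2 [simp]:
  fixes a b :: "real^2^2"
  shows "(a ** b)$i$j = a$i$1 * b$1$j + a$i$2 * b$2$j"
  by (simp add: matrix_matrix_mult_def sum_2)

lemma minv: "det g \<noteq> 0 \<Longrightarrow> minv g ** g = mat 1" "det g \<noteq> 0 \<Longrightarrow> g ** minv g = mat 1"
  by (rule matrix2_eqI; simp add: minv_def mat_def; simp add: field_simps; simp add: det_2 algebra_simps)+

lemma minv_unique: "0 < det g \<Longrightarrow> h ** g = mat 1 \<Longrightarrow> h = minv g"
  by (metis less_irrefl matrix_mul_assoc matrix_mul_lid matrix_mul_rid minv(2))

lemma det_minv: "0 < det g \<Longrightarrow> 0 < det (minv g)"
  by (metis det_I det_mul minv(1) less_irrefl zero_less_mult_pos2 zero_less_one)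

lemma fst_inv: "h \<in> carrier GLt \<Longrightarrow> fst (inv\<^bsub>GLt\<^esub> h) = minv (fst h)"
  by (metis GLt.l_inv GLt_det fst_mult fst_one minv_unique)

lemma wc_inv:
  assumes "h \<in> carrier GLt"
  shows "wc (inv\<^bsub>GLt\<^esub> h) = 1 / (wc h * csqrt (aut_factor (minv (fst h)) (moebius_act (fst h) \<i>) / aut_factor (minv (fst h)) \<i>))"
proof -
  have "wc (inv\<^bsub>GLt\<^esub> h \<otimes>\<^bsub>GLt\<^esub> h) = 1" using assms by simp
  then have "wc (inv\<^bsub>GLt\<^esub> h) * (wc h * csqrt (aut_factor (minv (fst h)) (moebius_act (fst h) \<i>) / aut_factor (minv (fst h)) \<i>)) = 1"
    using wc_mult[of "inv\<^bsub>GLt\<^esub> h" h] assms by (simp add: fst_inv mult_ac)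
  then show ?thesis by (metis eq_divide_imp mult_zero_right zero_neq_one)
qed

lemma continuous_on_minv:
  fixes f :: "'a::topological_space \<Rightarrow> real^2^2"
  assumes "continuous_on S f" "\<And>x. x \<in> S \<Longrightarrow> 0 < det (f x)"
  shows "continuous_on S (\<lambda>x. minv (f x))"
proof (rule continuous_on_matrix2)
  fix i j :: 2
  have d: "x \<in> S \<Longrightarrow> det (f x) \<noteq> 0" for x using assms(2) by fastforce
  have "continuous_on S (\<lambda>x. f x $ 2 $ 2 / det (f x))" "continuous_on S (\<lambda>x. - f x $ 1 $ 2 / det (f x))"
    "continuous_on S (\<lambda>x. - f x $ 2 $ 1 / det (f x))" "continuous_on S (\<lambda>x. f x $ 1 $ 1 / det (f x))"
    using d by (intro continuous_intros assms(1); simp)+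
  then show "continuous_on S (\<lambda>x. minv (f x) $ i $ j)"
    using exhaust_2[of i] exhaust_2[of j] by (auto simp: minv_def)
qed

lemma continuous_GLt_inv:
  assumes f: "continuous_map X GLt_top f"
  shows "continuous_map X GLt_top (\<lambda>x. inv\<^bsub>GLt\<^esub> (f x))"
proof -
  note in_f = continuous_map_GLt_in[OF f]
  define F where "F = (\<lambda>x. (fst (f x), wc (f x)))"
  define S where "S = {(a::real^2^2, u::complex). 0 < det a \<and> u \<noteq> 0}"
  have F: "continuous_map X euclidean F"
    unfolding F_def continuous_map_pair_euclidean using f by (auto simp: continuous_map_GLt_top)
  have FS: "F \<in> topspace X \<rightarrow> S"
    using in_f by (auto simp: F_def S_def GLt_det wc_nonzero)
  have m: "continuous_on S (\<lambda>p. minv (fst p))"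
    by (rule continuous_on_minv) (auto simp: S_def intro!: continuous_intros)
  have "continuous_on S (\<lambda>p. 1 / (snd p * csqrt (aut_factor (minv (fst p)) (moebius_act (fst p) \<i>) / aut_factor (minv (fst p)) \<i>)))"
  proof -
    have s: "aut_factor (minv (fst p)) (moebius_act (fst p) \<i>) / aut_factor (minv (fst p)) \<i> \<notin> \<real>\<^sub>\<le>\<^sub>0"
      and n: "aut_factor (minv (fst p)) \<i> \<noteq> 0" "aut_factor (fst p) \<i> \<noteq> 0" "snd p \<noteq> 0" if "p \<in> S" for p
      using that by (auto simp: S_def aut_ratio_slit aut_factor_nonzero moebius_act_in det_minv)
    have t: "aut_factor (minv (fst p)) (moebius_act (fst p) \<i>) / aut_factor (minv (fst p)) \<i> \<noteq> 0" if "p \<in> S" for p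
      using s[OF that] by (metis nonpos_Reals_zero_I)
    show ?thesis
      using s n t by (intro continuous_intros m) auto
  qed
  then have "continuous_map X euclidean (\<lambda>x. (\<lambda>p. 1 / (snd p * csqrt (aut_factor (minv (fst p)) (moebius_act (fst p) \<i>) / aut_factor (minv (fst p)) \<i>))) (F x))"
    by (rule continuous_map_compose_on[OF F FS])
  then have w: "continuous_map X euclidean (\<lambda>x. wc (inv\<^bsub>GLt\<^esub> (f x)))"
    by (rule continuous_map_eq) (simp add: F_def wc_inv in_f)
  have "continuous_map X euclidean (\<lambda>x. minv (fst (F x)))"
    by (rule continuous_map_compose_on[OF F FS m])
  then have "continuous_map X euclidean (\<lambda>x. fst (inv\<^bsub>GLt\<^esub> (f x)))"
    by (rule continuous_map_eq) (simp add: F_def fst_inv in_f)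
  with w in_f show ?thesis by (simp add: continuous_map_GLt_top Pi_iff)
qed

text \<open>A lift of \<open>M\<close> amounts to a continuous choice of the coordinate
  \<open>wc\<close>, that is, of a square root of the nowhere vanishing function
  \<open>aut_factor (M z) \<i>\<close>. On a contractible set there is one.\<close>

lemma lift_exists:
  fixes S :: "complex set"
  assumes "contractible S" "continuous_on S M" "\<And>z. z \<in> S \<Longrightarrow> 0 < det (M z)"
  obtains H where "continuous_map (top_of_set S) GLt_top H" "\<And>z. z \<in> S \<Longrightarrow> fst (H z) = M z"
proof -
  have "continuous_on S (\<lambda>z. aut_factor (M z) \<i>)"
    unfolding aut_factor_def by (intro continuous_intros assms)
  moreover have "aut_factor (M z) \<i> \<noteq> 0" if "z \<in> S" for z
    using assms(3)[OF that] aut_factor_nonzero by simp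
  ultimately obtain w where w: "continuous_on S w" "\<And>z. z \<in> S \<Longrightarrow> aut_factor (M z) \<i> = (w z)\<^sup>2"
    using continuous_sqrt_on_contractible[OF _ assms(1), of "\<lambda>z. aut_factor (M z) \<i>"] by blast
  show ?thesis
  proof (rule that[of "\<lambda>z. mkGL (M z) (w z)"])
    have "continuous_on S (\<lambda>z. wc (mkGL (M z) (w z)))"
      using w(1) by (rule continuous_on_eq) (simp add: assms(3))
    then show "continuous_map (top_of_set S) GLt_top (\<lambda>z. mkGL (M z) (w z))"
      using assms w by (auto simp: continuous_map_GLt_top mkGL_in)
  qed simp
qed

subsection \<open>The spinor action on square roots of tangent directions\<close>

lemma gl_lin_mult: "gl_lin (a ** b) z = gl_lin a (gl_lin b z)"
  by (simp add: gl_lin_def complex_eq_iff algebra_simps)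

lemma gl_lin_cmat: "gl_lin (cmat u) z = u * z"
  by (simp add: gl_lin_def cmat_def complex_eq_iff)

lemma gl_lin_one [simp]: "gl_lin (mat 1) z = z"
  by (simp add: gl_lin_def mat_def complex_eq_iff)

lemma gl_lin_scale: "gl_lin g (of_real r * z) = of_real r * gl_lin g z"
  by (simp add: gl_lin_def complex_eq_iff algebra_simps)

lemma gl_lin_minus: "gl_lin g (- z) = - gl_lin g z"
  by (simp add: gl_lin_def complex_eq_iff algebra_simps)

lemma gl_lin_add: "gl_lin g (y + z) = gl_lin g y + gl_lin g z"
  by (simp add: gl_lin_def complex_eq_iff algebra_simps)

lemma gl_lin_nonzero: "0 < det g \<Longrightarrow> z \<noteq> 0 \<Longrightarrow> gl_lin g z \<noteq> 0"
  by (metis gl_lin_mult gl_lin_one less_irrefl minv(1) gl_lin_scale mult_zero_left of_real_0)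

lemma cmat_mult: "cmat u ** cmat v = cmat (u * v)"
  by (rule matrix2_eqI) (simp_all add: cmat_def algebra_simps)

lemma cmat_1: "cmat 1 = mat 1"
  by (rule matrix2_eqI) (simp_all add: cmat_def mat_def)

lemma det_cmat: "det (cmat u) = (cmod u)\<^sup>2"
  unfolding cmod_power2 by (simp add: det_2 cmat_def power2_eq_square)

lemma aut_factor_cmat_i: "aut_factor (cmat u) \<i> = u"
  by (simp add: aut_factor_i cmat_def complex_eq_iff)

lemma moebius_act_cmat: "u \<noteq> 0 \<Longrightarrow> moebius_act (cmat u) \<i> = \<i>"
proof -
  have "of_real (cmat u $ 1 $ 1) * \<i> + of_real (cmat u $ 1 $ 2) = \<i> * u"
    by (simp add: cmat_def complex_eq_iff)
  then show "u \<noteq> 0 \<Longrightarrow> moebius_act (cmat u) \<i> = \<i>" by (simp add: moebius_act_def aut_factor_cmat_i)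
qed

lemma delta_eq: "z \<noteq> 0 \<Longrightarrow> \<delta> z = mkGL (cmat (z\<^sup>2)) z"
  unfolding \<delta>_def
proof (rule the_equality)
  assume z: "z \<noteq> 0"
  have d: "0 < det (cmat (z\<^sup>2))" using z by (simp add: det_cmat)
  show "mkGL (cmat (z\<^sup>2)) z \<in> carrier GLt \<and> fst (mkGL (cmat (z\<^sup>2)) z) = cmat (z\<^sup>2) \<and> snd (mkGL (cmat (z\<^sup>2)) z) \<i> = z"
    using wc_mkGL[OF d, of z] mkGL_in[OF d, of z] by (simp add: aut_factor_cmat_i wc_def)
  fix h assume "h \<in> carrier GLt \<and> p_GL h = cmat (z\<^sup>2) \<and> snd h \<i> = z"
  then show "h = mkGL (cmat (z\<^sup>2)) z" using GLt_eq_mkGL by (metis wc_def)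
qed

lemma delta_in [simp]: "z \<noteq> 0 \<Longrightarrow> \<delta> z \<in> carrier GLt"
  and fst_delta [simp]: "z \<noteq> 0 \<Longrightarrow> fst (\<delta> z) = cmat (z\<^sup>2)"
  and wc_delta [simp]: "z \<noteq> 0 \<Longrightarrow> wc (\<delta> z) = z"
  by (simp_all add: delta_eq mkGL_in aut_factor_cmat_i det_cmat)

lemma delta_inj: "\<delta> u = \<delta> v \<Longrightarrow> u \<noteq> 0 \<Longrightarrow> v \<noteq> 0 \<Longrightarrow> u = v"
  by (metis wc_delta)

lemma delta_mult: "u \<noteq> 0 \<Longrightarrow> v \<noteq> 0 \<Longrightarrow> \<delta> u \<otimes>\<^bsub>GLt\<^esub> \<delta> v = \<delta> (u * v)"
  by (rule GLt_eqI) (simp_all add: wc_mult moebius_act_cmat aut_factor_cmat_i cmat_mult power_mult_distrib)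

lemma delta_1: "\<delta> 1 = \<one>\<^bsub>GLt\<^esub>"
  by (rule GLt_eqI) (simp_all add: cmat_1)

lemma wc_mult_delta: "h \<in> carrier GLt \<Longrightarrow> u \<noteq> 0 \<Longrightarrow> wc (h \<otimes>\<^bsub>GLt\<^esub> \<delta> u) = wc h * u"
  using aut_factor_nonzero[OF GLt_det i_in_uhp, of h] by (simp add: wc_mult moebius_act_cmat)

lemma aut_factor_id: "aut_factor (mat 1) z = 1" by (simp add: aut_factor_def mat_def)

lemma delta_minus_central:
  assumes "h \<in> carrier GLt"
  shows "\<delta> (-1) \<otimes>\<^bsub>GLt\<^esub> h = h \<otimes>\<^bsub>GLt\<^esub> \<delta> (-1)"
proof (rule GLt_eqI)
  show "wc (\<delta> (-1) \<otimes>\<^bsub>GLt\<^esub> h) = wc (h \<otimes>\<^bsub>GLt\<^esub> \<delta> (-1))"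
    using assms wc_mult_delta[OF assms, of "-1"] wc_mult[of "\<delta> (-1)" h] by (simp add: cmat_1 aut_factor_id)
qed (use assms in \<open>simp_all add: cmat_1\<close>)

text \<open>By \<open>wc_square\<close> the two values of \<open>wc\<close> have the same square,
  and right multiplication by \<open>\<delta> (-1)\<close> changes the sign of
  \<open>wc\<close>.\<close>

lemma GLt_lift_cases:
  assumes "h \<in> carrier GLt" "k \<in> carrier GLt" "fst h = fst k"
  shows "h = k \<or> h = k \<otimes>\<^bsub>GLt\<^esub> \<delta> (-1)"
proof -
  have "(wc h)\<^sup>2 = (wc k)\<^sup>2" using assms by (simp add: wc_square)
  then consider "wc h = wc k" | "wc h = - wc k" by (auto simp: power2_eq_iff)
  then show ?thesis
  proof cases
    case 1 then show ?thesis using GLt_eqI assms by blast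
  next
    case 2
    have "h = k \<otimes>\<^bsub>GLt\<^esub> \<delta> (-1)"
      by (rule GLt_eqI) (use assms 2 in \<open>simp_all add: cmat_1 wc_mult_delta\<close>)
    then show ?thesis ..
  qed
qed

text \<open>The spinor action lifts the linear action on tangent vectors through the squaring map; the
  sign is pinned down because a matrix of positive determinant turns no vector to the opposite
  of its rotation by \<open>(wc h)\<^sup>2\<close>.\<close>

definition spin_act :: "gl \<Rightarrow> complex \<Rightarrow> complex" where
  "spin_act h b = wc h * b * csqrt (gl_lin (fst h) (b\<^sup>2) / ((wc h)\<^sup>2 * b\<^sup>2))"

text \<open>Write x = p + q \<i>, and a, b, c, d for the entries of \<open>g\<close>. Both g x and
  (d + c \<i>) x have the imaginary part c p + d q, so a quotient r \<le> 0 forces it to vanish.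
  Then det g times p^2 + q^2 equals r (d p - c q)^2 \<le> 0, a contradiction. Hence the root in
  \<open>spin_act\<close> depends continuously on its data.\<close>

lemma gl_lin_ratio_slit:
  assumes "0 < det g" "x \<noteq> 0"
  shows "gl_lin g x / (aut_factor g \<i> * x) \<notin> \<real>\<^sub>\<le>\<^sub>0"
proof
  assume "gl_lin g x / (aut_factor g \<i> * x) \<in> \<real>\<^sub>\<le>\<^sub>0"
  then obtain r where r: "r \<le> 0" "gl_lin g x / (aut_factor g \<i> * x) = of_real r"
    by (auto elim: nonpos_Reals_cases)
  have nz: "aut_factor g \<i> * x \<noteq> 0" using aut_factor_nonzero[OF assms(1)] assms(2) by simp
  then have e: "gl_lin g x = of_real r * (aut_factor g \<i> * x)" using r(2) by (simp add: field_simps)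
  define a b c d p q where "a = g$1$1" "b = g$1$2" "c = g$2$1" "d = g$2$2" "p = Re x" "q = Im x"
  note defs = this
  have "Re (gl_lin g x) = a * p + b * q" "Im (gl_lin g x) = c * p + d * q"
    "Re (of_real r * (aut_factor g \<i> * x)) = r * (d * p - c * q)"
    "Im (of_real r * (aut_factor g \<i> * x)) = r * (c * p + d * q)"
    by (simp_all add: gl_lin_def aut_factor_i defs algebra_simps)
  then have e1: "a * p + b * q = r * (d * p - c * q)" and e2: "c * p + d * q = r * (c * p + d * q)"
    using e by metis+
  have "(1 - r) * (c * p + d * q) = (c * p + d * q) - r * (c * p + d * q)" by (simp add: algebra_simps)
  then have "(1 - r) * (c * p + d * q) = 0" using e2 by linarith
  then have z: "c * p + d * q = 0" using r(1) by auto
  have det: "a * d - b * c > 0" using assms(1) by (simp add: det_2 defs)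
  have 1: "(a * d - b * c) * p = d * (a * p + b * q)"
    using z by algebra
  have 2: "(a * d - b * c) * q = - c * (a * p + b * q)"
    using z by algebra
  have "p \<noteq> 0 \<or> q \<noteq> 0" using assms(2) by (auto simp: defs complex_eq_iff)
  then have "0 < (a * d - b * c) * (p\<^sup>2 + q\<^sup>2)" using det by (simp add: sum_power2_gt_zero_iff)
  also have "(a * d - b * c) * (p\<^sup>2 + q\<^sup>2) = (a * p + b * q) * (d * p - c * q)"
    using 1 2 by (simp add: power2_eq_square) algebra
  also have "\<dots> = r * (d * p - c * q)\<^sup>2" using e1 by (simp add: power2_eq_square)
  also have "\<dots> \<le> 0" using r(1) by (simp add: mult_nonpos_nonneg)
  finally show False by simp
qed

lemma spin_act_ratio_slit:
  assumes "h \<in> carrier GLt" "b \<noteq> 0"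
  shows "gl_lin (fst h) (b\<^sup>2) / ((wc h)\<^sup>2 * b\<^sup>2) \<notin> \<real>\<^sub>\<le>\<^sub>0"
  using gl_lin_ratio_slit[OF GLt_det[OF assms(1)], of "b\<^sup>2"] assms by (simp add: wc_square)

lemma spin_act_square:
  assumes "h \<in> carrier GLt" "b \<noteq> 0" shows "(spin_act h b)\<^sup>2 = gl_lin (fst h) (b\<^sup>2)"
  using wc_nonzero[OF assms(1)] assms(2) by (simp add: spin_act_def power_mult_distrib)

lemma spin_act_Re:
  assumes "h \<in> carrier GLt" "b \<noteq> 0" shows "0 < Re (spin_act h b / (wc h * b))"
  using wc_nonzero[OF assms(1)] assms(2) Re_csqrt_pos[OF spin_act_ratio_slit[OF assms]]
  by (simp add: spin_act_def)

text \<open>Of the two square roots of the image vector, \<open>spin_act\<close> is the one that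
  forms an angle of less than pi / 2 with \<open>wc h * b\<close>. The identities that follow are
  proved by checking these two properties.\<close>

lemma spin_act_unique:
  assumes "h \<in> carrier GLt" "b \<noteq> 0" "y\<^sup>2 = gl_lin (fst h) (b\<^sup>2)" "0 < Re (y / (wc h * b))"
  shows "y = spin_act h b"
proof -
  have n: "wc h * b \<noteq> 0" using wc_nonzero assms by simp
  have "(y / (wc h * b))\<^sup>2 = gl_lin (fst h) (b\<^sup>2) / ((wc h)\<^sup>2 * b\<^sup>2)"
    using assms(3) by (simp add: power_divide power_mult_distrib)
  then have "csqrt (gl_lin (fst h) (b\<^sup>2) / ((wc h)\<^sup>2 * b\<^sup>2)) = y / (wc h * b)"
    using csqrt_square[of "y / (wc h * b)"] assms(4) by simp
  then show ?thesis using n by (simp add: spin_act_def)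
qed

lemma spin_act_nonzero: "h \<in> carrier GLt \<Longrightarrow> b \<noteq> 0 \<Longrightarrow> spin_act h b \<noteq> 0"
  by (metis spin_act_Re div_0 less_irrefl zero_complex.simps(1))

lemma spin_act_minus: 
  assumes "h \<in> carrier GLt" "b \<noteq> 0" shows "spin_act h (- b) = - spin_act h b"
  by (rule spin_act_unique[symmetric]) (use assms spin_act_square spin_act_Re in auto)

lemma spin_act_i: 
  assumes "h \<in> carrier GLt" "b \<noteq> 0" shows "spin_act h (\<i> * b) = \<i> * spin_act h b"
proof (rule spin_act_unique[symmetric])
  have "\<i> * spin_act h b / (wc h * (\<i> * b)) = spin_act h b / (wc h * b)" by simp
  then show "0 < Re (\<i> * spin_act h b / (wc h * (\<i> * b)))" using spin_act_Re[OF assms] by simp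
qed (use assms in \<open>simp_all add: spin_act_square power_mult_distrib gl_lin_minus\<close>)

lemma spin_act_scale: 
  assumes "h \<in> carrier GLt" "b \<noteq> 0" "0 < r" shows "spin_act h (of_real r * b) = of_real r * spin_act h b"
proof (rule spin_act_unique[symmetric])
  have "of_real r * spin_act h b / (wc h * (of_real r * b)) = spin_act h b / (wc h * b)" using assms by simp
  then show "0 < Re (of_real r * spin_act h b / (wc h * (of_real r * b)))" using spin_act_Re[OF assms(1,2)] by simp
  have "gl_lin (fst h) (of_real (r\<^sup>2) * b\<^sup>2) = of_real (r\<^sup>2) * gl_lin (fst h) (b\<^sup>2)" by (rule gl_lin_scale)
  then show "(of_real r * spin_act h b)\<^sup>2 = gl_lin (fst h) ((of_real r * b)\<^sup>2)"
    using assms by (simp add: spin_act_square power_mult_distrib)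
qed (use assms in simp_all)

lemma spin_act_delta:
  assumes "u \<noteq> 0" "b \<noteq> 0" shows "spin_act (\<delta> u) b = u * b"
  by (rule spin_act_unique[symmetric]) (use assms in \<open>auto simp: gl_lin_cmat power_mult_distrib\<close>)

lemma continuous_spin_act:
  assumes f: "continuous_map X GLt_top f" and b: "b \<noteq> 0"
  shows "continuous_map X euclidean (\<lambda>x. spin_act (f x) b)"
proof -
  note in_f = continuous_map_GLt_in[OF f]
  define F where "F = (\<lambda>x. (fst (f x), wc (f x)))"
  define S where "S = {(a::real^2^2, u::complex). 0 < det a \<and> u\<^sup>2 = aut_factor a \<i>}"
  have F: "continuous_map X euclidean F"
    unfolding F_def continuous_map_pair_euclidean using f by (auto simp: continuous_map_GLt_top)
  have FS: "F \<in> topspace X \<rightarrow> S"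
    using in_f by (auto simp: F_def S_def GLt_det wc_square)
  have lin: "continuous_on S (\<lambda>p. gl_lin (fst p) (b\<^sup>2))"
    unfolding gl_lin_def Complex_eq by (intro continuous_intros)
  have "continuous_on S (\<lambda>p. snd p * b * csqrt (gl_lin (fst p) (b\<^sup>2) / ((snd p)\<^sup>2 * b\<^sup>2)))"
  proof -
    have s: "gl_lin (fst p) (b\<^sup>2) / ((snd p)\<^sup>2 * b\<^sup>2) \<notin> \<real>\<^sub>\<le>\<^sub>0" and n: "(snd p)\<^sup>2 * b\<^sup>2 \<noteq> 0"
      if "p \<in> S" for p
      using that b gl_lin_ratio_slit[of "fst p" "b\<^sup>2"] aut_factor_nonzero[of "fst p" \<i>] by (auto simp: S_def)
    show ?thesis using s n by (intro continuous_intros lin ballI)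
  qed
  then have "continuous_map X euclidean (\<lambda>x. (\<lambda>p. snd p * b * csqrt (gl_lin (fst p) (b\<^sup>2) / ((snd p)\<^sup>2 * b\<^sup>2))) (F x))"
    by (rule continuous_map_compose_on[OF F FS])
  then show ?thesis by (simp add: F_def spin_act_def)
qed

subsection \<open>QR decomposition\<close>

text \<open>Membership in terms of the coordinates \<open>fst\<close> and \<open>wc\<close>. The
  condition on \<open>wc r\<close> picks the positive one of the two roots of the lower right entry
  and so one of the two lifts of the matrix.\<close>

lemma R_part_eq:
  "r \<in> R_part \<longleftrightarrow> r \<in> carrier GLt \<and> fst r $ 2 $ 1 = 0 \<and> 0 < fst r $ 1 $ 1 \<and> 0 < Re (wc r) \<and> Im (wc r) = 0"
proof
  assume "r \<in> R_part"
  then obtain a c b where r: "r = (vector [vector [a, b], vector [0, c]], \<lambda>z\<in>upper_half_plane. of_real (sqrt c))" "0 < a" "0 < c"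
    by (auto simp: R_part_def)
  have "(\<lambda>z\<in>upper_half_plane. complex_of_real (sqrt c)) holomorphic_on upper_half_plane"
    by (rule holomorphic_transform[of "\<lambda>_. of_real (sqrt c)"]) auto
  then have "r \<in> carrier GLt" using r
    by (auto simp: GLt_def det_2 aut_factor_def complex_eq_iff simp flip: of_real_power)
  then show "r \<in> carrier GLt \<and> fst r $ 2 $ 1 = 0 \<and> 0 < fst r $ 1 $ 1 \<and> 0 < Re (wc r) \<and> Im (wc r) = 0"
    using r by (simp add: wc_def)
next
  assume r: "r \<in> carrier GLt \<and> fst r $ 2 $ 1 = 0 \<and> 0 < fst r $ 1 $ 1 \<and> 0 < Re (wc r) \<and> Im (wc r) = 0"
  define a b c where "a = fst r $ 1 $ 1" "b = fst r $ 1 $ 2" "c = fst r $ 2 $ 2"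
  note defs = this
  have "0 < a * c" using r GLt_det[of r] by (simp add: det_2 defs)
  then have ac: "0 < a" "0 < c" using r by (auto simp: defs zero_less_mult_iff)
  have m: "fst r = vector [vector [a, b], vector [0, c]]"
    using r by (intro matrix2_eqI) (simp_all add: defs)
  have wr: "wc r = of_real (Re (wc r))" using r by (simp add: complex_eq_iff)
  have "(wc r)\<^sup>2 = of_real c" using r wc_square[of r] by (simp add: aut_factor_i defs complex_eq_iff)
  then have "of_real ((Re (wc r))\<^sup>2) = complex_of_real c" using wr by (metis of_real_power)
  then have "(Re (wc r))\<^sup>2 = c" by (simp only: of_real_eq_iff)
  then have w: "wc r = of_real (sqrt c)" using r wr by (metis less_imp_le real_sqrt_unique)
  have "snd r = (\<lambda>z\<in>upper_half_plane. of_real (sqrt c))"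
  proof (rule extensionalityI[of _ upper_half_plane])
    fix z assume z: "z \<in> upper_half_plane"
    have "aut_factor (fst r) z / aut_factor (fst r) \<i> = 1"
      using m ac by (simp add: aut_factor_def)
    then show "snd r z = (\<lambda>z\<in>upper_half_plane. complex_of_real (sqrt c)) z"
      using snd_GLt[of r z] r z w by simp
  qed (use r in \<open>auto simp: GLt_def\<close>)
  then have "r = (vector [vector [a, b], vector [0, c]], \<lambda>z\<in>upper_half_plane. of_real (sqrt c))"
    using m by (metis prod.collapse)
  then show "r \<in> R_part" using ac by (auto simp: R_part_def)
qed

lemma R_part_mult: "r \<in> R_part \<Longrightarrow> s \<in> R_part \<Longrightarrow> r \<otimes>\<^bsub>GLt\<^esub> s \<in> R_part"
proof -
  assume a: "r \<in> R_part" "s \<in> R_part"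
  then have "aut_factor (fst r) (moebius_act (fst s) \<i>) / aut_factor (fst r) \<i> = 1"
    using aut_factor_nonzero[OF GLt_det i_in_uhp, of r] by (simp add: R_part_eq aut_factor_def)
  then show ?thesis using a by (simp add: R_part_eq wc_mult)
qed

lemma cmod_sgn_square: "z \<noteq> 0 \<Longrightarrow> cnj ((sgn z)\<^sup>2) * z\<^sup>2 = of_real ((cmod z)\<^sup>2)"
proof -
  assume "z \<noteq> 0"
  then have "(cnj (sgn z) * z) = of_real (cmod z)"
    by (simp add: sgn_div_norm scaleR_conv_of_real complex_norm_square[symmetric] power2_eq_square field_simps)
  then show ?thesis by (metis complex_cnj_power of_real_power power_mult_distrib)
qed

text \<open>The matrix of \<open>h\<close> times that of \<open>\<delta> b\<close> sends 1 to the
  square of \<open>spin_act h b\<close>. Rotating this square back to the positive real axis leaves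
  an upper triangular matrix with positive diagonal. That settles the decomposition up to the
  element \<open>\<delta> (-1)\<close>, and the sign is decided by
  \<open>spin_act_Re\<close>.\<close>

lemma QR_exists:
  assumes h: "h \<in> carrier GLt" and b: "b \<noteq> 0"
  obtains r where "r \<in> R_part" "h \<otimes>\<^bsub>GLt\<^esub> \<delta> b = \<delta> (sgn (spin_act h b)) \<otimes>\<^bsub>GLt\<^esub> r"
proof -
  let ?y = "spin_act h b"
  define c where "c = sgn ?y"
  have y0: "?y \<noteq> 0" using spin_act_nonzero[OF h b] .
  have c0: "c \<noteq> 0" and c1: "cmod c = 1" using y0 by (simp_all add: c_def norm_sgn sgn_zero_iff)
  have cc: "cnj (c\<^sup>2) * c\<^sup>2 = 1" using c1
    by (metis complex_norm_square mult.commute norm_power of_real_1 one_power2 power_one)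
  have hb: "h \<otimes>\<^bsub>GLt\<^esub> \<delta> b \<in> carrier GLt" using h b by simp
  define m where "m = cmat (cnj (c\<^sup>2)) ** (fst h ** cmat (b\<^sup>2))"
  have "gl_lin m 1 = cnj (c\<^sup>2) * ?y\<^sup>2"
    by (simp add: m_def gl_lin_mult gl_lin_cmat spin_act_square[OF h b])
  also have "\<dots> = of_real ((cmod ?y)\<^sup>2)" unfolding c_def using cmod_sgn_square[OF y0] .
  finally have m1: "m$1$1 = (cmod ?y)\<^sup>2" "m$2$1 = 0" by (simp_all add: gl_lin_def complex_eq_iff)
  have dm: "0 < det m" using GLt_det[OF h] c0 b by (simp add: m_def det_mul det_cmat)
  then have m2: "0 < m$2$2" using m1 y0 by (simp add: det_2 zero_less_mult_iff)
  define r where "r = mkGL m (of_real (sqrt (m$2$2)))"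
  have "(complex_of_real (sqrt (m$2$2)))\<^sup>2 = aut_factor m \<i>"
    using m1 m2 by (simp add: aut_factor_i complex_eq_iff flip: of_real_power)
  then have rG: "r \<in> carrier GLt" unfolding r_def by (rule mkGL_in[OF dm])
  have wr: "wc r = of_real (sqrt (m$2$2))" by (simp add: r_def dm)
  have rR: "r \<in> R_part" unfolding R_part_eq using rG m1 m2 y0 by (simp add: r_def wc_mkGL[OF dm])
  have cr: "\<delta> c \<otimes>\<^bsub>GLt\<^esub> r \<in> carrier GLt" using c0 rG by simp
  have "cmat (c\<^sup>2) ** m = fst h ** cmat (b\<^sup>2)"
    using cc by (simp add: m_def matrix_mul_assoc cmat_mult cmat_1 mult.commute)
  then have "fst (h \<otimes>\<^bsub>GLt\<^esub> \<delta> b) = fst (\<delta> c \<otimes>\<^bsub>GLt\<^esub> r)" using b c0 by (simp add: r_def)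
  then consider "h \<otimes>\<^bsub>GLt\<^esub> \<delta> b = \<delta> c \<otimes>\<^bsub>GLt\<^esub> r" | "h \<otimes>\<^bsub>GLt\<^esub> \<delta> b = \<delta> c \<otimes>\<^bsub>GLt\<^esub> r \<otimes>\<^bsub>GLt\<^esub> \<delta> (-1)"
    using GLt_lift_cases[OF hb cr] by blast
  then show ?thesis
  proof cases
    case 1 then show ?thesis using that[OF rR] by (simp add: c_def)
  next
    case 2
    \<comment> \<open>With the wrong lift, \<open>wc_mult\<close> gives \<open>wc h * b / c\<close>
      negative real part, since \<open>k\<close> has positive real part. But by
      \<open>spin_act_Re\<close> the inverse of this number, up to the positive factor
      \<open>cmod ?y\<close>, has positive real part, and inversion preserves the sign of the real
      part.\<close>
    define k where "k = csqrt (aut_factor (cmat (c\<^sup>2)) (moebius_act (fst r) \<i>) / aut_factor (cmat (c\<^sup>2)) \<i>)"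
    have "0 < det (cmat (c\<^sup>2))" using c0 by (simp add: det_cmat)
    then have k: "0 < Re k" unfolding k_def
      by (intro Re_csqrt_pos aut_ratio_slit moebius_act_in GLt_det rG) auto
    have "wc h * b = - (c * k * of_real (sqrt (m$2$2)))"
      using arg_cong[OF 2, of wc] wc_mult_delta[OF h b] wc_mult_delta[OF cr, of "-1"] wc_mult[of "\<delta> c" r] c0 rG
      by (simp add: k_def wr)
    then have e: "wc h * b / c = - (k * of_real (sqrt (m$2$2)))" using c0 by (simp add: field_simps)
    have "0 < Re (?y / (wc h * b))" using spin_act_Re[OF h b] .
    moreover have "?y / (wc h * b) = of_real (cmod ?y) / (wc h * b / c)"
      using c0 y0 by (simp add: c_def sgn_div_norm scaleR_conv_of_real field_simps)
    ultimately have "0 < Re (of_real (cmod ?y) / - (k * of_real (sqrt (m$2$2))))" unfolding e by simp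
    moreover have "Re (of_real (cmod ?y) / - (k * of_real (sqrt (m$2$2)))) \<le> 0"
      using k m2 by (simp add: Re_divide divide_nonpos_nonneg mult_nonneg_nonneg)
    ultimately show ?thesis by simp
  qed
qed

text \<open>Comparing the images of 1 shows that the square of q = c / d is a positive real of
  modulus 1. So q is 1 or -1, and -1 would turn the positive \<open>wc r\<close> into the negative
  of a positive number.\<close>

lemma QR_unique:
  assumes "c \<noteq> 0" "d \<noteq> 0" "cmod c = cmod d" "r \<in> R_part" "s \<in> R_part" "\<delta> c \<otimes>\<^bsub>GLt\<^esub> r = \<delta> d \<otimes>\<^bsub>GLt\<^esub> s"
  shows "c = d"
proof -
  have rs: "r \<in> carrier GLt" "s \<in> carrier GLt" using assms by (auto simp: R_part_eq)
  have "\<delta> (c / d) = \<delta> (inverse d) \<otimes>\<^bsub>GLt\<^esub> \<delta> c" using assms by (simp add: delta_mult divide_inverse mult.commute)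
  then have "\<delta> (c / d) \<otimes>\<^bsub>GLt\<^esub> r = \<delta> (inverse d) \<otimes>\<^bsub>GLt\<^esub> (\<delta> d \<otimes>\<^bsub>GLt\<^esub> s)"
    using assms rs by (metis GLt.m_assoc delta_in inverse_nonzero_iff_nonzero)
  also have "\<dots> = \<delta> (inverse d) \<otimes>\<^bsub>GLt\<^esub> \<delta> d \<otimes>\<^bsub>GLt\<^esub> s" using assms rs by (simp add: GLt.m_assoc)
  also have "\<dots> = s" using assms rs by (simp add: delta_mult delta_1)
  finally have e: "\<delta> (c / d) \<otimes>\<^bsub>GLt\<^esub> r = s" .
  define q where "q = c / d"
  have q: "cmod q = 1" "q \<noteq> 0" using assms by (auto simp: q_def norm_divide)
  have "gl_lin (fst (\<delta> q \<otimes>\<^bsub>GLt\<^esub> r)) 1 = gl_lin (fst s) 1" using e by (simp add: q_def)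
  then have "q\<^sup>2 * gl_lin (fst r) 1 = gl_lin (fst s) 1" using q by (simp add: gl_lin_mult gl_lin_cmat)
  moreover have "gl_lin (fst r) 1 = of_real (fst r$1$1)" "gl_lin (fst s) 1 = of_real (fst s$1$1)"
    using assms(4,5) by (auto simp: R_part_eq gl_lin_def complex_eq_iff)
  ultimately have "q\<^sup>2 = of_real (fst s$1$1 / fst r$1$1)"
    using assms(4) by (simp add: R_part_eq field_simps)
  moreover have "0 < fst s$1$1 / fst r$1$1" using assms(4,5) by (simp add: R_part_eq)
  moreover have "cmod (q\<^sup>2) = 1" using q by (simp add: norm_power)
  ultimately have "q\<^sup>2 = 1" by (metis abs_of_pos norm_of_real of_real_1)
  then consider "q = 1" | "q = -1" by (auto simp: power2_eq_1_iff)
  then show ?thesis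
  proof cases
    case 1 then show ?thesis using assms by (simp add: q_def)
  next
    case 2
    have "s = r \<otimes>\<^bsub>GLt\<^esub> \<delta> (-1)" using e 2 rs delta_minus_central by (simp add: q_def)
    then have "wc s = - wc r" using rs by (simp add: wc_mult_delta)
    then show ?thesis using assms(4,5) by (simp add: R_part_eq)
  qed
qed

text \<open>The squares of both sides agree; the sign cannot be read off from the definition,
  because \<open>wc\<close> is not multiplicative. Instead the product of \<open>h\<close>,
  \<open>k\<close> and \<open>\<delta> b\<close> is decomposed twice, once directly and once by
  moving \<delta> to the left past \<open>k\<close> and then past \<open>h\<close>. Uniqueness of
  the decomposition identifies the two directions.\<close>

lemma spin_act_mult:
  assumes h: "h \<in> carrier GLt" and k: "k \<in> carrier GLt" and b: "b \<noteq> 0"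
  shows "spin_act (h \<otimes>\<^bsub>GLt\<^esub> k) b = spin_act h (spin_act k b)"
proof -
  let ?y = "spin_act k b" let ?x = "spin_act h ?y" let ?z = "spin_act (h \<otimes>\<^bsub>GLt\<^esub> k) b"
  have y: "?y \<noteq> 0" using spin_act_nonzero k b .
  have x: "?x \<noteq> 0" using spin_act_nonzero h y .
  have z: "?z \<noteq> 0" using spin_act_nonzero h k b by simp
  obtain r where r: "r \<in> R_part" "k \<otimes>\<^bsub>GLt\<^esub> \<delta> b = \<delta> (sgn ?y) \<otimes>\<^bsub>GLt\<^esub> r" using QR_exists[OF k b] .
  have sy: "sgn ?y \<noteq> 0" using y by (simp add: sgn_zero_iff)
  obtain s where s: "s \<in> R_part" "h \<otimes>\<^bsub>GLt\<^esub> \<delta> (sgn ?y) = \<delta> (sgn (spin_act h (sgn ?y))) \<otimes>\<^bsub>GLt\<^esub> s" using QR_exists[OF h sy] .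
  \<comment> \<open>The first decomposition yields the normalised value \<open>sgn ?y\<close>
    instead of \<open>?y\<close>; a positive factor passes through the action and does not affect
    directions.\<close>
  have "spin_act h (of_real (inverse (cmod ?y)) * ?y) = of_real (inverse (cmod ?y)) * ?x"
    using y h by (intro spin_act_scale) auto
  then have "spin_act h (sgn ?y) = of_real (inverse (cmod ?y)) * ?x"
    by (simp add: sgn_div_norm scaleR_conv_of_real)
  then have "sgn (spin_act h (sgn ?y)) = sgn ?x"
    using y by (simp add: sgn_mult sgn_of_real del: of_real_inverse)
  with s have s': "h \<otimes>\<^bsub>GLt\<^esub> \<delta> (sgn ?y) = \<delta> (sgn ?x) \<otimes>\<^bsub>GLt\<^esub> s" by simp
  have sx: "sgn ?x \<noteq> 0" using x by (simp add: sgn_zero_iff)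
  obtain t where t: "t \<in> R_part" "(h \<otimes>\<^bsub>GLt\<^esub> k) \<otimes>\<^bsub>GLt\<^esub> \<delta> b = \<delta> (sgn ?z) \<otimes>\<^bsub>GLt\<^esub> t"
    using QR_exists[of "h \<otimes>\<^bsub>GLt\<^esub> k" b] h k b by auto
  have rG: "r \<in> carrier GLt" "s \<in> carrier GLt" using r s by (auto simp: R_part_eq)
  have "(h \<otimes>\<^bsub>GLt\<^esub> k) \<otimes>\<^bsub>GLt\<^esub> \<delta> b = h \<otimes>\<^bsub>GLt\<^esub> (\<delta> (sgn ?y) \<otimes>\<^bsub>GLt\<^esub> r)" using r(2) h k b by (simp add: GLt.m_assoc)
  also have "\<dots> = (h \<otimes>\<^bsub>GLt\<^esub> \<delta> (sgn ?y)) \<otimes>\<^bsub>GLt\<^esub> r" using h sy rG by (simp add: GLt.m_assoc)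
  also have "\<dots> = \<delta> (sgn ?x) \<otimes>\<^bsub>GLt\<^esub> (s \<otimes>\<^bsub>GLt\<^esub> r)" unfolding s' using sx rG by (simp add: GLt.m_assoc)
  finally have "\<delta> (sgn ?z) \<otimes>\<^bsub>GLt\<^esub> t = \<delta> (sgn ?x) \<otimes>\<^bsub>GLt\<^esub> (s \<otimes>\<^bsub>GLt\<^esub> r)" using t(2) by simp
  then have sg: "sgn ?z = sgn ?x"
    using QR_unique[of "sgn ?z" "sgn ?x" t "s \<otimes>\<^bsub>GLt\<^esub> r"] t(1) r(1) s(1) sx z x R_part_mult
    by (simp add: sgn_zero_iff norm_sgn)
  have "?z\<^sup>2 = ?x\<^sup>2" using h k b y by (simp add: spin_act_square gl_lin_mult)
  then have "cmod ?z = cmod ?x" by (auto simp: power2_eq_iff)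
  then show ?thesis using sg x z by (simp add: sgn_div_norm)
qed

lemma Qt_mult_delta:
  assumes "h \<in> carrier GLt" "b \<noteq> 0"
  shows "Qt (h \<otimes>\<^bsub>GLt\<^esub> \<delta> b) = \<delta> (sgn (spin_act h b))"
proof -
  let ?c = "sgn (spin_act h b)"
  have c: "?c \<noteq> 0" "cmod ?c = 1" using spin_act_nonzero[OF assms] by (simp_all add: norm_sgn sgn_zero_iff)
  obtain r where r: "r \<in> R_part" "h \<otimes>\<^bsub>GLt\<^esub> \<delta> b = \<delta> ?c \<otimes>\<^bsub>GLt\<^esub> r" using QR_exists[OF assms] .
  show ?thesis unfolding Qt_def r(2)
  proof (rule the_equality)
    show "\<delta> ?c \<in> \<delta> ` sphere 0 1 \<and> (\<exists>ra\<in>R_part. \<delta> ?c \<otimes>\<^bsub>GLt\<^esub> r = \<delta> ?c \<otimes>\<^bsub>GLt\<^esub> ra)" using r c by auto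
    fix q assume "q \<in> \<delta> ` sphere 0 1 \<and> (\<exists>ra\<in>R_part. \<delta> ?c \<otimes>\<^bsub>GLt\<^esub> r = q \<otimes>\<^bsub>GLt\<^esub> ra)"
    then obtain d s where d: "q = \<delta> d" "cmod d = 1" "s \<in> R_part" "\<delta> ?c \<otimes>\<^bsub>GLt\<^esub> r = \<delta> d \<otimes>\<^bsub>GLt\<^esub> s" by auto
    then have "d \<noteq> 0" by auto
    then show "q = \<delta> ?c" using QR_unique[of ?c d r s] c r d by auto
  qed
qed

text \<open>The bridge from the definition of the edge sign to the spinor action: conjugation by a
  lift of \<open>b^2\<close>, followed by dropping the triangular factor, leaves the rotation from
  \<open>b\<close> to the direction of \<open>spin_act h b\<close>. The lift picked by
  \<open>SOME\<close> is \<open>\<delta> b\<close> or \<open>\<delta> (- b)\<close>, and the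
  resulting quotient is the same for both.\<close>

lemma Qt_at_eq:
  assumes h: "h \<in> carrier GLt" and b: "cmod b = 1"
  shows "Qt_at (b\<^sup>2) h = \<delta> (sgn (spin_act h b) / b)"
proof -
  define l where "l = (SOME l. l \<in> carrier GLt \<and> p_GL l = cmat (b\<^sup>2))"
  have b0: "b \<noteq> 0" using b by auto
  have "\<delta> b \<in> carrier GLt \<and> fst (\<delta> b) = cmat (b\<^sup>2)" using b0 by simp
  then have l: "l \<in> carrier GLt" "fst l = cmat (b\<^sup>2)" unfolding l_def by (metis (mono_tags, lifting) someI_ex)+
  define c where "c = wc l"
  have "c\<^sup>2 = b\<^sup>2" unfolding c_def using wc_square[OF l(1)] l(2) by (simp add: aut_factor_cmat_i)
  then have cb: "c = b \<or> c = - b" by (simp add: power2_eq_iff)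
  have c0: "c \<noteq> 0" using cb b0 by auto
  have lc: "l = \<delta> c" by (rule GLt_eqI) (use l c0 \<open>c\<^sup>2 = b\<^sup>2\<close> in \<open>simp_all add: c_def\<close>)
  have "inv\<^bsub>GLt\<^esub> l = \<delta> (inverse c)" unfolding lc
    by (rule GLt.inv_equality) (simp_all add: c0 delta_mult delta_1)
  then have "Qt_at (b\<^sup>2) h = Qt ((\<delta> (inverse c) \<otimes>\<^bsub>GLt\<^esub> h) \<otimes>\<^bsub>GLt\<^esub> \<delta> c)"
    unfolding Qt_at_def l_def[symmetric] Let_def by (simp add: lc)
  also have "\<dots> = \<delta> (sgn (spin_act (\<delta> (inverse c) \<otimes>\<^bsub>GLt\<^esub> h) c))"
    using Qt_mult_delta c0 h by simp
  also have "spin_act (\<delta> (inverse c) \<otimes>\<^bsub>GLt\<^esub> h) c = inverse c * spin_act h c"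
    using c0 h by (simp add: spin_act_mult spin_act_delta spin_act_nonzero)
  also have "inverse c * spin_act h c = spin_act h b / b"
    using cb b0 h by (auto simp: spin_act_minus divide_inverse)
  also have "sgn (spin_act h b / b) = sgn (spin_act h b) / b"
    using b by (simp add: sgn_div_norm norm_divide scaleR_conv_of_real)
  finally show ?thesis .
qed

text \<open>A matrix of positive determinant preserves the orientation of two directions less than
  pi apart; the claim is the corresponding statement for their square roots, including the sign. The
  QR-decomposition reduces it to a triangular matrix with positive diagonal, which fixes the
  direction of 1.\<close>

lemma spin_act_rotate:
  assumes h: "h \<in> carrier GLt" and b: "cmod b = 1" and t: "0 < t" "t < pi"
  shows "0 < Re (spin_act h (b * cis (t / 2)) / spin_act h b)" (is "0 < Re ?e")
    and "0 < Im (spin_act h (b * cis (t / 2)) / spin_act h b)"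
proof -
  define u where "u = cis (t / 2)"
  have u: "0 < Re u" "0 < Im u" "u \<noteq> 0" using t by (auto simp: u_def intro!: cos_gt_zero sin_gt_zero)
  have b0: "b \<noteq> 0" using b by auto
  define c where "c = sgn (spin_act h b)"
  have c0: "c \<noteq> 0" using spin_act_nonzero[OF h b0] by (simp add: c_def sgn_zero_iff)
  obtain r where r: "r \<in> R_part" "h \<otimes>\<^bsub>GLt\<^esub> \<delta> b = \<delta> c \<otimes>\<^bsub>GLt\<^esub> r" using QR_exists[OF h b0] c_def by blast
  have rG: "r \<in> carrier GLt" using r by (simp add: R_part_eq)
  have *: "spin_act h (b * x) = c * spin_act r x" if "x \<noteq> 0" for x
    using arg_cong[OF r(2), of "\<lambda>h. spin_act h x"] that h b0 c0 rG
    by (simp add: spin_act_mult spin_act_delta spin_act_nonzero)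
  define a where "a = fst r $ 1 $ 1"
  have a: "0 < a" using r(1) by (simp add: R_part_eq a_def)
  define d where "d = fst r $ 2 $ 2"
  have d: "0 < d" using r(1) GLt_det[OF rG] by (simp add: R_part_eq det_2 d_def zero_less_mult_iff)
  have wr: "wc r = of_real (Re (wc r))" "0 < Re (wc r)" using r(1) by (simp_all add: R_part_eq complex_eq_iff)
  have 1: "spin_act r 1 = of_real (sqrt a)"
  proof (rule spin_act_unique[symmetric, OF rG])
    show "(complex_of_real (sqrt a))\<^sup>2 = gl_lin (p_GL r) (1\<^sup>2)"
      using r(1) a by (simp add: R_part_eq a_def gl_lin_def complex_eq_iff flip: of_real_power)
    show "0 < Re (complex_of_real (sqrt a) / (wc r * 1))"
      using a wr by (metis Re_complex_of_real divide_pos_pos mult.right_neutral of_real_divide real_sqrt_gt_zero)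
  qed simp
  define y where "y = spin_act r u"
  have y2: "y\<^sup>2 = gl_lin (fst r) (u\<^sup>2)" unfolding y_def using spin_act_square[OF rG u(3)] .
  have "u\<^sup>2 = cis t" by (simp add: u_def power2_eq_square cis_mult)
  then have "Im (y\<^sup>2) = d * sin t" using y2 r(1) by (simp add: R_part_eq gl_lin_def d_def)
  moreover have "0 < d * sin t" using d t sin_gt_zero by (intro mult_pos_pos) auto
  ultimately have "0 < 2 * (Re y * Im y)" by (simp add: Im_power2 mult.assoc)
  then have "0 < Re y * Im y" by (simp add: mult.commute)
  \<comment> \<open>The square of \<open>y\<close> lies in the upper half plane, so \<open>y\<close>
    is in the first or the third quadrant. Its inner product with \<open>u\<close>, a point of the
    first quadrant, is positive, which excludes the third.\<close>
  then have sgn: "0 < Re y \<and> 0 < Im y \<or> Re y < 0 \<and> Im y < 0" by (auto simp: zero_less_mult_iff)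
  have "0 < Re (y / (wc r * u))" unfolding y_def using spin_act_Re[OF rG u(3)] .
  also have "y / (wc r * u) = (y / u) / of_real (Re (wc r))" using wr by (simp add: field_simps)
  also have "Re ((y / u) / of_real (Re (wc r))) = Re (y / u) / Re (wc r)" by (rule Re_divide_of_real)
  finally have "0 < Re (y / u)" using wr(2) by (metis zero_less_divide_iff order.asym)
  moreover have "Re (y / u) = (Re y * Re u + Im y * Im u) / ((Re u)\<^sup>2 + (Im u)\<^sup>2)" by (simp add: Re_divide)
  moreover have "0 < (Re u)\<^sup>2 + (Im u)\<^sup>2" using u by (simp add: sum_power2_gt_zero_iff)
  ultimately have "0 < Re y * Re u + Im y * Im u" by (metis zero_less_divide_iff order.asym)
  then have "0 < Re y" "0 < Im y" using sgn u by (smt (verit) mult_neg_pos)+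
  moreover have "?e = y / of_real (sqrt a)"
    using *[of u] *[of 1] u c0 1 by (simp add: u_def[symmetric] y_def)
  ultimately show "0 < Re ?e" "0 < Im ?e" using a by simp_all
qed

subsection \<open>Principal bundles\<close>

lemma continuous_map_locally:
  assumes "\<And>z. z \<in> topspace Z \<Longrightarrow> \<exists>T. openin Z T \<and> z \<in> T \<and> continuous_map (subtopology Z T) Y f"
  shows "continuous_map Z Y f"
proof -
  obtain T where T: "\<And>z. z \<in> topspace Z \<Longrightarrow> openin Z (T z) \<and> z \<in> T z \<and> continuous_map (subtopology Z (T z)) Y f"
    using assms by metis
  show ?thesis
    by (rule pasting_lemma[of "topspace Z" Z T Y "\<lambda>_. f"]) (use T in auto)
qed

locale principal_bundle =
  fixes X :: "'a topology" and P :: "('p, 'a) spin_bundle"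
  assumes principal: "principal_GLt_bundle X P"
begin

abbreviation "tot \<equiv> topspace (total_space P)"

lemma continuous_proj: "continuous_map (total_space P) X (proj P)"
  and continuous_act: "continuous_map (prod_topology (total_space P) GLt_top) (total_space P) (\<lambda>(u, g). act P u g)"
  and act_one: "u \<in> tot \<Longrightarrow> act P u \<one>\<^bsub>GLt\<^esub> = u"
  and proj_act: "u \<in> tot \<Longrightarrow> g \<in> carrier GLt \<Longrightarrow> proj P (act P u g) = proj P u"
  and act_act: "u \<in> tot \<Longrightarrow> g \<in> carrier GLt \<Longrightarrow> h \<in> carrier GLt \<Longrightarrow> act P (act P u g) h = act P u (g \<otimes>\<^bsub>GLt\<^esub> h)"
  using principal by (auto simp: principal_GLt_bundle_def)

lemma local_triv:
  assumes "x \<in> topspace X"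
  shows "\<exists>U \<tau>. openin X U \<and> x \<in> U \<and>
    homeomorphic_map (prod_topology (subtopology X U) GLt_top) (subtopology (total_space P) {u. proj P u \<in> U}) \<tau> \<and>
    (\<forall>y\<in>U. \<forall>g\<in>carrier GLt. proj P (\<tau> (y, g)) = y \<and>
      (\<forall>h\<in>carrier GLt. \<tau> (y, g \<otimes>\<^bsub>GLt\<^esub> h) = act P (\<tau> (y, g)) h))"
  using principal assms unfolding principal_GLt_bundle_def by (elim conjE) (rule bspec)

lemma proj_in: "u \<in> tot \<Longrightarrow> proj P u \<in> topspace X"
  using continuous_proj continuous_map_image_subset_topspace by fast

lemma act_in: "u \<in> tot \<Longrightarrow> g \<in> carrier GLt \<Longrightarrow> act P u g \<in> tot"
  using continuous_map_image_subset_topspace[OF continuous_act] by fastforce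

lemma continuous_act_compose:
  assumes "continuous_map Z (total_space P) f" "continuous_map Z GLt_top g"
  shows "continuous_map Z (total_space P) (\<lambda>z. act P (f z) (g z))"
  using continuous_map_compose[OF _ continuous_act, of Z "\<lambda>z. (f z, g z)"] assms
  by (simp add: continuous_map_pairwise o_def)

lemma act_inv:
  assumes "u \<in> tot" "g \<in> carrier GLt" shows "act P (act P u g) (inv\<^bsub>GLt\<^esub> g) = u"
  using assms by (simp add: act_act act_one)

text \<open>Of the inverse of a trivialisation only the group coordinate \<kappa> is recorded, as
  the base coordinate is \<open>proj P\<close>.\<close>

definition triv_chart :: "'a set \<Rightarrow> ('a \<times> gl \<Rightarrow> 'p) \<Rightarrow> ('p \<Rightarrow> gl) \<Rightarrow> bool" where
  "triv_chart U \<tau> \<kappa> \<longleftrightarrow> openin X U \<and>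
    continuous_map (subtopology (total_space P) {u. proj P u \<in> U}) GLt_top \<kappa> \<and>
    continuous_map (prod_topology (subtopology X U) GLt_top) (total_space P) \<tau> \<and>
    (\<forall>y\<in>U. \<forall>g\<in>carrier GLt. proj P (\<tau> (y, g)) = y \<and> \<kappa> (\<tau> (y, g)) = g \<and>
      (\<forall>h\<in>carrier GLt. \<tau> (y, g \<otimes>\<^bsub>GLt\<^esub> h) = act P (\<tau> (y, g)) h)) \<and>
    (\<forall>u\<in>tot. proj P u \<in> U \<longrightarrow> \<kappa> u \<in> carrier GLt \<and> \<tau> (proj P u, \<kappa> u) = u)"

lemma triv_chart_exists:
  assumes "x \<in> topspace X"
  obtains U \<tau> \<kappa> where "triv_chart U \<tau> \<kappa>" "x \<in> U"
proof -
  obtain U \<tau> where *: "openin X U \<and> x \<in> U \<and>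
    homeomorphic_map (prod_topology (subtopology X U) GLt_top) (subtopology (total_space P) {u. proj P u \<in> U}) \<tau> \<and>
    (\<forall>y\<in>U. \<forall>g\<in>carrier GLt. proj P (\<tau> (y, g)) = y \<and>
      (\<forall>h\<in>carrier GLt. \<tau> (y, g \<otimes>\<^bsub>GLt\<^esub> h) = act P (\<tau> (y, g)) h))"
    using local_triv[OF assms] by (elim exE)
  then have U: "openin X U" "x \<in> U"
    and hom: "homeomorphic_map (prod_topology (subtopology X U) GLt_top) (subtopology (total_space P) {u. proj P u \<in> U}) \<tau>"
    and pr: "\<And>y g. y \<in> U \<Longrightarrow> g \<in> carrier GLt \<Longrightarrow> proj P (\<tau> (y, g)) = y"
    and eq: "\<And>y g h. y \<in> U \<Longrightarrow> g \<in> carrier GLt \<Longrightarrow> h \<in> carrier GLt \<Longrightarrow> \<tau> (y, g \<otimes>\<^bsub>GLt\<^esub> h) = act P (\<tau> (y, g)) h"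
    by auto
  have UX: "U \<subseteq> topspace X" using U openin_subset by auto
  obtain \<rho> where maps: "homeomorphic_maps (prod_topology (subtopology X U) GLt_top) (subtopology (total_space P) {u. proj P u \<in> U}) \<tau> \<rho>"
    using hom homeomorphic_map_maps by blast
  then have ct: "continuous_map (prod_topology (subtopology X U) GLt_top) (subtopology (total_space P) {u. proj P u \<in> U}) \<tau>"
    and cr: "continuous_map (subtopology (total_space P) {u. proj P u \<in> U}) (prod_topology (subtopology X U) GLt_top) \<rho>"
    and rt: "\<And>p. p \<in> U \<times> carrier GLt \<Longrightarrow> \<rho> (\<tau> p) = p"
    and tr: "\<And>u. u \<in> tot \<Longrightarrow> proj P u \<in> U \<Longrightarrow> \<tau> (\<rho> u) = u"
    using UX by (auto simp: homeomorphic_maps_def Int_absorb1)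
  have "triv_chart U \<tau> (\<lambda>u. snd (\<rho> u))" unfolding triv_chart_def
  proof (intro conjI ballI impI)
    show "continuous_map (subtopology (total_space P) {u. proj P u \<in> U}) GLt_top (\<lambda>u. snd (\<rho> u))"
      using continuous_map_compose[OF cr continuous_map_snd] by (simp add: o_def)
    show "continuous_map (prod_topology (subtopology X U) GLt_top) (total_space P) \<tau>"
      using ct continuous_map_in_subtopology by blast
    fix u assume u: "u \<in> tot" "proj P u \<in> U"
    have i: "\<rho> u \<in> U \<times> carrier GLt"
      using continuous_map_image_subset_topspace[OF cr] u UX by (auto simp: Int_absorb1)
    then show "snd (\<rho> u) \<in> carrier GLt" by auto
    have "fst (\<rho> u) = proj P u" using i tr[OF u] pr[of "fst (\<rho> u)" "snd (\<rho> u)"] by auto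
    then show "\<tau> (proj P u, snd (\<rho> u)) = u" using tr[OF u] by (metis prod.collapse)
  qed (use U pr eq rt in auto)
  then show ?thesis using that U by blast
qed

lemma triv_chartD:
  assumes "triv_chart U \<tau> \<kappa>"
  shows "openin X U"
    "continuous_map (subtopology (total_space P) {u. proj P u \<in> U}) GLt_top \<kappa>"
    "continuous_map (prod_topology (subtopology X U) GLt_top) (total_space P) \<tau>"
    "y \<in> U \<Longrightarrow> g \<in> carrier GLt \<Longrightarrow> proj P (\<tau> (y, g)) = y"
    "y \<in> U \<Longrightarrow> g \<in> carrier GLt \<Longrightarrow> \<kappa> (\<tau> (y, g)) = g"
    "y \<in> U \<Longrightarrow> g \<in> carrier GLt \<Longrightarrow> h \<in> carrier GLt \<Longrightarrow> \<tau> (y, g \<otimes>\<^bsub>GLt\<^esub> h) = act P (\<tau> (y, g)) h"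
    "u \<in> tot \<Longrightarrow> proj P u \<in> U \<Longrightarrow> \<kappa> u \<in> carrier GLt"
    "u \<in> tot \<Longrightarrow> proj P u \<in> U \<Longrightarrow> \<tau> (proj P u, \<kappa> u) = u"
  using assms by (simp_all add: triv_chart_def)

lemma act_injective:
  assumes "u \<in> tot" "g \<in> carrier GLt" "h \<in> carrier GLt" "act P u g = act P u h" shows "g = h"
proof -
  obtain U \<tau> \<kappa> where C: "triv_chart U \<tau> \<kappa>" and U: "proj P u \<in> U"
    using triv_chart_exists[OF proj_in[OF assms(1)]] .
  note k = triv_chartD(5)[OF C] and eq = triv_chartD(6)[OF C] and tk = triv_chartD(7,8)[OF C]
  have "\<kappa> (act P u a) = \<kappa> u \<otimes>\<^bsub>GLt\<^esub> a" if "a \<in> carrier GLt" for a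
    using tk(1)[OF assms(1) U] tk(2)[OF assms(1) U] eq[OF U _ that, of "\<kappa> u"] k[OF U, of "\<kappa> u \<otimes>\<^bsub>GLt\<^esub> a"] that by simp
  then have "\<kappa> u \<otimes>\<^bsub>GLt\<^esub> g = \<kappa> u \<otimes>\<^bsub>GLt\<^esub> h" using assms by metis
  then show ?thesis using tk(1)[OF assms(1) U] assms by simp
qed

lemma act_transitive:
  assumes "u \<in> tot" "u' \<in> tot" "proj P u = proj P u'"
  shows "\<exists>g\<in>carrier GLt. act P u g = u'"
proof -
  obtain U \<tau> \<kappa> where C: "triv_chart U \<tau> \<kappa>" and U: "proj P u \<in> U"
    using triv_chart_exists[OF proj_in[OF assms(1)]] .
  note eq = triv_chartD(6)[OF C] and tk = triv_chartD(8)[OF C]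
  have k: "\<kappa> u \<in> carrier GLt" "\<kappa> u' \<in> carrier GLt" using triv_chartD(7)[OF C] assms U by auto
  then have "act P u (inv\<^bsub>GLt\<^esub> (\<kappa> u) \<otimes>\<^bsub>GLt\<^esub> \<kappa> u') = u'"
    using eq[OF U, of "\<kappa> u" "inv\<^bsub>GLt\<^esub> (\<kappa> u) \<otimes>\<^bsub>GLt\<^esub> \<kappa> u'"] tk[OF assms(1)] tk[OF assms(2)] U assms(3)
    by (simp add: GLt.m_assoc[symmetric])
  then show ?thesis using k by blast
qed

definition transl :: "'p \<Rightarrow> 'p \<Rightarrow> gl" where
  "transl u u' = (THE g. g \<in> carrier GLt \<and> act P u g = u')"

lemma transl_act: "u \<in> tot \<Longrightarrow> g \<in> carrier GLt \<Longrightarrow> transl u (act P u g) = g"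
  unfolding transl_def by (rule the_equality) (auto dest: act_injective)

lemma transl:
  assumes "u \<in> tot" "u' \<in> tot" "proj P u = proj P u'"
  shows "transl u u' \<in> carrier GLt" "act P u (transl u u') = u'"
  using act_transitive[OF assms] transl_act[OF assms(1)] by auto

text \<open>In a trivialisation the translation element from u to u' is the inverse of
  \<open>\<kappa> u\<close> times \<open>\<kappa> u'\<close>, and multiplication and inversion of
  \<open>GLt\<close> are continuous. Comparing two lifts of the same points thus gives a continuous
  map to the group.\<close>

lemma continuous_transl:
  assumes f: "continuous_map Z (total_space P) f" and g: "continuous_map Z (total_space P) g"
    and e: "\<And>z. z \<in> topspace Z \<Longrightarrow> proj P (f z) = proj P (g z)"
  shows "continuous_map Z GLt_top (\<lambda>z. transl (f z) (g z))"
proof (rule continuous_map_locally)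
  fix z assume z: "z \<in> topspace Z"
  have fin: "f w \<in> tot" "g w \<in> tot" if "w \<in> topspace Z" for w
    using that f g continuous_map_image_subset_topspace by blast+
  obtain U \<tau> \<kappa> where C: "triv_chart U \<tau> \<kappa>" and U: "proj P (f z) \<in> U"
    using triv_chart_exists[OF proj_in[OF fin(1)[OF z]]] .
  note ck = triv_chartD(2)[OF C] and eq = triv_chartD(6)[OF C] and tk = triv_chartD(7,8)[OF C]
  define T where "T = {w \<in> topspace Z. proj P (f w) \<in> U}"
  have oT: "openin Z T" unfolding T_def
    using openin_continuous_map_preimage[OF continuous_map_compose[OF f continuous_proj] triv_chartD(1)[OF C]] by (simp add: o_def)
  have c: "continuous_map (subtopology Z T) GLt_top (\<lambda>w. \<kappa> (h w))"
    if h: "continuous_map Z (total_space P) h" "\<And>w. w \<in> T \<Longrightarrow> proj P (h w) \<in> U" for h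
  proof -
    have "continuous_map (subtopology Z T) (subtopology (total_space P) {u. proj P u \<in> U}) h"
      using h by (auto simp: continuous_map_in_subtopology continuous_map_from_subtopology)
    then show ?thesis using continuous_map_compose[OF _ ck] by (simp add: o_def)
  qed
  have "continuous_map (subtopology Z T) GLt_top (\<lambda>w. inv\<^bsub>GLt\<^esub> (\<kappa> (f w)) \<otimes>\<^bsub>GLt\<^esub> \<kappa> (g w))"
    using e by (intro continuous_GLt_mult continuous_GLt_inv c f g) (auto simp: T_def)
  then have "continuous_map (subtopology Z T) GLt_top (\<lambda>w. transl (f w) (g w))"
  proof (rule continuous_map_eq)
    fix w assume "w \<in> topspace (subtopology Z T)"
    then have w: "w \<in> topspace Z" "proj P (f w) \<in> U" by (auto simp: T_def)
    note kf = tk(1)[OF fin(1)[OF w(1)] w(2)] tk(2)[OF fin(1)[OF w(1)] w(2)]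
    have kg: "\<kappa> (g w) \<in> carrier GLt" "\<tau> (proj P (f w), \<kappa> (g w)) = g w"
      using tk(1)[OF fin(2)[OF w(1)]] tk(2)[OF fin(2)[OF w(1)]] e[OF w(1)] w(2) by auto
    have "act P (f w) (inv\<^bsub>GLt\<^esub> (\<kappa> (f w)) \<otimes>\<^bsub>GLt\<^esub> \<kappa> (g w)) = g w"
      using eq[OF w(2), of "\<kappa> (f w)" "inv\<^bsub>GLt\<^esub> (\<kappa> (f w)) \<otimes>\<^bsub>GLt\<^esub> \<kappa> (g w)"] kf kg
      by (simp add: GLt.m_assoc[symmetric])
    then show "inv\<^bsub>GLt\<^esub> (\<kappa> (f w)) \<otimes>\<^bsub>GLt\<^esub> \<kappa> (g w) = transl (f w) (g w)"
      using transl_act[OF fin(1)[OF w(1)], of "inv\<^bsub>GLt\<^esub> (\<kappa> (f w)) \<otimes>\<^bsub>GLt\<^esub> \<kappa> (g w)"] kf kg by simp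
  qed
  then show "\<exists>T. openin Z T \<and> z \<in> T \<and> continuous_map (subtopology Z T) GLt_top (\<lambda>z. transl (f z) (g z))"
    using oT z U by (auto simp: T_def)
qed

text \<open>A section trivialises the bundle. The inverse map is continuous because its group
  component is the translation element from the section to the given point.\<close>

lemma section_homeomorphic:
  assumes s: "continuous_map (subtopology X U) (total_space P) s" and U: "U \<subseteq> topspace X"
    and ps: "\<And>y. y \<in> U \<Longrightarrow> proj P (s y) = y"
  shows "homeomorphic_map (prod_topology (subtopology X U) GLt_top)
    (subtopology (total_space P) {u. proj P u \<in> U}) (\<lambda>(y, g). act P (s y) g)"
proof -
  have sin: "s y \<in> tot" if "y \<in> U" for y
    using that U s continuous_map_image_subset_topspace[OF s] by auto
  have c1: "continuous_map (prod_topology (subtopology X U) GLt_top) (total_space P) (\<lambda>p. act P (s (fst p)) (snd p))"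
    using continuous_map_compose[OF continuous_map_fst s]
    by (intro continuous_act_compose) (auto simp: o_def continuous_map_snd)
  have c2: "continuous_map (subtopology (total_space P) {u. proj P u \<in> U}) (subtopology X U) (proj P)"
    using continuous_proj by (auto simp: continuous_map_in_subtopology continuous_map_from_subtopology)
  have c3: "continuous_map (subtopology (total_space P) {u. proj P u \<in> U}) GLt_top (\<lambda>u. transl (s (proj P u)) u)"
  proof (rule continuous_transl)
    show "continuous_map (subtopology (total_space P) {u. proj P u \<in> U}) (total_space P) (\<lambda>u. s (proj P u))"
      using continuous_map_compose[OF c2 s] by (simp add: o_def)
    show "continuous_map (subtopology (total_space P) {u. proj P u \<in> U}) (total_space P) (\<lambda>u. u)"
      by (rule continuous_map_from_subtopology) (simp add: continuous_map_id[unfolded id_def])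
  qed (use ps in auto)
  have "homeomorphic_maps (prod_topology (subtopology X U) GLt_top)
    (subtopology (total_space P) {u. proj P u \<in> U}) (\<lambda>(y, g). act P (s y) g) (\<lambda>u. (proj P u, transl (s (proj P u)) u))"
    unfolding homeomorphic_maps_def
  proof (intro conjI ballI)
    show "continuous_map (prod_topology (subtopology X U) GLt_top)
        (subtopology (total_space P) {u. proj P u \<in> U}) (\<lambda>(y, g). act P (s y) g)"
      using c1 sin ps by (auto simp: continuous_map_in_subtopology case_prod_unfold proj_act)
    show "continuous_map (subtopology (total_space P) {u. proj P u \<in> U})
        (prod_topology (subtopology X U) GLt_top) (\<lambda>u. (proj P u, transl (s (proj P u)) u))"
      using c2 c3 by (simp add: continuous_map_pairwise o_def)
  qed (use sin ps transl in \<open>auto simp: proj_act transl_act\<close>)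
  then show ?thesis using homeomorphic_map_maps by blast
qed

end

subsection \<open>Adding a fibre\<close>

lemma subtopology_cong: "topspace X \<inter> S = topspace X \<inter> T \<Longrightarrow> subtopology X S = subtopology X T"
  using subtopology_restrict[of X S] subtopology_restrict[of X T] by simp

text \<open>The setting for filling in a fibre over the closed point \<open>x\<close>: the section
  \<open>s\<close> over \<open>U - {x}\<close> prescribes how the fibre is attached. The framing
  \<open>fr\<close> of the new fibre is a parameter, whose compatibility is checked when a spin
  structure is assembled.\<close>

locale glue =
  fixes Y :: "'a topology" and x :: 'a and U :: "'a set" and P :: "('p, 'a) spin_bundle"
    and s :: "'a \<Rightarrow> 'p" and fr :: "gl \<Rightarrow> 'a chart \<Rightarrow> real^2^2"
  assumes xY: "x \<in> topspace Y" and x_closed: "openin Y (topspace Y - {x})"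
    and PP: "principal_GLt_bundle (subtopology Y (topspace Y - {x})) P"
    and oU: "openin Y U" and xU: "x \<in> U"
    and s: "continuous_map (subtopology Y (U - {x})) (total_space P) s"
    and ps: "\<And>y. y \<in> U - {x} \<Longrightarrow> proj P (s y) = y"
begin

sublocale principal_bundle "subtopology Y (topspace Y - {x})" P
  by unfold_locales (rule PP)

abbreviation "Ug \<equiv> prod_topology (subtopology Y U) GLt_top"

definition E :: "('p + gl) set" where "E = Inl ` tot \<union> Inr ` carrier GLt"

definition \<theta> :: "'a \<times> gl \<Rightarrow> 'p + gl" where
  "\<theta> p = (if fst p = x then Inr (snd p) else Inl (act P (s (fst p)) (snd p)))"

text \<open>Gluing along \<open>\<theta>\<close>, the trivialisation over \<open>U\<close> determined by the section \<open>s\<close> and the new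
  fibre \<open>carrier GLt\<close> over \<open>x\<close>.\<close>

definition gopen :: "('p + gl) set \<Rightarrow> bool" where
  "gopen W \<longleftrightarrow> W \<subseteq> E \<and> openin (total_space P) {u \<in> tot. Inl u \<in> W} \<and>
     openin Ug {p \<in> U \<times> carrier GLt. \<theta> p \<in> W}"

definition glue_bundle :: "('p + gl, 'a) spin_bundle" where
  "glue_bundle = \<lparr> total_space = topology gopen, proj = case_sum (proj P) (\<lambda>_. x),
     act = (\<lambda>u h. case u of Inl p \<Rightarrow> Inl (act P p h) | Inr g \<Rightarrow> Inr (g \<otimes>\<^bsub>GLt\<^esub> h)),
     framing = case_sum (framing P) fr \<rparr>"

abbreviation "gtop \<equiv> topology gopen"

lemma UY: "U \<subseteq> topspace Y" using oU openin_subset by auto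

lemma topspace_Ug: "topspace Ug = U \<times> carrier GLt"
  using UY by (auto simp: Int_absorb1)

lemma istopology_gopen: "istopology gopen"
  unfolding istopology_def
proof (intro conjI allI impI)
  fix S T assume "gopen S" "gopen T"
  moreover have "{u \<in> tot. Inl u \<in> S \<inter> T} = {u \<in> tot. Inl u \<in> S} \<inter> {u \<in> tot. Inl u \<in> T}"
    "{p \<in> U \<times> carrier GLt. \<theta> p \<in> S \<inter> T} = {p \<in> U \<times> carrier GLt. \<theta> p \<in> S} \<inter> {p \<in> U \<times> carrier GLt. \<theta> p \<in> T}" by auto
  ultimately show "gopen (S \<inter> T)" by (auto simp: gopen_def simp del: mem_Sigma_iff)
next
  fix K assume K: "\<forall>S\<in>K. gopen S"
  have e: "{u \<in> tot. Inl u \<in> \<Union>K} = (\<Union>S\<in>K. {u \<in> tot. Inl u \<in> S})"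
    "{p \<in> U \<times> carrier GLt. \<theta> p \<in> \<Union>K} = (\<Union>S\<in>K. {p \<in> U \<times> carrier GLt. \<theta> p \<in> S})" by auto
  have o: "openin (total_space P) (\<Union>S\<in>K. {u \<in> tot. Inl u \<in> S})" "openin Ug (\<Union>S\<in>K. {p \<in> U \<times> carrier GLt. \<theta> p \<in> S})"
    using K by (intro openin_Union; fastforce simp: gopen_def)+
  have "\<Union>K \<subseteq> E" using K unfolding gopen_def by blast
  with o show "gopen (\<Union>K)" unfolding gopen_def e by blast
qed

lemma openin_gtop: "openin gtop W \<longleftrightarrow> gopen W"
  using istopology_gopen by (simp add: topology_inverse')

lemma s_in: "y \<in> U - {x} \<Longrightarrow> s y \<in> tot"
  using continuous_map_image_subset_topspace[OF s] UY by auto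

lemma theta_in: "p \<in> U \<times> carrier GLt \<Longrightarrow> \<theta> p \<in> E"
  using s_in act_in by (auto simp: \<theta>_def E_def)

lemma topspace_gtop [simp]: "topspace gtop = E"
proof -
  have "{p \<in> U \<times> carrier GLt. \<theta> p \<in> E} = topspace Ug" "{u \<in> tot. Inl u \<in> E} = tot"
    using theta_in UY by (auto simp: E_def)
  then have "gopen E" unfolding gopen_def by (metis openin_topspace order_refl)
  then show ?thesis using openin_gtop by (metis gopen_def openin_subset openin_topspace subset_antisym)
qed

text \<open>The universal property of the glued space: its topology is final with respect to
  \<open>Inl\<close> and \<theta>.\<close>

lemma continuous_map_gtop:
  assumes "continuous_map (total_space P) Z (\<lambda>u. f (Inl u))" "continuous_map Ug Z (\<lambda>p. f (\<theta> p))"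
  shows "continuous_map gtop Z f"
  unfolding continuous_map_def
proof (intro conjI allI impI)
  show "f \<in> topspace gtop \<rightarrow> topspace Z"
  proof
    fix w assume w: "w \<in> topspace gtop"
    show "f w \<in> topspace Z"
    proof (cases w)
      case (Inl u) then show ?thesis using w continuous_map_image_subset_topspace[OF assms(1)] by (auto simp: E_def)
    next
      case (Inr g)
      then have "w = \<theta> (x, g)" "(x, g) \<in> topspace Ug" using w xU unfolding topspace_Ug by (auto simp: \<theta>_def E_def)
      then show ?thesis using continuous_map_image_subset_topspace[OF assms(2)] by fast
    qed
  qed
  fix V assume V: "openin Z V"
  have "openin (total_space P) {u \<in> tot. f (Inl u) \<in> V}" using openin_continuous_map_preimage[OF assms(1) V] .
  moreover have "{u \<in> tot. f (Inl u) \<in> V} = {u \<in> tot. Inl u \<in> {w \<in> E. f w \<in> V}}" by (auto simp: E_def)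
  moreover have "openin Ug {p \<in> U \<times> carrier GLt. f (\<theta> p) \<in> V}"
    using openin_continuous_map_preimage[OF assms(2) V] unfolding topspace_Ug .
  moreover have "{p \<in> U \<times> carrier GLt. f (\<theta> p) \<in> V} = {p \<in> U \<times> carrier GLt. \<theta> p \<in> {w \<in> E. f w \<in> V}}"
    using theta_in by auto
  ultimately have "gopen {w \<in> E. f w \<in> V}" unfolding gopen_def by (metis (no_types, lifting) mem_Collect_eq subsetI)
  then show "openin gtop {w \<in> topspace gtop. f w \<in> V}" by (simp add: openin_gtop)
qed

lemma open_Ux: "openin Y (U - {x})"
proof -
  have "U - {x} = U \<inter> (topspace Y - {x})" using UY by auto
  then show ?thesis using oU x_closed by auto
qed

lemma continuous_Inl: "continuous_map (total_space P) gtop Inl"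
  unfolding continuous_map_def
proof (intro conjI allI impI)
  fix V assume "openin gtop V"
  then show "openin (total_space P) {u \<in> tot. Inl u \<in> V}" unfolding openin_gtop gopen_def by (elim conjE)
qed (simp add: E_def)

lemma continuous_theta: "continuous_map Ug gtop \<theta>"
  unfolding continuous_map_def topspace_Ug
proof (intro conjI allI impI)
  show "\<theta> \<in> U \<times> carrier GLt \<rightarrow> topspace gtop"
    unfolding topspace_gtop by (rule funcsetI) (rule theta_in)
next
  fix V assume "openin gtop V"
  then show "openin Ug {p \<in> U \<times> carrier GLt. \<theta> p \<in> V}" unfolding openin_gtop gopen_def by (elim conjE)
qed

abbreviation "Uxg \<equiv> prod_topology (subtopology Y (U - {x})) GLt_top"

lemma sec_hom:
  "homeomorphic_map Uxg (subtopology (total_space P) {u. proj P u \<in> U - {x}}) (\<lambda>(y, g). act P (s y) g)"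
proof -
  have "(topspace Y - {x}) \<inter> (U - {x}) = U - {x}" using UY by blast
  then have e: "subtopology (subtopology Y (topspace Y - {x})) (U - {x}) = subtopology Y (U - {x})"
    by (simp only: subtopology_subtopology)
  have "homeomorphic_map (prod_topology (subtopology (subtopology Y (topspace Y - {x})) (U - {x})) GLt_top)
    (subtopology (total_space P) {u. proj P u \<in> U - {x}}) (\<lambda>(y, g). act P (s y) g)"
  proof (rule section_homeomorphic)
    show "continuous_map (subtopology (subtopology Y (topspace Y - {x})) (U - {x})) (total_space P) s"
      unfolding e by (rule s)
    show "U - {x} \<subseteq> topspace (subtopology Y (topspace Y - {x}))" using UY by auto
  qed (rule ps)
  then show ?thesis unfolding e .
qed

lemma subtopology_carrier: "subtopology GLt_top (carrier GLt) = GLt_top"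
  using subtopology_topspace[of GLt_top] by simp

lemma Uxg_eq: "Uxg = subtopology Ug ((U - {x}) \<times> carrier GLt)"
  unfolding subtopology_Times subtopology_subtopology subtopology_carrier
  by (simp add: Int_absorb1)

lemma Uxg_open: "openin Uxg W \<Longrightarrow> openin Ug W"
proof -
  have o: "openin Ug ((U - {x}) \<times> carrier GLt)"
  proof -
    have "openin (subtopology Y U) (U - {x})" using open_Ux openin_open_subtopology[OF oU] by blast
    then show ?thesis unfolding openin_prod_Times_iff using openin_topspace[of GLt_top] by simp
  qed
  show "openin Uxg W \<Longrightarrow> openin Ug W" unfolding Uxg_eq by (rule openin_trans_full[OF _ o])
qed

lemma open_over_Ux: "openin (total_space P) {u \<in> tot. proj P u \<in> U - {x}}"
proof -
  have "openin (subtopology Y (topspace Y - {x})) (U - {x})" using open_Ux UY by (auto simp: openin_open_subtopology x_closed)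
  then show ?thesis using openin_continuous_map_preimage[OF continuous_proj] by blast
qed

text \<open>The preimage under \<theta> is open over \<open>U - {x}\<close>, by continuity of the
  trivialisation given by \<open>s\<close>, and hence open over \<open>U\<close>, since
  \<open>x\<close> is a closed point.\<close>

lemma open_Inl: assumes "openin (total_space P) W" shows "openin gtop (Inl ` W)"
proof -
  have c: "continuous_map Uxg (total_space P) (\<lambda>(y, g). act P (s y) g)"
    using homeomorphic_imp_continuous_map[OF sec_hom] continuous_map_in_subtopology by blast
  have "openin Uxg {p \<in> topspace Uxg. (\<lambda>(y, g). act P (s y) g) p \<in> W}"
    by (rule openin_continuous_map_preimage[OF c assms])
  then have "openin Ug {p \<in> topspace Uxg. (\<lambda>(y, g). act P (s y) g) p \<in> W}" by (rule Uxg_open)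
  moreover have "{p \<in> topspace Uxg. (\<lambda>(y, g). act P (s y) g) p \<in> W} = {p \<in> U \<times> carrier GLt. \<theta> p \<in> Inl ` W}"
    using UY by (auto simp: \<theta>_def)
  moreover have "{u \<in> tot. Inl u \<in> Inl ` W} = W" using openin_subset[OF assms] by auto
  moreover have "Inl ` W \<subseteq> E" using openin_subset[OF assms] by (auto simp: E_def)
  ultimately show ?thesis using assms unfolding openin_gtop gopen_def by metis
qed

lemma inj_theta: "inj_on \<theta> (U \<times> carrier GLt)"
proof (rule inj_onI)
  fix p q assume pq: "p \<in> U \<times> carrier GLt" "q \<in> U \<times> carrier GLt" "\<theta> p = \<theta> q"
  have i: "inj_on (\<lambda>(y, g). act P (s y) g) (topspace Uxg)"
    using sec_hom homeomorphic_imp_injective_map by blast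
  show "p = q"
  proof (cases "fst p = x")
    case True then show ?thesis using pq by (auto simp: \<theta>_def split: if_splits)
  next
    case False
    then have q: "fst q \<noteq> x" using pq(3) by (auto simp: \<theta>_def split: if_splits)
    have "(\<lambda>(y, g). act P (s y) g) p = (\<lambda>(y, g). act P (s y) g) q"
      using pq(3) False q by (auto simp: \<theta>_def split_beta)
    moreover have "p \<in> topspace Uxg" "q \<in> topspace Uxg" using pq False q UY by auto
    ultimately show ?thesis using i by (meson inj_onD)
  qed
qed

text \<open>The part of the image inside the old bundle is the image of an open set under the
  trivialisation by \<open>s\<close>, which is a homeomorphism onto an open subset. Together with
  \<open>open_Inl\<close> and injectivity this makes \<open>Inl\<close> and \<theta> open
  embeddings.\<close>

lemma open_theta: assumes "openin Ug W" shows "openin gtop (\<theta> ` W)"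
proof -
  have WU: "W \<subseteq> U \<times> carrier GLt" using openin_subset[OF assms] unfolding topspace_Ug .
  have 1: "{p \<in> U \<times> carrier GLt. \<theta> p \<in> \<theta> ` W} = W"
    using WU inj_theta by (auto dest: inj_onD)
  let ?W = "W \<inter> ((U - {x}) \<times> carrier GLt)"
  let ?f = "\<lambda>(y, g). act P (s y) g"
  have "openin Uxg ?W" unfolding Uxg_eq using assms by (simp add: openin_subtopology_Int)
  then have "openin (subtopology (total_space P) {u. proj P u \<in> U - {x}}) (?f ` ?W)"
    using sec_hom homeomorphic_map_openness_eq homeomorphic_imp_open_map open_map_def by blast
  then have "openin (total_space P) (?f ` ?W)"
    using openin_trans_full[OF _ open_over_Ux] subtopology_restrict[of "total_space P" "{u. proj P u \<in> U - {x}}"]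
    by (simp add: Int_def)
  moreover have "{u \<in> tot. Inl u \<in> \<theta> ` W} = ?f ` ?W"
  proof (intro equalityI subsetI)
    fix u assume "u \<in> {u \<in> tot. Inl u \<in> \<theta> ` W}"
    then obtain p where "p \<in> W" "Inl u = \<theta> p" by auto
    then show "u \<in> ?f ` ?W" using WU by (intro image_eqI[of _ _ p]) (auto simp: \<theta>_def split: if_splits)
  next
    fix u assume "u \<in> ?f ` ?W"
    then obtain y g where "(y, g) \<in> W" "y \<in> U - {x}" "g \<in> carrier GLt" "u = act P (s y) g" by auto
    then show "u \<in> {u \<in> tot. Inl u \<in> \<theta> ` W}"
      using act_in s_in by (auto intro!: image_eqI[of _ _ "(y, g)"] simp: \<theta>_def)
  qed
  moreover have "\<theta> ` W \<subseteq> E" using WU theta_in by auto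
  ultimately show ?thesis using 1 assms by (simp add: openin_gtop gopen_def)
qed

lemma hom_Inl: "homeomorphic_map (total_space P) (subtopology gtop (Inl ` tot)) Inl"
  by (rule bijective_open_imp_homeomorphic_map)
    (auto simp: continuous_map_in_subtopology continuous_Inl open_map_def E_def inj_on_def
      intro!: openin_subset_topspace_eq[THEN iffD2] subset_openin_subtopology open_Inl dest: openin_subset)

lemma hom_theta: "homeomorphic_map Ug (subtopology gtop (\<theta> ` (U \<times> carrier GLt))) \<theta>"
proof (rule bijective_open_imp_homeomorphic_map)
  show "continuous_map Ug (subtopology gtop (\<theta> ` (U \<times> carrier GLt))) \<theta>"
    using continuous_theta UY by (auto simp: continuous_map_in_subtopology)
  show "open_map Ug (subtopology gtop (\<theta> ` (U \<times> carrier GLt))) \<theta>"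
    unfolding open_map_def
  proof (intro allI impI)
    fix W assume W: "openin Ug W"
    show "openin (subtopology gtop (\<theta> ` (U \<times> carrier GLt))) (\<theta> ` W)"
      using open_theta[OF W] openin_subset[OF W] unfolding topspace_Ug by (intro subset_openin_subtopology) auto
  qed
  show "\<theta> ` topspace Ug = topspace (subtopology gtop (\<theta> ` (U \<times> carrier GLt)))"
    using theta_in unfolding topspace_Ug by auto
  show "inj_on \<theta> (topspace Ug)" using inj_theta unfolding topspace_Ug .
qed

lemma total_space_glue [simp]: "total_space glue_bundle = gtop"
  and proj_Inl [simp]: "proj glue_bundle (Inl u) = proj P u"
  and proj_Inr [simp]: "proj glue_bundle (Inr g) = x"
  and act_Inl [simp]: "act glue_bundle (Inl u) h = Inl (act P u h)"
  and act_Inr [simp]: "act glue_bundle (Inr g) h = Inr (g \<otimes>\<^bsub>GLt\<^esub> h)"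
  and framing_Inl [simp]: "framing glue_bundle (Inl u) = framing P u"
  and framing_Inr [simp]: "framing glue_bundle (Inr g) = fr g"
  by (simp_all add: glue_bundle_def)

lemma proj_theta: "p \<in> U \<times> carrier GLt \<Longrightarrow> proj glue_bundle (\<theta> p) = fst p"
  using s_in ps by (auto simp: \<theta>_def proj_act)

lemma act_theta: "p \<in> U \<times> carrier GLt \<Longrightarrow> h \<in> carrier GLt \<Longrightarrow> act glue_bundle (\<theta> p) h = \<theta> (fst p, snd p \<otimes>\<^bsub>GLt\<^esub> h)"
  using s_in by (auto simp: \<theta>_def act_act)

lemma proj_P_neq: "u \<in> tot \<Longrightarrow> proj P u \<noteq> x" and proj_P_in: "u \<in> tot \<Longrightarrow> proj P u \<in> topspace Y"
  using proj_in by auto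

lemma over_U: "{u \<in> E. proj glue_bundle u \<in> U} = \<theta> ` (U \<times> carrier GLt)"
proof (intro equalityI subsetI)
  fix u assume u: "u \<in> {u \<in> E. proj glue_bundle u \<in> U}"
  show "u \<in> \<theta> ` (U \<times> carrier GLt)"
  proof (cases u)
    case (Inl w)
    then have w: "w \<in> tot" "proj P w \<in> U" using u by (auto simp: E_def)
    then have n: "proj P w \<noteq> x" using proj_P_neq by auto
    then have "u = \<theta> (proj P w, transl (s (proj P w)) w)" "transl (s (proj P w)) w \<in> carrier GLt"
      using w n transl[of "s (proj P w)" w] s_in ps Inl by (auto simp: \<theta>_def)
    then show ?thesis using w by blast
  next
    case (Inr g)
    then have "u = \<theta> (x, g)" "g \<in> carrier GLt" using u by (auto simp: \<theta>_def E_def)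
    then show ?thesis using xU by blast
  qed
qed (use proj_theta theta_in in auto)

lemma continuous_proj_glue: "continuous_map gtop Y (proj glue_bundle)"
proof (rule continuous_map_gtop)
  show "continuous_map (total_space P) Y (\<lambda>u. proj glue_bundle (Inl u))"
    using continuous_proj by (simp add: continuous_map_in_subtopology)
  have "continuous_map Ug Y fst"
    using continuous_map_fst[of "subtopology Y U" GLt_top] continuous_map_in_subtopology by blast
  then show "continuous_map Ug Y (\<lambda>p. proj glue_bundle (\<theta> p))"
    by (rule continuous_map_eq) (use proj_theta topspace_Ug in auto)
qed

text \<open>The images of \<open>Inl\<close> and \<theta> form an open cover. On each of them the
  action is transported from the old bundle or from the product, where it is known to be
  continuous.\<close>

lemma continuous_act_glue:
  "continuous_map (prod_topology gtop GLt_top) gtop (\<lambda>(u, g). act glue_bundle u g)"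
proof (rule continuous_map_locally)
  fix z assume z: "z \<in> topspace (prod_topology gtop GLt_top)"
  have E: "E = Inl ` tot \<union> \<theta> ` (U \<times> carrier GLt)"
  proof -
    have "Inr g \<in> \<theta> ` (U \<times> carrier GLt)" if "g \<in> carrier GLt" for g
      using that xU by (intro image_eqI[of _ _ "(x, g)"]) (auto simp: \<theta>_def)
    moreover have "\<theta> ` (U \<times> carrier GLt) \<subseteq> E" by (rule image_subsetI) (rule theta_in)
    ultimately show ?thesis unfolding E_def by blast
  qed
  have st: "subtopology (prod_topology gtop GLt_top) (A \<times> carrier GLt) = prod_topology (subtopology gtop A) GLt_top" for A
    unfolding subtopology_Times subtopology_carrier ..
  from z E consider "fst z \<in> Inl ` tot" | "fst z \<in> \<theta> ` (U \<times> carrier GLt)" by auto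
  then show "\<exists>T. openin (prod_topology gtop GLt_top) T \<and> z \<in> T \<and>
      continuous_map (subtopology (prod_topology gtop GLt_top) T) gtop (\<lambda>(u, g). act glue_bundle u g)"
  proof cases
    case 1
    have o: "openin (prod_topology gtop GLt_top) (Inl ` tot \<times> carrier GLt)"
      by (metis open_Inl openin_prod_Times_iff openin_topspace topspace_GLt_top)
    obtain j where j: "homeomorphic_maps (total_space P) (subtopology gtop (Inl ` tot)) Inl j"
      using hom_Inl homeomorphic_map_maps by blast
    have "continuous_map (prod_topology (subtopology gtop (Inl ` tot)) GLt_top) gtop (\<lambda>z. Inl (act P (j (fst z)) (snd z)))"
    proof -
      have "continuous_map (prod_topology (subtopology gtop (Inl ` tot)) GLt_top) (total_space P) (\<lambda>z. act P (j (fst z)) (snd z))"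
      proof (rule continuous_act_compose)
        have "continuous_map (subtopology gtop (Inl ` tot)) (total_space P) j" using j by (simp add: homeomorphic_maps_def)
        then show "continuous_map (prod_topology (subtopology gtop (Inl ` tot)) GLt_top) (total_space P) (\<lambda>z. j (fst z))"
          using continuous_map_compose[OF continuous_map_fst] by (simp add: o_def)
      qed (rule continuous_map_snd)
      then show ?thesis using continuous_map_compose[OF _ continuous_Inl] by (simp add: o_def)
    qed
    then have "continuous_map (prod_topology (subtopology gtop (Inl ` tot)) GLt_top) gtop (\<lambda>(u, g). act glue_bundle u g)"
      by (rule continuous_map_eq) (use j in \<open>auto simp: homeomorphic_maps_def\<close>)
    then show ?thesis using o 1 z by (intro exI[of _ "Inl ` tot \<times> carrier GLt"]) (auto simp: st mem_Times_iff)
  next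
    case 2
    let ?A = "\<theta> ` (U \<times> carrier GLt)"
    have o: "openin (prod_topology gtop GLt_top) (?A \<times> carrier GLt)"
      by (metis open_theta openin_prod_Times_iff openin_topspace topspace_GLt_top topspace_Ug)
    obtain j where j: "homeomorphic_maps Ug (subtopology gtop ?A) \<theta> j"
      using hom_theta homeomorphic_map_maps by blast
    then have cj: "continuous_map (subtopology gtop ?A) Ug j" and jt: "\<And>p. p \<in> U \<times> carrier GLt \<Longrightarrow> j (\<theta> p) = p"
      using topspace_Ug by (auto simp: homeomorphic_maps_def)
    have cjf: "continuous_map (prod_topology (subtopology gtop ?A) GLt_top) Ug (\<lambda>z. j (fst z))"
      using continuous_map_compose[OF continuous_map_fst cj] by (simp add: o_def)
    have "continuous_map (prod_topology (subtopology gtop ?A) GLt_top) Ug (\<lambda>z. (fst (j (fst z)), snd (j (fst z)) \<otimes>\<^bsub>GLt\<^esub> snd z))"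
      using cjf continuous_map_compose[OF cjf continuous_map_fst] continuous_map_compose[OF cjf continuous_map_snd]
      by (simp add: continuous_map_pairwise o_def continuous_GLt_mult continuous_map_snd)
    then have "continuous_map (prod_topology (subtopology gtop ?A) GLt_top) gtop
        (\<lambda>z. \<theta> (fst (j (fst z)), snd (j (fst z)) \<otimes>\<^bsub>GLt\<^esub> snd z))"
      using continuous_map_compose[OF _ continuous_theta] by (simp add: o_def)
    then have "continuous_map (prod_topology (subtopology gtop ?A) GLt_top) gtop (\<lambda>(u, g). act glue_bundle u g)"
    proof (rule continuous_map_eq)
      fix z assume "z \<in> topspace (prod_topology (subtopology gtop ?A) GLt_top)"
      then obtain p g where "z = (\<theta> p, g)" "p \<in> U \<times> carrier GLt" "g \<in> carrier GLt" by auto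
      then show "\<theta> (fst (j (fst z)), snd (j (fst z)) \<otimes>\<^bsub>GLt\<^esub> snd z) = (\<lambda>(u, g). act glue_bundle u g) z"
        using act_theta jt by simp
    qed
    then show ?thesis using o 2 z by (intro exI[of _ "?A \<times> carrier GLt"]) (auto simp: st mem_Times_iff)
  qed
qed

text \<open>At \<open>x\<close> the embedding \<theta> is itself a local trivialisation; at any
  other point an old one, taken over an open set without \<open>x\<close>, can be composed with
  \<open>Inl\<close>.\<close>

theorem principal_glue: "principal_GLt_bundle Y glue_bundle"
  unfolding principal_GLt_bundle_def total_space_glue
proof (intro conjI ballI)
  show "continuous_map gtop Y (proj glue_bundle)" by (rule continuous_proj_glue)
  show "continuous_map (prod_topology gtop GLt_top) gtop (\<lambda>(u, g). act glue_bundle u g)" by (rule continuous_act_glue)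
  fix u assume u: "u \<in> topspace gtop"
  then show "act glue_bundle u \<one>\<^bsub>GLt\<^esub> = u" by (auto simp: E_def act_one)
  fix g assume g: "g \<in> carrier GLt"
  then show "proj glue_bundle (act glue_bundle u g) = proj glue_bundle u" using u by (auto simp: E_def proj_act)
  fix h assume "h \<in> carrier GLt"
  then show "act glue_bundle (act glue_bundle u g) h = act glue_bundle u (g \<otimes>\<^bsub>GLt\<^esub> h)"
    using u g by (auto simp: E_def act_act GLt.m_assoc)
next
  fix y assume y: "y \<in> topspace Y"
  show "\<exists>V \<tau>. openin Y V \<and> y \<in> V \<and>
     homeomorphic_map (prod_topology (subtopology Y V) GLt_top) (subtopology gtop {u. proj glue_bundle u \<in> V}) \<tau> \<and>
     (\<forall>y\<in>V. \<forall>g\<in>carrier GLt. proj glue_bundle (\<tau> (y, g)) = y \<and>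
        (\<forall>h\<in>carrier GLt. \<tau> (y, g \<otimes>\<^bsub>GLt\<^esub> h) = act glue_bundle (\<tau> (y, g)) h))"
  proof (cases "y = x")
    case True
    have "subtopology gtop {u. proj glue_bundle u \<in> U} = subtopology gtop (\<theta> ` (U \<times> carrier GLt))"
      using over_U subtopology_restrict[of gtop "{u. proj glue_bundle u \<in> U}"] by (simp add: Int_def)
    then show ?thesis using hom_theta oU xU True proj_theta act_theta
      by (intro exI[of _ U] exI[of _ \<theta>]) auto
  next
    case False
    let ?X = "subtopology Y (topspace Y - {x})"
    have "y \<in> topspace ?X" using y False by auto
    then obtain V \<tau> where "openin ?X V \<and> y \<in> V \<and>
      homeomorphic_map (prod_topology (subtopology ?X V) GLt_top) (subtopology (total_space P) {u. proj P u \<in> V}) \<tau> \<and>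
      (\<forall>y\<in>V. \<forall>g\<in>carrier GLt. proj P (\<tau> (y, g)) = y \<and>
        (\<forall>h\<in>carrier GLt. \<tau> (y, g \<otimes>\<^bsub>GLt\<^esub> h) = act P (\<tau> (y, g)) h))"
      using local_triv[of y] by blast
    then have V: "openin ?X V" "y \<in> V"
      and hom: "homeomorphic_map (prod_topology (subtopology ?X V) GLt_top) (subtopology (total_space P) {u. proj P u \<in> V}) \<tau>"
      and pr: "\<And>y g. y \<in> V \<Longrightarrow> g \<in> carrier GLt \<Longrightarrow> proj P (\<tau> (y, g)) = y"
      and eq: "\<And>y g h. y \<in> V \<Longrightarrow> g \<in> carrier GLt \<Longrightarrow> h \<in> carrier GLt \<Longrightarrow> \<tau> (y, g \<otimes>\<^bsub>GLt\<^esub> h) = act P (\<tau> (y, g)) h"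
      by auto
    have oV: "openin Y V" using V(1) x_closed openin_trans_full by blast
    have VX: "V \<subseteq> topspace Y - {x}" using openin_subset[OF V(1)] by auto
    have sX: "subtopology ?X V = subtopology Y V" using VX by (simp add: subtopology_subtopology Int_absorb1)
    have h1: "homeomorphic_map (subtopology (total_space P) {u. proj P u \<in> V})
        (subtopology (subtopology gtop (Inl ` tot)) (Inl ` {u \<in> tot. proj P u \<in> V})) Inl"
      by (rule homeomorphic_map_subtopologies[OF hom_Inl]) (auto simp: E_def)
    have h2: "subtopology (subtopology gtop (Inl ` tot)) (Inl ` {u \<in> tot. proj P u \<in> V}) = subtopology gtop {u. proj glue_bundle u \<in> V}"
    proof -
      have "Inl ` tot \<inter> Inl ` {u \<in> tot. proj P u \<in> V} = topspace gtop \<inter> {u. proj glue_bundle u \<in> V}"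
        using VX by (auto simp: E_def)
      then show ?thesis unfolding subtopology_subtopology by (intro subtopology_cong) blast
    qed
    have "homeomorphic_map (prod_topology (subtopology Y V) GLt_top) (subtopology gtop {u. proj glue_bundle u \<in> V}) (Inl \<circ> \<tau>)"
      using homeomorphic_map_compose[OF hom h1] unfolding sX h2 .
    moreover have "proj glue_bundle ((Inl \<circ> \<tau>) (y, g)) = y" if "y \<in> V" "g \<in> carrier GLt" for y g
      using pr[OF that] by simp
    moreover have "(Inl \<circ> \<tau>) (y, g \<otimes>\<^bsub>GLt\<^esub> h) = act glue_bundle ((Inl \<circ> \<tau>) (y, g)) h"
      if "y \<in> V" "g \<in> carrier GLt" "h \<in> carrier GLt" for y g h
      using eq[OF that] by simp
    ultimately show ?thesis using oV V(2) by blast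
  qed
qed

text \<open>A version of \<open>continuous_map_gtop\<close> over an open part of the base. The
  framing is tested for continuity chart by chart, so its coordinates are considered only over the
  domain of the chart.\<close>

lemma continuous_map_gtop_over:
  assumes N: "openin Y N"
    and c1: "continuous_map (subtopology (total_space P) {u. proj P u \<in> N}) Z (\<lambda>u. f (Inl u))"
    and c2: "continuous_map (subtopology Ug {p. fst p \<in> N}) Z (\<lambda>p. f (\<theta> p))"
  shows "continuous_map (subtopology gtop {u. proj glue_bundle u \<in> N}) Z f"
  unfolding continuous_map_def
proof (intro conjI allI impI)
  show "f \<in> topspace (subtopology gtop {u. proj glue_bundle u \<in> N}) \<rightarrow> topspace Z"
  proof
    fix w assume w: "w \<in> topspace (subtopology gtop {u. proj glue_bundle u \<in> N})"
    show "f w \<in> topspace Z"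
    proof (cases w)
      case (Inl u)
      then have "u \<in> topspace (subtopology (total_space P) {u. proj P u \<in> N})" using w by (auto simp: E_def)
      then show ?thesis using continuous_map_image_subset_topspace[OF c1] Inl by blast
    next
      case (Inr g)
      then have "w = \<theta> (x, g)" using w by (auto simp: \<theta>_def E_def)
      moreover have "(x, g) \<in> topspace (subtopology Ug {p. fst p \<in> N})"
        using w Inr xU unfolding topspace_subtopology topspace_Ug by (auto simp: E_def)
      ultimately show ?thesis using continuous_map_image_subset_topspace[OF c2] by blast
    qed
  qed
  fix V assume V: "openin Z V"
  define W where "W = {w \<in> E. proj glue_bundle w \<in> N \<and> f w \<in> V}"
  have o1: "openin (total_space P) {u \<in> tot. proj P u \<in> N}"
    using openin_continuous_map_preimage[OF _ N, of "total_space P" "proj P"] continuous_proj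
    by (simp add: continuous_map_in_subtopology)
  have "openin (subtopology (total_space P) {u \<in> tot. proj P u \<in> N}) {u \<in> topspace (subtopology (total_space P) {u. proj P u \<in> N}). f (Inl u) \<in> V}"
    using openin_continuous_map_preimage[OF c1 V] subtopology_restrict[of "total_space P" "{u. proj P u \<in> N}"] by (simp add: Int_def)
  then have "openin (total_space P) {u \<in> topspace (subtopology (total_space P) {u. proj P u \<in> N}). f (Inl u) \<in> V}"
    by (rule openin_trans_full[OF _ o1])
  moreover have "{u \<in> topspace (subtopology (total_space P) {u. proj P u \<in> N}). f (Inl u) \<in> V} = {u \<in> tot. Inl u \<in> W}"
    by (auto simp: W_def E_def)
  ultimately have w1: "openin (total_space P) {u \<in> tot. Inl u \<in> W}" by simp
  have "continuous_map Ug Y fst"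
    using continuous_map_fst[of "subtopology Y U" GLt_top] continuous_map_in_subtopology by blast
  then have o2: "openin Ug {p \<in> topspace Ug. fst p \<in> N}" by (rule openin_continuous_map_preimage[OF _ N])
  have "openin (subtopology Ug {p \<in> topspace Ug. fst p \<in> N}) {p \<in> topspace (subtopology Ug {p. fst p \<in> N}). f (\<theta> p) \<in> V}"
    using openin_continuous_map_preimage[OF c2 V] subtopology_restrict[of Ug "{p. fst p \<in> N}"] by (simp add: Int_def)
  then have "openin Ug {p \<in> topspace (subtopology Ug {p. fst p \<in> N}). f (\<theta> p) \<in> V}"
    by (rule openin_trans_full[OF _ o2])
  moreover have "{p \<in> topspace (subtopology Ug {p. fst p \<in> N}). f (\<theta> p) \<in> V} = {p \<in> U \<times> carrier GLt. \<theta> p \<in> W}"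
    unfolding topspace_subtopology topspace_Ug using proj_theta theta_in by (auto simp: W_def)
  ultimately have w2: "openin Ug {p \<in> U \<times> carrier GLt. \<theta> p \<in> W}" by simp
  have "gopen W" unfolding gopen_def using w1 w2 by (auto simp: W_def)
  then have "openin gtop W" unfolding openin_gtop .
  moreover have "{w \<in> topspace (subtopology gtop {u. proj glue_bundle u \<in> N}). f w \<in> V} = W" by (auto simp: W_def)
  ultimately show "openin (subtopology gtop {u. proj glue_bundle u \<in> N})
      {w \<in> topspace (subtopology gtop {u. proj glue_bundle u \<in> N}). f w \<in> V}"
    by (auto intro!: subset_openin_subtopology simp: W_def)
qed

lemma spin_restriction_glue: "x \<notin> S \<Longrightarrow> topspace Y \<subseteq> insert x S \<Longrightarrow> spin_restriction P glue_bundle S"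
  unfolding spin_restriction_def
proof (intro exI[of _ Inl] conjI ballI)
  assume S: "x \<notin> S" "topspace Y \<subseteq> insert x S"
  have "topspace gtop \<inter> {u. proj glue_bundle u \<in> S} = topspace gtop \<inter> Inl ` tot"
    using S proj_P_in proj_P_neq by (fastforce simp: E_def)
  then have "subtopology gtop {u. proj glue_bundle u \<in> S} = subtopology gtop (Inl ` tot)"
    by (rule subtopology_cong)
  then show "homeomorphic_map (total_space P) (subtopology (total_space glue_bundle) {u. proj glue_bundle u \<in> S}) Inl"
    using hom_Inl by simp
qed auto

end

subsection \<open>Derivatives on subsets of the plane\<close>

definition deriv_mat :: "(complex \<Rightarrow> complex) \<Rightarrow> real^2^2" where
  "deriv_mat L = vector [vector [Re (L 1), Re (L \<i>)], vector [Im (L 1), Im (L \<i>)]]"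

lemma gl_lin_deriv_mat: "linear L \<Longrightarrow> gl_lin (deriv_mat L) = L"
proof
  fix v assume L: "linear L"
  have "L v = L (Re v *\<^sub>R 1 + Im v *\<^sub>R \<i>)"
    by (rule arg_cong[of _ _ L]) (simp add: complex_eq_iff)
  also have "\<dots> = Re v *\<^sub>R L 1 + Im v *\<^sub>R L \<i>" using L by (simp add: linear_add linear_scale)
  finally show "gl_lin (deriv_mat L) v = L v"
    by (simp add: gl_lin_def deriv_mat_def complex_eq_iff algebra_simps)
qed

lemma deriv_mat_gl_lin [simp]: "deriv_mat (gl_lin g) = g"
  by (rule matrix2_eqI) (simp_all add: deriv_mat_def gl_lin_def)

lemma bounded_linear_gl_lin: "bounded_linear (gl_lin g)"
  by (rule linear_conv_bounded_linear[THEN iffD1], rule linearI)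
    (simp_all add: gl_lin_def complex_eq_iff algebra_simps)

text \<open>A derivative within a set need not be unique; this singles out the points where
  \<open>jac\<close> is determined by any derivative that has been found.\<close>

definition deriv_unique :: "complex set \<Rightarrow> complex \<Rightarrow> bool" where
  "deriv_unique S z \<longleftrightarrow> (\<forall>f L L'. ((f :: complex \<Rightarrow> complex) has_derivative L) (at z within S) \<and>
     (f has_derivative L') (at z within S) \<longrightarrow> L = L')"

lemma deriv_unique_open: "open S \<Longrightarrow> z \<in> S \<Longrightarrow> deriv_unique S z"
  unfolding deriv_unique_def using has_derivative_unique by (metis at_within_open)

text \<open>An interior point y of the convex set is joined to \<open>z\<close> by a segment inside
  the set, so the derivative is determined on y - z as a one-sided derivative of a curve. As y runs
  through a ball, differences of such vectors span the plane.\<close>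

lemma deriv_unique_convex:
  assumes T: "convex T" "interior T \<noteq> {}" "z \<in> closure T" and D: "interior T \<subseteq> D"
  shows "deriv_unique D z"
  unfolding deriv_unique_def
proof (intro allI impI, elim conjE)
  fix f :: "complex \<Rightarrow> complex" and L L'
  assume L: "(f has_derivative L) (at z within D)" and L': "(f has_derivative L') (at z within D)"
  have *: "((\<lambda>t. f (z + t *\<^sub>R (y - z))) has_vector_derivative K (y - z)) (at 0 within {0..1})"
    if y: "y \<in> interior T" and K: "(f has_derivative K) (at z within D)" for y K
  proof -
    have sub: "(\<lambda>t. z + t *\<^sub>R (y - z)) ` {0..1} \<subseteq> insert z D"
    proof (rule image_subsetI)
      fix t :: real assume t: "t \<in> {0..1}"
      show "z + t *\<^sub>R (y - z) \<in> insert z D"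
      proof (cases "t = 0 \<or> y = z")
        case True then show ?thesis by auto
      next
        case False
        have "z + t *\<^sub>R (y - z) \<in> interior T"
        proof (cases "t = 1")
          case True then show ?thesis using y by simp
        next
          case f: False
          have "z + t *\<^sub>R (y - z) \<in> open_segment z y"
            unfolding in_segment using t False f by (intro conjI exI[of _ t]) (auto simp: algebra_simps)
          then show ?thesis using in_interior_closure_convex_segment[OF T(1) y T(3)] by (metis open_segment_commute subsetD)
        qed
        then show ?thesis using D by auto
      qed
    qed
    \<comment> \<open>The limit disregards the point itself, so \<open>z\<close> may be adjoined to
      \<open>D\<close>; the segment passes through it at parameter 0.\<close>
    have "(f has_derivative K) (at z within insert z D)"
      using K by (simp add: at_within_def insert_Diff_if)
    then have "(f has_derivative K) (at (z + 0 *\<^sub>R (y - z)) within (\<lambda>t. z + t *\<^sub>R (y - z)) ` {0..1})"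
      using has_derivative_subset[OF _ sub] by simp
    moreover have "((\<lambda>t. z + t *\<^sub>R (y - z)) has_derivative (\<lambda>t. t *\<^sub>R (y - z))) (at 0 within {0..1})"
      by (auto intro!: derivative_eq_intros)
    ultimately have "((\<lambda>t. f (z + t *\<^sub>R (y - z))) has_derivative (\<lambda>t. K (t *\<^sub>R (y - z)))) (at 0 within {0..1})"
      using has_derivative_in_compose by blast
    then show ?thesis unfolding has_vector_derivative_def
      using has_derivative_bounded_linear[OF K] by (simp add: linear_scale bounded_linear.linear)
  qed
  have eq: "L (y - z) = L' (y - z)" if y: "y \<in> interior T" for y
    using vector_derivative_unique_within_closed_interval[of 0 1 0 "\<lambda>t. f (z + t *\<^sub>R (y - z))" "L (y - z)" "L' (y - z)"]
      *[OF y L] *[OF y L'] by (simp add: box_real)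
  obtain c r where r: "0 < r" "ball c r \<subseteq> interior T"
    using T(2) open_interior open_contains_ball by (metis equals0I)
  have lin: "linear L" "linear L'" using L L' has_derivative_bounded_linear bounded_linear.linear by blast+
  show "L = L'"
  proof
    fix v
    show "L v = L' v"
    proof (cases "v = 0")
      case False
      \<comment> \<open>The vector is scaled so that the centre \<open>c\<close> and
        \<open>c + k *\<^sub>R v\<close> both lie in the ball of interior points; subtracting the
        two identities leaves a multiple of \<open>v\<close>.\<close>
      define k where "k = r / (2 * norm v)"
      have k: "0 < k" using False r by (simp add: k_def)
      have "c + k *\<^sub>R v \<in> ball c r" using False r by (simp add: k_def dist_norm)
      moreover have "c \<in> ball c r" using r by simp
      ultimately have "L (c + k *\<^sub>R v - z) = L' (c + k *\<^sub>R v - z)" "L (c - z) = L' (c - z)" using eq r(2) by blast+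
      moreover have "k *\<^sub>R v = (c + k *\<^sub>R v - z) - (c - z)" by simp
      ultimately have "L (k *\<^sub>R v) = L' (k *\<^sub>R v)" using lin by (metis linear_diff)
      then show ?thesis using lin k by (simp add: linear_scale)
    qed (use lin in \<open>simp add: linear_0\<close>)
  qed
qed

lemma jac_eqI:
  assumes "deriv_unique S z" "(f has_derivative gl_lin M) (at z within S)"
  shows "jac f S z = M"
proof -
  have "f differentiable (at z within S)" using assms(2) differentiable_def by blast
  then have "(f has_derivative frechet_derivative f (at z within S)) (at z within S)"
    by (simp add: frechet_derivative_works)
  then have "frechet_derivative f (at z within S) = gl_lin M" using assms unfolding deriv_unique_def by blast
  then show ?thesis unfolding jac_def Let_def deriv_mat_def[symmetric] by simp
qed

text \<open>The derivative is carried along as a matrix field, so that continuity and inversion of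
  derivatives become statements about matrices.\<close>

definition C1_on :: "complex set \<Rightarrow> (complex \<Rightarrow> complex) \<Rightarrow> (complex \<Rightarrow> real^2^2) \<Rightarrow> bool" where
  "C1_on W g G \<longleftrightarrow> open W \<and> (\<forall>y\<in>W. (g has_derivative gl_lin (G y)) (at y)) \<and> continuous_on W G"

lemma C1_on_subset: "C1_on W g G \<Longrightarrow> open V \<Longrightarrow> V \<subseteq> W \<Longrightarrow> C1_on V g G"
  by (auto simp: C1_on_def intro: continuous_on_subset)

lemma C1_on_continuous: "C1_on W g G \<Longrightarrow> continuous_on W g"
  unfolding C1_on_def by (metis continuous_at_imp_continuous_on has_derivative_continuous)

lemma C1_on_cong:
  assumes "C1_on W g G" "\<And>y. y \<in> W \<Longrightarrow> f y = g y" shows "C1_on W f G"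
  unfolding C1_on_def
proof (intro conjI ballI)
  fix y assume y: "y \<in> W"
  have "open W" "(g has_derivative gl_lin (G y)) (at y)" using assms(1) y by (auto simp: C1_on_def)
  then show "(f has_derivative gl_lin (G y)) (at y)"
    using has_derivative_transform_within_open[of g "gl_lin (G y)" y UNIV W f] y assms(2) by auto
qed (use assms in \<open>auto simp: C1_on_def\<close>)

lemma smooth_C1:
  assumes "smooth_map_on S f" "z \<in> S"
  obtains W g G where "z \<in> W" "C1_on W g G" "\<And>y. y \<in> S \<inter> W \<Longrightarrow> g y = f y"
proof -
  obtain W g where W: "open W" "z \<in> W" "\<And>k. Ck_on k W g" "\<And>y. y \<in> S \<inter> W \<Longrightarrow> g y = f y"
    using bspec[OF assms(1)[unfolded smooth_map_on_def] assms(2)] by auto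
  have "Ck_on (Suc 0) W g" using W(3) .
  then have d: "\<And>y. y \<in> W \<Longrightarrow> (g has_derivative frechet_derivative g (at y)) (at y)"
    and c: "\<And>v. continuous_on W (\<lambda>y. frechet_derivative g (at y) v)"
    by (auto simp: frechet_derivative_works)
  define G where "G = (\<lambda>y. deriv_mat (frechet_derivative g (at y)))"
  have "continuous_on W G"
  proof (rule continuous_on_matrix2)
    fix i j :: 2
    have "continuous_on W (\<lambda>x. Re (frechet_derivative g (at x) 1))" "continuous_on W (\<lambda>x. Im (frechet_derivative g (at x) 1))"
      "continuous_on W (\<lambda>x. Re (frechet_derivative g (at x) \<i>))" "continuous_on W (\<lambda>x. Im (frechet_derivative g (at x) \<i>))"
      by (intro continuous_intros c)+
    then show "continuous_on W (\<lambda>x. G x $ i $ j)"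
      using exhaust_2[of i] exhaust_2[of j] by (auto simp: G_def deriv_mat_def)
  qed
  moreover have "gl_lin (G y) = frechet_derivative g (at y)" if "y \<in> W" for y
    using gl_lin_deriv_mat[OF bounded_linear.linear[OF has_derivative_bounded_linear[OF d[OF that]]]]
    by (simp add: G_def)
  ultimately have "C1_on W g G" using W(1) d by (auto simp: C1_on_def)
  then show ?thesis using that W by blast
qed

lemma C1_jac:
  assumes "C1_on W g G" "y \<in> W" "y \<in> S" "\<And>y. y \<in> S \<inter> W \<Longrightarrow> g y = f y"
  shows "(f has_derivative gl_lin (G y)) (at y within S)"
proof -
  have "(g has_derivative gl_lin (G y)) (at y within (S \<inter> W))"
    using assms by (auto simp: C1_on_def intro: has_derivative_at_withinI)
  then have "(f has_derivative gl_lin (G y)) (at y within (S \<inter> W))"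
    using assms by (intro has_derivative_transform[of y "S \<inter> W" f g]) auto
  moreover have "at y within (S \<inter> W) = at y within S"
    using assms by (intro at_within_nhd[of _ W]) (auto simp: C1_on_def)
  ultimately show ?thesis by simp
qed

lemma C1_jac_eq:
  assumes "C1_on W g G" "y \<in> W" "y \<in> S" "\<And>y. y \<in> S \<inter> W \<Longrightarrow> g y = f y" "deriv_unique S y"
  shows "jac f S y = G y"
  using C1_jac[OF assms(1-4)] jac_eqI[OF assms(5)] by blast

lemma smooth_jac:
  assumes "smooth_map_on S f" "\<And>z. z \<in> S \<Longrightarrow> deriv_unique S z"
  shows "continuous_on S (jac f S)" "z \<in> S \<Longrightarrow> (f has_derivative gl_lin (jac f S z)) (at z within S)"
proof -
  have 1: "continuous (at z within S) (jac f S)" "(f has_derivative gl_lin (jac f S z)) (at z within S)" if z: "z \<in> S" for z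
  proof -
    obtain W g G where W: "z \<in> W" "C1_on W g G" "\<And>y. y \<in> S \<inter> W \<Longrightarrow> g y = f y" using smooth_C1[OF assms(1) z] by blast
    have oW: "open W" and cG: "continuous_on W G" using W(2) by (auto simp: C1_on_def)
    have e: "jac f S y = G y" if "y \<in> S \<inter> W" for y using C1_jac_eq[OF W(2) _ _ W(3)] assms(2) that by auto
    show "(f has_derivative gl_lin (jac f S z)) (at z within S)" using C1_jac[OF W(2,1) z W(3)] e z W(1) by simp
    have "continuous_on (S \<inter> W) (jac f S)"
      using continuous_on_subset[OF cG, of "S \<inter> W"] by (rule continuous_on_eq) (use e in auto)
    then have "continuous (at z within (S \<inter> W)) (jac f S)" using z W(1) continuous_on_eq_continuous_within by blast
    then show "continuous (at z within S) (jac f S)"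
      using at_within_nhd[of z W "S \<inter> W" S] oW W(1) by (simp add: continuous_within Int_assoc)
  qed
  then show "continuous_on S (jac f S)" "z \<in> S \<Longrightarrow> (f has_derivative gl_lin (jac f S z)) (at z within S)"
    by (auto simp: continuous_on_eq_continuous_within)
qed

text \<open>The inverse function theorem in matrix form. Restricting first to the open set
  \<open>W'\<close> of positive determinant makes the derivative of the inverse defined and
  continuous on all of \<open>V\<close>.\<close>

lemma C1_inverse:
  assumes C: "C1_on W g G" and z: "z \<in> W" and d: "0 < det (G z)"
  obtains U V h where "open U" "z \<in> U" "U \<subseteq> W" "open V" "g z \<in> V" "homeomorphism U V g h"
    "C1_on V h (\<lambda>y. minv (G (h y)))" "\<And>y. y \<in> U \<Longrightarrow> 0 < det (G y)"
proof -
  have oW: "open W" and cG: "continuous_on W G" and dg: "\<And>y. y \<in> W \<Longrightarrow> (g has_derivative gl_lin (G y)) (at y)"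
    using C by (auto simp: C1_on_def)
  define W' where "W' = {y \<in> W. 0 < det (G y)}"
  have oW': "open W'"
  proof -
    have "continuous_on W (\<lambda>y. det (G y))" using cG by (rule continuous_on_det2)
    then have "open (W \<inter> (\<lambda>y. det (G y)) -` {0<..})" by (rule continuous_open_preimage[OF _ oW]) simp
    then show ?thesis by (simp add: W'_def Int_def vimage_def)
  qed
  define F where "F = (\<lambda>y. Blinfun (gl_lin (G y)))"
  have F: "blinfun_apply (F y) = gl_lin (G y)" for y
    unfolding F_def using bounded_linear_gl_lin bounded_linear_Blinfun_apply by blast
  have cF: "continuous_on W' F"
  proof (rule continuous_on_blinfun_componentwise)
    fix i :: complex
    have "continuous_on W' G" using cG W'_def by (auto intro: continuous_on_subset)
    then show "continuous_on W' (\<lambda>x. blinfun_apply (F x) i)"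
      unfolding F gl_lin_def Complex_eq by (intro continuous_intros)
  qed
  have inv0: "blinfun_compose (Blinfun (gl_lin (minv (G z)))) (F z) = id_blinfun"
  proof (rule blinfun_eqI)
    fix v
    have "blinfun_apply (Blinfun (gl_lin (minv (G z)))) = gl_lin (minv (G z))"
      using bounded_linear_gl_lin bounded_linear_Blinfun_apply by blast
    then show "blinfun_apply (blinfun_compose (Blinfun (gl_lin (minv (G z)))) (F z)) v = blinfun_apply id_blinfun v"
      using d by (simp add: F minv(1) flip: gl_lin_mult)
  qed
  have 1: "\<And>y. y \<in> W' \<Longrightarrow> (g has_derivative blinfun_apply (F y)) (at y)" using dg by (simp add: F W'_def)
  have 2: "z \<in> W'" using z d by (simp add: W'_def)
  have "\<exists>U V h h'. open U \<and> U \<subseteq> W' \<and> z \<in> U \<and> open V \<and> g z \<in> V \<and> homeomorphism U V g h \<and>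
    (\<forall>y\<in>V. (h has_derivative h' y) (at y) \<and> h' y = Hilbert_Choice.inv (blinfun_apply (F (h y))))"
  proof (rule inverse_function_theorem[OF oW' 1 cF 2 inv0])
    fix U V h h'
    assume "open U" "U \<subseteq> W'" "z \<in> U" "open V" "g z \<in> V" "homeomorphism U V g h"
      and "\<And>y. y \<in> V \<Longrightarrow> (h has_derivative h' y) (at y)"
      and "\<And>y. y \<in> V \<Longrightarrow> h' y = Hilbert_Choice.inv (blinfun_apply (F (h y)))"
    then show ?thesis
      by (intro exI[of _ U] exI[of _ V] exI[of _ h] exI[of _ h']) simp
  qed
  then obtain U V h h' where "open U \<and> U \<subseteq> W' \<and> z \<in> U \<and> open V \<and> g z \<in> V \<and> homeomorphism U V g h \<and>
    (\<forall>y\<in>V. (h has_derivative h' y) (at y) \<and> h' y = Hilbert_Choice.inv (blinfun_apply (F (h y))))"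
    by (elim exE)
  then have U: "open U" "U \<subseteq> W'" "z \<in> U" "open V" "g z \<in> V" "homeomorphism U V g h"
    and dh: "\<And>y. y \<in> V \<Longrightarrow> (h has_derivative (h' y)) (at y)"
      "\<And>y. y \<in> V \<Longrightarrow> h' y = Hilbert_Choice.inv (blinfun_apply (F (h y)))"
    by auto
  have hV: "h y \<in> W'" if "y \<in> V" for y using U that by (auto simp: homeomorphism_def)
  have "h' y = gl_lin (minv (G (h y)))" if y: "y \<in> V" for y
  proof -
    have n: "det (G (h y)) \<noteq> 0" using hV[OF y] by (auto simp: W'_def)
    show ?thesis unfolding dh(2)[OF y] F
      by (rule inv_equality) (simp_all add: minv[OF n] flip: gl_lin_mult)
  qed
  moreover have "continuous_on V (\<lambda>y. minv (G (h y)))"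
  proof (rule continuous_on_minv)
    show "continuous_on V (\<lambda>y. G (h y))"
      using U hV cG by (intro continuous_on_compose2[of W G V h]) (auto simp: homeomorphism_def W'_def)
  qed (use hV in \<open>auto simp: W'_def\<close>)
  ultimately have "C1_on V h (\<lambda>y. minv (G (h y)))" using dh U by (auto simp: C1_on_def)
  then show ?thesis using that[of U V h] U unfolding W'_def by blast
qed

subsection \<open>Cyclic families of disjoint cones\<close>

text \<open>The coefficients come from the law of sines in the triangle with sides along the three
  directions.\<close>

lemma cone_mem:
  assumes "0 < \<psi>" "\<psi> < \<theta>" "\<theta> < pi" "0 < \<rho>"
  shows "\<exists>p q. 0 < p \<and> 0 < q \<and> of_real p * a + of_real q * (a * of_real \<rho> * cis \<theta>) = a * cis \<psi>"
proof -
  have s: "0 < sin \<theta>" "0 < sin \<psi>" "0 < sin (\<theta> - \<psi>)" using assms by (auto intro!: sin_gt_zero)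
  define q where "q = sin \<psi> / (\<rho> * sin \<theta>)"
  define p where "p = sin (\<theta> - \<psi>) / sin \<theta>"
  have "p + q * \<rho> * cos \<theta> = cos \<psi>" "q * \<rho> * sin \<theta> = sin \<psi>"
    using s assms by (simp_all add: p_def q_def field_simps sin_diff)
  then have "of_real p + of_real q * (of_real \<rho> * cis \<theta>) = cis \<psi>"
    by (simp add: complex_eq_iff mult.assoc)
  then have "a * (of_real p + of_real q * (of_real \<rho> * cis \<theta>)) = a * cis \<psi>" by simp
  moreover have "0 < p" "0 < q" using s assms by (auto simp: p_def q_def)
  ultimately show ?thesis by (intro exI[of _ p] exI[of _ q]) (simp add: algebra_simps)
qed

lemma csqrt_polar: "0 \<le> r \<Longrightarrow> 0 < t \<Longrightarrow> t < pi \<Longrightarrow> csqrt (of_real r * cis t) = of_real (sqrt r) * cis (t / 2)"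
proof (cases "r = 0")
  case False
  assume r: "0 \<le> r" "0 < t" "t < pi"
  have "csqrt ((of_real (sqrt r) * cis (t / 2))\<^sup>2) = of_real (sqrt r) * cis (t / 2)"
    using r False by (intro csqrt_square) (auto intro!: mult_pos_pos cos_gt_zero)
  moreover have "(of_real (sqrt r) * cis (t / 2))\<^sup>2 = of_real r * cis t"
  proof -
    have "(complex_of_real (sqrt r))\<^sup>2 = of_real r" using r by (simp flip: of_real_power)
    moreover have "(cis (t / 2))\<^sup>2 = cis t" by (simp add: power2_eq_square cis_mult)
    ultimately show ?thesis by (simp add: power_mult_distrib)
  qed
  ultimately show ?thesis by simp
qed simp

text \<open>The disjointness of the cones forces the total angle to be exactly \<open>2 * pi\<close>, so that the
  square roots turn by the angle \<open>pi\<close>.\<close>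

lemma cyclic_cones:
  fixes a :: "nat \<Rightarrow> complex"
  assumes N: "0 < N" "a N = a 0"
    and Im: "\<And>i. i < N \<Longrightarrow> 0 < Im (a (Suc i) / a i)"
    and disj: "\<And>i j p q p' q'. \<lbrakk>i < N; j < N; 0 < p; 0 < q; 0 < p'; 0 < q';
      of_real p * a i + of_real q * a (Suc i) = of_real p' * a j + of_real q' * a (Suc j)\<rbrakk> \<Longrightarrow> i = j"
  shows "(\<Prod>i<N. csqrt (a (Suc i) / a i)) = -1"
proof -
  have a0: "a i \<noteq> 0" if "i \<le> N" for i
  proof (cases "i = N")
    case True then show ?thesis using Im[of 0] N by auto
  qed (use Im[of i] that in auto)
  define \<theta> where "\<theta> i = Arg (a (Suc i) / a i)" for i
  have \<theta>: "0 < \<theta> i" "\<theta> i < pi" if "i < N" for i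
    using Im[OF that] Arg_lt_pi[of "a (Suc i) / a i"] by (auto simp: \<theta>_def)
  have step: "a (Suc i) / a i = of_real (cmod (a (Suc i)) / cmod (a i)) * cis (\<theta> i)" if "i < N" for i
    using a0[of i] a0[of "Suc i"] that rcis_cmod_Arg[of "a (Suc i) / a i"]
    by (simp add: \<theta>_def rcis_def norm_divide)
  have stepm: "a (Suc i) = a i * of_real (cmod (a (Suc i)) / cmod (a i)) * cis (\<theta> i)" if "i < N" for i
    using step[OF that] a0[of i] that by (simp add: field_simps)
  define A where "A k = (\<Sum>i<k. \<theta> i)" for k
  have ak: "a k = of_real (cmod (a k) / cmod (a 0)) * a 0 * cis (A k)" if "k \<le> N" for k
    using that
  proof (induction k)
    case 0 then show ?case using a0[of 0] by (simp add: A_def)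
  next
    case (Suc k)
    have "a (Suc k) = (of_real (cmod (a k) / cmod (a 0)) * a 0 * cis (A k)) * of_real (cmod (a (Suc k)) / cmod (a k)) * cis (\<theta> k)"
      using stepm[of k] Suc by (metis Suc_le_lessD Suc_leD)
    then show ?case using a0[of k] Suc.prems by (simp add: A_def cis_mult[symmetric] field_simps)
  qed
  have prod: "(\<Prod>i<k. csqrt (a (Suc i) / a i)) = of_real (sqrt (cmod (a k) / cmod (a 0))) * cis (A k / 2)" if "k \<le> N" for k
    using that
  proof (induction k)
    case 0 then show ?case using a0[of 0] by (simp add: A_def)
  next
    case (Suc k)
    have e0: "csqrt (a (Suc k) / a k) = of_real (sqrt (cmod (a (Suc k)) / cmod (a k))) * cis (\<theta> k / 2)"
      unfolding step[OF Suc_le_lessD[OF Suc.prems]] using \<theta>[of k] Suc.prems by (intro csqrt_polar) auto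
    have e1: "sqrt (cmod (a k) / cmod (a 0)) * sqrt (cmod (a (Suc k)) / cmod (a k)) = sqrt (cmod (a (Suc k)) / cmod (a 0))"
      using a0[of k] Suc.prems by (simp flip: real_sqrt_mult)
    have e2: "cis (A k / 2) * cis (\<theta> k / 2) = cis (A (Suc k) / 2)"
      by (simp add: cis_mult A_def add_divide_distrib)
    have e3: "(\<Prod>i<Suc k. csqrt (a (Suc i) / a i)) = (of_real (sqrt (cmod (a k) / cmod (a 0))) * cis (A k / 2)) * csqrt (a (Suc k) / a k)"
      using Suc by simp
    have "(\<Prod>i<Suc k. csqrt (a (Suc i) / a i)) =
      of_real (sqrt (cmod (a k) / cmod (a 0)) * sqrt (cmod (a (Suc k)) / cmod (a k))) * (cis (A k / 2) * cis (\<theta> k / 2))"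
      unfolding e3 e0 by (simp add: mult_ac)
    also have "\<dots> = of_real (sqrt (cmod (a (Suc k)) / cmod (a 0))) * cis (A (Suc k) / 2)"
      by (simp only: e1 e2)
    finally show ?case .
  qed
  have "cis (A N) = 1" using ak[of N] N a0[of 0] by simp
  then have "cos (A N) = 1" by (simp add: complex_eq_iff)
  then obtain m :: int where m: "A N = of_int m * (2 * pi)" using cos_one_2pi_int by auto
  have "0 < A N" using N \<theta> unfolding A_def by (intro sum_pos) auto
  then have m1: "1 \<le> m" using m by (simp add: zero_less_mult_iff)
  have "m = 1"
  proof (rule ccontr)
    assume "m \<noteq> 1"
    then have "2 * (2 * pi) \<le> of_int m * (2 * pi)" using m1 by (intro mult_right_mono) auto
    then have AN: "4 * pi \<le> A N" using m by simp
    \<comment> \<open>A direction \<phi> inside the first cone is chosen such that no ray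
      \<open>a j\<close> has the accumulated angle \<open>2 * pi + \<phi>\<close>; only finitely
      many values are excluded.\<close>
    have "infinite {0<..<\<theta> 0}" using \<theta>(1)[OF N(1)] by (rule infinite_Ioo)
    then have "infinite ({0<..<\<theta> 0} - (\<lambda>j. A j - 2 * pi) ` {..N})" by simp
    then have "{0<..<\<theta> 0} - (\<lambda>j. A j - 2 * pi) ` {..N} \<noteq> {}" by (metis finite.emptyI)
    then obtain \<phi> where "\<phi> \<in> {0<..<\<theta> 0} - (\<lambda>j. A j - 2 * pi) ` {..N}" by blast
    then have \<phi>: "0 < \<phi>" "\<phi> < \<theta> 0" "\<And>j. j \<le> N \<Longrightarrow> \<phi> \<noteq> A j - 2 * pi" by auto
    \<comment> \<open>If the total angle is at least 4 pi, the direction \<phi> is passed a second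
      time after one full turn. The first ray beyond it is number \<open>j\<close>, so the cone
      \<open>i = j - 1\<close> contains the direction as well.\<close>
    define j where "j = (LEAST j. 2 * pi + \<phi> < A j)"
    have "2 * pi + \<phi> < A N" using AN \<phi> \<theta>[OF N(1)] by linarith
    then have j: "2 * pi + \<phi> < A j" "j \<le> N" unfolding j_def by (rule LeastI, rule Least_le)
    have "A 0 = 0" by (simp add: A_def)
    then have "j \<noteq> 0" using j(1) \<phi>(1) pi_gt_zero by (intro notI) simp
    then obtain i where i: "j = Suc i" by (cases j) auto
    have "\<not> 2 * pi + \<phi> < A i" using not_less_Least[of i "\<lambda>j. 2 * pi + \<phi> < A j"] i j_def by simp
    then have Ai: "A i < 2 * pi + \<phi>" using \<phi>(3)[of i] i j(2) by fastforce
    have iN: "i < N" using i j by simp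
    define \<psi> where "\<psi> = 2 * pi + \<phi> - A i"
    have \<psi>: "0 < \<psi>" "\<psi> < \<theta> i" using Ai j(1) i by (auto simp: \<psi>_def A_def)
    define \<rho> where "\<rho> i = cmod (a (Suc i)) / cmod (a i)" for i
    have \<rho>: "0 < \<rho> i" if "i < N" for i using a0[of i] a0[of "Suc i"] that by (simp add: \<rho>_def)
    obtain p q where pq: "0 < p" "0 < q" "of_real p * a 0 + of_real q * a (Suc 0) = a 0 * cis \<phi>"
      using cone_mem[OF \<phi>(1,2) \<theta>(2)[OF N(1)] \<rho>[OF N(1)], of "a 0"] stepm[OF N(1)] unfolding \<rho>_def[symmetric] by auto
    obtain p' q' where pq': "0 < p'" "0 < q'" "of_real p' * a i + of_real q' * a (Suc i) = a i * cis \<psi>"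
      using cone_mem[OF \<psi> \<theta>(2)[OF iN] \<rho>[OF iN], of "a i"] stepm[OF iN] unfolding \<rho>_def[symmetric] by auto
    define r where "r = cmod (a i) / cmod (a 0)"
    have r: "0 < r" using a0[of i] a0[of 0] iN by (simp add: r_def)
    have "a i * cis \<psi> = of_real r * a 0 * cis (A i) * cis \<psi>"
      using ak[of i] iN unfolding r_def by (metis less_imp_le)
    also have "\<dots> = of_real r * a 0 * (cis (A i) * cis \<psi>)" by (simp only: mult.assoc)
    also have "cis (A i) * cis \<psi> = cis \<phi>" by (simp add: cis_mult \<psi>_def complex_eq_iff cos_add sin_add)
    finally have "of_real p' * a i + of_real q' * a (Suc i) = of_real r * (of_real p * a 0 + of_real q * a (Suc 0))"
      using pq pq' by simp
    then have "of_real p' * a i + of_real q' * a (Suc i) = of_real (r * p) * a 0 + of_real (r * q) * a (Suc 0)"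
      by (simp add: algebra_simps)
    then have "i = 0" using disj[OF iN N(1) pq'(1,2), of "r * p" "r * q"] r pq by simp
    \<comment> \<open>For \<open>i = 0\<close> the angle \<psi> would be
      \<open>2 * pi + \<phi>\<close>, more than the opening of the first cone.\<close>
    then show False using \<psi> \<phi> \<theta>(2)[OF N(1)] pi_gt_zero by (simp add: \<psi>_def A_def)
  qed
  then have "cis (A N / 2) = -1" using m by simp
  then show ?thesis using prod[of N] N a0[of 0] by simp
qed

subsection \<open>Extending a spin structure over the centre of a chart\<close>

lemma topspace_surf_top [simp]: "topspace (surf_top A) = surf_carrier A"
proof -
  have "fst c \<subseteq> \<Union> {fst c \<inter> snd c -` V | c V. c \<in> A \<and> open V}" if "c \<in> A" for c
    using that by (intro Union_upper CollectI exI[of _ c] exI[of _ UNIV]) auto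
  then show ?thesis unfolding surf_top_def surf_carrier_def topology_generated_by_topspace by blast
qed

lemma openin_surf_top: "c \<in> A \<Longrightarrow> open V \<Longrightarrow> openin (surf_top A) (fst c \<inter> snd c -` V)"
  unfolding surf_top_def by (rule topology_generated_by_Basis) blast

lemma openin_chart_domain: "c \<in> A \<Longrightarrow> openin (surf_top A) (fst c)"
  using openin_surf_top[of c A UNIV] by simp

lemma openin_surf_top_preimage:
  assumes W: "openin (surf_top A) W"
    and basis: "\<And>k V. k \<in> A \<Longrightarrow> open V \<Longrightarrow> openin X {z \<in> topspace X. f z \<in> fst k \<and> snd k (f z) \<in> V}"
    and f: "f \<in> topspace X \<rightarrow> surf_carrier A"
  shows "openin X {z \<in> topspace X. f z \<in> W}"
proof -
  have "continuous_map X (surf_top A) f"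
    unfolding surf_top_def
  proof (rule continuous_on_generated_topo)
    show "f ` topspace X \<subseteq> \<Union> {fst c \<inter> snd c -` V |c V. c \<in> A \<and> open V}"
      using f topspace_surf_top[of A] unfolding surf_top_def topology_generated_by_topspace by blast
    fix U assume "U \<in> {fst c \<inter> snd c -` V |c V. c \<in> A \<and> open V}"
    then obtain k V where k: "U = fst k \<inter> snd k -` V" "k \<in> A" "open V" by blast
    have "f -` U \<inter> topspace X = {z \<in> topspace X. f z \<in> fst k \<and> snd k (f z) \<in> V}" unfolding k(1) by blast
    then show "openin X (f -` U \<inter> topspace X)" using basis[OF k(2,3)] by simp
  qed
  then show ?thesis by (rule openin_continuous_map_preimage[OF _ W])
qed

lemma jac_interior:
  assumes "(f has_derivative gl_lin M) (at z)" "open V" "z \<in> V" "V \<subseteq> S"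
  shows "jac f S z = M"
proof (rule jac_eqI)
  have e: "at z within S = at z" using assms by (metis at_within_interior interiorI)
  show "(f has_derivative gl_lin M) (at z within S)" unfolding e by (rule assms(1))
  show "deriv_unique S z" unfolding deriv_unique_def e using has_derivative_unique by blast
qed

text \<open>This isolates what the extension argument uses of an atlas: near each of its points the
  chart \<open>C\<close> sees every other chart there as an orientation preserving C1 map. The atlas
  of the surface with collars is shown to satisfy this for charts off the boundary.\<close>

locale center_chart =
  fixes A :: "'a chart set" and C :: "'a chart"
  assumes CA: "C \<in> A" and injA: "\<And>k. k \<in> A \<Longrightarrow> inj_on (snd k) (fst k)"
    and oC: "open (snd C ` fst C)"
    and loc: "\<And>k z. \<lbrakk>k \<in> A; z \<in> snd C ` fst C; inv_into (fst C) (snd C) z \<in> fst k\<rbrakk> \<Longrightarrow>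
      \<exists>W G. z \<in> W \<and> W \<subseteq> snd C ` fst C \<and> C1_on W (\<lambda>z. snd k (inv_into (fst C) (snd C) z)) G \<and>
        (\<forall>y\<in>W. inv_into (fst C) (snd C) y \<in> fst k \<and> 0 < det (G y))"
begin

definition "\<psi> = inv_into (fst C) (snd C)"

definition "img = snd C ` fst C"

definition "cdom k = {z \<in> img. \<psi> z \<in> fst k}"

definition "Gm k z = jac (\<lambda>z. snd k (\<psi> z)) UNIV z"

lemma psi_in: "z \<in> img \<Longrightarrow> \<psi> z \<in> fst C" and C_psi [simp]: "z \<in> img \<Longrightarrow> snd C (\<psi> z) = z"
  and psi_C: "y \<in> fst C \<Longrightarrow> \<psi> (snd C y) = y" and C_img: "y \<in> fst C \<Longrightarrow> snd C y \<in> img"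
  using injA[OF CA] by (auto simp: \<psi>_def img_def inv_into_into f_inv_into_f)

lemma open_img: "open img" using oC by (simp add: img_def)

lemma cdom_local:
  assumes "k \<in> A" "z \<in> cdom k"
  obtains W where "open W" "z \<in> W" "W \<subseteq> cdom k" "C1_on W (\<lambda>z. snd k (\<psi> z)) (Gm k)" "\<And>y. y \<in> W \<Longrightarrow> 0 < det (Gm k y)"
proof -
  obtain W G where W: "z \<in> W" "W \<subseteq> img" "C1_on W (\<lambda>z. snd k (\<psi> z)) G" "\<And>y. y \<in> W \<Longrightarrow> \<psi> y \<in> fst k \<and> 0 < det (G y)"
    using loc[of k z] assms unfolding cdom_def img_def \<psi>_def by auto
  have e: "Gm k y = G y" if "y \<in> W" for y
    unfolding Gm_def by (rule jac_interior[of _ _ _ W]) (use W(3) that in \<open>auto simp: C1_on_def\<close>)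
  have "C1_on W (\<lambda>z. snd k (\<psi> z)) (Gm k)"
    using W(3) e unfolding C1_on_def by (metis (no_types, lifting) continuous_on_cong)
  then show ?thesis using that[of W] W e by (auto simp: C1_on_def cdom_def)
qed

lemma det_Gm: "k \<in> A \<Longrightarrow> z \<in> cdom k \<Longrightarrow> 0 < det (Gm k z)"
  using cdom_local by metis

lemma open_cdom: assumes "k \<in> A" shows "open (cdom k)"
proof (subst open_subopen, intro ballI)
  fix z assume "z \<in> cdom k"
  then show "\<exists>T. open T \<and> z \<in> T \<and> T \<subseteq> cdom k" using cdom_local[OF assms] by metis
qed

lemma C1_cdom: assumes k: "k \<in> A" shows "C1_on (cdom k) (\<lambda>z. snd k (\<psi> z)) (Gm k)"
  unfolding C1_on_def
proof (intro conjI ballI)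
  show "open (cdom k)" using open_cdom[OF k] .
  show "((\<lambda>z. snd k (\<psi> z)) has_derivative gl_lin (Gm k y)) (at y)" if "y \<in> cdom k" for y
    using cdom_local[OF k that] unfolding C1_on_def by metis
  have "isCont (Gm k) z" if "z \<in> cdom k" for z
    using cdom_local[OF k that] unfolding C1_on_def by (metis continuous_on_eq_continuous_at)
  then show "continuous_on (cdom k) (Gm k)" by (simp add: continuous_at_imp_continuous_on)
qed

lemma jac_transition_C:
  assumes k: "k \<in> A" and z: "z \<in> cdom k"
  shows "jac (transition C k) (overlap C k) z = Gm k z"
proof (rule jac_interior[OF _ open_cdom[OF k] z])
  have "transition C k = (\<lambda>z. snd k (\<psi> z))" by (auto simp: transition_def \<psi>_def)
  then show "(transition C k has_derivative gl_lin (Gm k z)) (at z)"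
    using C1_cdom[OF k] z by (simp add: C1_on_def)
  show "cdom k \<subseteq> overlap C k"
  proof
    fix y assume y: "y \<in> cdom k"
    then have "y = snd C (\<psi> y)" "\<psi> y \<in> fst C \<inter> fst k" using psi_in by (auto simp: cdom_def)
    then show "y \<in> overlap C k" unfolding overlap_def by blast
  qed
qed

text \<open>The transition from \<open>k\<close> to \<open>k'\<close> is factored through
  \<open>C\<close>, with the local inverse supplied by \<open>C1_inverse\<close>. It makes the
  coordinate matrices prescribed on a new fibre fit together to an oriented frame.\<close>

lemma cocycle:
  assumes k: "k \<in> A" and k': "k' \<in> A" and z: "z \<in> cdom k" "z \<in> cdom k'"
  shows "jac (transition k k') (overlap k k') (snd k (\<psi> z)) = Gm k' z ** minv (Gm k z)"
proof -
  let ?f = "\<lambda>z. snd k (\<psi> z)"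
  have c: "C1_on (cdom k \<inter> cdom k') ?f (Gm k)"
    using C1_on_subset[OF C1_cdom[OF k]] open_cdom[OF k] open_cdom[OF k'] by (simp add: open_Int)
  have zz: "z \<in> cdom k \<inter> cdom k'" using z by blast
  obtain U V h where U: "open U" "z \<in> U" "U \<subseteq> cdom k \<inter> cdom k'" "open V" "?f z \<in> V" "homeomorphism U V ?f h"
    and C1: "C1_on V h (\<lambda>y. minv (Gm k (h y)))"
    by (rule C1_inverse[OF c zz det_Gm[OF k z(1)]]) blast
  have hV: "h y \<in> U" "?f (h y) = y" if "y \<in> V" for y using U(6) that by (auto simp: homeomorphism_def)
  have hz: "h (?f z) = z" using U(2,6) by (auto simp: homeomorphism_def)
  show ?thesis
  proof (rule jac_interior[OF _ U(4,5)])
    have inv: "inv_into (fst k) (snd k) y = \<psi> (h y)" if "y \<in> V" for y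
    proof -
      have "\<psi> (h y) \<in> fst k" using hV(1)[OF that] U(3) by (auto simp: cdom_def)
      then show ?thesis using inv_into_f_f[OF injA[OF k], of "\<psi> (h y)"] hV(2)[OF that] by simp
    qed
    have "(h has_derivative gl_lin (minv (Gm k z))) (at (?f z))"
      using C1 U(5) hz unfolding C1_on_def by metis
    moreover have "((\<lambda>z. snd k' (\<psi> z)) has_derivative gl_lin (Gm k' z)) (at (h (?f z)))"
      using C1_cdom[OF k'] z hz by (simp add: C1_on_def)
    ultimately have "((\<lambda>y. snd k' (\<psi> (h y))) has_derivative (\<lambda>v. gl_lin (Gm k' z) (gl_lin (minv (Gm k z)) v))) (at (?f z))"
      using has_derivative_compose by fast
    then have "((\<lambda>y. snd k' (\<psi> (h y))) has_derivative gl_lin (Gm k' z ** minv (Gm k z))) (at (?f z))"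
      by (simp add: gl_lin_mult[abs_def])
    then show "(transition k k' has_derivative gl_lin (Gm k' z ** minv (Gm k z))) (at (?f z))"
      by (rule has_derivative_transform_within_open[OF _ U(4,5)]) (simp add: transition_def inv)
    show "V \<subseteq> overlap k k'"
    proof
      fix y assume y: "y \<in> V"
      have "\<psi> (h y) \<in> fst k \<inter> fst k'" using hV(1)[OF y] U(3) by (auto simp: cdom_def)
      then show "y \<in> overlap k k'" unfolding overlap_def using hV(2)[OF y] by (metis imageI)
    qed
  qed
qed

lemma continuous_psi: "continuous_map (top_of_set img) (surf_top A) \<psi>"
  unfolding continuous_map_def
proof (intro conjI allI impI)
  show "\<psi> \<in> topspace (top_of_set img) \<rightarrow> topspace (surf_top A)"
    using psi_in CA by (auto simp: surf_carrier_def)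
  fix W assume W: "openin (surf_top A) W"
  show "openin (top_of_set img) {z \<in> topspace (top_of_set img). \<psi> z \<in> W}"
  proof (rule openin_surf_top_preimage[OF W])
    show "\<psi> \<in> topspace (top_of_set img) \<rightarrow> surf_carrier A" using psi_in CA by (auto simp: surf_carrier_def)
    fix k V assume k: "k \<in> A" "open (V :: complex set)"
    have "open (cdom k \<inter> (\<lambda>z. snd k (\<psi> z)) -` V)"
      using C1_on_continuous[OF C1_cdom[OF k(1)]] open_cdom[OF k(1)] k(2) by (rule continuous_open_preimage)
    moreover have "{z \<in> topspace (top_of_set img). \<psi> z \<in> fst k \<and> snd k (\<psi> z) \<in> V} = cdom k \<inter> (\<lambda>z. snd k (\<psi> z)) -` V"
      by (auto simp: cdom_def)
    ultimately show "openin (top_of_set img) {z \<in> topspace (top_of_set img). \<psi> z \<in> fst k \<and> snd k (\<psi> z) \<in> V}"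
      using openin_open_eq[OF open_img] by (auto simp: cdom_def)
  qed
qed

lemma psi_image: "B \<subseteq> img \<Longrightarrow> \<psi> ` B = fst C \<inter> snd C -` B"
  using psi_in psi_C by (auto simp: image_iff) (metis psi_C)

lemma open_psi_image: "open B \<Longrightarrow> B \<subseteq> img \<Longrightarrow> openin (surf_top A) (\<psi> ` B)"
  using openin_surf_top[OF CA] by (simp add: psi_image)

lemma continuous_C: "continuous_map (subtopology (surf_top A) (fst C)) euclidean (snd C)"
  unfolding continuous_map_def
proof (intro conjI allI impI)
  fix V :: "complex set" assume "openin euclidean V"
  then have o: "openin (surf_top A) (fst C \<inter> snd C -` V)" using openin_surf_top[OF CA] by simp
  have "{y \<in> topspace (subtopology (surf_top A) (fst C)). snd C y \<in> V} = fst C \<inter> snd C -` V"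
    using openin_subset[OF o] CA by (auto simp: surf_carrier_def)
  then show "openin (subtopology (surf_top A) (fst C)) {y \<in> topspace (subtopology (surf_top A) (fst C)). snd C y \<in> V}"
    using o by (simp add: subset_openin_subtopology)
qed simp

lemma t1_surf: "openin (surf_top A) (surf_carrier A - {x})"
proof (subst openin_subopen, intro ballI)
  fix y assume y: "y \<in> surf_carrier A - {x}"
  then obtain k where k: "k \<in> A" "y \<in> fst k" by (auto simp: surf_carrier_def)
  define V where "V = (if x \<in> fst k then - {snd k x} else UNIV)"
  have "openin (surf_top A) (fst k \<inter> snd k -` V)" by (rule openin_surf_top[OF k(1)]) (auto simp: V_def)
  moreover have "y \<in> fst k \<inter> snd k -` V" using y k injA[OF k(1)] by (auto simp: V_def dest: inj_onD)
  moreover have "fst k \<inter> snd k -` V \<subseteq> surf_carrier A - {x}" using k by (auto simp: V_def surf_carrier_def)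
  ultimately show "\<exists>T. openin (surf_top A) T \<and> y \<in> T \<and> T \<subseteq> surf_carrier A - {x}" by blast
qed

definition has_framed_section :: "('p, 'a) spin_bundle \<Rightarrow> complex \<Rightarrow> complex set \<Rightarrow> (complex \<Rightarrow> 'p) \<Rightarrow> bool" where
  "has_framed_section P z0 B s \<longleftrightarrow> open B \<and> z0 \<in> B \<and> B \<subseteq> img \<and>
     continuous_map (top_of_set (B - {z0})) (total_space P) s \<and>
     (\<forall>z\<in>B - {z0}. proj P (s z) = \<psi> z \<and> framing P (s z) C = mat 1)"

text \<open>The section trivialises the bundle over the punctured neighbourhood and so permits one
  fibre to be glued in. Since it lies over the constant frame of \<open>C\<close>, the framing in
  this trivialisation is \<open>Gm k z ** p_GL g\<close> with respect to a chart \<open>k\<close>,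
  an expression that is still continuous at the centre.\<close>

theorem section_imp_extends:
  fixes P :: "('p, 'a) spin_bundle"
  assumes P: "spin_structure A S P" and sec: "has_framed_section P z0 B s" and x: "\<psi> z0 \<notin> S"
  shows "spin_extends_to A S P (\<psi> z0)"
proof -
  define x where "x = \<psi> z0"
  have B: "open B" "z0 \<in> B" "B \<subseteq> img" and cs: "continuous_map (top_of_set (B - {z0})) (total_space P) s"
    and ps: "\<And>z. z \<in> B - {z0} \<Longrightarrow> proj P (s z) = \<psi> z" and fs: "\<And>z. z \<in> B - {z0} \<Longrightarrow> framing P (s z) C = mat 1"
    using sec by (auto simp: has_framed_section_def)
  note psz = ps
  define Y where "Y = subtopology (surf_top A) (insert x S)"
  define U where "U = \<psi> ` B"
  have Pp: "principal_GLt_bundle (subtopology (surf_top A) S) P"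
    and Pf: "\<And>u. u \<in> topspace (total_space P) \<Longrightarrow> oriented_frame A (proj P u) (framing P u)"
    and Pa: "\<And>u g. u \<in> topspace (total_space P) \<Longrightarrow> g \<in> carrier GLt \<Longrightarrow> framing P (act P u g) = (\<lambda>c. framing P u c ** p_GL g)"
    and Pc: "\<And>c. c \<in> A \<Longrightarrow> continuous_map (subtopology (total_space P) {u. proj P u \<in> fst c}) euclidean (\<lambda>u. framing P u c)"
    using P by (auto simp: spin_structure_def)
  have xC: "x \<in> fst C" and Cx: "snd C x = z0" using B psi_in by (auto simp: x_def)
  have xA: "x \<in> surf_carrier A" using xC CA by (auto simp: surf_carrier_def)
  interpret PB: principal_bundle "subtopology (surf_top A) S" P by unfold_locales (rule Pp)
  have sin: "s z \<in> PB.tot" if "z \<in> B - {z0}" for z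
    using continuous_map_image_subset_topspace[OF cs] that by auto
  have US: "U \<subseteq> insert x S"
  proof
    fix y assume "y \<in> U"
    then obtain z where z: "z \<in> B" "y = \<psi> z" by (auto simp: U_def)
    show "y \<in> insert x S"
    proof (cases "z = z0")
      case False
      then have "proj P (s z) \<in> topspace (subtopology (surf_top A) S)" using PB.proj_in sin z by blast
      then show ?thesis using ps[of z] z False by auto
    qed (use z x_def in auto)
  qed
  have tY: "topspace Y = surf_carrier A \<inter> insert x S" by (simp add: Y_def)
  have e: "subtopology Y (topspace Y - {x}) = subtopology (surf_top A) S"
  proof -
    have "topspace (surf_top A) \<inter> (insert x S \<inter> (topspace Y - {x})) = topspace (surf_top A) \<inter> S"
      using x by (auto simp: tY x_def)
    then show ?thesis unfolding Y_def subtopology_subtopology by (rule subtopology_cong)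
  qed
  have Ux: "U - {x} = \<psi> ` (B - {z0})"
    using B C_psi by (auto simp: U_def x_def) (metis C_psi subsetD)
  \<comment> \<open>The value at \<open>z0\<close> of the expression that describes the framing at
    the points around it.\<close>
  define fr where "fr = (\<lambda>g k. if k \<in> A \<and> x \<in> fst k then Gm k z0 ** p_GL g else 0)"
  interpret glue Y x U P "\<lambda>y. s (snd C y)" fr
  proof unfold_locales
    show "x \<in> topspace Y" using xA by (simp add: tY)
    have "openin Y ((surf_carrier A - {x}) \<inter> insert x S)" unfolding Y_def by (rule openin_subtopology_Int[OF t1_surf])
    moreover have "topspace Y - {x} = (surf_carrier A - {x}) \<inter> insert x S" by (auto simp: tY)
    ultimately show "openin Y (topspace Y - {x})" by simp
    show "principal_GLt_bundle (subtopology Y (topspace Y - {x})) P" unfolding e by (rule Pp)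
    show "openin Y U" unfolding Y_def using US open_psi_image[OF B(1,3)] by (simp add: U_def subset_openin_subtopology)
    show "x \<in> U" using B by (simp add: U_def x_def)
    have UC: "U - {x} \<subseteq> fst C" using B psi_in by (auto simp: U_def)
    have "subtopology Y (U - {x}) = subtopology (subtopology (surf_top A) (fst C)) (U - {x})"
      unfolding Y_def subtopology_subtopology using US UC by (metis Diff_subset Int_absorb1 subset_trans)
    then have "continuous_map (subtopology Y (U - {x})) euclidean (snd C)"
      using continuous_C by (simp add: continuous_map_from_subtopology)
    moreover have "snd C ` (U - {x}) \<subseteq> B - {z0}" unfolding Ux using B by auto
    ultimately have "continuous_map (subtopology Y (U - {x})) (top_of_set (B - {z0})) (snd C)"
      by (auto simp: continuous_map_in_subtopology image_subset_iff_funcset)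
    then show "continuous_map (subtopology Y (U - {x})) (total_space P) (\<lambda>y. s (snd C y))"
      using continuous_map_compose[OF _ cs] by (simp add: o_def)
    fix y assume "y \<in> U - {x}"
    then obtain z where "z \<in> B - {z0}" "y = \<psi> z" unfolding Ux by blast
    then show "proj P (s (snd C y)) = y" using psz[of z] B by auto
  qed
  have z0k: "z0 \<in> cdom k \<longleftrightarrow> x \<in> fst k" for k using B by (auto simp: cdom_def x_def)
  have frame_x: "oriented_frame A x (fr g)" if g: "g \<in> carrier GLt" for g
    unfolding oriented_frame_def
  proof (intro conjI ballI allI impI)
    fix c assume "c \<in> A" "x \<in> fst c"
    moreover have "0 < det (Gm c z0)" using calculation det_Gm z0k by blast
    ultimately show "0 < det (fr g c)" using GLt_det[OF g] by (simp add: fr_def det_mul)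
  next
    fix c c' assume c: "c \<in> A" "c' \<in> A" "x \<in> fst c \<and> x \<in> fst c'"
    then have zc: "z0 \<in> cdom c" "z0 \<in> cdom c'" by (simp_all add: z0k)
    have "det (Gm c z0) \<noteq> 0" using det_Gm[OF c(1) zc(1)] by simp
    then have "Gm c' z0 ** minv (Gm c z0) ** (Gm c z0 ** p_GL g) = Gm c' z0 ** p_GL g"
      by (metis matrix_mul_assoc matrix_mul_rid minv(1))
    then show "fr g c' = jac (transition c c') (overlap c c') (snd c x) ** fr g c"
      using cocycle[OF c(1,2) zc] c by (simp add: fr_def x_def)
  qed (auto simp: fr_def)
  have "spin_structure A (insert x S) glue_bundle"
    unfolding spin_structure_def Y_def[symmetric] total_space_glue topspace_gtop
  proof (intro conjI ballI)
    show "principal_GLt_bundle Y glue_bundle" by (rule principal_glue)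
    fix u assume u: "u \<in> E"
    show "oriented_frame A (proj glue_bundle u) (framing glue_bundle u)"
      using u Pf frame_x by (auto simp: E_def)
    fix g assume g: "g \<in> carrier GLt"
    show "framing glue_bundle (act glue_bundle u g) = (\<lambda>c. framing glue_bundle u c ** p_GL g)"
    proof (cases u)
      case (Inl w)
      then have "w \<in> PB.tot" using u by (auto simp: E_def)
      then show ?thesis using Pa[OF _ g] Inl by simp
    next
      case (Inr h)
      have "fr (h \<otimes>\<^bsub>GLt\<^esub> g) = (\<lambda>c. fr h c ** p_GL g)"
        by (rule ext) (simp add: fr_def matrix_mul_assoc)
      then show ?thesis unfolding Inr act_Inr framing_Inr .
    qed
  next
    fix k assume k: "k \<in> A"
    define N where "N = fst k \<inter> insert x S"
    have oN: "openin Y N" unfolding Y_def N_def by (rule openin_subtopology_Int[OF openin_chart_domain[OF k]])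
    have "continuous_map (subtopology gtop {u. proj glue_bundle u \<in> N}) euclidean (\<lambda>u. framing glue_bundle u k)"
    proof (rule continuous_map_gtop_over[OF oN])
      have "continuous_map (subtopology (total_space P) {u. proj P u \<in> fst k}) euclidean (\<lambda>u. framing P u k)" by (rule Pc[OF k])
      then show "continuous_map (subtopology (total_space P) {u. proj P u \<in> N}) euclidean (\<lambda>u. framing glue_bundle (Inl u) k)"
        unfolding framing_Inl by (rule continuous_map_from_subtopology_mono) (auto simp: N_def)
      let ?Z = "subtopology Ug {p. fst p \<in> N}"
      have tZ: "p \<in> topspace ?Z \<longleftrightarrow> fst p \<in> U \<and> snd p \<in> carrier GLt \<and> fst p \<in> fst k" for p
        unfolding topspace_subtopology topspace_Ug using US by (auto simp: N_def mem_Times_iff)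
      have UC: "U \<subseteq> fst C" using B psi_in by (auto simp: U_def)
      have cf: "continuous_map ?Z (subtopology (surf_top A) (fst C)) fst"
      proof -
        have "continuous_map ?Z (subtopology Y U) fst" by (rule continuous_map_from_subtopology) (rule continuous_map_fst)
        then show ?thesis using UC unfolding Y_def by (auto simp: continuous_map_in_subtopology)
      qed
      have c1: "continuous_map ?Z euclidean (\<lambda>p. snd C (fst p))"
        using continuous_map_compose[OF cf continuous_C] by (simp add: o_def)
      have inC: "snd C (fst p) \<in> cdom k" if "p \<in> topspace ?Z" for p
        using that UC psi_C C_img unfolding tZ by (auto simp: cdom_def)
      have c2: "continuous_map ?Z euclidean (\<lambda>p. Gm k (snd C (fst p)))"
        by (rule continuous_map_compose_on[OF c1, of "cdom k"]) (use inC C1_cdom[OF k] in \<open>auto simp: C1_on_def\<close>)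
      have c3: "continuous_map ?Z euclidean (\<lambda>p. fst (snd p))"
        by (rule continuous_map_GLt_fst) (rule continuous_map_from_subtopology, rule continuous_map_snd)
      have "continuous_map ?Z euclidean (\<lambda>p. fst (Gm k (snd C (fst p)), fst (snd p)) ** snd (Gm k (snd C (fst p)), fst (snd p)))"
        by (rule continuous_map_compose_on[of _ "\<lambda>p. (Gm k (snd C (fst p)), fst (snd p))" UNIV "\<lambda>q. fst q ** snd q"])
          (auto simp: continuous_map_pair_euclidean c2 c3 intro!: continuous_intros)
      then show "continuous_map ?Z euclidean (\<lambda>p. framing glue_bundle (\<theta> p) k)"
      proof (rule continuous_map_eq)
        fix p assume p: "p \<in> topspace ?Z"
        obtain y g where yg: "p = (y, g)" by (cases p)
        have "fst p \<in> U \<and> snd p \<in> carrier GLt \<and> fst p \<in> fst k" using p unfolding tZ .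
        then have y: "y \<in> U" "y \<in> fst k" "g \<in> carrier GLt" by (simp_all add: yg)
        show "fst (Gm k (snd C (fst p)), fst (snd p)) ** snd (Gm k (snd C (fst p)), fst (snd p)) = framing glue_bundle (\<theta> p) k"
        proof (cases "y = x")
          case True
          then have "framing glue_bundle (\<theta> p) k = fr g k" by (simp add: yg \<theta>_def)
          moreover have "fr g k = Gm k z0 ** p_GL g" using True k y by (simp add: fr_def)
          ultimately show ?thesis using True by (simp add: yg Cx)
        next
          case False
          then obtain z where z: "z \<in> B - {z0}" "y = \<psi> z" using y Ux by blast
          have zC: "snd C y = z" using z B by auto
          have of: "oriented_frame A y (framing P (s z))" using Pf[OF sin[OF z(1)]] psz[OF z(1)] z(2) by simp
          have zk: "z \<in> cdom k" using z y B by (auto simp: cdom_def)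
          have "y \<in> fst C" using y UC by auto
          then have "framing P (s z) k = jac (transition C k) (overlap C k) (snd C y) ** framing P (s z) C"
            using of CA k y(2) unfolding oriented_frame_def by blast
          then have "framing P (s z) k = Gm k z" using jac_transition_C[OF k zk] fs[OF z(1)] zC by simp
          then show ?thesis using False Pa[OF sin[OF z(1)] y(3)] by (simp add: yg \<theta>_def zC)
        qed
      qed
    qed
    moreover have "subtopology gtop {u. proj glue_bundle u \<in> N} = subtopology gtop {u. proj glue_bundle u \<in> fst k}"
    proof -
      have "topspace gtop \<inter> {u. proj glue_bundle u \<in> N} = topspace gtop \<inter> {u. proj glue_bundle u \<in> fst k}"
        using continuous_map_image_subset_topspace[OF continuous_proj_glue] by (auto simp: N_def tY)
      then show ?thesis by (rule subtopology_cong)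
    qed
    ultimately show "continuous_map (subtopology gtop {u. proj glue_bundle u \<in> fst k}) euclidean (\<lambda>u. framing glue_bundle u k)"
      by simp
  qed
  moreover have "spin_restriction P glue_bundle S"
    by (rule spin_restriction_glue) (use x in \<open>auto simp: x_def tY\<close>)
  ultimately show ?thesis unfolding spin_extends_to_def x_def[symmetric] by blast
qed

text \<open>A local trivialisation of the extended bundle gives a section over a small ball. Its
  frame, as a matrix in the chart \<open>C\<close>, lifts to the double cover because a ball is
  contractible, and acting with the inverse of the lift makes the frame constant. Off the centre the
  isomorphism with the given bundle carries the section back.\<close>

theorem extends_imp_section:
  fixes P :: "('p, 'a) spin_bundle"
  assumes P: "spin_structure A S P" and x: "\<psi> z0 \<notin> S" and ext: "spin_extends_to A S P (\<psi> z0)"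
    and B0: "open B0" "z0 \<in> B0" "B0 \<subseteq> img" "\<psi> ` (B0 - {z0}) \<subseteq> S"
  obtains B s where "has_framed_section P z0 B s" "B \<subseteq> B0"
proof -
  define x where "x = \<psi> z0"
  obtain Q :: "('p + gl, 'a) spin_bundle" where Q: "spin_structure A (insert x S) Q" and R: "spin_restriction P Q S"
    using ext unfolding spin_extends_to_def x_def by blast
  define Y where "Y = subtopology (surf_top A) (insert x S)"
  have Qp: "principal_GLt_bundle Y Q"
    and Qf: "\<And>u. u \<in> topspace (total_space Q) \<Longrightarrow> oriented_frame A (proj Q u) (framing Q u)"
    and Qa: "\<And>u g. u \<in> topspace (total_space Q) \<Longrightarrow> g \<in> carrier GLt \<Longrightarrow> framing Q (act Q u g) = (\<lambda>c. framing Q u c ** p_GL g)"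
    and Qc: "\<And>c. c \<in> A \<Longrightarrow> continuous_map (subtopology (total_space Q) {u. proj Q u \<in> fst c}) euclidean (\<lambda>u. framing Q u c)"
    using Q by (auto simp: spin_structure_def Y_def)
  interpret QB: principal_bundle Y Q by unfold_locales (rule Qp)
  have "\<psi> z0 \<in> fst C" using psi_in[of z0] B0 by auto
  then have xY: "x \<in> topspace Y" using CA by (auto simp: Y_def x_def surf_carrier_def intro: bexI[of _ C])
  obtain V \<tau> \<kappa> where tc: "QB.triv_chart V \<tau> \<kappa>" and xV: "x \<in> V" using QB.triv_chart_exists[OF xY] .
  note T = QB.triv_chartD[OF tc]
  obtain V' where V': "openin (surf_top A) V'" "V = V' \<inter> insert x S"
    using T(1) unfolding Y_def openin_subtopology by blast
  have "openin (top_of_set img) {z \<in> topspace (top_of_set img). \<psi> z \<in> V'}"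
    by (rule openin_continuous_map_preimage[OF continuous_psi V'(1)])
  then have "open {z \<in> img. \<psi> z \<in> V'}" using openin_open_eq[OF open_img] by auto
  then have "open ({z \<in> img. \<psi> z \<in> V'} \<inter> B0)" using B0 by (simp add: open_Int)
  moreover have "z0 \<in> {z \<in> img. \<psi> z \<in> V'} \<inter> B0" using B0 xV V' by (auto simp: x_def)
  ultimately obtain r where r: "0 < r" "ball z0 r \<subseteq> {z \<in> img. \<psi> z \<in> V'} \<inter> B0"
    using open_contains_ball by metis
  define B where "B = ball z0 r"
  have Bi: "B \<subseteq> img" "B \<subseteq> B0" using r by (auto simp: B_def)
  have zB: "z0 \<in> B" using r by (simp add: B_def)
  have BS: "\<psi> z \<in> insert x S" if "z \<in> B" for z using that B0(4) Bi(2) by (cases "z = z0") (auto simp: x_def)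
  have BV: "\<psi> z \<in> V" if "z \<in> B" for z using that r BS V' by (auto simp: B_def)
  have cB: "continuous_map (top_of_set B) (subtopology Y V) \<psi>"
  proof -
    have "continuous_map (top_of_set B) (surf_top A) \<psi>"
      using continuous_map_from_subtopology_mono[OF continuous_psi Bi(1)] .
    then show ?thesis using BS BV unfolding Y_def by (auto simp: continuous_map_in_subtopology)
  qed
  define s0 where "s0 z = \<tau> (\<psi> z, \<one>\<^bsub>GLt\<^esub>)" for z
  have cs0: "continuous_map (top_of_set B) (total_space Q) s0"
  proof -
    have "continuous_map (top_of_set B) (prod_topology (subtopology Y V) GLt_top) (\<lambda>z. (\<psi> z, \<one>\<^bsub>GLt\<^esub>))"
      using cB by (simp add: continuous_map_pairwise o_def)
    then show ?thesis using continuous_map_compose[OF _ T(3)] by (simp add: s0_def[abs_def] o_def)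
  qed
  have s0in: "s0 z \<in> QB.tot" if "z \<in> B" for z
    using continuous_map_image_subset_topspace[OF cs0] that by auto
  have ps0: "proj Q (s0 z) = \<psi> z" if "z \<in> B" for z using T(4)[OF BV[OF that], of "\<one>\<^bsub>GLt\<^esub>"] by (simp add: s0_def)
  have pC: "\<psi> z \<in> fst C" if "z \<in> B" for z using psi_in Bi that by auto
  have "continuous_map (top_of_set B) (subtopology (total_space Q) {u. proj Q u \<in> fst C}) s0"
    using cs0 ps0 pC by (auto simp: continuous_map_in_subtopology)
  then have cF: "continuous_on B (\<lambda>z. framing Q (s0 z) C)"
    using continuous_map_compose[OF _ Qc[OF CA]] by (fastforce simp: o_def)
  have dF: "0 < det (framing Q (s0 z) C)" if "z \<in> B" for z
  proof -
    have "oriented_frame A (\<psi> z) (framing Q (s0 z))" using Qf[OF s0in[OF that]] ps0[OF that] by simp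
    then have "\<forall>c\<in>A. \<psi> z \<in> fst c \<longrightarrow> 0 < det (framing Q (s0 z) c)" unfolding oriented_frame_def by (elim conjE)
    then show ?thesis using pC[OF that] CA by blast
  qed
  have cb: "contractible B" by (simp add: B_def convex_imp_contractible)
  obtain H where H: "continuous_map (top_of_set B) GLt_top H" "\<And>z. z \<in> B \<Longrightarrow> fst (H z) = framing Q (s0 z) C"
    using lift_exists[OF cb cF dF] by blast
  have Hin: "H z \<in> carrier GLt" if "z \<in> B" for z using continuous_map_GLt_in[OF H(1)] that by auto
  define s1 where "s1 z = act Q (s0 z) (inv\<^bsub>GLt\<^esub> (H z))" for z
  have cs1: "continuous_map (top_of_set B) (total_space Q) s1"
    unfolding s1_def[abs_def] by (intro QB.continuous_act_compose cs0 continuous_GLt_inv H(1))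
  have s1in: "s1 z \<in> QB.tot" if "z \<in> B" for z using continuous_map_image_subset_topspace[OF cs1] that by auto
  have ps1: "proj Q (s1 z) = \<psi> z" if "z \<in> B" for z
    using QB.proj_act[OF s0in[OF that]] Hin[OF that] ps0[OF that] by (simp add: s1_def)
  have fs1: "framing Q (s1 z) C = mat 1" if "z \<in> B" for z
    using Qa[OF s0in[OF that], of "inv\<^bsub>GLt\<^esub> (H z)"] Hin[OF that] H(2)[OF that] dF[OF that]
    by (simp add: s1_def fst_inv minv(2))
  obtain h where h: "homeomorphic_map (total_space P) (subtopology (total_space Q) {u. proj Q u \<in> S}) h"
    and hp: "\<And>u. u \<in> topspace (total_space P) \<Longrightarrow> proj Q (h u) = proj P u \<and> framing Q (h u) = framing P u"
  proof -
    obtain h where "homeomorphic_map (total_space P) (subtopology (total_space Q) {u. proj Q u \<in> S}) h \<and>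
        (\<forall>u\<in>topspace (total_space P). proj Q (h u) = proj P u \<and> framing Q (h u) = framing P u \<and>
           (\<forall>g\<in>carrier GLt. h (act P u g) = act Q (h u) g))"
      using R unfolding spin_restriction_def by (elim exE)
    then show ?thesis by (intro that[of h]) blast+
  qed
  obtain j where "homeomorphic_maps (total_space P) (subtopology (total_space Q) {u. proj Q u \<in> S}) h j"
    using h homeomorphic_map_maps by blast
  then have cj: "continuous_map (subtopology (total_space Q) {u. proj Q u \<in> S}) (total_space P) j"
    and hj: "\<And>u. u \<in> QB.tot \<Longrightarrow> proj Q u \<in> S \<Longrightarrow> h (j u) = u"
    by (simp_all add: homeomorphic_maps_def)
  have BS': "proj Q (s1 z) \<in> S" if "z \<in> B - {z0}" for z using ps1[of z] that B0(4) Bi(2) by auto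
  have "continuous_map (top_of_set (B - {z0})) (subtopology (total_space Q) {u. proj Q u \<in> S}) s1"
    using continuous_map_from_subtopology_mono[OF cs1, of "B - {z0}"] BS' by (auto simp: continuous_map_in_subtopology)
  then have cs: "continuous_map (top_of_set (B - {z0})) (total_space P) (\<lambda>z. j (s1 z))"
    using continuous_map_compose[OF _ cj] by (simp add: o_def)
  have "has_framed_section P z0 B (\<lambda>z. j (s1 z))"
    unfolding has_framed_section_def
  proof (intro conjI ballI)
    fix z assume z: "z \<in> B - {z0}"
    have "j (s1 z) \<in> topspace (total_space P)" using continuous_map_image_subset_topspace[OF cs] z by auto
    note q = hp[OF this]
    have "h (j (s1 z)) = s1 z" using hj s1in BS' z by auto
    then show "proj P (j (s1 z)) = \<psi> z" "framing P (j (s1 z)) C = mat 1"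
      using q ps1[of z] fs1[of z] z by simp_all
  qed (use cs zB Bi in \<open>auto simp: B_def\<close>)
  then show ?thesis using that Bi by blast
qed

end

subsection \<open>The interior of a spin triangulated surface\<close>

lemma smooth_map_on_continuous: assumes "smooth_map_on S f" shows "continuous_on S f"
proof (rule continuous_on_eq_continuous_within[THEN iffD2], intro ballI)
  fix z assume z: "z \<in> S"
  obtain W g G where W: "z \<in> W" "C1_on W g G" "\<And>y. y \<in> S \<inter> W \<Longrightarrow> g y = f y"
    using smooth_C1[OF assms z] by blast
  have "continuous_on (S \<inter> W) g" using C1_on_continuous[OF W(2)] by (rule continuous_on_subset) simp
  then have "continuous_on (S \<inter> W) f" by (rule continuous_on_eq) (rule W(3))
  then have "continuous (at z within (S \<inter> W)) f" using z W(1) by (simp add: continuous_on_eq_continuous_within)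
  moreover have "at z within (S \<inter> W) = at z within S" 
    by (rule at_within_nhd[of _ W]) (use W in \<open>auto simp: C1_on_def\<close>)
  ultimately show "continuous (at z within S) f" using W(1,3) z by (simp add: continuous_within)
qed

lemma smooth_map_on_subset:
  assumes "smooth_map_on S f" "T \<subseteq> S" shows "smooth_map_on T f"
  unfolding smooth_map_on_def
proof (intro ballI)
  fix x assume x: "x \<in> T"
  then obtain W g where W: "open W \<and> x \<in> W \<and> (\<forall>k. Ck_on k W g) \<and> (\<forall>y\<in>S \<inter> W. g y = f y)"
    using assms unfolding smooth_map_on_def by (elim ballE[of _ _ x] exE) auto
  then have "\<forall>y\<in>T \<inter> W. g y = f y" using assms(2) by auto
  with W show "\<exists>W g. open W \<and> x \<in> W \<and> (\<forall>k. Ck_on k W g) \<and> (\<forall>y\<in>T \<inter> W. g y = f y)"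
    by (intro exI[of _ W] exI[of _ g]) simp
qed

lemma smooth_map_on_C1:
  assumes "smooth_map_on S f" "open W" "W \<subseteq> S"
  shows "C1_on W f (jac f W)"
proof -
  have s: "smooth_map_on W f" using assms(1,3) by (rule smooth_map_on_subset)
  note j = smooth_jac[OF s deriv_unique_open[OF assms(2)]]
  show ?thesis unfolding C1_on_def using j at_within_open[OF _ assms(2)] assms(2) by auto
qed

lemma jac_open_subset: "open W \<Longrightarrow> z \<in> W \<Longrightarrow> W \<subseteq> S \<Longrightarrow> jac f S z = jac f W z"
  using at_within_interior[of z S] at_within_open[of z W] interiorI[of W z S] by (simp add: jac_def)

locale spin_tri =
  fixes T :: "('a, 'v, 'p) spin_surface"
  assumes pst: "punctured_spin_triangulated_surface T"
begin

abbreviation "A \<equiv> atlas T"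
abbreviation "bdy \<equiv> surf_boundary A"

lemma mts: "marked_triangulated_surface T" and spin: "spin_structure (plus_atlas T) (punctured_plus T) (spin T)"
  and trilift: "\<And>s. s \<in> triangles T \<Longrightarrow> spin_lift (plus_atlas T) (spin T) NS_type
        (std_triangle - {1, \<zeta>, \<zeta>\<^sup>2}) (Inl \<circ> tri_param T s) (tri_lift T s)"
  using pst by (simp_all add: punctured_spin_triangulated_surface_def)

lemma collar: "0 < collar_radius T" "collar_radius T < 1"
  using pst by (simp_all add: punctured_spin_triangulated_surface_def)

lemma ts: "triangulated_surface T" using mts by (simp add: marked_triangulated_surface_def)

lemmas tsD = ts[unfolded triangulated_surface_def]

lemma spb: "surface_with_parametrised_boundary T" by (rule tsD[THEN conjunct1])

lemma o2c: "oriented_2_complex T" by (rule tsD[THEN conjunct2, THEN conjunct1])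

lemma bvert_inj: "i < ncomp T \<Longrightarrow> inj_on (bvert T i) {..<3}" using tsD[THEN conjunct2, THEN conjunct2, THEN conjunct1] by blast

lemma bedges: "boundary_edges T = {{bvert T i k, bvert T i (Suc k mod 3)} | i k. i < ncomp T \<and> k < 3}"
  by (rule tsD[THEN conjunct2, THEN conjunct2, THEN conjunct2, THEN conjunct2, THEN conjunct1])

lemma homeo: "homeomorphic_map (top_of_set (realisation T)) (surf_top A) (homeo T)" by (rule tsD[THEN conjunct2, THEN conjunct2, THEN conjunct2, THEN conjunct2, THEN conjunct2, THEN conjunct2, THEN conjunct1])

lemma tri_emb: "s \<in> triangles T \<Longrightarrow> a \<in> s \<Longrightarrow>
    oriented_smooth_embedding std_triangle A (homeo T \<circ> affine_triangle T s a)"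
  using tsD[THEN conjunct2, THEN conjunct2, THEN conjunct2, THEN conjunct2, THEN conjunct2, THEN conjunct2, THEN conjunct2, THEN conjunct1] by blast

lemma homeo_b: "i < ncomp T \<Longrightarrow> z \<in> frontier std_triangle \<Longrightarrow> homeo T (bmap T i z) = bparam T i (z / of_real (cmod z))"
  using tsD[THEN conjunct2, THEN conjunct2, THEN conjunct2, THEN conjunct2, THEN conjunct2, THEN conjunct2, THEN conjunct2, THEN conjunct2] by blast

lemmas spbD = spb[unfolded surface_with_parametrised_boundary_def]

lemma os: "oriented_surface A" by (rule spbD[THEN conjunct1])

lemma outer: "i < ncomp T \<Longrightarrow> 1 < outer_radius T i"
  and b_emb: "i < ncomp T \<Longrightarrow> oriented_smooth_embedding (half_annulus (outer_radius T i)) A (bparam T i)"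
  using spbD[THEN conjunct2, THEN conjunct2, THEN conjunct1] by blast+

lemma b_comp: "connected_components_of (subtopology (surf_top A) bdy) = (\<lambda>i. bparam T i ` sphere 0 1) ` {..<ncomp T}"
  by (rule spbD[THEN conjunct2, THEN conjunct2, THEN conjunct2, THEN conjunct2])

lemmas osD = os[unfolded oriented_surface_def]

lemma inj_chart: "c \<in> A \<Longrightarrow> inj_on (snd c) (fst c)" using osD[THEN conjunct1] by blast

lemma overlap_open: "c \<in> A \<Longrightarrow> c' \<in> A \<Longrightarrow> openin (top_of_set (snd c ` fst c)) (overlap c c')"
  and transition_smooth: "c \<in> A \<Longrightarrow> c' \<in> A \<Longrightarrow> smooth_map_on (overlap c c') (transition c c')"
  and transition_det: "c \<in> A \<Longrightarrow> c' \<in> A \<Longrightarrow> z \<in> overlap c c' \<Longrightarrow> 0 < det (jac (transition c c') (overlap c c') z)"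
  using osD[THEN conjunct2, THEN conjunct1] by blast+

lemma Haus: "Hausdorff_space (surf_top A)" by (rule osD[THEN conjunct2, THEN conjunct2, THEN conjunct1])

lemma bdy_carrier: "bdy \<subseteq> surf_carrier A"
  by (auto simp: surf_boundary_def surf_carrier_def)

lemma bdy_eq: "bdy = (\<Union>i<ncomp T. bparam T i ` sphere 0 1)"
proof -
  have "\<Union> (connected_components_of (subtopology (surf_top A) bdy)) = bdy"
    using Union_connected_components_of[of "subtopology (surf_top A) bdy"] bdy_carrier by (simp add: Int_absorb1)
  then show ?thesis unfolding b_comp by simp
qed

lemma sphere_annulus: "i < ncomp T \<Longrightarrow> sphere 0 1 \<subseteq> half_annulus (outer_radius T i)"
  using outer by (auto simp: half_annulus_def)

lemma bparam_homeo:
  assumes "i < ncomp T"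
  shows "homeomorphic_map (top_of_set (half_annulus (outer_radius T i)))
    (subtopology (surf_top A) (bparam T i ` half_annulus (outer_radius T i))) (bparam T i)"
  using b_emb[OF assms] by (simp add: oriented_smooth_embedding_def embedding_map_def)

lemma bparam_continuous:
  assumes "i < ncomp T" shows "continuous_map (top_of_set (half_annulus (outer_radius T i))) (surf_top A) (bparam T i)"
  using homeomorphic_imp_continuous_map[OF bparam_homeo[OF assms]] continuous_map_in_subtopology by blast

lemma bparam_inj: assumes "i < ncomp T" shows "inj_on (bparam T i) (half_annulus (outer_radius T i))"
  using homeomorphic_imp_injective_map[OF bparam_homeo[OF assms]] by simp

text \<open>The boundary is a finite union of compact circles, and compact sets are closed in a
  Hausdorff space. Hence the charts may be cut down to the interior without losing openness.\<close>

lemma closed_bdy: "closedin (surf_top A) bdy"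
proof -
  have "compactin (surf_top A) (bparam T i ` sphere 0 1)" if i: "i < ncomp T" for i
  proof (rule image_compactin[OF _ bparam_continuous[OF i]])
    show "compactin (top_of_set (half_annulus (outer_radius T i))) (sphere 0 1)"
      using sphere_annulus[OF i] by (simp add: compactin_subtopology)
  qed
  then have "closedin (surf_top A) (bparam T i ` sphere 0 1)" if "i < ncomp T" for i
    using that compactin_imp_closedin[OF Haus] by blast
  then show ?thesis unfolding bdy_eq by (intro closedin_Union) auto
qed

lemma open_interior: "openin (surf_top A) (surf_carrier A - bdy)"
  using openin_diff[OF openin_topspace closed_bdy] by simp

abbreviation "cinv c \<equiv> inv_into (fst c) (snd c)"

lemma cinv: "c \<in> A \<Longrightarrow> x \<in> fst c \<Longrightarrow> cinv c (snd c x) = x"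
  and cinv_in: "z \<in> snd c ` fst c \<Longrightarrow> cinv c z \<in> fst c" and c_cinv: "z \<in> snd c ` fst c \<Longrightarrow> snd c (cinv c z) = z"
  using inj_chart by (auto simp: inv_into_into f_inv_into_f)

lemma chart_preimage_open:
  assumes c: "c \<in> A" and W: "openin (surf_top A) W"
  shows "openin (top_of_set (snd c ` fst c)) {z \<in> snd c ` fst c. cinv c z \<in> W}"
proof -
  have "openin (top_of_set (snd c ` fst c)) {z \<in> topspace (top_of_set (snd c ` fst c)). cinv c z \<in> W}"
  proof (rule openin_surf_top_preimage[OF W])
    show "cinv c \<in> topspace (top_of_set (snd c ` fst c)) \<rightarrow> surf_carrier A"
      using c cinv_in[of _ c] by (auto simp: surf_carrier_def)
    fix k V assume k: "k \<in> A" "open (V :: complex set)"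
    have eq: "{z \<in> topspace (top_of_set (snd c ` fst c)). cinv c z \<in> fst k \<and> snd k (cinv c z) \<in> V} =
        overlap c k \<inter> transition c k -` V" (is "?L = ?R")
    proof (intro equalityI subsetI)
      fix z assume z: "z \<in> ?L"
      then have "z = snd c (cinv c z)" "cinv c z \<in> fst c \<inter> fst k" using c_cinv[of z c] cinv_in[of z c] by simp_all
      then have "z \<in> overlap c k" unfolding overlap_def by (rule image_eqI)
      then show "z \<in> ?R" using z by (simp add: transition_def)
    next
      fix z assume z: "z \<in> ?R"
      then obtain x where x: "x \<in> fst c" "x \<in> fst k" "z = snd c x" by (auto simp: overlap_def)
      then show "z \<in> ?L" using z cinv[OF c x(1)] by (simp add: transition_def)
    qed
    have "openin (top_of_set (overlap c k)) (overlap c k \<inter> transition c k -` V)"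
      using smooth_map_on_continuous[OF transition_smooth[OF c k(1)]] k(2) by (rule continuous_openin_preimage_gen)
    then show "openin (top_of_set (snd c ` fst c)) {z \<in> topspace (top_of_set (snd c ` fst c)). cinv c z \<in> fst k \<and> snd k (cinv c z) \<in> V}"
      unfolding eq using overlap_open[OF c k(1)] openin_trans by blast
  qed
  then show ?thesis by simp
qed

section \<open>Charts of the surface with collars, seen from an interior chart\<close>

definition "Oc c = snd c ` (fst c - bdy)"

lemma Oc_interior: "c \<in> A \<Longrightarrow> Oc c \<subseteq> interior (snd c ` fst c)"
  by (auto simp: Oc_def surf_boundary_def)

text \<open>The image is relatively open in the image of the chart and contained in the interior of
  the latter, hence open in the plane even if the chart is modelled on a half plane.\<close>

lemma open_chart_image:
  assumes c: "c \<in> A" and W: "openin (surf_top A) W" and Wb: "W \<inter> bdy = {}"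
  shows "open (snd c ` (fst c \<inter> W))"
proof -
  have eq: "{z \<in> snd c ` fst c. cinv c z \<in> W} = snd c ` (fst c \<inter> W)" using cinv[OF c] by auto
  obtain V where V: "open V" "snd c ` (fst c \<inter> W) = snd c ` fst c \<inter> V"
    using chart_preimage_open[OF c W] unfolding eq by (meson openin_open)
  have "snd c ` (fst c \<inter> W) \<subseteq> interior (snd c ` fst c)"
    using Oc_interior[OF c] Wb by (auto simp: Oc_def)
  moreover have "I = K \<inter> V" if "I = J \<inter> V" "I \<subseteq> K" "K \<subseteq> J" for I J K :: "complex set" using that by blast
  ultimately have "snd c ` (fst c \<inter> W) = interior (snd c ` fst c) \<inter> V"
    using V(2) interior_subset[of "snd c ` fst c"] by metis
  then show ?thesis using V(1) by (simp add: open_Int)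
qed

lemma open_Oc: assumes c: "c \<in> A" shows "open (Oc c)"
proof -
  have "fst c \<inter> (surf_carrier A - bdy) = fst c - bdy" using c by (auto simp: surf_carrier_def)
  moreover have "(surf_carrier A - bdy) \<inter> bdy = {}" by blast
  ultimately show ?thesis using open_chart_image[OF c open_interior] by (simp add: Oc_def)
qed

definition pc :: "'a chart \<Rightarrow> ('a + nat \<times> complex) chart" where "pc c = (Inl ` (fst c - bdy), snd c \<circ> projl)"

definition kc :: "nat \<Rightarrow> ('a + nat \<times> complex) chart" where "kc i = (collar_map T i ` full_annulus T i, inv_into (full_annulus T i) (collar_map T i))"

lemma plus_atlas_eq: "plus_atlas T = pc ` A \<union> kc ` {..<ncomp T}"
  by (simp add: plus_atlas_def pc_def[abs_def] kc_def[abs_def])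

lemma collar_inj: assumes i: "i < ncomp T" shows "inj_on (collar_map T i) (full_annulus T i)"
proof (rule inj_onI)
  fix y z assume yz: "y \<in> full_annulus T i" "z \<in> full_annulus T i" "collar_map T i y = collar_map T i z"
  show "y = z"
  proof (cases "cmod y < 1")
    case True then show ?thesis using yz(3) by (auto simp: collar_map_def split: if_splits)
  next
    case False
    then have "\<not> cmod z < 1" "bparam T i y = bparam T i z" using yz(3) by (auto simp: collar_map_def split: if_splits)
    then show ?thesis using inj_onD[OF bparam_inj[OF i]] yz False by (auto simp: full_annulus_def half_annulus_def)
  qed
qed

lemma inj_plus: assumes "k \<in> plus_atlas T" shows "inj_on (snd k) (fst k)"
proof -
  from assms consider c where "c \<in> A" "k = pc c" | i where "i < ncomp T" "k = kc i" unfolding plus_atlas_eq by blast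
  then show ?thesis
  proof cases
    case 1 then show ?thesis using inj_chart[of c] by (auto simp: pc_def inj_on_def)
  next
    case 2 then show ?thesis by (auto simp: kc_def intro: inj_on_inv_into)
  qed
qed

lemma pc_img: "snd (pc c) ` fst (pc c) = Oc c"
  by (simp add: pc_def Oc_def image_image)

lemma pc_inv: assumes c: "c \<in> A" and z: "z \<in> Oc c" shows "inv_into (fst (pc c)) (snd (pc c)) z = Inl (cinv c z)"
proof -
  obtain x where x: "x \<in> fst c - bdy" "z = snd c x" using z by (auto simp: Oc_def)
  have "pc c \<in> plus_atlas T" using c by (simp add: plus_atlas_eq)
  then have "inv_into (fst (pc c)) (snd (pc c)) (snd (pc c) (Inl x)) = Inl x"
    using x by (intro inv_into_f_f inj_plus) (auto simp: pc_def)
  then show ?thesis using x cinv[OF c] by (simp add: pc_def)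
qed

lemma Oc_cinv: "c \<in> A \<Longrightarrow> z \<in> Oc c \<Longrightarrow> cinv c z \<in> fst c - bdy \<and> snd c (cinv c z) = z"
  using cinv by (auto simp: Oc_def)

lemma local_pc:
  assumes c: "c \<in> A" and d: "d \<in> A" and z: "z \<in> Oc c" "cinv c z \<in> fst d"
  shows "\<exists>W G. z \<in> W \<and> W \<subseteq> Oc c \<and> C1_on W (\<lambda>z. snd (pc d) (Inl (cinv c z))) G \<and>
    (\<forall>y\<in>W. Inl (cinv c y) \<in> fst (pc d) \<and> 0 < det (G y))"
proof -
  define W where "W = Oc c \<inter> overlap c d"
  have "openin (top_of_set (Oc c)) (Oc c \<inter> overlap c d)"
  proof -
    obtain V where "open V" "overlap c d = snd c ` fst c \<inter> V" using overlap_open[OF c d] by (meson openin_open)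
    moreover have "Oc c \<subseteq> snd c ` fst c" by (auto simp: Oc_def)
    ultimately show ?thesis unfolding openin_open by (intro exI[of _ V]) auto
  qed
  then have oW: "open W" using open_Oc[OF c] by (simp add: W_def openin_open_eq)
  have C: "C1_on W (transition c d) (jac (transition c d) W)"
    by (rule smooth_map_on_C1[OF transition_smooth[OF c d] oW]) (simp add: W_def)
  have e: "snd (pc d) (Inl (cinv c y)) = transition c d y" for y by (simp add: pc_def transition_def)
  have in_d: "cinv c y \<in> fst d" if "y \<in> W" for y using that cinv[OF c] by (auto simp: W_def overlap_def)
  have "z \<in> W" using z Oc_cinv[OF c z(1)] by (auto simp: W_def overlap_def image_iff intro!: bexI[of _ "cinv c z"])
  moreover have "0 < det (jac (transition c d) W y)" if "y \<in> W" for y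
    using transition_det[OF c d, of y] that jac_open_subset[OF oW that, of "overlap c d" "transition c d"] by (simp add: W_def)
  ultimately show ?thesis unfolding e using C in_d Oc_cinv[OF c]
    by (intro exI[of _ W] exI[of _ "jac (transition c d) W"]) (auto simp: W_def pc_def)
qed

text \<open>The unit circle of a collar chart is mapped to the boundary, so a point off the boundary
  has a collar coordinate \<open>w\<close> of modulus greater than 1. Near \<open>w\<close> the map
  \<open>bparam T i\<close> is a smooth embedding of an open set, and the coordinate change is a
  local inverse of it in the chart \<open>c\<close>.\<close>

lemma local_kc:
  assumes c: "c \<in> A" and i: "i < ncomp T" and z: "z \<in> Oc c" "Inl (cinv c z) \<in> fst (kc i)"
  shows "\<exists>W G. z \<in> W \<and> W \<subseteq> Oc c \<and> C1_on W (\<lambda>z. snd (kc i) (Inl (cinv c z))) G \<and>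
    (\<forall>y\<in>W. Inl (cinv c y) \<in> fst (kc i) \<and> 0 < det (G y))"
proof -
  let ?H = "half_annulus (outer_radius T i)"
  let ?b = "snd c \<circ> bparam T i"
  define D where "D = {w \<in> ?H. 1 < cmod w \<and> bparam T i w \<in> fst c - bdy}"
  obtain w where w: "w \<in> full_annulus T i" "collar_map T i w = Inl (cinv c z)" using z(2) by (auto simp: kc_def)
  have w1: "\<not> cmod w < 1" "bparam T i w = cinv c z" using w(2) by (auto simp: collar_map_def split: if_splits)
  have "cinv c z \<notin> bdy" using Oc_cinv[OF c z(1)] by simp
  moreover have "bparam T i w \<in> bdy" if "w \<in> sphere 0 1" unfolding bdy_eq using i that by blast
  ultimately have "cmod w \<noteq> 1" using w1(2) by auto
  then have wD: "w \<in> D" using w w1 Oc_cinv[OF c z(1)] by (auto simp: D_def full_annulus_def half_annulus_def)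
  have oD: "open D"
  proof -
    have "openin (surf_top A) (fst c \<inter> (surf_carrier A - bdy))" by (intro openin_Int openin_chart_domain c open_interior)
    moreover have "fst c \<inter> (surf_carrier A - bdy) = fst c - bdy" using c by (auto simp: surf_carrier_def)
    ultimately have "openin (surf_top A) (fst c - bdy)" by simp
    then have "openin (top_of_set ?H) {y \<in> topspace (top_of_set ?H). bparam T i y \<in> fst c - bdy}"
      by (rule openin_continuous_map_preimage[OF bparam_continuous[OF i]])
    then obtain V where V: "open V" "{y \<in> ?H. bparam T i y \<in> fst c - bdy} = ?H \<inter> V"
      by (auto simp: openin_open)
    have "D = {w. 1 < cmod w} \<inter> {y \<in> ?H. bparam T i y \<in> fst c - bdy}" unfolding D_def by blast
    also have "\<dots> = {w. 1 < cmod w} \<inter> (?H \<inter> V)" unfolding V(2) ..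
    also have "\<dots> = {w. 1 < cmod w} \<inter> {w. cmod w < outer_radius T i} \<inter> V" by (auto simp: half_annulus_def)
    finally have "D = {w. 1 < cmod w} \<inter> {w. cmod w < outer_radius T i} \<inter> V" .
    moreover have "open {w::complex. 1 < cmod w}" "open {w. cmod w < outer_radius T i}"
      by (intro open_Collect_less continuous_intros)+
    ultimately show ?thesis using V(1) by (simp add: open_Int)
  qed
  have sm: "smooth_map_on {z \<in> ?H. bparam T i z \<in> fst c} ?b" and dt: "\<And>y. y \<in> ?H \<Longrightarrow> bparam T i y \<in> fst c \<Longrightarrow> 0 < det (jac ?b ?H y)"
    using b_emb[OF i] c by (auto simp: oriented_smooth_embedding_def)
  have C: "C1_on D ?b (jac ?b D)" by (rule smooth_map_on_C1[OF sm oD]) (auto simp: D_def)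
  have dD: "0 < det (jac ?b D y)" if "y \<in> D" for y
    using dt[of y] jac_open_subset[OF oD that, of ?H ?b] that by (auto simp: D_def)
  obtain U V h where U: "open U" "w \<in> U" "U \<subseteq> D" "open V" "?b w \<in> V" "homeomorphism U V ?b h"
    "C1_on V h (\<lambda>y. minv (jac ?b D (h y)))"
    by (rule C1_inverse[OF C wD dD[OF wD]]) blast
  have hV: "h y \<in> U" "snd c (bparam T i (h y)) = y" if "y \<in> V" for y using U(6) that by (auto simp: homeomorphism_def)
  have zw: "?b w = z" using w1 Oc_cinv[OF c z(1)] by simp
  have cV: "cinv c y = bparam T i (h y)" "h y \<in> D" if "y \<in> V" for y
    using hV[OF that] U(3) cinv[OF c, of "bparam T i (h y)"] by (auto simp: D_def)
  have eq: "Inl (cinv c y) = collar_map T i (h y)" "h y \<in> full_annulus T i" if "y \<in> V" for y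
    using cV[OF that] collar by (auto simp: collar_map_def D_def full_annulus_def half_annulus_def)
  have "snd (kc i) (Inl (cinv c y)) = h y" if "y \<in> V" for y
    using inv_into_f_f[OF collar_inj[OF i] eq(2)[OF that]] eq(1)[OF that] by (simp add: kc_def)
  then have "C1_on V (\<lambda>z. snd (kc i) (Inl (cinv c z))) (\<lambda>y. minv (jac ?b D (h y)))"
    by (rule C1_on_cong[OF U(7)])
  moreover have "V \<subseteq> Oc c"
  proof
    fix y assume y: "y \<in> V"
    show "y \<in> Oc c" unfolding Oc_def
      by (rule image_eqI[of _ _ "bparam T i (h y)"]) (use hV[OF y] cV[OF y] in \<open>auto simp: D_def\<close>)
  qed
  moreover have "Inl (cinv c y) \<in> fst (kc i)" "0 < det (minv (jac ?b D (h y)))" if "y \<in> V" for y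
    using eq[OF that] det_minv[OF dD[OF cV(2)[OF that]]] by (auto simp: kc_def)
  ultimately show ?thesis using U(5) zw by (intro exI[of _ V] exI[of _ "\<lambda>y. minv (jac ?b D (h y))"]) auto
qed

lemma center_chart_pc: assumes c: "c \<in> A" shows "center_chart (plus_atlas T) (pc c)"
proof
  show "pc c \<in> plus_atlas T" using c by (simp add: plus_atlas_eq)
  show "open (snd (pc c) ` fst (pc c))" unfolding pc_img by (rule open_Oc[OF c])
  show "inj_on (snd k) (fst k)" if "k \<in> plus_atlas T" for k using that by (rule inj_plus)
  fix k z assume k: "k \<in> plus_atlas T" and z: "z \<in> snd (pc c) ` fst (pc c)" "inv_into (fst (pc c)) (snd (pc c)) z \<in> fst k"
  have zO: "z \<in> Oc c" using z(1) unfolding pc_img .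
  have zk: "Inl (cinv c z) \<in> fst k" using z(2) pc_inv[OF c zO] by simp
  have "\<exists>W G. z \<in> W \<and> W \<subseteq> Oc c \<and> C1_on W (\<lambda>z. snd k (Inl (cinv c z))) G \<and>
    (\<forall>y\<in>W. Inl (cinv c y) \<in> fst k \<and> 0 < det (G y))"
    using k unfolding plus_atlas_eq
  proof
    assume "k \<in> pc ` A"
    then obtain d where "d \<in> A" "k = pc d" by blast
    then show ?thesis using local_pc[OF c _ zO] zk by (auto simp: pc_def)
  next
    assume "k \<in> kc ` {..<ncomp T}"
    then show ?thesis using local_kc[OF c _ zO] zk by auto
  qed
  then obtain W G where W: "z \<in> W" "W \<subseteq> Oc c" "C1_on W (\<lambda>z. snd k (Inl (cinv c z))) G"
    "\<forall>y\<in>W. Inl (cinv c y) \<in> fst k \<and> 0 < det (G y)" by blast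
  have e: "inv_into (fst (pc c)) (snd (pc c)) y = Inl (cinv c y)" if "y \<in> W" for y using pc_inv[OF c] W(2) that by auto
  have "C1_on W (\<lambda>z. snd k (inv_into (fst (pc c)) (snd (pc c)) z)) G"
    by (rule C1_on_cong[OF W(3)]) (simp add: e)
  then show "\<exists>W G. z \<in> W \<and> W \<subseteq> snd (pc c) ` fst (pc c) \<and>
      C1_on W (\<lambda>z. snd k (inv_into (fst (pc c)) (snd (pc c)) z)) G \<and>
      (\<forall>y\<in>W. inv_into (fst (pc c)) (snd (pc c)) y \<in> fst k \<and> 0 < det (G y))"
    using W e unfolding pc_img by (intro exI[of _ W] exI[of _ G]) simp
qed

end

subsection \<open>The standard triangle\<close>

lemma zeta_eq: "\<zeta> = Complex (-1/2) (sqrt 3 / 2)"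
proof -
  have "cos (2 * pi / 3) = cos (pi - pi / 3)" "sin (2 * pi / 3) = sin (pi - pi / 3)" by simp_all
  then have "cos (2 * pi / 3) = - 1/2" "sin (2 * pi / 3) = sqrt 3 / 2"
    unfolding cos_diff sin_diff by (simp_all add: cos_60 sin_60)
  then show ?thesis by (simp add: \<zeta>_def complex_eq_iff)
qed

lemma zeta_sq: "\<zeta>\<^sup>2 = Complex (-1/2) (- sqrt 3 / 2)"
  by (simp add: zeta_eq complex_eq_iff power2_eq_square)

lemma zeta_cube: "\<zeta> ^ 3 = 1"
proof -
  have "\<zeta> ^ 3 = \<zeta>\<^sup>2 * \<zeta>" by (simp add: power3_eq_cube power2_eq_square)
  then show ?thesis unfolding zeta_sq unfolding zeta_eq by (simp add: complex_eq_iff)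
qed

lemma zeta_mod: "\<zeta> ^ (k + 3) = \<zeta> ^ k"
  by (simp add: power_add zeta_cube)

lemma zeta_cnj: "\<zeta> ^ k * cnj (\<zeta> ^ k) = 1"
proof -
  have "cmod (\<zeta> ^ k) = 1" by (simp add: \<zeta>_def norm_power)
  then show ?thesis using complex_norm_square[of "\<zeta> ^ k"] by (simp del: complex_cnj_power)
qed

lemma bary_mod: "bary (k + 3) z = bary k z"
  by (simp only: bary_def zeta_mod)

text \<open>Rotation permutes the corners of the triangle, so statements about the corner
  \<open>k\<close> reduce to the corner 0. Indices are kept unreduced and have period 3.\<close>

lemma bary_rotate: "bary (k + j) (\<zeta> ^ k * z) = bary j z"
proof -
  have "\<zeta> ^ k * z * cnj (\<zeta> ^ (k + j)) = (\<zeta> ^ k * cnj (\<zeta> ^ k)) * (z * cnj (\<zeta> ^ j))"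
    by (simp only: power_add complex_cnj_mult ac_simps)
  then have e: "\<zeta> ^ k * z * cnj (\<zeta> ^ (k + j)) = z * cnj (\<zeta> ^ j)"
    unfolding zeta_cnj by (simp only: mult_1)
  show ?thesis by (simp only: bary_def e)
qed

lemma bary_012: "bary 0 z = (1 + 2 * Re z) / 3"
  "bary 1 z = (1 - Re z + sqrt 3 * Im z) / 3" "bary (Suc 0) z = (1 - Re z + sqrt 3 * Im z) / 3" "bary 2 z = (1 - Re z - sqrt 3 * Im z) / 3"
  by (simp_all only: bary_def power_0 power_one_right zeta_sq One_nat_def[symmetric]) (simp_all add: zeta_eq)

lemma bary_sum: "bary 0 z + bary 1 z + bary 2 z = 1"
  by (simp add: bary_012 field_simps)

lemma bary_sum': "bary k z + bary (k + 1) z + bary (k + 2) z = 1"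
proof -
  have z: "z = \<zeta> ^ k * (cnj (\<zeta> ^ k) * z)" using zeta_cnj[of k] by (simp add: mult.assoc[symmetric])
  show ?thesis by (subst (1 2 3) z) (use bary_rotate[of k 0] bary_rotate[of k 1] bary_rotate[of k 2] bary_sum in simp)
qed

text \<open>Coordinates adapted to the corner \<open>k\<close>: \<open>s\<close> runs along edge
  \<open>k\<close>, which leaves the corner counterclockwise, and \<open>t\<close> runs backwards
  along the edge that arrives there.\<close>

definition tri_pt :: "nat \<Rightarrow> real \<Rightarrow> real \<Rightarrow> complex" where
  "tri_pt k s t = \<zeta> ^ k + of_real s * (\<zeta> ^ (k + 1) - \<zeta> ^ k) + of_real t * (\<zeta> ^ (k + 2) - \<zeta> ^ k)"

lemma tri_pt_rotate: "tri_pt k s t = \<zeta> ^ k * tri_pt 0 s t"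
  by (simp add: tri_pt_def power_add algebra_simps)

lemma bary_tri_pt: "bary k (tri_pt k s t) = 1 - s - t" "bary (k + 1) (tri_pt k s t) = s" "bary (k + 2) (tri_pt k s t) = t"
proof -
  have e: "Re (tri_pt 0 s t) = 1 - 3/2 * s - 3/2 * t" "Im (tri_pt 0 s t) = sqrt 3 / 2 * s - sqrt 3 / 2 * t"
    by (simp_all only: tri_pt_def power_0 power_one_right add_0 zeta_sq) (simp_all add: zeta_eq field_simps)
  have s3: "sqrt 3 * (sqrt 3 * x) = 3 * x" for x by (simp flip: mult.assoc)
  have "bary 0 (tri_pt 0 s t) = 1 - s - t" "bary 1 (tri_pt 0 s t) = s" "bary 2 (tri_pt 0 s t) = t"
    unfolding bary_012 e by (simp_all add: field_simps s3)
  then show "bary k (tri_pt k s t) = 1 - s - t" "bary (k + 1) (tri_pt k s t) = s" "bary (k + 2) (tri_pt k s t) = t"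
    unfolding tri_pt_rotate[of k] using bary_rotate[of k 0] bary_rotate[of k 1] bary_rotate[of k 2] by simp_all
qed

lemma tri_pt_bary: "tri_pt k (bary (k + 1) z) (bary (k + 2) z) = z"
proof -
  define y where "y = cnj (\<zeta> ^ k) * z"
  have z: "z = \<zeta> ^ k * y" using zeta_cnj[of k] by (simp add: y_def mult.assoc[symmetric])
  have s3: "sqrt 3 * (sqrt 3 * x) = 3 * x" for x by (simp flip: mult.assoc)
  have "tri_pt 0 (bary 1 y) (bary 2 y) = y"
    unfolding bary_012 by (simp only: tri_pt_def power_0 power_one_right add_0 zeta_sq) (simp add: zeta_eq complex_eq_iff field_simps s3)
  then show ?thesis unfolding z bary_rotate unfolding tri_pt_rotate[of k] by simp
qed

lemma std_triangle_eq: "z \<in> std_triangle \<longleftrightarrow> 0 \<le> bary k z \<and> 0 \<le> bary (k + 1) z \<and> 0 \<le> bary (k + 2) z"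
proof -
  have vals: "z = u *\<^sub>R 1 + v *\<^sub>R \<zeta> + w *\<^sub>R \<zeta>\<^sup>2 \<longleftrightarrow> z = tri_pt 0 v w" if "u + v + w = 1" for u v w
  proof -
    have u: "u = 1 - v - w" using that by simp
    show ?thesis unfolding u tri_pt_def by (simp add: scaleR_conv_of_real algebra_simps power2_eq_square)
  qed
  have "z \<in> std_triangle \<longleftrightarrow> (\<exists>u v w. 0 \<le> u \<and> 0 \<le> v \<and> 0 \<le> w \<and> u + v + w = 1 \<and> z = u *\<^sub>R 1 + v *\<^sub>R \<zeta> + w *\<^sub>R \<zeta>\<^sup>2)"
    unfolding std_triangle_def convex_hull_3 by auto
  also have "\<dots> \<longleftrightarrow> 0 \<le> bary 0 z \<and> 0 \<le> bary 1 z \<and> 0 \<le> bary 2 z"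
  proof
    assume "\<exists>u v w. 0 \<le> u \<and> 0 \<le> v \<and> 0 \<le> w \<and> u + v + w = 1 \<and> z = u *\<^sub>R 1 + v *\<^sub>R \<zeta> + w *\<^sub>R \<zeta>\<^sup>2"
    then obtain u v w where uvw: "0 \<le> u" "0 \<le> v" "0 \<le> w" "u + v + w = 1" "z = tri_pt 0 v w" using vals by blast
    then show "0 \<le> bary 0 z \<and> 0 \<le> bary 1 z \<and> 0 \<le> bary 2 z"
      using bary_tri_pt[of 0 v w] by (simp add: numeral_2_eq_2)
  next
    assume b: "0 \<le> bary 0 z \<and> 0 \<le> bary 1 z \<and> 0 \<le> bary 2 z"
    have "z = tri_pt 0 (bary 1 z) (bary 2 z)" using tri_pt_bary[of 0 z] by (simp add: numeral_2_eq_2)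
    then show "\<exists>u v w. 0 \<le> u \<and> 0 \<le> v \<and> 0 \<le> w \<and> u + v + w = 1 \<and> z = u *\<^sub>R 1 + v *\<^sub>R \<zeta> + w *\<^sub>R \<zeta>\<^sup>2"
      using b vals[OF bary_sum[of z]] bary_sum[of z] by blast
  qed
  also have "\<dots> \<longleftrightarrow> 0 \<le> bary k z \<and> 0 \<le> bary (k + 1) z \<and> 0 \<le> bary (k + 2) z"
  proof (induction k)
    case 0 then show ?case by (simp add: numeral_2_eq_2)
  next
    case (Suc k)
    have "bary (Suc k + 2) z = bary k z" using bary_mod[of k z] by (simp add: eval_nat_numeral)
    moreover have "Suc k + 1 = k + 2" "Suc k = k + 1" by simp_all
    ultimately show ?case using Suc by metis
  qed
  finally show ?thesis .
qed

lemma std_triangle_012: "z \<in> std_triangle \<longleftrightarrow> 0 \<le> bary 0 z \<and> 0 \<le> bary (Suc 0) z \<and> 0 \<le> bary 2 z"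
  using std_triangle_eq[of z 0] by (simp add: numeral_2_eq_2)

lemma tri_pt_in: "0 \<le> s \<Longrightarrow> 0 \<le> t \<Longrightarrow> s + t \<le> 1 \<Longrightarrow> tri_pt k s t \<in> std_triangle"
  using std_triangle_eq[of "tri_pt k s t" k] bary_tri_pt by simp

definition punct :: "complex set" where "punct = std_triangle - {1, \<zeta>, \<zeta>\<^sup>2}"

definition open_tri :: "complex set" where "open_tri = {z. 0 < bary 0 z \<and> 0 < bary (Suc 0) z \<and> 0 < bary 2 z}"

lemma bary_vertices: "z \<in> {1, \<zeta>, \<zeta>\<^sup>2} \<Longrightarrow> bary k z = 0 \<or> bary k z = 1"
proof -
  have s3: "sqrt 3 * (sqrt 3 * x) = 3 * x" for x by (simp flip: mult.assoc)
  assume z: "z \<in> {1, \<zeta>, \<zeta>\<^sup>2}"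
  have b0: "bary 0 z \<in> {0, 1} \<and> bary (0 + 1) z \<in> {0, 1} \<and> bary (0 + 2) z \<in> {0, 1}"
  proof -
    have b: "bary 0 1 = 1" "bary 1 1 = 0" "bary 2 1 = 0" "bary 0 \<zeta> = 0" "bary 1 \<zeta> = 1" "bary 2 \<zeta> = 0"
      "bary 0 (\<zeta>\<^sup>2) = 0" "bary 1 (\<zeta>\<^sup>2) = 0" "bary 2 (\<zeta>\<^sup>2) = 1"
      unfolding bary_012 zeta_sq by (simp_all add: zeta_eq)
    from z consider "z = 1" | "z = \<zeta>" | "z = \<zeta>\<^sup>2" by auto
    then show ?thesis unfolding add_0 using b by cases simp_all
  qed
  have "bary k z \<in> {0, 1} \<and> bary (k + 1) z \<in> {0, 1} \<and> bary (k + 2) z \<in> {0, 1}"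
  proof (induction k)
    case (Suc k)
    have "bary (Suc k + 2) z = bary k z" using bary_mod[of k z] by (simp add: eval_nat_numeral)
    moreover have "Suc k + 1 = k + 2" "Suc k = k + 1" by simp_all
    ultimately show ?case using Suc by metis
  qed (rule b0)
  then show ?thesis by auto
qed

lemma punctI: "z \<in> std_triangle \<Longrightarrow> 0 < bary k z \<Longrightarrow> bary k z < 1 \<Longrightarrow> z \<in> punct"
  using bary_vertices[of z k] by (auto simp: punct_def)

lemma punct_std: "punct \<subseteq> std_triangle" by (auto simp: punct_def)

lemma open_tri_punct: "open_tri \<subseteq> punct"
proof
  fix z assume z: "z \<in> open_tri"
  then have "bary 0 z < 1" using bary_sum[of z] by (simp add: open_tri_def)
  moreover have "z \<in> std_triangle" using z by (simp add: open_tri_def std_triangle_012)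
  ultimately show "z \<in> punct" using punctI[of z 0] z by (simp add: open_tri_def)
qed

lemma continuous_on_bary [continuous_intros]: "continuous_on S f \<Longrightarrow> continuous_on S (\<lambda>x. bary k (f x))"
  unfolding bary_def by (intro continuous_intros) auto

lemma open_open_tri: "open open_tri"
proof -
  have o: "open {z. 0 < bary k z}" for k by (intro open_Collect_less continuous_intros)
  have e: "open_tri = {z. 0 < bary 0 z} \<inter> {z. 0 < bary (Suc 0) z} \<inter> {z. 0 < bary 2 z}" by (auto simp: open_tri_def)
  show ?thesis unfolding e by (intro open_Int o)
qed

lemma bary_convex: "u + v = 1 \<Longrightarrow> bary k (u *\<^sub>R x + v *\<^sub>R y) = u * bary k x + v * bary k y"
proof -
  assume "u + v = 1"
  then have u: "u = 1 - v" by simp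
  show ?thesis unfolding u bary_def by (simp add: field_simps scaleR_conv_of_real)
qed

lemma zero_open_tri: "0 \<in> open_tri" by (simp add: open_tri_def bary_012)

lemma convex_open_tri: "convex open_tri"
  unfolding convex_def
proof (intro ballI allI impI)
  fix x y and u v :: real assume a: "x \<in> open_tri" "y \<in> open_tri" "0 \<le> u" "0 \<le> v" "u + v = 1"
  have "0 < u * bary k x + v * bary k y" if "0 < bary k x" "0 < bary k y" for k
    using that a by (metis add.commute add_0 add_nonneg_pos add_pos_nonneg less_eq_real_def mult_eq_0_iff mult_nonneg_nonneg mult_pos_pos zero_neq_one)
  then show "u *\<^sub>R x + v *\<^sub>R y \<in> open_tri" using a by (simp add: open_tri_def bary_convex)
qed

lemma std_closure: assumes "z \<in> std_triangle" shows "z \<in> closure open_tri"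
proof (rule closure_approachable[THEN iffD2], intro allI impI)
  fix e :: real assume e: "0 < e"
  \<comment> \<open>The point is pulled towards the centre 0 by the fraction \<open>r\<close>, which
    moves it by at most \<open>r * cmod z\<close>; adding 1 to \<open>cmod z\<close> avoids a zero
    denominator.\<close>
  define r where "r = min (1/2) (e / (2 * (cmod z + 1)))"
  have c: "0 < cmod z + 1" by (simp add: add_nonneg_pos)
  then have r: "0 < r" "r < 1" using e by (auto simp: r_def)
  have b: "bary k ((1 - r) *\<^sub>R z + r *\<^sub>R 0) = (1 - r) * bary k z + r * bary k 0" for k by (rule bary_convex) simp
  have "0 < (1 - r) * bary k z + r * bary k 0" if "0 \<le> bary k z" "0 < bary k 0" for k
    using that r by (intro add_nonneg_pos mult_nonneg_nonneg mult_pos_pos) auto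
  then have "(1 - r) *\<^sub>R z + r *\<^sub>R 0 \<in> open_tri"
    using zero_open_tri assms unfolding open_tri_def mem_Collect_eq b std_triangle_012 by simp
  moreover have "dist ((1 - r) *\<^sub>R z + r *\<^sub>R 0) z < e"
  proof -
    have "dist ((1 - r) *\<^sub>R z + r *\<^sub>R 0) z = r * cmod z" using r by (simp add: dist_norm algebra_simps)
    also have "\<dots> \<le> e / (2 * (cmod z + 1)) * (cmod z + 1)" using e c by (intro mult_mono) (auto simp: r_def)
    also have "\<dots> = e / 2" using c by (simp add: field_simps)
    finally show ?thesis using e by simp
  qed
  ultimately show "\<exists>y\<in>open_tri. dist y z < e" by blast
qed

lemma deriv_unique_std: "z \<in> std_triangle \<Longrightarrow> deriv_unique std_triangle z"
  and deriv_unique_punct: "z \<in> std_triangle \<Longrightarrow> deriv_unique punct z"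
  using deriv_unique_convex[OF convex_open_tri _ std_closure, of z] open_tri_punct punct_std zero_open_tri
  by (auto simp: interior_open[OF open_open_tri])

lemma compact_std: "compact std_triangle"
  unfolding std_triangle_def by (intro compact_convex_hull) auto

lemma zero_interior_std: "0 \<in> interior std_triangle"
  using open_tri_punct punct_std zero_open_tri open_open_tri by (meson interiorI subset_trans)

lemma frontier_std: assumes "z \<in> frontier std_triangle" shows "z \<in> std_triangle" "\<exists>k<3. bary k z = 0"
proof -
  have cl: "closed std_triangle" using compact_std compact_imp_closed by blast
  show z: "z \<in> std_triangle" using assms cl by (simp add: frontier_def)
  show "\<exists>k<3. bary k z = 0"
  proof (rule ccontr)
    assume n: "\<not> (\<exists>k<3. bary k z = 0)"
    have "bary 0 z \<noteq> 0" "bary 1 z \<noteq> 0" "bary 2 z \<noteq> 0" using n by (metis (no_types) less_numeral_extra(1) numeral_less_iff one_less_numeral_iff pos2 semiring_norm zero_less_numeral)+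
    then have "z \<in> open_tri" using z by (simp add: open_tri_def std_triangle_012)
    then have "z \<in> interior std_triangle" using open_tri_punct punct_std open_open_tri by (meson interiorI subset_trans)
    then show False using assms by (simp add: frontier_def)
  qed
qed

text \<open>Every ray from the interior point 0 leaves the bounded triangle, so radial projection
  maps its frontier onto the circle.\<close>

lemma sphere_frontier_std:
  assumes "cmod w = 1" obtains z where "z \<in> frontier std_triangle" "z / of_real (cmod z) = w"
proof -
  have "w \<noteq> 0" using assms by auto
  then obtain d where d: "0 < d" "0 + d *\<^sub>R w \<in> frontier std_triangle"
    using ray_to_frontier[of std_triangle 0 w] compact_imp_bounded[OF compact_std] zero_interior_std by metis
  have "d *\<^sub>R w / of_real (cmod (d *\<^sub>R w)) = w" using d assms by (simp add: scaleR_conv_of_real norm_mult)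
  then show ?thesis using that[of "d *\<^sub>R w"] d by simp
qed

subsection \<open>Triangles of a triangulated surface\<close>

context spin_tri
begin

lemma sum_lessThan_3: "(\<Sum>k<3::nat. F k) = F 0 + F 1 + F 2"
  by (simp add: numeral_3_eq_3 numeral_2_eq_2)

lemmas o2D = o2c[unfolded oriented_2_complex_def]

lemma simplex: "s \<in> simplices T \<Longrightarrow> finite s \<and> s \<noteq> {}"
  and subsimplex: "s \<in> simplices T \<Longrightarrow> t \<subseteq> s \<Longrightarrow> t \<noteq> {} \<Longrightarrow> t \<in> simplices T"
  using o2D[THEN conjunct2, THEN conjunct1] by blast+

lemma simplex_triangle: "s \<in> simplices T \<Longrightarrow> \<exists>t\<in>triangles T. s \<subseteq> t"
  using o2D[THEN conjunct2, THEN conjunct2, THEN conjunct1] by blast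

lemma tri_nxt: "s \<in> triangles T \<Longrightarrow> a \<in> s \<Longrightarrow> s = {a, nxt T s a, nxt T s (nxt T s a)}"
  by (rule o2D[THEN conjunct2, THEN conjunct2, THEN conjunct2, THEN conjunct1, THEN bspec, THEN bspec, THEN conjunct1])

lemma nxt3: "s \<in> triangles T \<Longrightarrow> a \<in> s \<Longrightarrow> nxt T s (nxt T s (nxt T s a)) = a"
  by (rule o2D[THEN conjunct2, THEN conjunct2, THEN conjunct2, THEN conjunct1, THEN bspec, THEN bspec, THEN conjunct2])

lemma nxt_opp:
  assumes "s \<in> triangles T" "t \<in> triangles T" "a \<in> s" "s \<noteq> t" "{a, nxt T s a} \<subseteq> t"
  shows "nxt T t (nxt T s a) = a"
  using o2D[THEN conjunct2, THEN conjunct2, THEN conjunct2, THEN conjunct2, THEN conjunct1, THEN bspec, OF assms(1), THEN bspec, OF assms(2), THEN bspec, OF assms(3)] assms(4,5) by simp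

lemma mem_tri: "s \<in> triangles T \<Longrightarrow> a \<in> s \<Longrightarrow> w \<in> s \<longleftrightarrow> w = a \<or> w = nxt T s a \<or> w = nxt T s (nxt T s a)"
  using arg_cong[OF tri_nxt, of s a "\<lambda>S. w \<in> S"] by simp

lemma tri_simplex: "s \<in> triangles T \<Longrightarrow> s \<in> simplices T" and tri_card: "s \<in> triangles T \<Longrightarrow> card s = 3"
  by (auto simp: triangles_def)

lemma nxt_in: "s \<in> triangles T \<Longrightarrow> a \<in> s \<Longrightarrow> nxt T s a \<in> s"
  using mem_tri by blast

lemma nxt_neq: 
  assumes "s \<in> triangles T" "a \<in> s"
  shows "nxt T s a \<noteq> a" "nxt T s (nxt T s a) \<noteq> a" "nxt T s (nxt T s a) \<noteq> nxt T s a"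
proof -
  have c: "card {a, nxt T s a, nxt T s (nxt T s a)} = 3"
    unfolding tri_nxt[OF assms, symmetric] by (rule tri_card[OF assms(1)])
  then show "nxt T s a \<noteq> a" "nxt T s (nxt T s a) \<noteq> a" "nxt T s (nxt T s a) \<noteq> nxt T s a"
    by (auto simp: card_insert_if split: if_splits)
qed

lemma corner: 
  assumes s: "s \<in> triangles T" shows "corner T s \<in> s" "preferred T s = {corner T s, nxt T s (corner T s)}"
proof -
  have p: "preferred T s \<in> edges T" "preferred T s \<subseteq> s" using mts s by (auto simp: marked_triangulated_surface_def)
  then obtain x y where xy: "preferred T s = {x, y}" "x \<noteq> y" by (auto simp: edges_def card_2_iff)
  have xs: "x \<in> s" "y \<in> s" using p xy by auto
  then have "y = nxt T s x \<or> y = nxt T s (nxt T s x)" using mem_tri[OF s xs(1), of y] xs(2) xy(2) by simp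
  then have ex: "\<exists>a. a \<in> s \<and> preferred T s = {a, nxt T s a}"
    using xs xy nxt3[OF s xs(1)] by (metis insert_commute)
  have un: "a = b" if "a \<in> s \<and> preferred T s = {a, nxt T s a}" "b \<in> s \<and> preferred T s = {b, nxt T s b}" for a b
    using that nxt_neq[OF s] by (metis doubleton_eq_iff)
  have "\<exists>!a. a \<in> s \<and> preferred T s = {a, nxt T s a}" using ex un by blast
  from theI'[OF this] show "corner T s \<in> s" "preferred T s = {corner T s, nxt T s (corner T s)}"
    unfolding corner_def by blast+
qed

lemma nxt_pow_in: "s \<in> triangles T \<Longrightarrow> a \<in> s \<Longrightarrow> (nxt T s ^^ k) a \<in> s"
  by (induction k) (auto intro: nxt_in)

text \<open>The vertex of \<open>s\<close> that corresponds to \<open>\<zeta> ^ k\<close> under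
  \<open>tri_param\<close>; it is the start of the edge \<open>d2 T k s\<close>.\<close>

definition vtx :: "'v set \<Rightarrow> nat \<Rightarrow> 'v" where "vtx s k = (nxt T s ^^ k) (corner T s)"

lemma vtx_in: "s \<in> triangles T \<Longrightarrow> vtx s k \<in> s"
  unfolding vtx_def by (rule nxt_pow_in[OF _ corner(1)])

lemma vtx_Suc: "vtx s (Suc k) = nxt T s (vtx s k)" by (simp add: vtx_def)

lemma vtx_mod: "s \<in> triangles T \<Longrightarrow> vtx s (k + 3) = vtx s k"
  using nxt3[OF _ vtx_in, of s k] by (simp add: vtx_Suc eval_nat_numeral)

lemma d2_vtx: "d2 T k s = {vtx s k, nxt T s (vtx s k)}"
  by (simp add: d2_def vtx_def)

lemma d2_iff:
  assumes "s \<in> triangles T" "a \<in> s" shows "d2 T k s = {a, nxt T s a} \<longleftrightarrow> vtx s k = a"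
  unfolding d2_vtx using nxt_neq[OF assms] nxt_neq[OF assms(1) vtx_in[OF assms(1), of k]]
  by (metis doubleton_eq_iff)

lemma vtx_exists:
  assumes s: "s \<in> triangles T" "a \<in> s" obtains k where "k < 3" "vtx s k = a"
proof -
  have "a = vtx s 0 \<or> a = vtx s 1 \<or> a = vtx s 2"
    using mem_tri[OF s(1) vtx_in[OF s(1), of 0], of a] s(2) by (simp add: vtx_Suc numeral_2_eq_2)
  then show ?thesis using that[of 0] that[of 1] that[of 2] by auto
qed

lemma vtx_inj: 
  assumes s: "s \<in> triangles T" and "j < 3" "k < 3" "vtx s j = vtx s k" shows "j = k"
proof -
  note n = nxt_neq[OF s vtx_in[OF s, of 0]]
  have "vtx s 1 = nxt T s (vtx s 0)" "vtx s 2 = nxt T s (nxt T s (vtx s 0))" by (simp_all add: vtx_Suc numeral_2_eq_2)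
  with n have d: "vtx s 0 \<noteq> vtx s 1" "vtx s 0 \<noteq> vtx s 2" "vtx s 1 \<noteq> vtx s 2" by metis+
  have "j = 0 \<or> j = 1 \<or> j = 2" "k = 0 \<or> k = 1 \<or> k = 2" using assms by auto
  then show ?thesis using d assms(4) by metis
qed

definition tri_bary :: "'v \<Rightarrow> 'v \<Rightarrow> 'v \<Rightarrow> real \<Rightarrow> real \<Rightarrow> 'v \<Rightarrow> real" where
  "tri_bary a b c s t w = (1 - s - t) * vertex_point a w + s * vertex_point b w + t * vertex_point c w"

text \<open>Barycentric coordinates and vertices both have period 3 in the index, so the defining
  sum may begin at \<open>k\<close> instead of 0. The result refers to the vertices around
  \<open>v\<close> and no longer to the preferred edge, which allows adjacent triangles to be
  compared.\<close>

lemma tri_param_tri_pt: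
  assumes s: "s \<in> triangles T" and v: "vtx s k = v"
  shows "tri_param T s (tri_pt k x y) = homeo T (tri_bary v (nxt T s v) (nxt T s (nxt T s v)) x y)"
proof -
  have per: "F 0 + F 1 + F 2 = F k + F (k + 1) + F (k + 2)" if "\<And>j. F (j + 3) = F j" for F :: "nat \<Rightarrow> real"
  proof (induction k)
    case (Suc k)
    have "F (Suc k + 2) = F k" using that[of k] by (simp add: eval_nat_numeral)
    then show ?case using Suc by (simp add: eval_nat_numeral)
  qed (simp add: numeral_2_eq_2)
  have "affine_triangle T s (corner T s) (tri_pt k x y) w = tri_bary v (nxt T s v) (nxt T s (nxt T s v)) x y w" for w
  proof -
    define F where "F j = bary j (tri_pt k x y) * vertex_point (vtx s j) w" for j
    have "affine_triangle T s (corner T s) (tri_pt k x y) w = F 0 + F 1 + F 2"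
      unfolding affine_triangle_def sum_lessThan_3[symmetric] by (intro sum.cong refl) (simp only: F_def vtx_def)
    also have "\<dots> = F k + F (k + 1) + F (k + 2)"
      by (rule per) (simp only: F_def bary_mod vtx_mod[OF s])
    also have "\<dots> = tri_bary v (nxt T s v) (nxt T s (nxt T s v)) x y w"
      unfolding F_def bary_tri_pt tri_bary_def using v by (simp add: vtx_Suc)
    finally show ?thesis .
  qed
  then have "affine_triangle T s (corner T s) (tri_pt k x y) = tri_bary v (nxt T s v) (nxt T s (nxt T s v)) x y" by (rule ext)
  then show ?thesis by (simp add: tri_param_def)
qed

lemma tri_bary_realisation:
  assumes s: "s \<in> triangles T" "a \<in> s" and xy: "0 \<le> x" "0 \<le> y" "x + y \<le> 1"
  shows "tri_bary a (nxt T s a) (nxt T s (nxt T s a)) x y \<in> realisation T"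
proof -
  define b c where "b = nxt T s a" "c = nxt T s (nxt T s a)"
  let ?Y = "tri_bary a b c x y"
  have n: "b \<noteq> a" "c \<noteq> a" "c \<noteq> b" using nxt_neq[OF s] by (simp_all add: b_c_def)
  have e: "s = {a, b, c}" unfolding b_c_def by (rule tri_nxt[OF s])
  have sub: "{w. ?Y w \<noteq> 0} \<subseteq> s" unfolding e by (auto simp: tri_bary_def vertex_point_def split: if_splits)
  have "sum ?Y s = ?Y a + ?Y b + ?Y c" unfolding e using n by auto
  also have "\<dots> = 1" using n by (auto simp: tri_bary_def vertex_point_def)
  finally have s1: "sum ?Y s = 1" .
  have fin: "finite s" using simplex[OF tri_simplex[OF s(1)]] by simp
  have "sum ?Y {w. ?Y w \<noteq> 0} = sum ?Y s"
    by (rule sum.mono_neutral_left[OF fin sub]) auto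
  then have s2: "sum ?Y {w. ?Y w \<noteq> 0} = 1" using s1 by simp
  then have "{w. ?Y w \<noteq> 0} \<noteq> {}" by (metis sum.empty zero_neq_one)
  then have "{w. ?Y w \<noteq> 0} \<in> simplices T" using subsimplex[OF tri_simplex[OF s(1)] sub] by blast
  moreover have "0 \<le> ?Y w" for w using xy by (auto simp: tri_bary_def vertex_point_def)
  ultimately show ?thesis using s2 unfolding b_c_def by (simp add: realisation_def)
qed

lemma homeo_inj: "inj_on (homeo T) (realisation T)"
  using homeomorphic_imp_injective_map[OF homeo] by simp

lemma homeo_in: "y \<in> realisation T \<Longrightarrow> homeo T y \<in> surf_carrier A"
  using continuous_map_image_subset_topspace[OF homeomorphic_imp_continuous_map[OF homeo]] by auto

text \<open>Each boundary circle is the image of boundary edges, and their points have weight 0 at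
  an inner vertex. Injectivity of \<open>homeo T\<close> then excludes a point with nonzero weight
  at \<open>v\<close>.\<close>

lemma inner_not_bdy:
  assumes y: "y \<in> realisation T" and v: "v \<in> inner_vertices T" "y v \<noteq> 0"
  shows "homeo T y \<notin> bdy"
proof
  assume "homeo T y \<in> bdy"
  then obtain i where "i < ncomp T" "homeo T y \<in> bparam T i ` sphere 0 1" unfolding bdy_eq by blast
  then obtain w where i: "i < ncomp T" "cmod w = 1" "homeo T y = bparam T i w" by (auto simp: dist_norm)
  obtain z where z: "z \<in> frontier std_triangle" "z / of_real (cmod z) = w" using sphere_frontier_std[OF i(2)] .
  have bv: "\<And>j. j < 3 \<Longrightarrow> {bvert T i j, bvert T i (Suc j mod 3)} \<in> boundary_edges T" using bedges i(1) by blast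
  have vb: "v \<noteq> bvert T i j" if "j < 3" for j using bv[OF that] v(1) by (auto simp: inner_vertices_def)
  have inj: "inj_on (bvert T i) {..<3}" by (rule bvert_inj[OF i(1)])
  \<comment> \<open>On the frontier of the triangle some barycentric coordinate vanishes, so the
    point lies on the edge spanned by the other two corners, which begins at the index
    \<open>j\<close> after \<open>k\<close>.\<close>
  obtain k where k: "k < 3" "bary k z = 0" using frontier_std(2)[OF z(1)] by blast
  define j where "j = Suc k mod 3"
  have j: "j < 3" "{..<3} = {k, j, Suc j mod 3}"
  proof -
    have l: "{..<3::nat} = {0, 1, 2}" and kk: "k = 0 \<or> k = 1 \<or> k = 2" using k(1) by auto
    show "j < 3" by (simp add: j_def)
    from kk show "{..<3} = {k, j, Suc j mod 3}" unfolding l j_def by (elim disjE) auto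
  qed
  have Y: "bmap T i z w = bary 0 z * vertex_point (bvert T i 0) w + bary 1 z * vertex_point (bvert T i 1) w + bary 2 z * vertex_point (bvert T i 2) w" for w
    unfolding bmap_def by (rule sum_lessThan_3)
  have nn: "0 \<le> bary 0 z" "0 \<le> bary 1 z" "0 \<le> bary 2 z" using frontier_std(1)[OF z(1)] by (simp_all add: std_triangle_012)
  have "bmap T i z \<in> realisation T"
  proof -
    have e: "{bvert T i j, bvert T i (Suc j mod 3)} \<in> simplices T" using bv[OF j(1)] by (auto simp: boundary_edges_def edges_def)
    have sub: "{w. bmap T i z w \<noteq> 0} \<subseteq> {bvert T i j, bvert T i (Suc j mod 3)}"
    proof
      fix w assume "w \<in> {w. bmap T i z w \<noteq> 0}"
      then have "\<exists>l\<in>{..<3}. bary l z * vertex_point (bvert T i l) w \<noteq> 0" unfolding bmap_def by (auto dest: sum.not_neutral_contains_not_neutral)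
      then show "w \<in> {bvert T i j, bvert T i (Suc j mod 3)}" unfolding j(2) using k(2) by (auto simp: vertex_point_def split: if_splits)
    qed
    have d: "bvert T i 0 \<noteq> bvert T i 1" "bvert T i 0 \<noteq> bvert T i 2" "bvert T i 1 \<noteq> bvert T i 2"
      using inj_onD[OF inj, of 0 1] inj_onD[OF inj, of 0 2] inj_onD[OF inj, of 1 2] by auto
    let ?V = "{bvert T i 0, bvert T i 1, bvert T i 2}"
    have subV: "{w. bmap T i z w \<noteq> 0} \<subseteq> ?V" by (auto simp: Y vertex_point_def split: if_splits)
    have "sum (bmap T i z) ?V = 1" using d bary_sum[of z] by (simp add: Y vertex_point_def)
    moreover have "sum (bmap T i z) {w. bmap T i z w \<noteq> 0} = sum (bmap T i z) ?V"
      by (rule sum.mono_neutral_left[OF _ subV]) auto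
    ultimately have s1: "sum (bmap T i z) {w. bmap T i z w \<noteq> 0} = 1" by simp
    then have "{w. bmap T i z w \<noteq> 0} \<noteq> {}" by (metis sum.empty zero_neq_one)
    then have "{w. bmap T i z w \<noteq> 0} \<in> simplices T" using subsimplex[OF e sub] by blast
    then show ?thesis using s1 nn by (auto simp: realisation_def Y vertex_point_def)
  qed
  moreover have "homeo T y = homeo T (bmap T i z)" using homeo_b[OF i(1) z(1)] z(2) i(3) by simp
  ultimately have "y = bmap T i z" using homeo_inj y by (meson inj_onD)
  then have "y v = 0" using vb by (simp add: Y vertex_point_def)
  then show False using v(2) by simp
qed

end

subsection \<open>Spin lifts and edge signs\<close>

lemma smooth_jac_open:
  assumes sm: "smooth_map_on D f" and D: "openin (top_of_set S) D" and u: "\<And>z. z \<in> D \<Longrightarrow> deriv_unique S z"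
  shows "continuous_on D (jac f S)" "z \<in> D \<Longrightarrow> (f has_derivative gl_lin (jac f S z)) (at z within S)"
proof -
  obtain V where V: "open V" "D = S \<inter> V" using D by (auto simp: openin_open)
  have e: "at z within D = at z within S" if "z \<in> D" for z
    unfolding V(2) by (rule at_within_nhd[of _ V]) (use V that in auto)
  have j: "jac f S z = jac f D z" if "z \<in> D" for z unfolding jac_def e[OF that] ..
  have u': "deriv_unique D z" if "z \<in> D" for z using u[OF that] unfolding deriv_unique_def e[OF that] .
  note sj = smooth_jac[OF sm u']
  show "continuous_on D (jac f S)" using sj(1) by (rule continuous_on_eq) (simp_all add: j)
  show "z \<in> D \<Longrightarrow> (f has_derivative gl_lin (jac f S z)) (at z within S)"
    using sj(2)[of z] e[of z] j[of z] by simp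
qed

text \<open>A unit square root of the direction of edge \<open>k\<close>, which has argument 5 pi /
  6 + 2 pi k / 3. For \<open>k = kR\<close> the square is the \<alpha> in the definition of the edge
  sign. The root changes its sign when \<open>k\<close> grows by 3, so here indices modulo 3 must be
  distinguished from unreduced ones.\<close>

definition \<beta> :: "nat \<Rightarrow> complex" where "\<beta> k = cis (pi * (real k / 3 + 5 / 12))"

lemma norm_beta [simp]: "cmod (\<beta> k) = 1" and beta_nonzero [simp]: "\<beta> k \<noteq> 0"
  by (simp_all add: \<beta>_def)

lemma zeta_power_cis: "\<zeta> ^ k = cis (2 * pi * real k / 3)"
  by (simp only: \<zeta>_def Complex.DeMoivre) (rule arg_cong[of _ _ cis], simp add: field_simps)

lemma beta_square_cis: "(\<beta> k)\<^sup>2 = cis (2 * pi * (real k / 3 + 5 / 12))"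
  by (simp add: \<beta>_def power2_eq_square cis_mult algebra_simps)

lemma cis_sub_1: "\<zeta> - 1 = of_real (sqrt 3) * cis (pi * 5 / 6)"
proof -
  have "cos (pi * 5 / 6) = cos (pi - pi / 6)" "sin (pi * 5 / 6) = sin (pi - pi / 6)"
    by (rule arg_cong[of _ _ cos], simp) (rule arg_cong[of _ _ sin], simp)
  then have "cos (pi * 5 / 6) = - sqrt 3 / 2" "sin (pi * 5 / 6) = 1 / 2"
    unfolding cos_diff sin_diff by (simp_all add: cos_30 sin_30)
  then show ?thesis by (simp add: zeta_eq complex_eq_iff)
qed

lemma edge_direction: "\<zeta> ^ (k + 1) - \<zeta> ^ k = of_real (sqrt 3) * (\<beta> k)\<^sup>2"
proof -
  have "\<zeta> ^ (k + 1) - \<zeta> ^ k = \<zeta> ^ k * (\<zeta> - 1)" by (simp add: algebra_simps)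
  also have "\<dots> = of_real (sqrt 3) * (cis (2 * pi * real k / 3) * cis (pi * 5 / 6))"
    unfolding cis_sub_1 zeta_power_cis by (simp add: mult_ac)
  also have "cis (2 * pi * real k / 3) * cis (pi * 5 / 6) = (\<beta> k)\<^sup>2"
    by (simp add: cis_mult beta_square_cis algebra_simps)
  finally show ?thesis .
qed

context spin_tri
begin

abbreviation "P \<equiv> spin T"

lemma spin_principal: "principal_GLt_bundle (subtopology (surf_top (plus_atlas T)) (punctured_plus T)) P"
  by (rule spin[unfolded spin_structure_def, THEN conjunct1])

sublocale PB: principal_bundle "subtopology (surf_top (plus_atlas T)) (punctured_plus T)" P
  by unfold_locales (rule spin_principal)

lemma framing_act: "u \<in> PB.tot \<Longrightarrow> g \<in> carrier GLt \<Longrightarrow> framing P (act P u g) k = framing P u k ** p_GL g"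
  using spin[unfolded spin_structure_def, THEN conjunct2, THEN conjunct1] by simp

definition "tdom c s = {z \<in> std_triangle. tri_param T s z \<in> fst c}"
definition "J c s z = jac (snd c \<circ> tri_param T s) std_triangle z"

lemma tri_param_emb: "s \<in> triangles T \<Longrightarrow> oriented_smooth_embedding std_triangle A (tri_param T s)"
  unfolding tri_param_def by (rule tri_emb[OF _ corner(1)])

lemma tri_param_homeo:
  assumes "s \<in> triangles T"
  shows "homeomorphic_map (top_of_set std_triangle) (subtopology (surf_top A) (tri_param T s ` std_triangle)) (tri_param T s)"
  using tri_param_emb[OF assms] by (simp add: oriented_smooth_embedding_def embedding_map_def)

lemma tri_param_continuous:
  assumes "s \<in> triangles T" shows "continuous_map (top_of_set std_triangle) (surf_top A) (tri_param T s)"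
  using homeomorphic_imp_continuous_map[OF tri_param_homeo[OF assms]] continuous_map_in_subtopology by blast

lemma tri_param_inj: "s \<in> triangles T \<Longrightarrow> inj_on (tri_param T s) std_triangle"
  using homeomorphic_imp_injective_map[OF tri_param_homeo] by simp

lemma tdom_open: 
  assumes s: "s \<in> triangles T" and c: "c \<in> A" shows "openin (top_of_set std_triangle) (tdom c s)"
  using openin_continuous_map_preimage[OF tri_param_continuous[OF s] openin_chart_domain[OF c]] by (simp add: tdom_def)

lemma tri_smooth: 
  assumes s: "s \<in> triangles T" and c: "c \<in> A"
  shows "smooth_map_on (tdom c s) (snd c \<circ> tri_param T s)" "z \<in> tdom c s \<Longrightarrow> 0 < det (J c s z)"
proof -
  have e: "smooth_map_on {z \<in> std_triangle. tri_param T s z \<in> fst c} (snd c \<circ> tri_param T s) \<and>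
    (\<forall>z\<in>std_triangle. tri_param T s z \<in> fst c \<longrightarrow> 0 < det (jac (snd c \<circ> tri_param T s) std_triangle z))"
    using tri_param_emb[OF s, unfolded oriented_smooth_embedding_def, THEN conjunct2] c by (rule bspec)
  show "smooth_map_on (tdom c s) (snd c \<circ> tri_param T s)" unfolding tdom_def by (rule e[THEN conjunct1])
  show "z \<in> tdom c s \<Longrightarrow> 0 < det (J c s z)" using e[THEN conjunct2] unfolding tdom_def J_def by simp
qed

lemma J_continuous: "s \<in> triangles T \<Longrightarrow> c \<in> A \<Longrightarrow> continuous_on (tdom c s) (J c s)"
  and J_derivative: "s \<in> triangles T \<Longrightarrow> c \<in> A \<Longrightarrow> z \<in> tdom c s \<Longrightarrow>
    ((snd c \<circ> tri_param T s) has_derivative gl_lin (J c s z)) (at z within std_triangle)"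
  unfolding J_def
  by (rule smooth_jac_open[OF tri_smooth(1) tdom_open]; simp add: deriv_unique_std tdom_def)+

lemma jac_punct:
  assumes "s \<in> triangles T" "c \<in> A" "z \<in> tdom c s" "z \<in> punct"
  shows "jac (snd c \<circ> tri_param T s) punct z = J c s z"
proof (rule jac_eqI)
  show "deriv_unique punct z" using deriv_unique_punct assms(3) by (simp add: tdom_def)
  show "((snd c \<circ> tri_param T s) has_derivative gl_lin (J c s z)) (at z within punct)"
    using J_derivative[OF assms(1-3)] punct_std by (rule has_derivative_subset)
qed

lemma lift_in: "s \<in> triangles T \<Longrightarrow> z \<in> punct \<Longrightarrow> g \<in> carrier GLt \<Longrightarrow> tri_lift T s (z, g) \<in> PB.tot"
  and lift_continuous: "s \<in> triangles T \<Longrightarrow> continuous_map (prod_topology (top_of_set punct) GLt_top) (total_space P) (tri_lift T s)"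
proof -
  show c: "s \<in> triangles T \<Longrightarrow> continuous_map (prod_topology (top_of_set punct) GLt_top) (total_space P) (tri_lift T s)" for s
    unfolding punct_def by (rule trilift[unfolded spin_lift_def, THEN conjunct1])
  show "s \<in> triangles T \<Longrightarrow> z \<in> punct \<Longrightarrow> g \<in> carrier GLt \<Longrightarrow> tri_lift T s (z, g) \<in> PB.tot"
    using continuous_map_image_subset_topspace[OF c, of s] by auto
qed

lemma lift_all:
  assumes "s \<in> triangles T" "z \<in> punct" "g \<in> carrier GLt"
  shows "proj P (tri_lift T s (z, g)) = (Inl \<circ> tri_param T s) z"
    "framing P (tri_lift T s (z, g)) = push_frame (plus_atlas T) punct (Inl \<circ> tri_param T s) z (p_GL g)"
    "h \<in> carrier GLt \<Longrightarrow> tri_lift T s (z, g \<otimes>\<^bsub>GLt\<^esub> h) = act P (tri_lift T s (z, g)) h"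
proof -
  have "\<forall>z\<in>punct. \<forall>g\<in>carrier GLt. proj P (tri_lift T s (z, g)) = (Inl \<circ> tri_param T s) z \<and>
        (\<forall>h\<in>carrier GLt. tri_lift T s (z, g \<otimes>\<^bsub>GLt\<^esub> h) = act P (tri_lift T s (z, g)) h) \<and>
        framing P (tri_lift T s (z, g)) = push_frame (plus_atlas T) punct (Inl \<circ> tri_param T s) z (model_frame NS_type z g)"
    using trilift[OF assms(1)] unfolding spin_lift_def punct_def by (elim conjE)
  from bspec[OF bspec[OF this assms(2)] assms(3)]
  show "proj P (tri_lift T s (z, g)) = (Inl \<circ> tri_param T s) z"
    "framing P (tri_lift T s (z, g)) = push_frame (plus_atlas T) punct (Inl \<circ> tri_param T s) z (p_GL g)"
    "h \<in> carrier GLt \<Longrightarrow> tri_lift T s (z, g \<otimes>\<^bsub>GLt\<^esub> h) = act P (tri_lift T s (z, g)) h"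
    by simp_all
qed

lemma lift_act:
  assumes "s \<in> triangles T" "z \<in> punct" "g \<in> carrier GLt"
  shows "tri_lift T s (z, g) = act P (tri_lift T s (z, \<one>\<^bsub>GLt\<^esub>)) g"
  using lift_all(3)[OF assms(1,2) GLt.one_closed assms(3)] assms(3) by simp

lemma lift_proj: "s \<in> triangles T \<Longrightarrow> z \<in> punct \<Longrightarrow> g \<in> carrier GLt \<Longrightarrow> proj P (tri_lift T s (z, g)) = Inl (tri_param T s z)"
  using lift_all(1) by simp

lemma lift_framing:
  assumes s: "s \<in> triangles T" and z: "z \<in> punct" and g: "g \<in> carrier GLt" and c: "c \<in> A" and x: "tri_param T s z \<in> fst c - bdy"
  shows "framing P (tri_lift T s (z, g)) (pc c) = J c s z ** p_GL g"
proof -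
  have e: "snd (pc c) \<circ> (Inl \<circ> tri_param T s) = snd c \<circ> tri_param T s" by (simp add: pc_def fun_eq_iff)
  have "pc c \<in> plus_atlas T" "(Inl \<circ> tri_param T s) z \<in> fst (pc c)" using c x by (auto simp: plus_atlas_eq pc_def)
  then have "framing P (tri_lift T s (z, g)) (pc c) = jac (snd c \<circ> tri_param T s) punct z ** p_GL g"
    unfolding lift_all(2)[OF s z g] push_frame_def e by simp
  also have "z \<in> tdom c s" using z x punct_std by (auto simp: tdom_def)
  then have "jac (snd c \<circ> tri_param T s) punct z = J c s z" by (rule jac_punct[OF s c _ z])
  finally show ?thesis .
qed

lemma curve_derivative:
  assumes s: "s \<in> triangles T" and c: "c \<in> A" and t: "t \<in> {0..1}"
    and sub: "\<And>r. r \<in> {0..1} \<Longrightarrow> a + of_real r * d \<in> std_triangle" and z: "a + of_real t * d \<in> tdom c s"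
  shows "((\<lambda>r. snd c (tri_param T s (a + of_real r * d))) has_vector_derivative gl_lin (J c s (a + of_real t * d)) d) (at t within {0..1})"
proof -
  let ?z = "\<lambda>r::real. a + of_real r * d"
  have "((snd c \<circ> tri_param T s) has_derivative gl_lin (J c s (?z t))) (at (?z t) within ?z ` {0..1})"
    using J_derivative[OF s c z] by (rule has_derivative_subset) (use sub in auto)
  moreover have "(?z has_derivative (\<lambda>r. of_real r * d)) (at t within {0..1})"
    by (auto intro!: derivative_eq_intros)
  ultimately have "((\<lambda>r. (snd c \<circ> tri_param T s) (?z r)) has_derivative (\<lambda>r. gl_lin (J c s (?z t)) (of_real r * d))) (at t within {0..1})"
    using has_derivative_in_compose by blast
  then show ?thesis unfolding has_vector_derivative_def by (simp add: gl_lin_scale scaleR_conv_of_real)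
qed

text \<open>Both sides are the velocity, in the chart \<open>c\<close>, of one and the same curve on
  the surface. This relates the Jacobians of two triangles along a common edge, where they need not
  be equal.\<close>

lemma curve_derivative_eq:
  assumes s: "s \<in> triangles T" "s' \<in> triangles T" and c: "c \<in> A" and t: "t \<in> {0..1}"
    and sub: "\<And>r. r \<in> {0..1} \<Longrightarrow> a + of_real r * d \<in> std_triangle"
    and sub': "\<And>r. r \<in> {0..1} \<Longrightarrow> a' + of_real r * d' \<in> std_triangle"
    and eq: "\<And>r. r \<in> {0..1} \<Longrightarrow> tri_param T s (a + of_real r * d) = tri_param T s' (a' + of_real r * d')"
    and z: "tri_param T s (a + of_real t * d) \<in> fst c"
  shows "gl_lin (J c s (a + of_real t * d)) d = gl_lin (J c s' (a' + of_real t * d')) d'"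
proof -
  let ?f = "\<lambda>r. snd c (tri_param T s (a + of_real r * d))"
  have z1: "a + of_real t * d \<in> tdom c s" "a' + of_real t * d' \<in> tdom c s'"
    using z sub[OF t] sub'[OF t] eq[OF t] by (simp_all add: tdom_def)
  have 1: "(?f has_vector_derivative gl_lin (J c s (a + of_real t * d)) d) (at t within {0..1})"
    by (rule curve_derivative[OF s(1) c t sub z1(1)])
  have "((\<lambda>r. snd c (tri_param T s' (a' + of_real r * d'))) has_vector_derivative gl_lin (J c s' (a' + of_real t * d')) d') (at t within {0..1})"
    by (rule curve_derivative[OF s(2) c t sub' z1(2)])
  then have 2: "(?f has_vector_derivative gl_lin (J c s' (a' + of_real t * d')) d') (at t within {0..1})"
    by (rule has_vector_derivative_transform[OF t, rotated]) (simp add: eq)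
  show ?thesis
    using vector_derivative_unique_within_closed_interval[of 0 1 t ?f, OF _ _ 1[folded box_real(2)] 2[folded box_real(2)]] t
    by (simp add: box_real)
qed

lemma tri_pt_edge: "tri_pt k t 0 = \<zeta> ^ k + of_real t * (\<zeta> ^ (k + 1) - \<zeta> ^ k)"
  and tri_pt_edge_rev: "tri_pt k (1 - t) 0 = \<zeta> ^ (k + 1) + of_real t * (\<zeta> ^ k - \<zeta> ^ (k + 1))"
  by (simp_all add: tri_pt_def algebra_simps)

lemma edge_punct: "0 < t \<Longrightarrow> t < 1 \<Longrightarrow> tri_pt k t 0 \<in> punct"
  by (rule punctI[of _ k]) (auto simp: bary_tri_pt intro: tri_pt_in)

lemma edge_glue:
  assumes s: "sL \<in> triangles T" "sR \<in> triangles T" and L: "vtx sL kL = a" "nxt T sL a = b"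
    and R: "vtx sR kR = b" "nxt T sR b = a"
  shows "tri_param T sR (tri_pt kR t 0) = tri_param T sL (tri_pt kL (1 - t) 0)"
proof -
  have "tri_bary b a u t 0 = tri_bary a b w (1 - t) 0" for u w by (auto simp: tri_bary_def)
  then show ?thesis unfolding tri_param_tri_pt[OF s(1) L(1)] tri_param_tri_pt[OF s(2) R(1)] L(2) R(2) by metis
qed

text \<open>Two adjacent triangles run through the common edge in opposite directions, whence the
  minus sign. All edges of the standard triangle have length \<open>sqrt 3\<close>, so this factor
  cancels.\<close>

lemma edge_J:
  assumes s: "sL \<in> triangles T" "sR \<in> triangles T" and L: "vtx sL kL = a" "nxt T sL a = b"
    and R: "vtx sR kR = b" "nxt T sR b = a" and c: "c \<in> A" and t: "t \<in> {0..1}" and x: "tri_param T sR (tri_pt kR t 0) \<in> fst c"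
  shows "gl_lin (J c sR (tri_pt kR t 0)) ((\<beta> kR)\<^sup>2) = - gl_lin (J c sL (tri_pt kL (1 - t) 0)) ((\<beta> kL)\<^sup>2)"
proof -
  have "gl_lin (J c sR (\<zeta> ^ kR + of_real t * (\<zeta> ^ (kR + 1) - \<zeta> ^ kR))) (\<zeta> ^ (kR + 1) - \<zeta> ^ kR) =
    gl_lin (J c sL (\<zeta> ^ (kL + 1) + of_real t * (\<zeta> ^ kL - \<zeta> ^ (kL + 1)))) (\<zeta> ^ kL - \<zeta> ^ (kL + 1))"
    by (rule curve_derivative_eq[OF s(2,1) c t])
      (use x in \<open>simp_all only: tri_pt_edge[symmetric] tri_pt_edge_rev[symmetric], auto intro!: tri_pt_in edge_glue[OF s L R]\<close>)
  moreover have "\<zeta> ^ kL - \<zeta> ^ (kL + 1) = of_real (- sqrt 3) * (\<beta> kL)\<^sup>2"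
    using edge_direction[of kL] by (simp add: algebra_simps)
  ultimately have "of_real (sqrt 3) * gl_lin (J c sR (tri_pt kR t 0)) ((\<beta> kR)\<^sup>2) =
    of_real (- sqrt 3) * gl_lin (J c sL (tri_pt kL (1 - t) 0)) ((\<beta> kL)\<^sup>2)"
    unfolding tri_pt_edge[symmetric] tri_pt_edge_rev[symmetric] unfolding edge_direction
    by (simp only: gl_lin_scale)
  then have "of_real (sqrt 3) * (gl_lin (J c sR (tri_pt kR t 0)) ((\<beta> kR)\<^sup>2) + gl_lin (J c sL (tri_pt kL (1 - t) 0)) ((\<beta> kL)\<^sup>2)) = 0"
    by (simp add: algebra_simps)
  then show ?thesis by (simp add: eq_neg_iff_add_eq_0)
qed

lemma edge_not_bdy:
  assumes s: "s \<in> triangles T" and v: "v \<in> inner_vertices T" "v = vtx s k \<or> v = nxt T s (vtx s k)" and t: "0 < t" "t < 1"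
  shows "tri_param T s (tri_pt k t 0) \<notin> bdy"
  unfolding tri_param_tri_pt[OF s refl]
proof (rule inner_not_bdy[OF _ v(1)])
  show "tri_bary (vtx s k) (nxt T s (vtx s k)) (nxt T s (nxt T s (vtx s k))) t 0 \<in> realisation T"
    using t by (intro tri_bary_realisation s vtx_in) auto
  show "tri_bary (vtx s k) (nxt T s (vtx s k)) (nxt T s (nxt T s (vtx s k))) t 0 v \<noteq> 0"
    using v(2) t nxt_neq[OF s vtx_in[OF s, of k]] by (auto simp: tri_bary_def vertex_point_def)
qed

lemma chart_exists: "x \<in> surf_carrier A \<Longrightarrow> \<exists>c\<in>A. x \<in> fst c" by (auto simp: surf_carrier_def)

lemma tri_param_in: "s \<in> triangles T \<Longrightarrow> z \<in> std_triangle \<Longrightarrow> tri_param T s z \<in> surf_carrier A"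
  using continuous_map_image_subset_topspace[OF tri_param_continuous] by auto

text \<open>By comparison of framings, \<open>g\<close> maps the direction of edge \<open>kR\<close>
  to the opposite of the direction of edge \<open>kL\<close>. So \<open>spin_act g\<close> maps
  \<open>\<beta> kR\<close> to \<open>\<i> * \<beta> kL\<close> up to a sign, which is constant
  along the open edge by continuity. The remaining work is to recognise this sign in the definition
  of the edge sign.\<close>

theorem edge_sign_spin:
  assumes s: "sL \<in> triangles T" "sR \<in> triangles T" and L: "vtx sL kL = a" "nxt T sL a = b"
    and R: "vtx sR kR = b" "nxt T sR b = a" and k: "kL < 3" "kR < 3"
    and e: "e = {a, b}" "edge_start T e = a" "edge_end T e = b"
    and v: "v \<in> inner_vertices T" "v \<in> e"
  shows "edge_sign T e \<in> {1, -1}"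
    and "\<And>t g. \<lbrakk>0 < t; t < 1; g \<in> carrier GLt; tri_lift T sR (tri_pt kR t 0, \<one>\<^bsub>GLt\<^esub>) = tri_lift T sL (tri_pt kL (1 - t) 0, g)\<rbrakk>
      \<Longrightarrow> spin_act g (\<beta> kR) = of_int (edge_sign T e) * (\<i> * \<beta> kL)"
proof -
  let ?R = "\<lambda>t. tri_lift T sR (tri_pt kR t 0, \<one>\<^bsub>GLt\<^esub>)" and ?L = "\<lambda>t. tri_lift T sL (tri_pt kL (1 - t) 0, \<one>\<^bsub>GLt\<^esub>)"
  let ?I = "{0<..<1} :: real set"
  have in_L: "tri_pt kL (1 - t) 0 \<in> punct" and in_R: "tri_pt kR t 0 \<in> punct" if "t \<in> ?I" for t
    using edge_punct[of "1 - t" kL] edge_punct[of t kR] that by simp_all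
  have ptR: "continuous_on X (\<lambda>t. tri_pt kR t 0)" and ptL: "continuous_on X (\<lambda>t. tri_pt kL (1 - t) 0)" for X
    unfolding tri_pt_def by (intro continuous_intros)+
  have cont: "continuous_map (top_of_set ?I) (total_space P) (\<lambda>t. tri_lift T s (p t, \<one>\<^bsub>GLt\<^esub>))"
    if "s \<in> triangles T" "continuous_on ?I p" "\<And>t. t \<in> ?I \<Longrightarrow> p t \<in> punct" for s p
  proof -
    have "continuous_map (top_of_set ?I) (prod_topology (top_of_set punct) GLt_top) (\<lambda>t. (p t, \<one>\<^bsub>GLt\<^esub>))"
      using that by (auto simp: continuous_map_pairwise o_def continuous_map_in_subtopology)
    then show ?thesis using continuous_map_compose[OF _ lift_continuous[OF that(1)]] by (simp add: o_def)
  qed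
  have cR: "continuous_map (top_of_set ?I) (total_space P) ?R" by (rule cont[OF s(2) ptR in_R])
  have cL: "continuous_map (top_of_set ?I) (total_space P) ?L" by (rule cont[OF s(1) ptL in_L])
  have tot: "?R t \<in> PB.tot" "?L t \<in> PB.tot" and pe: "proj P (?L t) = proj P (?R t)" if "t \<in> ?I" for t
    using lift_in[OF s(2) in_R[OF that]] lift_in[OF s(1) in_L[OF that]]
      lift_proj[OF s(2) in_R[OF that]] lift_proj[OF s(1) in_L[OF that]] edge_glue[OF s L R] by auto
  define G where "G t = PB.transl (?L t) (?R t)" for t
  have G: "G t \<in> carrier GLt" "act P (?L t) (G t) = ?R t" if "t \<in> ?I" for t
    unfolding G_def using PB.transl[OF tot(2,1)[OF that] pe[OF that]] by simp_all
  have cG: "continuous_map (top_of_set ?I) GLt_top G"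
    unfolding G_def[abs_def] by (rule PB.continuous_transl[OF cL cR]) (simp add: pe)
  have sq: "(spin_act (G t) (\<beta> kR))\<^sup>2 = (\<i> * \<beta> kL)\<^sup>2" if t: "t \<in> ?I" for t
  proof -
    have "tri_param T sR (tri_pt kR t 0) \<in> surf_carrier A" using tri_param_in[OF s(2)] in_R[OF t] punct_std by blast
    then obtain c where c: "c \<in> A" "tri_param T sR (tri_pt kR t 0) \<in> fst c" using chart_exists by blast
    have nb: "tri_param T sR (tri_pt kR t 0) \<notin> bdy" 
      by (rule edge_not_bdy[OF s(2) v(1)]) (use v(2) e(1) R t in auto)
    have "framing P (?R t) (pc c) = J c sR (tri_pt kR t 0)"
      using lift_framing[OF s(2) in_R[OF t] GLt.one_closed c(1)] c(2) nb by simp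
    moreover have "framing P (?L t) (pc c) = J c sL (tri_pt kL (1 - t) 0)"
      using lift_framing[OF s(1) in_L[OF t] GLt.one_closed c(1)] c(2) nb edge_glue[OF s L R, of t] by simp
    ultimately have m: "J c sR (tri_pt kR t 0) = J c sL (tri_pt kL (1 - t) 0) ** p_GL (G t)"
      using framing_act[OF tot(2)[OF t] G(1)[OF t], of "pc c"] G(2)[OF t] by simp
    define M where "M = J c sL (tri_pt kL (1 - t) 0)"
    have "tri_pt kL (1 - t) 0 \<in> tdom c sL" using c(2) in_L[OF t] punct_std edge_glue[OF s L R, of t] by (auto simp: tdom_def)
    then have dM: "0 < det M" unfolding M_def by (rule tri_smooth(2)[OF s(1) c(1)])
    have "gl_lin (M ** p_GL (G t)) ((\<beta> kR)\<^sup>2) = - gl_lin M ((\<beta> kL)\<^sup>2)"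
      using edge_J[OF s L R c(1) _ c(2)] t unfolding m M_def by simp
    then have "gl_lin M (gl_lin (p_GL (G t)) ((\<beta> kR)\<^sup>2) + (\<beta> kL)\<^sup>2) = 0" by (simp add: gl_lin_mult gl_lin_add)
    then have "gl_lin (p_GL (G t)) ((\<beta> kR)\<^sup>2) = - (\<beta> kL)\<^sup>2"
      using gl_lin_nonzero[OF dM] by (metis add_eq_0_iff2)
    then show ?thesis using spin_act_square[OF G(1)[OF t], of "\<beta> kR"] by (simp add: power_mult_distrib)
  qed
  have "(\<forall>t\<in>?I. spin_act (G t) (\<beta> kR) = \<i> * \<beta> kL) \<or> (\<forall>t\<in>?I. spin_act (G t) (\<beta> kR) = - (\<i> * \<beta> kL))"
  proof (rule square_eq_connected)
    show "continuous_on ?I (\<lambda>t. spin_act (G t) (\<beta> kR))" using continuous_spin_act[OF cG, of "\<beta> kR"] by simp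
  qed (use sq in \<open>auto intro: continuous_intros\<close>)
  then obtain \<epsilon>0 :: int where \<epsilon>0: "\<epsilon>0 \<in> {1, -1}" "\<And>t. t \<in> ?I \<Longrightarrow> spin_act (G t) (\<beta> kR) = of_int \<epsilon>0 * (\<i> * \<beta> kL)"
  proof
    assume "\<forall>t\<in>?I. spin_act (G t) (\<beta> kR) = \<i> * \<beta> kL" then show ?thesis using that[of 1] by simp
  next
    assume "\<forall>t\<in>?I. spin_act (G t) (\<beta> kR) = - (\<i> * \<beta> kL)" then show ?thesis using that[of "-1"] by simp
  qed
  have Gu: "g = G t" if "t \<in> ?I" "g \<in> carrier GLt" "?R t = tri_lift T sL (tri_pt kL (1 - t) 0, g)" for t g
    using lift_act[OF s(1) in_L[OF that(1)] that(2)] that(3) G[OF that(1)] PB.act_injective[OF tot(2)[OF that(1)]] that(2) by metis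
  have aL: "a \<in> sL" and bR: "b \<in> sR" and aR: "a \<in> sR" and bL: "b \<in> sL"
    using vtx_in s L R nxt_in by metis+
  \<comment> \<open>The orientation of the complex makes two triangles at an edge run through it in
    opposite directions; hence at most one lies on each side.\<close>
  have THE_L: "(THE s. on_left T e s) = sL"
  proof (rule the_equality)
    show "on_left T e sL" using s L aL bL e by (simp add: on_left_def)
    fix s' assume "on_left T e s'"
    then have s': "s' \<in> triangles T" "{a, b} \<subseteq> s'" "nxt T s' a = b" using e by (auto simp: on_left_def)
    show "s' = sL"
    proof (rule ccontr)
      assume "s' \<noteq> sL"
      then have "nxt T sL (nxt T s' a) = a" using nxt_opp[OF s'(1) s(1), of a] s' aL bL by auto
      then show False using s'(3) L nxt_neq[OF s(1) aL] by metis
    qed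
  qed
  have THE_R: "(THE s. on_right T e s) = sR"
  proof (rule the_equality)
    show "on_right T e sR" using s R aR bR e by (simp add: on_right_def)
    fix s' assume "on_right T e s'"
    then have s': "s' \<in> triangles T" "{a, b} \<subseteq> s'" "nxt T s' b = a" using e by (auto simp: on_right_def)
    show "s' = sR"
    proof (rule ccontr)
      assume "s' \<noteq> sR"
      then have "nxt T sR (nxt T s' b) = b" using nxt_opp[OF s'(1) s(2), of b] s' aR bR by auto
      then show False using s'(3) R nxt_neq[OF s(2) bR] by metis
    qed
  qed
  have THE_kL: "(THE k. k < 3 \<and> d2 T k sL = e) = kL"
  proof (rule the_equality)
    show "kL < 3 \<and> d2 T kL sL = e" using k(1) L e(1) by (simp add: d2_vtx)
    fix k' assume "k' < 3 \<and> d2 T k' sL = e"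
    then have "k' < 3" "vtx sL k' = a" using d2_iff[OF s(1) aL, of k'] L(2) e(1) by simp_all
    then show "k' = kL" using vtx_inj[OF s(1) _ k(1)] L(1) by simp
  qed
  have THE_kR: "(THE k. k < 3 \<and> d2 T k sR = e) = kR"
  proof (rule the_equality)
    show "kR < 3 \<and> d2 T kR sR = e" using k(2) R e(1) by (auto simp: d2_vtx)
    fix k' assume "k' < 3 \<and> d2 T k' sR = e"
    then have "k' < 3" "vtx sR k' = b" using d2_iff[OF s(2) bR, of k'] R(2) e(1) by (simp_all add: insert_commute)
    then show "k' = kR" using vtx_inj[OF s(2) _ k(2)] R(1) by simp
  qed
  \<comment> \<open>The correction factor in the definition of the edge sign. It is the inverse of
    \<open>\<i> * \<beta> kL / \<beta> kR\<close>, the value of the rotation for sign 1.\<close>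
  define w where "w = cis (- pi * (real kL / 3 - real kR / 3 + 1 / 2))"
  have bw: "\<i> * \<beta> kL / \<beta> kR * w = 1"
  proof -
    have i: "\<i> = cis (pi / 2)" by (simp add: cis_pi_half)
    show ?thesis unfolding i \<beta>_def w_def cis_mult cis_divide
      by (rule trans[OF arg_cong[of _ 0 cis]]) (simp_all add: field_simps)
  qed
  have Qeq: "Qt_at (cis (2 * pi * (real kR / 3 + 5 / 12))) (G t) \<otimes>\<^bsub>GLt\<^esub> \<delta> w = \<delta> (of_int \<epsilon>0)" if "t \<in> ?I" for t
  proof -
    have n: "cmod (of_int \<epsilon>0 * (\<i> * \<beta> kL)) = 1" using \<epsilon>0(1) by (auto simp: norm_mult)
    have "Qt_at ((\<beta> kR)\<^sup>2) (G t) = \<delta> (sgn (spin_act (G t) (\<beta> kR)) / \<beta> kR)" by (rule Qt_at_eq[OF G(1)[OF that]]) simp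
    also have "\<dots> = \<delta> (of_int \<epsilon>0 * (\<i> * \<beta> kL) / \<beta> kR)" using \<epsilon>0(2)[OF that] n by (simp add: sgn_div_norm)
    finally have "Qt_at (cis (2 * pi * (real kR / 3 + 5 / 12))) (G t) \<otimes>\<^bsub>GLt\<^esub> \<delta> w = \<delta> (of_int \<epsilon>0 * (\<i> * \<beta> kL) / \<beta> kR * w)"
      unfolding beta_square_cis using \<epsilon>0(1) by (subst delta_mult[symmetric]) (auto simp: w_def)
    also have "of_int \<epsilon>0 * (\<i> * \<beta> kL) / \<beta> kR * w = of_int \<epsilon>0 * (\<i> * \<beta> kL / \<beta> kR * w)" by simp
    finally show ?thesis unfolding bw by simp
  qed
  have es: "edge_sign T e = \<epsilon>0"
    unfolding edge_sign_def THE_L THE_R THE_kL THE_kR Let_def w_def[symmetric] punct_def[symmetric]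
  proof (rule the_equality)
    show "\<epsilon>0 \<in> {1, -1} \<and> (\<forall>p\<in>open_segment (\<zeta> ^ kR) (\<zeta> ^ Suc kR). \<forall>p'\<in>punct. \<forall>g\<in>carrier GLt.
        tri_lift T sR (p, \<one>\<^bsub>GLt\<^esub>) = tri_lift T sL (p', g) \<longrightarrow>
        \<delta> (of_int \<epsilon>0) = Qt_at (cis (2 * pi * (real kR / 3 + 5 / 12))) g \<otimes>\<^bsub>GLt\<^esub> \<delta> w)"
    proof (intro conjI ballI impI \<epsilon>0(1))
      fix p p' g assume p: "p \<in> open_segment (\<zeta> ^ kR) (\<zeta> ^ Suc kR)" and p': "p' \<in> punct" and g: "g \<in> carrier GLt"
        and eq: "tri_lift T sR (p, \<one>\<^bsub>GLt\<^esub>) = tri_lift T sL (p', g)"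
      obtain t where t: "t \<in> ?I" "p = tri_pt kR t 0"
        using p unfolding in_segment tri_pt_edge by (auto simp: scaleR_conv_of_real algebra_simps)
      have "tri_param T sL p' = tri_param T sL (tri_pt kL (1 - t) 0)"
        using lift_proj[OF s(2) in_R[OF t(1)] GLt.one_closed] lift_proj[OF s(1) p' g] eq t(2) edge_glue[OF s L R, of t] by simp
      then have "p' = tri_pt kL (1 - t) 0"
        using tri_param_inj[OF s(1)] p' in_L[OF t(1)] punct_std by (meson inj_onD subsetD)
      then have "g = G t" using Gu[OF t(1) g] eq t(2) by simp
      then show "\<delta> (of_int \<epsilon>0) = Qt_at (cis (2 * pi * (real kR / 3 + 5 / 12))) g \<otimes>\<^bsub>GLt\<^esub> \<delta> w" using Qeq[OF t(1)] by simp
    qed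
    fix \<epsilon> :: int
    assume \<epsilon>: "\<epsilon> \<in> {1, -1} \<and> (\<forall>p\<in>open_segment (\<zeta> ^ kR) (\<zeta> ^ Suc kR). \<forall>p'\<in>punct. \<forall>g\<in>carrier GLt.
        tri_lift T sR (p, \<one>\<^bsub>GLt\<^esub>) = tri_lift T sL (p', g) \<longrightarrow>
        \<delta> (of_int \<epsilon>) = Qt_at (cis (2 * pi * (real kR / 3 + 5 / 12))) g \<otimes>\<^bsub>GLt\<^esub> \<delta> w)"
    \<comment> \<open>The defining condition quantifies over all points of the edge; it determines
      the sign since it has an instance, here the midpoint.\<close>
    have h: "1/2 \<in> ?I" by simp
    have "\<zeta> ^ (kR + 1) - \<zeta> ^ kR \<noteq> 0" unfolding edge_direction by simp
    then have "\<zeta> ^ kR \<noteq> \<zeta> ^ Suc kR" by (metis Suc_eq_plus1 right_minus_eq)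
    then have os: "tri_pt kR (1/2) 0 \<in> open_segment (\<zeta> ^ kR) (\<zeta> ^ Suc kR)"
      unfolding in_segment tri_pt_edge by (intro conjI exI[of _ "1/2"]) (auto simp: scaleR_conv_of_real algebra_simps)
    have eq: "?R (1/2) = tri_lift T sL (tri_pt kL (1 - 1/2) 0, G (1/2))"
      using lift_act[OF s(1) in_L[OF h] G(1)[OF h]] G(2)[OF h] by simp
    have "\<delta> (of_int \<epsilon>) = \<delta> (of_int \<epsilon>0)"
      unfolding Qeq[OF h, symmetric]
      by (rule \<epsilon>[THEN conjunct2, THEN bspec, THEN bspec, THEN bspec, THEN mp, OF os in_L[OF h] G(1)[OF h] eq])
    then have "complex_of_int \<epsilon> = of_int \<epsilon>0" using \<epsilon> \<epsilon>0(1) by (intro delta_inj) auto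
    then show "\<epsilon> = \<epsilon>0" by simp
  qed
  show "edge_sign T e \<in> {1, -1}" using es \<epsilon>0(1) by simp
  show "spin_act g (\<beta> kR) = of_int (edge_sign T e) * (\<i> * \<beta> kL)"
    if "0 < t" "t < 1" "g \<in> carrier GLt" "tri_lift T sR (tri_pt kR t 0, \<one>\<^bsub>GLt\<^esub>) = tri_lift T sL (tri_pt kL (1 - t) 0, g)" for t g
    using Gu[of t g] \<epsilon>0(2)[of t] that es by simp
qed

end

subsection \<open>The star of an inner vertex\<close>

text \<open>The edge before edge \<open>k\<close> arrives at the corner that edge \<open>k\<close>
  leaves. Reversing it gives the direction of edge \<open>k\<close> turned counterclockwise by pi /
  3, the angle of the triangle, and \<open>cis (pi / 6)\<close> is the corresponding turn of roots.
  For \<open>k = 0\<close> the predecessor wraps around to 2, where \<beta> shows its change of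
  sign; this is the origin of the number D.\<close>

lemma i_beta_pred:
  assumes "k < 3"
  shows "\<i> * \<beta> ((k + 2) mod 3) = (if k = 0 then -1 else 1) * (\<beta> k * cis (pi / 6))"
proof -
  have k: "k = 0 \<or> k = 1 \<or> k = 2" using assms by auto
  have i: "\<i> = cis (pi / 2)" by (simp add: cis_pi_half)
  have m: "(-1::complex) = cis pi" by simp
  have 0: "\<i> * \<beta> 2 = -1 * (\<beta> 0 * cis (pi / 6))"
    unfolding i m \<beta>_def cis_mult by (rule arg_cong[of _ _ cis]) (simp add: field_simps)
  have 1: "\<i> * \<beta> 0 = \<beta> 1 * cis (pi / 6)"
    unfolding i \<beta>_def cis_mult by (rule arg_cong[of _ _ cis]) (simp add: field_simps)
  have 2: "\<i> * \<beta> 1 = \<beta> 2 * cis (pi / 6)"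
    unfolding i \<beta>_def cis_mult by (rule arg_cong[of _ _ cis]) (simp add: field_simps)
  have m: "(0 + 2) mod 3 = (2 :: nat)" "(1 + 2) mod 3 = (0 :: nat)" "(2 + 2) mod 3 = (1 :: nat)" by simp_all
  from k show ?thesis
  proof (elim disjE)
    assume "k = 0" then show ?thesis by (simp only: m 0) simp
  next
    assume "k = 1" then show ?thesis by (simp only: m 1) simp
  next
    assume "k = 2" then show ?thesis by (simp only: m 2) simp
  qed
qed

lemma tri_pt_mod: "tri_pt (k mod 3) s t = tri_pt k s t"
proof -
  have "\<zeta> ^ (k mod 3) = \<zeta> ^ k" for k
  proof -
    have "\<zeta> ^ k = \<zeta> ^ (3 * (k div 3) + k mod 3)" by simp
    also have "\<dots> = \<zeta> ^ (k mod 3)" unfolding power_add power_mult zeta_cube by simp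
    finally show ?thesis ..
  qed
  then show ?thesis unfolding tri_pt_def power_add by simp
qed

lemma tri_pt_cycle: "tri_pt ((k + 2) mod 3) (1 - t) 0 = tri_pt k 0 t"
proof -
  have e: "\<zeta> ^ (k + 2 + 1) = \<zeta> ^ k" using zeta_mod[of k] by (simp add: eval_nat_numeral)
  have "x + of_real (1 - t) * (y - x) + of_real 0 * z = y + of_real 0 * w + of_real t * (x - y)" for x y z w :: complex
    by (simp add: algebra_simps)
  then show ?thesis unfolding tri_pt_mod unfolding tri_pt_def e .
qed

lemma tri_pt_0: "tri_pt k 0 0 = \<zeta> ^ k" by (simp add: tri_pt_def)

locale spin_star = spin_tri T for T :: "('a, 'v, 'p) spin_surface" +
  fixes v :: 'v and \<sigma> :: "nat \<Rightarrow> 'v set" and N :: nat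
  assumes v: "v \<in> inner_vertices T" and star: "ccw_star T v \<sigma> N"
begin

text \<open>The star is continued periodically to all natural numbers, which avoids a case
  distinction at the last triangle. The edge between \<open>\<tau> i\<close> and
  \<open>\<tau> (Suc i)\<close> then joins \<open>v\<close> and \<open>n (Suc i)\<close>.\<close>

definition "\<tau> i = \<sigma> (i mod N)"
definition "n i = nxt T (\<tau> i) v"
definition "\<kappa> i = (THE k. k < 3 \<and> vtx (\<tau> i) k = v)"

lemma sbij: "bij_betw \<sigma> {..<N} {s \<in> triangles T. v \<in> s}"
  and sstep: "i < N \<Longrightarrow> nxt T (\<sigma> (Suc i mod N)) v = nxt T (\<sigma> i) (nxt T (\<sigma> i) v)"
  using star by (simp_all add: ccw_star_def)

lemma N_pos: "0 < N"
proof -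
  have "v \<in> vertices T" using v by (simp add: inner_vertices_def)
  then obtain s where "s \<in> simplices T" "v \<in> s" by (auto simp: vertices_def)
  then obtain t where "t \<in> triangles T" "v \<in> t" using simplex_triangle by blast
  then have "t \<in> \<sigma> ` {..<N}" using sbij by (simp add: bij_betw_def)
  then show ?thesis by auto
qed

lemma tau: "\<tau> i \<in> triangles T" "v \<in> \<tau> i"
proof -
  have "i mod N \<in> {..<N}" using N_pos by simp
  then have "\<sigma> (i mod N) \<in> {s \<in> triangles T. v \<in> s}" by (rule bij_betwE[OF sbij, rule_format])
  then show "\<tau> i \<in> triangles T" "v \<in> \<tau> i" by (simp_all add: \<tau>_def)
qed

lemma tau_eq_iff: "\<tau> i = \<tau> j \<longleftrightarrow> i mod N = j mod N"
  using inj_on_eq_iff[OF bij_betw_imp_inj_on[OF sbij], of "i mod N" "j mod N"] N_pos by (simp add: \<tau>_def)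

lemma tau_surj: assumes "s \<in> triangles T" "v \<in> s" obtains i where "i < N" "\<tau> i = s"
proof -
  have "s \<in> \<sigma> ` {..<N}" using assms sbij by (simp add: bij_betw_def)
  then obtain i where "i < N" "\<sigma> i = s" by auto
  then show ?thesis using that[of i] by (simp add: \<tau>_def)
qed

lemma per: "\<tau> (i + N) = \<tau> i" "n (i + N) = n i" "\<kappa> (i + N) = \<kappa> i"
  by (simp_all add: \<tau>_def n_def \<kappa>_def)

lemma n_Suc: "n (Suc i) = nxt T (\<tau> i) (n i)"
  using sstep[of "i mod N"] N_pos by (simp add: n_def \<tau>_def mod_Suc_eq)

lemma kappa: "\<kappa> i < 3" "vtx (\<tau> i) (\<kappa> i) = v"
proof -
  obtain k where k: "k < 3" "vtx (\<tau> i) k = v" using vtx_exists[OF tau] .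
  have "\<exists>!k. k < 3 \<and> vtx (\<tau> i) k = v" using k vtx_inj[OF tau(1)] by blast
  from theI'[OF this] show "\<kappa> i < 3" "vtx (\<tau> i) (\<kappa> i) = v" unfolding \<kappa>_def by blast+
qed

lemma mem_tau: "w \<in> \<tau> i \<longleftrightarrow> w = v \<or> w = n i \<or> w = n (Suc i)"
  using mem_tri[OF tau] by (simp add: n_Suc n_def[of i])

lemma n_neq: "n i \<noteq> v" "n (Suc i) \<noteq> v" "n (Suc i) \<noteq> n i"
  using nxt_neq[OF tau, of i] by (simp_all add: n_Suc n_def[of i])

lemma nxt_n_Suc: "nxt T (\<tau> i) (n (Suc i)) = v"
  using nxt3[OF tau, of i] by (simp add: n_Suc n_def[of i])

text \<open>Two different triangles would run through the edge from \<open>v\<close> to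
  \<open>n i\<close> in the same direction, contrary to the orientation of the complex.\<close>

lemma n_inj: assumes "n i = n j" shows "\<tau> i = \<tau> j"
proof (rule ccontr)
  assume ne: "\<tau> i \<noteq> \<tau> j"
  have "{v, nxt T (\<tau> i) v} \<subseteq> \<tau> j" using mem_tau[of _ j] assms by (simp add: n_def[symmetric])
  from nxt_opp[OF tau(1) tau(1) tau(2) ne this] have "nxt T (\<tau> j) (n i) = v" by (simp add: n_def)
  then have "n (Suc j) = v" using assms by (simp add: n_Suc)
  then show False using n_neq by simp
qed

lemma tau_Suc_neq: "\<tau> (Suc i) \<noteq> \<tau> i"
proof
  assume "\<tau> (Suc i) = \<tau> i"
  then have "n (Suc i) = n i" by (simp add: n_def)
  then show False using n_neq by simp
qed

text \<open>Otherwise two consecutive triangles would have the same three vertices, and in a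
  simplicial complex they would be equal. This excludes a star of two triangles, in which the common
  edge would not be determined by the triangles.\<close>

lemma n_neq2: "n i \<noteq> n (Suc (Suc i))"
proof
  assume e: "n i = n (Suc (Suc i))"
  have "w \<in> \<tau> i \<longleftrightarrow> w \<in> \<tau> (Suc i)" for w unfolding mem_tau using e by auto
  then show False using tau_Suc_neq[of i] by blast
qed

lemma edge_eq: "\<tau> i \<inter> \<tau> (Suc i) = {v, n (Suc i)}"
  using n_neq2[of i] by (auto simp: mem_tau)

text \<open>In \<open>\<tau> i\<close> a vertex other than \<open>v\<close> is \<open>n i\<close> or
  \<open>n (Suc i)\<close>, and equal values of \<open>n\<close> belong to equal triangles. So
  outside \<open>v\<close> only consecutive triangles of the star meet, and only there do local
  sections have to be compared.\<close>

lemma shared: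
  assumes "i < N" "j < N" "i \<noteq> j" "w \<in> \<tau> i" "w \<in> \<tau> j" "w \<noteq> v"
  obtains "j = Suc i mod N" "w = n (Suc i)" | "i = Suc j mod N" "w = n (Suc j)"
proof -
  have t: "\<tau> a = \<tau> b \<Longrightarrow> a < N \<Longrightarrow> b < N \<Longrightarrow> a = b" for a b by (simp add: tau_eq_iff)
  have tS: "\<tau> (Suc a) = \<tau> b \<Longrightarrow> b < N \<Longrightarrow> b = Suc a mod N" for a b by (simp add: tau_eq_iff)
  have "w = n i \<or> w = n (Suc i)" "w = n j \<or> w = n (Suc j)" using assms mem_tau by blast+
  then consider "n i = n j" | "n i = n (Suc j)" "w = n (Suc j)" | "n (Suc i) = n j" "w = n (Suc i)" | "n (Suc i) = n (Suc j)" by metis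
  then show ?thesis
  proof cases
    case 1 then show ?thesis using n_inj t assms by blast
  next
    case 2 then show ?thesis using n_inj[of "Suc j" i] tS[of j i] assms that by simp
  next
    case 3 then show ?thesis using n_inj[of "Suc i" j] tS[of i j] assms that by simp
  next
    case 4
    then have "Suc i mod N = Suc j mod N" using n_inj tau_eq_iff by blast
    then have "i = j" using assms(1,2) by (auto simp: mod_Suc split: if_splits)
    then show ?thesis using assms by simp
  qed
qed

definition "Y i s t = tri_bary v (n i) (n (Suc i)) s t"

lemma tri_param_Y: "tri_param T (\<tau> i) (tri_pt (\<kappa> i) s t) = homeo T (Y i s t)"
  using tri_param_tri_pt[OF tau(1) kappa(2)] by (simp add: Y_def n_Suc n_def[of i])

lemma Y_realisation: "0 \<le> s \<Longrightarrow> 0 \<le> t \<Longrightarrow> s + t \<le> 1 \<Longrightarrow> Y i s t \<in> realisation T"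
  using tri_bary_realisation[OF tau] by (simp add: Y_def n_Suc n_def[of i])

lemma Y_vals: "Y i s t v = 1 - s - t" "Y i s t (n i) = s" "Y i s t (n (Suc i)) = t"
  "w \<notin> \<tau> i \<Longrightarrow> Y i s t w = 0"
  using n_neq[of i] by (auto simp: Y_def tri_bary_def vertex_point_def mem_tau)

lemma Y_edge: "Y i 0 t = Y (Suc i) t 0"
  by (auto simp: Y_def tri_bary_def)

lemma Y_0: "Y i 0 0 = vertex_point v"
  by (auto simp: Y_def tri_bary_def)

text \<open>Positive weight at \<open>v\<close> forces the triangle that contains the support of
  \<open>y\<close> to belong to the star.\<close>

lemma realisation_Y:
  assumes y: "y \<in> realisation T" "0 < y v"
  obtains i where "i < N" "y = Y i (y (n i)) (y (n (Suc i)))" "0 \<le> y (n i)" "0 \<le> y (n (Suc i))" "y v + y (n i) + y (n (Suc i)) = 1"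
proof -
  have supp: "{w. y w \<noteq> 0} \<in> simplices T" and s1: "sum y {w. y w \<noteq> 0} = 1" and nn: "\<And>w. 0 \<le> y w"
    using y by (auto simp: realisation_def)
  obtain s where s: "s \<in> triangles T" "{w. y w \<noteq> 0} \<subseteq> s" using simplex_triangle[OF supp] by blast
  have "v \<in> s" using y(2) s(2) by auto
  then obtain i where i: "i < N" "\<tau> i = s" using tau_surj[OF s(1)] by blast
  have seq: "s = {v, n i, n (Suc i)}" using i(2) mem_tau[of _ i] by blast
  have z: "y w = 0" if "w \<noteq> v" "w \<noteq> n i" "w \<noteq> n (Suc i)" for w using s(2) that unfolding seq by blast
  have fs: "finite s" by (simp add: seq)
  have "sum y {w. y w \<noteq> 0} = sum y s" by (rule sum.mono_neutral_left[OF fs s(2)]) auto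
  then have s1': "sum y {v, n i, n (Suc i)} = 1" using s1 by (simp only: seq)
  have "sum y {v, n i, n (Suc i)} = y v + (y (n i) + y (n (Suc i)))"
    using n_neq[of i] by (subst sum.insert; auto)
  then have S: "y v + y (n i) + y (n (Suc i)) = 1" using s1' by linarith
  have "y w = Y i (y (n i)) (y (n (Suc i))) w" for w
    using n_neq[of i] z[of w] S by (auto simp: Y_def tri_bary_def vertex_point_def)
  then show ?thesis using that i(1) S nn by blast
qed

section \<open>Corners and sectors of the triangles at the inner vertex\<close>

definition "p0 i = \<zeta> ^ \<kappa> i"

lemma p0_std: "p0 i \<in> std_triangle"
  using tri_pt_in[of 0 0 "\<kappa> i"] by (simp add: p0_def tri_pt_0)

definition "xv = homeo T (vertex_point v)"

lemma vertex_realisation: "vertex_point v \<in> realisation T"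
  using Y_realisation[of 0 0 0] by (simp add: Y_0)

lemma tri_param_p0: "tri_param T (\<tau> i) (p0 i) = xv"
  using tri_param_Y[of i 0 0] by (simp add: Y_0 xv_def p0_def tri_pt_0)

lemma xv_not_bdy: "xv \<notin> bdy"
  unfolding xv_def by (rule inner_not_bdy[OF vertex_realisation v]) (simp add: vertex_point_def)

lemma xv_in: "xv \<in> surf_carrier A"
  unfolding xv_def by (rule homeo_in[OF vertex_realisation])

lemma std_Y:
  assumes "z \<in> std_triangle"
  shows "tri_param T (\<tau> i) z = homeo T (Y i (bary (\<kappa> i + 1) z) (bary (\<kappa> i + 2) z))"
  using tri_param_Y[of i "bary (\<kappa> i + 1) z" "bary (\<kappa> i + 2) z"] by (simp only: tri_pt_bary)

lemma std_not_bdy: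
  assumes z: "z \<in> std_triangle" "0 < bary (\<kappa> i) z" shows "tri_param T (\<tau> i) z \<notin> bdy"
proof -
  have b: "0 \<le> bary (\<kappa> i + 1) z" "0 \<le> bary (\<kappa> i + 2) z" using z(1) std_triangle_eq[of z "\<kappa> i"] by simp_all
  have s: "bary (\<kappa> i) z + bary (\<kappa> i + 1) z + bary (\<kappa> i + 2) z = 1" by (rule bary_sum')
  show ?thesis unfolding std_Y[OF z(1)]
  proof (rule inner_not_bdy[OF Y_realisation v])
    show "Y i (bary (\<kappa> i + 1) z) (bary (\<kappa> i + 2) z) v \<noteq> 0" using s z(2) by (simp only: Y_vals)
  qed (use b s z(2) in linarith)+
qed

text \<open>The part of the standard triangle cut off at the corner of \<open>v\<close> by a
  parallel to the opposite edge. The corner belongs to it, so that Jacobians and their lifts can be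
  evaluated at \<open>v\<close>.\<close>

definition "sec i \<eta> = {z \<in> std_triangle. 1 - \<eta> < bary (\<kappa> i) z}"

lemma convex_sec: "convex (sec i \<eta>)"
proof -
  have "convex std_triangle" by (simp add: std_triangle_def convex_convex_hull)
  moreover have "convex {z. 1 - \<eta> < bary (\<kappa> i) z}"
    unfolding convex_def
  proof (intro ballI allI impI, unfold mem_Collect_eq)
    fix x y :: complex and a b :: real
    assume h: "1 - \<eta> < bary (\<kappa> i) x" "1 - \<eta> < bary (\<kappa> i) y" "0 \<le> a" "0 \<le> b" "a + b = 1"
    have "a * - bary (\<kappa> i) x + b * - bary (\<kappa> i) y < \<eta> - 1" by (rule convex_bound_lt) (use h in auto)
    then show "1 - \<eta> < bary (\<kappa> i) (a *\<^sub>R x + b *\<^sub>R y)" unfolding bary_convex[OF h(5)] by linarith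
  qed
  ultimately have "convex (std_triangle \<inter> {z. 1 - \<eta> < bary (\<kappa> i) z})" by (rule convex_Int)
  then show ?thesis by (simp add: sec_def Int_def)
qed

lemma sec_tri_pt: "0 \<le> s \<Longrightarrow> 0 \<le> t \<Longrightarrow> s + t < \<eta> \<Longrightarrow> \<eta> \<le> 1 \<Longrightarrow> tri_pt (\<kappa> i) s t \<in> sec i \<eta>"
  using bary_tri_pt[of "\<kappa> i" s t] tri_pt_in[of s t "\<kappa> i"] by (simp add: sec_def)

lemma p0_sec: "0 < \<eta> \<Longrightarrow> p0 i \<in> sec i \<eta>"
  using bary_tri_pt(1)[of "\<kappa> i" 0 0] p0_std[of i] by (simp add: sec_def p0_def tri_pt_0)

lemma std_nonneg: "z \<in> std_triangle \<Longrightarrow> 0 \<le> bary k z"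
  using std_triangle_eq[of z k] by simp

lemma sec_p0: assumes "z \<in> std_triangle" "bary (\<kappa> i) z = 1" shows "z = p0 i"
proof -
  have "bary (\<kappa> i + 1) z = 0 \<and> bary (\<kappa> i + 2) z = 0"
    using bary_sum'[of "\<kappa> i" z] std_nonneg[OF assms(1), of "\<kappa> i + 1"] std_nonneg[OF assms(1), of "\<kappa> i + 2"] assms(2)
    by (intro conjI) linarith+
  then show ?thesis using tri_pt_bary[of "\<kappa> i" z] by (simp only: tri_pt_0 p0_def)
qed

lemma sec_bary_le: "z \<in> std_triangle \<Longrightarrow> bary (\<kappa> i) z \<le> 1"
  using bary_sum'[of "\<kappa> i" z] std_nonneg[of z "\<kappa> i + 1"] std_nonneg[of z "\<kappa> i + 2"] by linarith

lemma sec_punct: assumes "z \<in> sec i \<eta> - {p0 i}" "\<eta> \<le> 1" shows "z \<in> punct"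
proof (rule punctI[of _ "\<kappa> i"])
  show z: "z \<in> std_triangle" using assms(1) by (simp add: sec_def)
  show "0 < bary (\<kappa> i) z" using assms by (auto simp: sec_def)
  show "bary (\<kappa> i) z < 1" using sec_bary_le[OF z, of i] sec_p0[OF z, of i] assms(1) by fastforce
qed

text \<open>The corner is the only point of the triangle with barycentric coordinate 1, so removing
  it is the same as intersecting with an open half plane. Convexity supplies the connectedness on
  which signs are constant.\<close>

lemma convex_sec_punct: assumes "0 < \<eta>" shows "convex (sec i \<eta> - {p0 i})"
proof -
  have e: "sec i \<eta> - {p0 i} = sec i \<eta> \<inter> {z. bary (\<kappa> i) z < 1}"
  proof (intro equalityI subsetI)
    fix z assume z: "z \<in> sec i \<eta> - {p0 i}"
    then have zs: "z \<in> std_triangle" by (simp add: sec_def)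
    show "z \<in> sec i \<eta> \<inter> {z. bary (\<kappa> i) z < 1}" using sec_bary_le[OF zs, of i] sec_p0[OF zs, of i] z by fastforce
  next
    fix z assume z: "z \<in> sec i \<eta> \<inter> {z. bary (\<kappa> i) z < 1}"
    then show "z \<in> sec i \<eta> - {p0 i}" using bary_tri_pt(1)[of "\<kappa> i" 0 0] by (auto simp: p0_def tri_pt_0)
  qed
  have "convex {z. bary (\<kappa> i) z < 1}" unfolding convex_def
  proof (intro ballI allI impI, unfold mem_Collect_eq)
    fix x y :: complex and a b :: real
    assume h: "bary (\<kappa> i) x < 1" "bary (\<kappa> i) y < 1" "0 \<le> a" "0 \<le> b" "a + b = 1"
    then show "bary (\<kappa> i) (a *\<^sub>R x + b *\<^sub>R y) < 1" unfolding bary_convex[OF h(5)] by (rule convex_bound_lt)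
  qed
  then show ?thesis unfolding e using convex_sec by (rule convex_Int[rotated])
qed

text \<open>The difference to the corner is a combination of two edge vectors of length at most 2,
  with coefficients that add up to \<open>1 - bary (\<kappa> i) z\<close>. The constant 4 leaves
  room to spare.\<close>

lemma dist_p0: assumes "z \<in> std_triangle" shows "dist z (p0 i) \<le> 4 * (1 - bary (\<kappa> i) z)"
proof -
  define s t where "s = bary (\<kappa> i + 1) z" "t = bary (\<kappa> i + 2) z"
  have st: "0 \<le> s" "0 \<le> t" "s + t = 1 - bary (\<kappa> i) z"
    using bary_sum'[of "\<kappa> i" z] std_nonneg[OF assms] unfolding s_t_def by (blast, blast, linarith)
  have c: "cmod (\<zeta> ^ j - \<zeta> ^ k) \<le> 2" for j k
    using norm_triangle_ineq4[of "\<zeta> ^ j" "\<zeta> ^ k"] by (simp add: \<zeta>_def norm_power)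
  have "z - p0 i = of_real s * (\<zeta> ^ (\<kappa> i + 1) - \<zeta> ^ \<kappa> i) + of_real t * (\<zeta> ^ (\<kappa> i + 2) - \<zeta> ^ \<kappa> i)"
    using tri_pt_bary[of "\<kappa> i" z] unfolding s_t_def tri_pt_def p0_def by (simp add: algebra_simps)
  then have "dist z (p0 i) \<le> cmod (of_real s * (\<zeta> ^ (\<kappa> i + 1) - \<zeta> ^ \<kappa> i)) + cmod (of_real t * (\<zeta> ^ (\<kappa> i + 2) - \<zeta> ^ \<kappa> i))"
    unfolding dist_norm by (metis norm_triangle_ineq)
  also have "\<dots> \<le> s * 2 + t * 2"
    unfolding norm_mult norm_of_real using st by (intro add_mono mult_mono c) auto
  also have "\<dots> \<le> 4 * (1 - bary (\<kappa> i) z)" unfolding st(3)[symmetric] using st(1,2) by (simp add: algebra_simps)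
  finally show ?thesis .
qed

text \<open>Continuity at the corner gives a radius for each triangle; the minimum over the finitely
  many triangles of the star works for all indices by periodicity. The bound 1/2 keeps the sectors
  away from the opposite edges and hence from the boundary and the other vertices.\<close>

lemma good_radius:
  assumes W: "openin (surf_top A) W" "xv \<in> W"
  obtains \<eta> where "0 < \<eta>" "\<eta> \<le> 1/2" "\<And>i z. z \<in> sec i \<eta> \<Longrightarrow> tri_param T (\<tau> i) z \<in> W"
proof -
  have "\<exists>r>0. \<forall>z\<in>std_triangle. dist z (p0 i) < r \<longrightarrow> tri_param T (\<tau> i) z \<in> W" for i
  proof -
    have "openin (top_of_set std_triangle) {z \<in> topspace (top_of_set std_triangle). tri_param T (\<tau> i) z \<in> W}"
      by (rule openin_continuous_map_preimage[OF tri_param_continuous[OF tau(1)] W(1)])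
    then have "openin (top_of_set std_triangle) {z \<in> std_triangle. tri_param T (\<tau> i) z \<in> W}" by simp
    moreover have "p0 i \<in> {z \<in> std_triangle. tri_param T (\<tau> i) z \<in> W}" using p0_std W(2) by (simp add: tri_param_p0)
    ultimately obtain r where "0 < r" "ball (p0 i) r \<inter> std_triangle \<subseteq> {z \<in> std_triangle. tri_param T (\<tau> i) z \<in> W}"
      by (meson openin_contains_ball)
    then show ?thesis by (intro exI[of _ r]) (auto simp: dist_commute)
  qed
  then obtain r where r: "\<And>i. 0 < r i" "\<And>i z. z \<in> std_triangle \<Longrightarrow> dist z (p0 i) < r i \<Longrightarrow> tri_param T (\<tau> i) z \<in> W" by metis
  define \<eta> where "\<eta> = Min (insert (1/2) ((\<lambda>i. r i / 4) ` {..<N}))"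
  have \<eta>: "\<eta> \<le> 1/2" "\<And>i. i < N \<Longrightarrow> \<eta> \<le> r i / 4" unfolding \<eta>_def by (intro Min_le; simp)+
  have "0 < \<eta>" unfolding \<eta>_def using r(1) by (subst Min_gr_iff) auto
  moreover have "tri_param T (\<tau> i) z \<in> W" if z: "z \<in> sec i \<eta>" for i z
  proof -
    define j where "j = i mod N"
    have j: "j < N" "\<tau> j = \<tau> i" "\<kappa> j = \<kappa> i" using N_pos by (simp_all add: j_def \<tau>_def \<kappa>_def)
    have "z \<in> std_triangle" "1 - bary (\<kappa> j) z < \<eta>" using z j(3) by (simp_all add: sec_def)
    then have "4 * (1 - bary (\<kappa> j) z) < 4 * \<eta>" by simp
    moreover have "4 * \<eta> \<le> r j" using \<eta>(2)[OF j(1)] by simp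
    ultimately have "dist z (p0 j) < r j"
      using order.strict_trans1[OF dist_p0[OF \<open>z \<in> std_triangle\<close>, of j]] order.strict_trans2 by blast
    then show ?thesis using r(2)[of z j] \<open>z \<in> std_triangle\<close> j(2) by simp
  qed
  ultimately show ?thesis using that \<eta>(1) by blast
qed

end

subsection \<open>Lifts of the Jacobians around an inner vertex\<close>

lemma beta_pred_square:
  assumes "k < 3" shows "- (\<beta> ((k + 2) mod 3))\<^sup>2 = (\<beta> k * cis (pi / 6))\<^sup>2"
proof -
  have "(\<i> * \<beta> ((k + 2) mod 3))\<^sup>2 = (\<beta> k * cis (pi / 6))\<^sup>2"
    unfolding i_beta_pred[OF assms] by (simp add: power_mult_distrib)
  then show ?thesis by (simp add: power_mult_distrib)
qed

lemma edge_direction':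
  assumes "k < 3" shows "\<zeta> ^ (k + 2) - \<zeta> ^ k = of_real (sqrt 3) * (\<beta> k * cis (pi / 6))\<^sup>2"
proof -
  have "tri_pt ((k + 2) mod 3) 0 0 = tri_pt k 0 1" "tri_pt ((k + 2) mod 3) 1 0 = tri_pt k 0 0"
    using tri_pt_cycle[of k 1] tri_pt_cycle[of k 0] by simp_all
  then have "\<zeta> ^ (k + 2) = \<zeta> ^ ((k + 2) mod 3)" "\<zeta> ^ k = \<zeta> ^ ((k + 2) mod 3 + 1)"
    by (simp_all add: tri_pt_def)
  then have "\<zeta> ^ (k + 2) - \<zeta> ^ k = - (\<zeta> ^ ((k + 2) mod 3 + 1) - \<zeta> ^ ((k + 2) mod 3))" by simp
  also have "\<dots> = of_real (sqrt 3) * (- (\<beta> ((k + 2) mod 3))\<^sup>2)" unfolding edge_direction by simp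
  finally show ?thesis unfolding beta_pred_square[OF assms] .
qed

lemma spin_act_one: "b \<noteq> 0 \<Longrightarrow> spin_act \<one>\<^bsub>GLt\<^esub> b = b"
  using spin_act_delta[of 1 b] by (simp add: delta_1)

lemma spin_act_sign:
  "h \<in> carrier GLt \<Longrightarrow> b \<noteq> 0 \<Longrightarrow> \<epsilon> \<in> {1, -1 :: int} \<Longrightarrow> spin_act h (of_int \<epsilon> * b) = of_int \<epsilon> * spin_act h b"
  by (auto simp: spin_act_minus)

lemma bary_derivative:
  assumes "(\<gamma> has_vector_derivative d) (at r)"
  shows "((\<lambda>r. bary j (\<gamma> r)) has_real_derivative 2 * Re (d * cnj (\<zeta> ^ j)) / 3) (at r)"
proof -
  define F where "F r = Re (\<gamma> r * cnj (\<zeta> ^ j))" for r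
  define D where "D = Re (d * cnj (\<zeta> ^ j))"
  have "((\<lambda>r. \<gamma> r * cnj (\<zeta> ^ j)) has_vector_derivative d * cnj (\<zeta> ^ j)) (at r)"
    by (rule has_vector_derivative_mult_left[OF assms])
  then have "(F has_real_derivative D) (at r)"
    unfolding has_real_derivative_iff_has_vector_derivative F_def[abs_def] D_def
    by (rule bounded_linear.has_vector_derivative[OF bounded_linear_Re])
  then have "((\<lambda>r. (1 + 2 * F r) / 3) has_real_derivative 2 * D / 3) (at r)"
    by (auto intro!: derivative_eq_intros)
  then show ?thesis unfolding bary_def F_def D_def .
qed

text \<open>A barycentric coordinate is affine, so its derivative along a velocity is the difference
  of its values at \<open>tri_pt k p q\<close> and at the corner.\<close>

lemma bary_derivative_cone:
  assumes "(\<gamma> has_vector_derivative of_real p * (\<zeta> ^ (k + 1) - \<zeta> ^ k) + of_real q * (\<zeta> ^ (k + 2) - \<zeta> ^ k)) (at r)"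
  shows "((\<lambda>r. bary (k + 1) (\<gamma> r)) has_real_derivative p) (at r)" "((\<lambda>r. bary (k + 2) (\<gamma> r)) has_real_derivative q) (at r)"
proof -
  have d: "of_real p * (\<zeta> ^ (k + 1) - \<zeta> ^ k) + of_real q * (\<zeta> ^ (k + 2) - \<zeta> ^ k) = tri_pt k p q - tri_pt k 0 0"
    unfolding tri_pt_def by simp
  have "2 * Re ((x - y) * cnj w) / 3 = (1 + 2 * Re (x * cnj w)) / 3 - (1 + 2 * Re (y * cnj w)) / 3" for x y w
    by (simp add: field_simps)
  then have e: "2 * Re ((tri_pt k p q - tri_pt k 0 0) * cnj (\<zeta> ^ j)) / 3 = bary j (tri_pt k p q) - bary j (tri_pt k 0 0)" for j
    unfolding bary_def .
  show "((\<lambda>r. bary (k + 1) (\<gamma> r)) has_real_derivative p) (at r)" "((\<lambda>r. bary (k + 2) (\<gamma> r)) has_real_derivative q) (at r)"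
    using bary_derivative[OF assms, of "k + 1"] bary_derivative[OF assms, of "k + 2"] unfolding d e bary_tri_pt by simp_all
qed

text \<open>The auxiliary choices: a chart at \<open>v\<close>, a size of the sectors and lifts of
  the Jacobians on them. By \<open>H_per\<close> one returns to the same lift after a full turn,
  which gives the product of the transition signs its meaning as a holonomy.\<close>

locale spin_star_lift = spin_star T v \<sigma> N
  for T :: "('a, 'v, 'p) spin_surface" and v \<sigma> N +
  fixes c :: "'a chart" and \<eta> :: real and H :: "nat \<Rightarrow> complex \<Rightarrow> gl"
  assumes c: "c \<in> A" "xv \<in> fst c" and eta: "0 < \<eta>" "\<eta> \<le> 1/2"
    and sec_chart: "\<And>i z. z \<in> sec i \<eta> \<Longrightarrow> tri_param T (\<tau> i) z \<in> fst c"
    and H_cont: "\<And>i. continuous_map (top_of_set (sec i \<eta>)) GLt_top (H i)"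
    and H_fst: "\<And>i z. z \<in> sec i \<eta> \<Longrightarrow> fst (H i z) = J c (\<tau> i) z"
    and H_per: "\<And>i. H (i + N) = H i"
begin

abbreviation "pt i \<equiv> tri_pt (\<kappa> i)"

definition "wsgn i = (if edge_start T {v, n (Suc i)} = v then -1 else 1) * (if \<kappa> i = 0 then -1 else 1) * edge_sign T {v, n (Suc i)}"

lemma ed_edge: "{v, n (Suc i)} \<in> edges T"
proof -
  have "\<tau> i \<in> simplices T" using tau by (simp add: triangles_def)
  then have "{v, n (Suc i)} \<in> simplices T" by (rule subsimplex) (auto simp: mem_tau)
  then show ?thesis using n_neq[of i] by (simp add: edges_def card_insert_if)
qed

lemma ed_orient: "(edge_start T {v, n (Suc i)} = v \<and> edge_end T {v, n (Suc i)} = n (Suc i)) \<or>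
  (edge_start T {v, n (Suc i)} = n (Suc i) \<and> edge_end T {v, n (Suc i)} = v)"
proof -
  have "{v, n (Suc i)} = {edge_start T {v, n (Suc i)}, edge_end T {v, n (Suc i)}}"
    using mts ed_edge by (simp add: marked_triangulated_surface_def)
  then show ?thesis by (metis doubleton_eq_iff)
qed

text \<open>The index of the edge of \<open>\<tau> i\<close> that arrives at \<open>v\<close>. It is
  reduced modulo 3 because the edge sign uses the representative below 3 and \<beta> does not have
  period 3.\<close>

definition "\<kappa>' i = (\<kappa> i + 2) mod 3"

lemma kappa': "\<kappa>' i < 3" "vtx (\<tau> i) (\<kappa>' i) = n (Suc i)"
proof -
  have "vtx (\<tau> i) (\<kappa> i + 2) = n (Suc i)"
    using kappa(2)[of i] by (simp add: vtx_Suc n_Suc n_def[of i] numeral_2_eq_2)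
  moreover have "vtx (\<tau> i) (\<kappa>' i) = vtx (\<tau> i) (\<kappa> i + 2)"
  proof -
    have "\<kappa> i = 0 \<or> \<kappa> i = 1 \<or> \<kappa> i = 2" using kappa(1)[of i] by auto
    then show ?thesis
    proof (elim disjE)
      assume "\<kappa> i = 0" then show ?thesis by (simp add: \<kappa>'_def)
    next
      assume "\<kappa> i = 1"
      then have "\<kappa>' i = 0" "\<kappa> i + 2 = 0 + 3" by (simp_all add: \<kappa>'_def)
      then show ?thesis by (simp only: vtx_mod[OF tau(1)])
    next
      assume "\<kappa> i = 2"
      then have "\<kappa>' i = 1" "\<kappa> i + 2 = 1 + 3" by (simp_all add: \<kappa>'_def)
      then show ?thesis by (simp only: vtx_mod[OF tau(1)])
    qed
  qed
  ultimately show "vtx (\<tau> i) (\<kappa>' i) = n (Suc i)" by simp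
qed (simp add: \<kappa>'_def)

lemma pt_cycle: "tri_pt (\<kappa>' i) (1 - t) 0 = pt i 0 t"
  unfolding \<kappa>'_def by (rule tri_pt_cycle)

lemma Suc_vtx: "vtx (\<tau> (Suc i)) (\<kappa> (Suc i)) = v" "nxt T (\<tau> (Suc i)) v = n (Suc i)"
  using kappa[of "Suc i"] by (simp_all add: n_def)

text \<open>If the edge points towards \<open>v\<close>, then \<open>\<tau> i\<close> is on its
  left, and \<open>edge_sign_spin\<close> applies directly; \<open>i_beta_pred\<close> rewrites the
  result and brings in the sign for \<open>\<kappa> i = 0\<close>. If the edge points away from
  \<open>v\<close>, the two triangles exchange their roles and the theorem speaks about the inverse
  of \<open>g\<close>. Solving for \<open>g\<close> turns the factor \<i> into its inverse
  \<open>- \<i>\<close>, and this extra sign is the origin of the number K.\<close>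

lemma edge_sign_cases: "edge_sign T {v, n (Suc i)} \<in> {1, -1}"
  and key_edge: "\<lbrakk>0 < t; t < 1; g \<in> carrier GLt;
      tri_lift T (\<tau> (Suc i)) (pt (Suc i) t 0, \<one>\<^bsub>GLt\<^esub>) = tri_lift T (\<tau> i) (pt i 0 t, g)\<rbrakk>
    \<Longrightarrow> spin_act g (\<beta> (\<kappa> (Suc i))) = of_int (wsgn i) * (\<beta> (\<kappa> i) * cis (pi / 6))"
proof -
  let ?e = "{v, n (Suc i)}" let ?s = "edge_sign T ?e"
  let ?\<kappa>s = "if \<kappa> i = 0 then -1 else 1 :: complex"
  have ib: "\<i> * \<beta> (\<kappa>' i) = ?\<kappa>s * (\<beta> (\<kappa> i) * cis (pi / 6))" unfolding \<kappa>'_def by (rule i_beta_pred[OF kappa(1)])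
  have K: "?s \<in> {1, -1} \<and> (\<forall>t g. 0 < t \<longrightarrow> t < 1 \<longrightarrow> g \<in> carrier GLt \<longrightarrow>
      tri_lift T (\<tau> (Suc i)) (pt (Suc i) t 0, \<one>\<^bsub>GLt\<^esub>) = tri_lift T (\<tau> i) (pt i 0 t, g) \<longrightarrow>
      spin_act g (\<beta> (\<kappa> (Suc i))) = of_int (wsgn i) * (\<beta> (\<kappa> i) * cis (pi / 6)))"
  proof (cases "edge_start T ?e = v")
    case False
    then have o: "edge_start T ?e = n (Suc i)" "edge_end T ?e = v" using ed_orient[of i] by auto
    have vi: "v \<in> ?e" by simp
    have ee: "?e = {n (Suc i), v}" by blast
    note E = edge_sign_spin[OF tau(1) tau(1) kappa'(2) nxt_n_Suc Suc_vtx kappa'(1) kappa(1) ee o v vi]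
    show ?thesis
    proof (intro conjI allI impI)
      show "?s \<in> {1, -1}" by (rule E(1))
      fix t g assume h: "0 < t" "t < 1" "g \<in> carrier GLt"
        "tri_lift T (\<tau> (Suc i)) (pt (Suc i) t 0, \<one>\<^bsub>GLt\<^esub>) = tri_lift T (\<tau> i) (pt i 0 t, g)"
      have "spin_act g (\<beta> (\<kappa> (Suc i))) = of_int ?s * (\<i> * \<beta> (\<kappa>' i))"
        by (rule E(2)[OF h(1-3)]) (simp only: pt_cycle h(4))
      then show "spin_act g (\<beta> (\<kappa> (Suc i))) = of_int (wsgn i) * (\<beta> (\<kappa> i) * cis (pi / 6))"
        unfolding ib wsgn_def using False by simp
    qed
  next
    case True
    then have o: "edge_start T ?e = v" "edge_end T ?e = n (Suc i)" using ed_orient[of i] n_neq[of i] by auto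
    have vi: "v \<in> ?e" by simp
    note E = edge_sign_spin[OF tau(1) tau(1) Suc_vtx kappa'(2) nxt_n_Suc kappa(1) kappa'(1) refl o v vi]
    show ?thesis
    proof (intro conjI allI impI)
      show s: "?s \<in> {1, -1}" by (rule E(1))
      fix t g assume h: "0 < t" "t < 1" "g \<in> carrier GLt"
        "tri_lift T (\<tau> (Suc i)) (pt (Suc i) t 0, \<one>\<^bsub>GLt\<^esub>) = tri_lift T (\<tau> i) (pt i 0 t, g)"
      have p: "pt (Suc i) t 0 \<in> punct" by (rule edge_punct[OF h(1,2)])
      have p': "pt i 0 t \<in> punct" unfolding pt_cycle[symmetric] by (rule edge_punct) (use h in auto)
      have ig: "inv\<^bsub>GLt\<^esub> g \<in> carrier GLt" using h(3) by simp
      have "tri_lift T (\<tau> i) (pt i 0 t, \<one>\<^bsub>GLt\<^esub>) = act P (tri_lift T (\<tau> i) (pt i 0 t, g)) (inv\<^bsub>GLt\<^esub> g)"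
        using PB.act_inv[OF lift_in[OF tau(1) p' GLt.one_closed] h(3)] lift_act[OF tau(1) p' h(3)] by simp
      also have "\<dots> = tri_lift T (\<tau> (Suc i)) (pt (Suc i) t 0, inv\<^bsub>GLt\<^esub> g)"
        unfolding h(4)[symmetric] by (rule lift_act[OF tau(1) p ig, symmetric])
      finally have "spin_act (inv\<^bsub>GLt\<^esub> g) (\<beta> (\<kappa>' i)) = of_int ?s * (\<i> * \<beta> (\<kappa> (Suc i)))"
        using E(2)[of "1 - t" "inv\<^bsub>GLt\<^esub> g"] h(1,2) ig by (simp add: pt_cycle)
      then have "\<beta> (\<kappa>' i) = spin_act g (of_int ?s * (\<i> * \<beta> (\<kappa> (Suc i))))"
        using spin_act_mult[OF h(3) ig, of "\<beta> (\<kappa>' i)"] h(3) by (simp add: spin_act_one)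
      also have "\<dots> = of_int ?s * (\<i> * spin_act g (\<beta> (\<kappa> (Suc i))))"
        using s h(3) by (simp add: spin_act_sign spin_act_i)
      finally have bk: "\<beta> (\<kappa>' i) = of_int ?s * (\<i> * spin_act g (\<beta> (\<kappa> (Suc i))))" .
      have "\<i> * \<beta> (\<kappa>' i) = of_int ?s * (\<i> * (\<i> * spin_act g (\<beta> (\<kappa> (Suc i)))))"
        unfolding bk by (rule mult.left_commute)
      then have "\<i> * \<beta> (\<kappa>' i) = - of_int ?s * spin_act g (\<beta> (\<kappa> (Suc i)))" by simp
      then have "spin_act g (\<beta> (\<kappa> (Suc i))) = - of_int ?s * (\<i> * \<beta> (\<kappa>' i))"
        using s by (elim insertE emptyE) simp_all
      then show "spin_act g (\<beta> (\<kappa> (Suc i))) = of_int (wsgn i) * (\<beta> (\<kappa> i) * cis (pi / 6))"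
        unfolding ib wsgn_def using True by simp
    qed
  qed
  show "?s \<in> {1, -1}" by (rule K[THEN conjunct1])
  show "\<lbrakk>0 < t; t < 1; g \<in> carrier GLt;
      tri_lift T (\<tau> (Suc i)) (pt (Suc i) t 0, \<one>\<^bsub>GLt\<^esub>) = tri_lift T (\<tau> i) (pt i 0 t, g)\<rbrakk>
    \<Longrightarrow> spin_act g (\<beta> (\<kappa> (Suc i))) = of_int (wsgn i) * (\<beta> (\<kappa> i) * cis (pi / 6))"
    by (rule K[THEN conjunct2, rule_format])
qed

lemma wsgn_cases: "wsgn i \<in> {1, -1}" using edge_sign_cases[of i] by (auto simp: wsgn_def)

lemma H_in: "z \<in> sec i \<eta> \<Longrightarrow> H i z \<in> carrier GLt"
  using continuous_map_GLt_in[OF H_cont] by simp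

lemma pt_sec: "0 \<le> t \<Longrightarrow> t < \<eta> \<Longrightarrow> pt i t 0 \<in> sec i \<eta>" "0 \<le> t \<Longrightarrow> t < \<eta> \<Longrightarrow> pt i 0 t \<in> sec i \<eta>"
  using eta by (auto intro: sec_tri_pt)

lemma J_edge:
  assumes t: "0 \<le> t" "t < \<eta>"
  shows "gl_lin (J c (\<tau> (Suc i)) (pt (Suc i) t 0)) ((\<beta> (\<kappa> (Suc i)))\<^sup>2) =
    gl_lin (J c (\<tau> i) (pt i 0 t)) ((\<beta> (\<kappa> i) * cis (pi / 6))\<^sup>2)"
proof -
  have t1: "t \<in> {0..1}" using t eta by simp
  have "gl_lin (J c (\<tau> (Suc i)) (pt (Suc i) t 0)) ((\<beta> (\<kappa> (Suc i)))\<^sup>2) =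
    - gl_lin (J c (\<tau> i) (tri_pt (\<kappa>' i) (1 - t) 0)) ((\<beta> (\<kappa>' i))\<^sup>2)"
    by (rule edge_J[OF tau(1) tau(1) kappa'(2) nxt_n_Suc Suc_vtx c(1) t1 sec_chart[OF pt_sec(1)[OF t]]])
  then show ?thesis unfolding pt_cycle gl_lin_minus[symmetric] unfolding \<kappa>'_def beta_pred_square[OF kappa(1)] .
qed

text \<open>With \<open>hL\<close> below, two square roots of one vector: the image in the chart of
  the direction from \<open>v\<close> to \<open>n (Suc i)\<close>. Here it is computed in
  \<open>\<tau> (Suc i)\<close>, where the edge leaves \<open>v\<close>; in \<open>hL\<close> it is
  computed in \<open>\<tau> i\<close>, as the first edge turned by the angle of the
  triangle.\<close>

definition "hR i t = spin_act (H (Suc i) (pt (Suc i) t 0)) (\<beta> (\<kappa> (Suc i)))"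
definition "hL i t = spin_act (H i (pt i 0 t)) (\<beta> (\<kappa> i) * cis (pi / 6))"
definition "\<rho> i = (if \<forall>t\<in>{0..<\<eta>}. hR i t = hL i t then 1 else -1 :: int)"

lemma rho_cases: "\<rho> i \<in> {1, -1}" by (simp add: \<rho>_def)

text \<open>By \<open>J_edge\<close> both sides are roots of the same nonzero vector, and the
  interval is connected. It includes 0, the vertex itself, where the lifts of the Jacobians exist
  although the spin bundle does not.\<close>

lemma rho: assumes "0 \<le> t" "t < \<eta>" shows "hR i t = of_int (\<rho> i) * hL i t"
proof -
  have cc: "continuous_on {0..<\<eta>} (\<lambda>t. spin_act (H j (p t)) b)"
    if "continuous_on {0..<\<eta>} p" "\<And>t. t \<in> {0..<\<eta>} \<Longrightarrow> p t \<in> sec j \<eta>" "b \<noteq> 0" for j p b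
  proof -
    have "continuous_map (top_of_set {0..<\<eta>}) (top_of_set (sec j \<eta>)) p" using that(1,2) by auto
    from continuous_spin_act[OF continuous_map_compose[OF this H_cont] that(3)] show ?thesis by simp
  qed
  have "(\<forall>t\<in>{0..<\<eta>}. hR i t = hL i t) \<or> (\<forall>t\<in>{0..<\<eta>}. hR i t = - hL i t)"
  proof (rule square_eq_connected)
    show "continuous_on {0..<\<eta>} (hR i)" unfolding hR_def[abs_def]
      by (rule cc) (auto simp: tri_pt_def intro!: continuous_intros, use pt_sec in \<open>auto simp: tri_pt_def\<close>)
    show "continuous_on {0..<\<eta>} (hL i)" unfolding hL_def[abs_def]
      by (rule cc) (auto simp: tri_pt_def intro!: continuous_intros, use pt_sec in \<open>auto simp: tri_pt_def\<close>)
    fix t assume "t \<in> {0..<\<eta>}"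
    then have t: "0 \<le> t" "t < \<eta>" by simp_all
    show "(hR i t)\<^sup>2 = (hL i t)\<^sup>2" unfolding hR_def hL_def
      using J_edge[OF t] by (simp add: spin_act_square H_in pt_sec t H_fst)
    show "hL i t \<noteq> 0" unfolding hL_def by (rule spin_act_nonzero) (simp_all add: H_in pt_sec t)
  qed simp
  then show ?thesis using assms by (auto simp: \<rho>_def)
qed

section \<open>The tangent cones of the triangles at the inner vertex\<close>

definition "z0 = snd c xv"

text \<open>The ray is straight in the chart and not in the triangle, because only then can the rays
  of two different triangles coincide as point sets.\<close>

definition "in_cone i d r \<longleftrightarrow> (\<exists>s t. 0 < s \<and> 0 < t \<and> s + t < 1 \<and> homeo T (Y i s t) \<in> fst c \<and>
  snd c (homeo T (Y i s t)) = z0 + of_real r * gl_lin (J c (\<tau> i) (p0 i)) d)"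

text \<open>The parametrisation of the triangle extends across the corner to a C1 map with a local
  inverse. Pulled back by this inverse, the ray becomes a curve that leaves the corner with velocity
  \<open>of_real p\<close> times one edge vector plus \<open>of_real q\<close> times the other. Its
  barycentric coordinates at the two other corners have the positive derivatives \<open>p\<close>
  and \<open>q\<close>, so it enters the open triangle at once.\<close>

lemma cone_hit:
  assumes pq: "0 < p" "0 < q"
  shows "\<exists>r0>0. \<forall>r. 0 < r \<and> r < r0 \<longrightarrow>
    in_cone i (of_real p * (\<zeta> ^ (\<kappa> i + 1) - \<zeta> ^ \<kappa> i) + of_real q * (\<zeta> ^ (\<kappa> i + 2) - \<zeta> ^ \<kappa> i)) r"
proof -
  let ?k = "\<kappa> i" let ?f = "snd c \<circ> tri_param T (\<tau> i)"
  define d where "d = of_real p * (\<zeta> ^ (?k + 1) - \<zeta> ^ ?k) + of_real q * (\<zeta> ^ (?k + 2) - \<zeta> ^ ?k)"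
  define w where "w = gl_lin (J c (\<tau> i) (p0 i)) d"
  have p0D: "p0 i \<in> tdom c (\<tau> i)" using p0_std c(2) by (simp add: tdom_def tri_param_p0)
  obtain D0 where D0: "open D0" "tdom c (\<tau> i) = std_triangle \<inter> D0"
    using tdom_open[OF tau(1) c(1), of i] by (auto simp: openin_open)
  obtain W g G where W: "p0 i \<in> W" "C1_on W g G" "\<And>y. y \<in> tdom c (\<tau> i) \<inter> W \<Longrightarrow> g y = ?f y"
    by (rule smooth_C1[OF tri_smooth(1)[OF tau(1) c(1)] p0D]) (rule that; assumption)
  define W' where "W' = W \<inter> D0"
  have W': "p0 i \<in> W'" "C1_on W' g G" "\<And>y. y \<in> std_triangle \<inter> W' \<Longrightarrow> g y = ?f y"
    using W D0 p0D C1_on_subset[OF W(2), of W'] by (auto simp: W'_def C1_on_def)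
  have G0: "G (p0 i) = J c (\<tau> i) (p0 i)"
    unfolding J_def by (rule C1_jac_eq[OF W'(2,1) p0_std W'(3) deriv_unique_std[OF p0_std], symmetric])
  have dG: "0 < det (G (p0 i))" unfolding G0 by (rule tri_smooth(2)[OF tau(1) c(1) p0D])
  have g0: "g (p0 i) = z0" using W'(3)[of "p0 i"] W'(1) p0_std by (simp add: tri_param_p0 z0_def)
  obtain U V h where U: "open U" "p0 i \<in> U" "U \<subseteq> W'" "open V" "g (p0 i) \<in> V" "homeomorphism U V g h"
    and hC: "C1_on V h (\<lambda>y. minv (G (h y)))"
    by (rule C1_inverse[OF W'(2,1) dG]) blast
  define \<gamma> where "\<gamma> r = h (z0 + of_real r * w)" for r :: real
  have h0: "h z0 = p0 i" using U g0 by (auto simp: homeomorphism_def)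
  have \<gamma>0: "\<gamma> 0 = p0 i" by (simp add: \<gamma>_def h0)
  have "(h has_derivative gl_lin (minv (G (p0 i)))) (at z0)"
    using hC U(5) g0 h0 unfolding C1_on_def by metis
  then have hd: "(h has_derivative gl_lin (minv (G (p0 i)))) (at (z0 + of_real 0 * w))" by simp
  have "((\<lambda>r::real. z0 + of_real r * w) has_vector_derivative w) (at 0)"
    by (auto intro!: derivative_eq_intros)
  then have "((\<lambda>r::real. z0 + of_real r * w) has_derivative (\<lambda>r. r *\<^sub>R w)) (at 0)" by (simp add: has_vector_derivative_def)
  from has_derivative_compose[OF this hd]
  have "(\<gamma> has_derivative (\<lambda>r. gl_lin (minv (G (p0 i))) (r *\<^sub>R w))) (at 0)" by (simp add: \<gamma>_def[abs_def])
  moreover have "gl_lin (minv (G (p0 i))) w = d"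
    unfolding w_def G0[symmetric] gl_lin_mult[symmetric] using minv(1)[of "G (p0 i)"] dG by simp
  ultimately have "(\<gamma> has_vector_derivative d) (at 0)"
    by (simp add: has_vector_derivative_def scaleR_conv_of_real gl_lin_scale)
  note bd = bary_derivative_cone[OF this[unfolded d_def]]
  have b0: "bary (?k + 1) (\<gamma> 0) = 0" "bary (?k + 2) (\<gamma> 0) = 0" "bary ?k (\<gamma> 0) = 1"
    using bary_tri_pt[of ?k 0 0] unfolding \<gamma>0 p0_def tri_pt_0 by simp_all
  obtain r1 where r1: "0 < r1" "\<And>r. 0 < r \<Longrightarrow> r < r1 \<Longrightarrow> 0 < bary (?k + 1) (\<gamma> r)"
    using DERIV_pos_inc_right[OF bd(1) pq(1)] b0(1) by auto
  obtain r2 where r2: "0 < r2" "\<And>r. 0 < r \<Longrightarrow> r < r2 \<Longrightarrow> 0 < bary (?k + 2) (\<gamma> r)"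
    using DERIV_pos_inc_right[OF bd(2) pq(2)] b0(2) by auto
  define Q where "Q = V \<inter> h -` {z. 0 < bary ?k z}"
  have "continuous_on V h" using hC by (rule C1_on_continuous)
  then have oQ: "open Q" unfolding Q_def
    by (rule continuous_open_preimage[OF _ U(4)]) (intro open_Collect_less continuous_intros)
  have "open ((\<lambda>r::real. z0 + of_real r * w) -` Q)" by (rule open_vimage[OF oQ]) (intro continuous_intros)
  moreover have "0 \<in> (\<lambda>r::real. z0 + of_real r * w) -` Q" using U(5) g0 h0 b0(3) \<gamma>0 by (simp add: Q_def)
  ultimately obtain r3 where r3: "0 < r3" "ball 0 r3 \<subseteq> (\<lambda>r::real. z0 + of_real r * w) -` Q" using open_contains_ball by metis
  show ?thesis unfolding d_def[symmetric]
  proof (intro exI[of _ "min r1 (min r2 r3)"] conjI allI impI)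
    show "0 < min r1 (min r2 r3)" using r1 r2 r3 by simp
    fix r assume r: "0 < r \<and> r < min r1 (min r2 r3)"
    define s t where "s = bary (?k + 1) (\<gamma> r)" "t = bary (?k + 2) (\<gamma> r)"
    have "r \<in> ball 0 r3" using r by simp
    then have q: "z0 + of_real r * w \<in> V" "0 < bary ?k (\<gamma> r)" using r3(2) by (auto simp: Q_def \<gamma>_def)
    have st: "0 < s" "0 < t" "s + t < 1"
      using r r1 r2 q(2) bary_sum'[of ?k "\<gamma> r"] unfolding s_t_def by auto
    have \<gamma>std: "\<gamma> r \<in> std_triangle" using std_triangle_eq[of "\<gamma> r" ?k] q(2) st s_t_def by simp
    have \<gamma>U: "\<gamma> r \<in> U" "g (\<gamma> r) = z0 + of_real r * w" using U(6) q(1) unfolding \<gamma>_def homeomorphism_def by auto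
    have x: "tri_param T (\<tau> i) (\<gamma> r) = homeo T (Y i s t)" using std_Y[OF \<gamma>std] by (simp only: s_t_def)
    have "\<gamma> r \<in> tdom c (\<tau> i)" using \<gamma>U(1) U(3) \<gamma>std D0(2) by (auto simp: W'_def)
    then have "homeo T (Y i s t) \<in> fst c" using x by (simp add: tdom_def)
    moreover have "snd c (homeo T (Y i s t)) = z0 + of_real r * w"
      using W'(3)[of "\<gamma> r"] \<gamma>U U(3) \<gamma>std x by auto
    ultimately show "in_cone i d r" unfolding in_cone_def w_def[symmetric] using st by blast
  qed
qed

text \<open>A common direction would produce, close to \<open>v\<close>, one point of the chart in
  the interiors of both triangles. Injectivity of the chart and of \<open>homeo T\<close> identifies
  its barycentric coordinates, and their support is the vertex set of the triangle.\<close>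

lemma cones_disjoint:
  assumes ij: "i < N" "j < N" and pq: "0 < p" "0 < q" "0 < p'" "0 < q'"
    and eq: "gl_lin (J c (\<tau> i) (p0 i)) (of_real p * (\<zeta> ^ (\<kappa> i + 1) - \<zeta> ^ \<kappa> i) + of_real q * (\<zeta> ^ (\<kappa> i + 2) - \<zeta> ^ \<kappa> i)) =
      gl_lin (J c (\<tau> j) (p0 j)) (of_real p' * (\<zeta> ^ (\<kappa> j + 1) - \<zeta> ^ \<kappa> j) + of_real q' * (\<zeta> ^ (\<kappa> j + 2) - \<zeta> ^ \<kappa> j))"
  shows "i = j"
proof -
  define d where "d = of_real p * (\<zeta> ^ (\<kappa> i + 1) - \<zeta> ^ \<kappa> i) + of_real q * (\<zeta> ^ (\<kappa> i + 2) - \<zeta> ^ \<kappa> i)"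
  define d' where "d' = of_real p' * (\<zeta> ^ (\<kappa> j + 1) - \<zeta> ^ \<kappa> j) + of_real q' * (\<zeta> ^ (\<kappa> j + 2) - \<zeta> ^ \<kappa> j)"
  obtain r1 where r1: "0 < r1" "\<And>r. 0 < r \<Longrightarrow> r < r1 \<Longrightarrow> in_cone i d r"
    using cone_hit[OF pq(1,2), of i] unfolding d_def[symmetric] by blast
  obtain r2 where r2: "0 < r2" "\<And>r. 0 < r \<Longrightarrow> r < r2 \<Longrightarrow> in_cone j d' r"
    using cone_hit[OF pq(3,4), of j] unfolding d'_def[symmetric] by blast
  define r where "r = min r1 r2 / 2"
  have r: "0 < r" "r < r1" "r < r2" using r1(1) r2(1) by (auto simp: r_def)
  obtain s t where st: "0 < s" "0 < t" "s + t < 1" "homeo T (Y i s t) \<in> fst c"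
    and e1: "snd c (homeo T (Y i s t)) = z0 + of_real r * gl_lin (J c (\<tau> i) (p0 i)) d"
    using r1(2)[OF r(1,2)] unfolding in_cone_def by blast
  obtain s' t' where st': "0 < s'" "0 < t'" "s' + t' < 1" "homeo T (Y j s' t') \<in> fst c"
    and e2: "snd c (homeo T (Y j s' t')) = z0 + of_real r * gl_lin (J c (\<tau> j) (p0 j)) d'"
    using r2(2)[OF r(1,3)] unfolding in_cone_def by blast
  have "snd c (homeo T (Y i s t)) = snd c (homeo T (Y j s' t'))" unfolding e1 e2 using eq unfolding d_def d'_def by simp
  then have "homeo T (Y i s t) = homeo T (Y j s' t')" using inj_chart[OF c(1)] st(4) st'(4) by (auto dest: inj_onD)
  then have Yeq: "Y i s t = Y j s' t'"
    by (rule inj_onD[OF homeo_inj]) (use st st' in \<open>auto intro: Y_realisation\<close>)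
  have supp: "w \<in> \<tau> i \<longleftrightarrow> Y i s t w \<noteq> 0" if "0 < s" "0 < t" "s + t < 1" for i s t w
  proof (cases "w \<in> \<tau> i")
    case True
    then have "w = v \<or> w = n i \<or> w = n (Suc i)" by (simp add: mem_tau)
    then show ?thesis using True that by (elim disjE) (simp_all add: Y_vals)
  qed (simp add: Y_vals)
  have "w \<in> \<tau> i \<longleftrightarrow> w \<in> \<tau> j" for w
    unfolding supp[of s t w i, OF st(1-3)] supp[of s' t' w j, OF st'(1-3)] Yeq ..
  then have "\<tau> i = \<tau> j" by (simp add: set_eq_iff)
  then show ?thesis using ij by (simp add: tau_eq_iff)
qed

text \<open>At \<open>v\<close> the images of the edge directions are vectors \<open>a i\<close> in
  one plane, with chosen roots \<open>b i\<close>. Crossing \<open>\<tau> i\<close> multiplies the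
  root by \<open>y i\<close>, the principal root of \<open>a (Suc i) / a i\<close>, and passing to
  the next lift multiplies it by \<open>\<rho> i\<close>. After a full turn one is back at
  \<open>b 0\<close>, so the product of all \<open>\<rho> i * y i\<close> is 1, while the product of
  the \<open>y i\<close> is -1 by \<open>cyclic_cones\<close>.\<close>

lemma prod_rho: "(\<Prod>i<N. \<rho> i) = -1"
proof -
  define b where "b i = spin_act (H i (p0 i)) (\<beta> (\<kappa> i))" for i
  define y where "y i = hL i 0 / b i" for i
  have p0: "pt i 0 0 = p0 i" for i by (simp add: tri_pt_0 p0_def)
  have Hp: "H i (p0 i) \<in> carrier GLt" and Hf: "fst (H i (p0 i)) = J c (\<tau> i) (p0 i)" for i
    using H_in H_fst p0_sec[OF eta(1)] by blast+
  have b0: "b i \<noteq> 0" for i unfolding b_def by (rule spin_act_nonzero[OF Hp]) simp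
  \<comment> \<open>The angle \<open>pi / 3\<close> is that of the standard triangle at its corner;
    its half \<open>pi / 6\<close> appears in \<open>hL\<close>.\<close>
  have y: "0 < Re (y i)" "0 < Im (y i)" for i
    using spin_act_rotate[OF Hp[of i] norm_beta, of "pi / 3" "\<kappa> i"] by (simp_all add: y_def b_def hL_def p0)
  have bS: "b (Suc i) = of_int (\<rho> i) * y i * b i" for i
    using rho[of 0 i] eta(1) b0[of i] by (simp add: y_def b_def hR_def p0)
  have r2: "(of_int (\<rho> i) :: complex)\<^sup>2 = 1" for i using rho_cases[of i] by auto
  define a where "a i = (b i)\<^sup>2" for i
  have aS: "a (Suc i) / a i = (y i)\<^sup>2" for i
    unfolding a_def bS using b0[of i] by (simp add: power_mult_distrib r2)
  have a1: "a i = gl_lin (J c (\<tau> i) (p0 i)) ((\<beta> (\<kappa> i))\<^sup>2)" for i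
    unfolding a_def b_def by (simp add: spin_act_square Hp Hf)
  have a2: "a (Suc i) = gl_lin (J c (\<tau> i) (p0 i)) ((\<beta> (\<kappa> i) * cis (pi / 6))\<^sup>2)" for i
    using J_edge[of 0 i] eta(1) unfolding a1 p0 by simp
  have cone: "of_real p * a i + of_real q * a (Suc i) = gl_lin (J c (\<tau> i) (p0 i))
      (of_real (p / sqrt 3) * (\<zeta> ^ (\<kappa> i + 1) - \<zeta> ^ \<kappa> i) + of_real (q / sqrt 3) * (\<zeta> ^ (\<kappa> i + 2) - \<zeta> ^ \<kappa> i))" for p q i
  proof -
    have x3: "of_real (x / sqrt 3) * (of_real (sqrt 3) * u) = of_real x * (u :: complex)" for x u
      by (simp add: field_simps)
    show ?thesis unfolding a1[of i] a2[of i] edge_direction edge_direction'[OF kappa(1)] gl_lin_add gl_lin_scale x3 ..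
  qed
  have bN: "b N = b 0" using per[of 0] H_per[of 0] by (simp add: b_def p0_def)
  have "(\<Prod>i<N. csqrt (a (Suc i) / a i)) = -1"
  proof (rule cyclic_cones[OF N_pos])
    show "a N = a 0" by (simp add: a_def bN)
    show "0 < Im (a (Suc i) / a i)" for i
      unfolding aS power2_eq_square using y[of i] by (simp add: mult_pos_pos add_pos_pos)
    fix i j p q p' q'
    assume h: "i < N" "j < N" "0 < p" "0 < q" "0 < p'" "0 < q'"
      and e: "of_real p * a i + of_real q * a (Suc i) = of_real p' * a j + of_real q' * a (Suc j)"
    note e' = e[unfolded cone]
    show "i = j" by (rule cones_disjoint[OF h(1,2) _ _ _ _ e']) (use h in simp_all)
  qed
  moreover have "csqrt (a (Suc i) / a i) = y i" for i unfolding aS by (rule csqrt_square) (use y[of i] in auto)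
  ultimately have py: "(\<Prod>i<N. y i) = -1" by simp
  have "b m = (\<Prod>i<m. of_int (\<rho> i) * y i) * b 0" for m by (induction m) (simp_all add: bS mult_ac)
  from this[of N] have "(\<Prod>i<N. of_int (\<rho> i) * y i) = 1" using b0[of 0] by (simp add: bN)
  then have "of_int (\<Prod>i<N. \<rho> i) * (-1) = (1 :: complex)" using py by (simp add: prod.distrib)
  then have "of_int (\<Prod>i<N. \<rho> i) = (of_int (-1) :: complex)" by (simp add: minus_equation_iff)
  then show ?thesis unfolding of_int_eq_iff .
qed

end

subsection \<open>Framed sections over the triangles of the star\<close>

lemma sign_delta_in: "\<epsilon> \<in> {1, -1 :: int} \<Longrightarrow> \<delta> (of_int \<epsilon>) \<in> carrier GLt" by auto

lemma sign_delta_fst: "\<epsilon> \<in> {1, -1 :: int} \<Longrightarrow> fst (\<delta> (of_int \<epsilon>)) = mat 1" by (auto simp: cmat_1)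

lemma sign_delta_mult: "\<epsilon> \<in> {1, -1 :: int} \<Longrightarrow> \<epsilon>' \<in> {1, -1} \<Longrightarrow> \<delta> (of_int \<epsilon>) \<otimes>\<^bsub>GLt\<^esub> \<delta> (of_int \<epsilon>') = \<delta> (of_int (\<epsilon> * \<epsilon>'))"
  by (subst delta_mult) auto

lemma sign_delta_central:
  assumes "h \<in> carrier GLt" "\<epsilon> \<in> {1, -1 :: int}"
  shows "\<delta> (of_int \<epsilon>) \<otimes>\<^bsub>GLt\<^esub> h = h \<otimes>\<^bsub>GLt\<^esub> \<delta> (of_int \<epsilon>)"
  using assms delta_minus_central[OF assms(1)] by (auto simp: delta_1)

lemma sign_prod: "(\<And>i. f i \<in> {1, -1 :: int}) \<Longrightarrow> (\<Prod>i\<in>I. f i) \<in> {1, -1}"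
  by (induction I rule: infinite_finite_induct) force+

lemma kernel_sign:
  assumes "g \<in> carrier GLt" "fst g = mat 1" shows "\<exists>\<epsilon>\<in>{1, -1 :: int}. g = \<delta> (of_int \<epsilon>)"
proof -
  have "g = \<one>\<^bsub>GLt\<^esub> \<or> g = \<one>\<^bsub>GLt\<^esub> \<otimes>\<^bsub>GLt\<^esub> \<delta> (-1)" by (rule GLt_lift_cases[OF assms(1)]) (simp_all add: assms)
  then show ?thesis using delta_1 by (auto simp: GLt.l_one)
qed

text \<open>The kernel of the covering has two elements, distinguished by their action on 1, so a
  continuous map from a connected set into it is constant.\<close>

lemma constant_kernel_sign:
  assumes g: "continuous_map (top_of_set S) GLt_top g" and S: "connected S" and k: "\<And>z. z \<in> S \<Longrightarrow> fst (g z) = mat 1"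
  shows "\<exists>\<epsilon>\<in>{1, -1 :: int}. \<forall>z\<in>S. g z = \<delta> (of_int \<epsilon>)"
proof -
  have gin: "g z \<in> carrier GLt" if "z \<in> S" for z using continuous_map_GLt_in[OF g] that by simp
  have "(\<forall>z\<in>S. spin_act (g z) 1 = 1) \<or> (\<forall>z\<in>S. spin_act (g z) 1 = - 1)"
  proof (rule square_eq_connected[OF S])
    show "continuous_on S (\<lambda>z. spin_act (g z) 1)" using continuous_spin_act[OF g, of 1] by simp
    show "(spin_act (g z) 1)\<^sup>2 = 1\<^sup>2" if "z \<in> S" for z using that by (simp add: spin_act_square gin k)
  qed simp_all
  then obtain \<epsilon> :: int where \<epsilon>: "\<epsilon> \<in> {1, -1}" "\<And>z. z \<in> S \<Longrightarrow> spin_act (g z) 1 = of_int \<epsilon>"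
    by (metis insertCI of_int_1 of_int_minus)
  have "g z = \<delta> (of_int \<epsilon>)" if z: "z \<in> S" for z
  proof -
    obtain \<epsilon>' :: int where e: "\<epsilon>' \<in> {1, -1}" "g z = \<delta> (of_int \<epsilon>')" using kernel_sign[OF gin[OF z] k[OF z]] by blast
    then have "spin_act (g z) 1 = of_int \<epsilon>'" by (subst e(2)) (auto simp: spin_act_delta)
    then show ?thesis using \<epsilon>(2)[OF z] e(2) by simp
  qed
  then show ?thesis using \<epsilon>(1) by blast
qed

context spin_star_lift
begin

definition "piece i \<epsilon> z = tri_lift T (\<tau> i) (z, inv\<^bsub>GLt\<^esub> (H i z) \<otimes>\<^bsub>GLt\<^esub> \<delta> (of_int (\<epsilon> :: int)))"

definition "hol i = wsgn i * \<rho> i"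

lemma hol_cases: "hol i \<in> {1, -1}" using wsgn_cases[of i] rho_cases[of i] by (auto simp: hol_def)

lemma piece_per: "piece (i + N) = piece i" "sec (i + N) r = sec i r" "p0 (i + N) = p0 i"
  by (simp_all add: piece_def[abs_def] sec_def p0_def per H_per)

lemma sec_facts:
  assumes z: "z \<in> sec i \<eta> - {p0 i}"
  shows "z \<in> punct" "z \<in> std_triangle" "tri_param T (\<tau> i) z \<in> fst c - bdy" "H i z \<in> carrier GLt" "0 < det (J c (\<tau> i) z)"
proof -
  show "z \<in> punct" using sec_punct[OF z] eta by simp
  show s: "z \<in> std_triangle" using z by (simp add: sec_def)
  have "0 < bary (\<kappa> i) z" using z eta by (simp add: sec_def)
  then show t: "tri_param T (\<tau> i) z \<in> fst c - bdy" using sec_chart[of z i] std_not_bdy[OF s] z by simp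
  show "H i z \<in> carrier GLt" using H_in z by simp
  show "0 < det (J c (\<tau> i) z)" by (rule tri_smooth(2)[OF tau(1) c(1)]) (use s t in \<open>simp add: tdom_def\<close>)
qed

lemma piece_facts:
  assumes z: "z \<in> sec i \<eta> - {p0 i}" and e: "\<epsilon> \<in> {1, -1}"
  shows "piece i \<epsilon> z \<in> PB.tot" "proj P (piece i \<epsilon> z) = Inl (tri_param T (\<tau> i) z)"
    "framing P (piece i \<epsilon> z) (pc c) = mat 1"
    "\<epsilon>' \<in> {1, -1} \<Longrightarrow> piece i (\<epsilon> * \<epsilon>') z = act P (piece i \<epsilon> z) (\<delta> (of_int \<epsilon>'))"
proof -
  note f = sec_facts[OF z]
  have g: "inv\<^bsub>GLt\<^esub> (H i z) \<otimes>\<^bsub>GLt\<^esub> \<delta> (of_int \<epsilon>) \<in> carrier GLt" using f(4) sign_delta_in[OF e] by simp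
  show "piece i \<epsilon> z \<in> PB.tot" unfolding piece_def by (rule lift_in[OF tau(1) f(1) g])
  show "proj P (piece i \<epsilon> z) = Inl (tri_param T (\<tau> i) z)" unfolding piece_def by (rule lift_proj[OF tau(1) f(1) g])
  have "fst (inv\<^bsub>GLt\<^esub> (H i z) \<otimes>\<^bsub>GLt\<^esub> \<delta> (of_int \<epsilon>)) = minv (J c (\<tau> i) z)"
    using f(4) sign_delta_in[OF e] sign_delta_fst[OF e] H_fst[of z i] z by (simp add: fst_mult fst_inv)
  then show "framing P (piece i \<epsilon> z) (pc c) = mat 1"
    unfolding piece_def lift_framing[OF tau(1) f(1) g c(1) f(3)] using minv(2)[of "J c (\<tau> i) z"] f(5) by simp
  show "piece i (\<epsilon> * \<epsilon>') z = act P (piece i \<epsilon> z) (\<delta> (of_int \<epsilon>'))" if e': "\<epsilon>' \<in> {1, -1}"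
  proof -
    have "inv\<^bsub>GLt\<^esub> (H i z) \<otimes>\<^bsub>GLt\<^esub> \<delta> (of_int (\<epsilon> * \<epsilon>')) = inv\<^bsub>GLt\<^esub> (H i z) \<otimes>\<^bsub>GLt\<^esub> \<delta> (of_int \<epsilon>) \<otimes>\<^bsub>GLt\<^esub> \<delta> (of_int \<epsilon>')"
      unfolding sign_delta_mult[OF e e', symmetric] using f(4) sign_delta_in[OF e] sign_delta_in[OF e'] by (simp add: GLt.m_assoc)
    then show ?thesis unfolding piece_def using lift_all(3)[OF tau(1) f(1) g sign_delta_in[OF e']] by simp
  qed
qed

lemma piece_inj:
  assumes z: "z \<in> sec i \<eta> - {p0 i}" and e: "\<epsilon> \<in> {1, -1}" "\<epsilon>' \<in> {1, -1}" "piece i \<epsilon> z = piece i \<epsilon>' z"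
  shows "\<epsilon> = \<epsilon>'"
proof -
  have 1: "(1 :: int) \<in> {1, -1}" by simp
  have "act P (piece i 1 z) (\<delta> (of_int \<epsilon>)) = act P (piece i 1 z) (\<delta> (of_int \<epsilon>'))"
    using piece_facts(4)[OF z 1 e(1)] piece_facts(4)[OF z 1 e(2)] e(3) by simp
  then have "\<delta> (of_int \<epsilon>) = \<delta> (of_int \<epsilon>')"
    by (rule PB.act_injective[OF piece_facts(1)[OF z 1] sign_delta_in[OF e(1)] sign_delta_in[OF e(2)]])
  then have "(of_int \<epsilon> :: complex) = of_int \<epsilon>'" by (rule delta_inj) (use e in auto)
  then show ?thesis by simp
qed

lemma piece_continuous:
  assumes e: "\<epsilon> \<in> {1, -1}"
  shows "continuous_map (top_of_set (sec i \<eta> - {p0 i})) (total_space P) (piece i \<epsilon>)"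
proof -
  let ?S = "sec i \<eta> - {p0 i}"
  have "continuous_map (top_of_set ?S) GLt_top (H i)"
    using H_cont[of i] by (rule continuous_map_from_subtopology_mono) auto
  then have "continuous_map (top_of_set ?S) GLt_top (\<lambda>z. inv\<^bsub>GLt\<^esub> (H i z) \<otimes>\<^bsub>GLt\<^esub> \<delta> (of_int \<epsilon>))"
    by (intro continuous_GLt_mult continuous_GLt_inv) (use sign_delta_in[OF e] in \<open>simp_all add: continuous_map_const\<close>)
  then have "continuous_map (top_of_set ?S) (prod_topology (top_of_set punct) GLt_top) (\<lambda>z. (z, inv\<^bsub>GLt\<^esub> (H i z) \<otimes>\<^bsub>GLt\<^esub> \<delta> (of_int \<epsilon>)))"
    using sec_facts(1)[of _ i] by (auto simp: continuous_map_pairwise o_def continuous_map_in_subtopology)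
  from continuous_map_compose[OF this lift_continuous[OF tau(1)]] show ?thesis
    by (simp add: piece_def[abs_def] o_def)
qed

lemma pt_not_p0: "0 \<le> s \<Longrightarrow> 0 \<le> t \<Longrightarrow> (s, t) \<noteq> (0, 0) \<Longrightarrow> s + t < \<eta> \<Longrightarrow> pt i s t \<in> sec i \<eta> - {p0 i}"
proof -
  assume h: "0 \<le> s" "0 \<le> t" "(s, t) \<noteq> (0, 0)" "s + t < \<eta>"
  have "pt i s t \<in> sec i \<eta>" using h eta by (intro sec_tri_pt) auto
  moreover have "pt i s t \<noteq> p0 i"
  proof
    assume "pt i s t = p0 i"
    then have "1 - s - t = 1" using bary_tri_pt(1)[of "\<kappa> i" s t] bary_tri_pt(1)[of "\<kappa> i" 0 0] by (simp add: p0_def tri_pt_0)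
    then show False using h by auto
  qed
  ultimately show ?thesis by simp
qed

text \<open>Along the edge the two triangle lifts differ by some \<open>g\<close>, and the lifted
  Jacobians satisfy that \<open>H (Suc i)\<close> is \<open>H i\<close> times \<open>g\<close> up to
  a sign \<theta>. Letting both act on the root \<open>\<beta> (\<kappa> (Suc i))\<close> gives
  \<open>\<rho> i = \<theta> * wsgn i\<close>, hence \<theta> is \<open>hol i\<close>. The pieces
  involve the inverses of the lifted Jacobians and therefore differ by the same sign.\<close>

lemma piece_transition:
  assumes t: "0 < t" "t < \<eta>" and e: "\<epsilon> \<in> {1, -1}"
  shows "piece (Suc i) \<epsilon> (pt (Suc i) t 0) = piece i (\<epsilon> * hol i) (pt i 0 t)"
proof -
  let ?z = "pt i 0 t" and ?z' = "pt (Suc i) t 0"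
  let ?h = "H i ?z" and ?h' = "H (Suc i) ?z'"
  have z: "?z \<in> sec i \<eta> - {p0 i}" by (rule pt_not_p0) (use t in auto)
  have z': "?z' \<in> sec (Suc i) \<eta> - {p0 (Suc i)}" by (rule pt_not_p0) (use t in auto)
  note f = sec_facts[OF z] and f' = sec_facts[OF z']
  have same: "tri_param T (\<tau> (Suc i)) ?z' = tri_param T (\<tau> i) ?z" by (simp only: tri_param_Y Y_edge)
  let ?u = "tri_lift T (\<tau> i) (?z, \<one>\<^bsub>GLt\<^esub>)" and ?u' = "tri_lift T (\<tau> (Suc i)) (?z', \<one>\<^bsub>GLt\<^esub>)"
  have u: "?u \<in> PB.tot" "?u' \<in> PB.tot" using lift_in[OF tau(1) f(1) GLt.one_closed] lift_in[OF tau(1) f'(1) GLt.one_closed] by simp_all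
  have pu: "proj P ?u = proj P ?u'"
    using lift_proj[OF tau(1) f(1) GLt.one_closed] lift_proj[OF tau(1) f'(1) GLt.one_closed] same by simp
  obtain g where g: "g \<in> carrier GLt" "act P ?u g = ?u'" using PB.act_transitive[OF u pu] by blast
  have ug: "?u' = tri_lift T (\<tau> i) (?z, g)" using lift_act[OF tau(1) f(1) g(1)] g(2) by simp
  have sg: "spin_act g (\<beta> (\<kappa> (Suc i))) = of_int (wsgn i) * (\<beta> (\<kappa> i) * cis (pi / 6))"
    by (rule key_edge[OF t(1) _ g(1) ug]) (use t eta in simp)
  have "framing P ?u' (pc c) = J c (\<tau> (Suc i)) ?z'" using lift_framing[OF tau(1) f'(1) GLt.one_closed c(1) f'(3)] by simp
  moreover have "framing P ?u (pc c) = J c (\<tau> i) ?z" using lift_framing[OF tau(1) f(1) GLt.one_closed c(1) f(3)] by simp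
  ultimately have Jg: "J c (\<tau> (Suc i)) ?z' = J c (\<tau> i) ?z ** fst g" using framing_act[OF u(1) g(1), of "pc c"] g(2) by simp
  have hg: "?h \<otimes>\<^bsub>GLt\<^esub> g \<in> carrier GLt" using f(4) g(1) by simp
  have "fst ?h' = fst (?h \<otimes>\<^bsub>GLt\<^esub> g)" using H_fst[of ?z' "Suc i"] H_fst[of ?z i] z z' Jg by (simp add: fst_mult)
  from GLt_lift_cases[OF f'(4) hg this] consider "?h' = ?h \<otimes>\<^bsub>GLt\<^esub> g" | "?h' = ?h \<otimes>\<^bsub>GLt\<^esub> g \<otimes>\<^bsub>GLt\<^esub> \<delta> (-1)" by blast
  then obtain \<theta> :: int where \<theta>: "\<theta> \<in> {1, -1}" "?h' = ?h \<otimes>\<^bsub>GLt\<^esub> g \<otimes>\<^bsub>GLt\<^esub> \<delta> (of_int \<theta>)"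
  proof cases
    case 1 then show ?thesis using that[of 1] hg by (simp add: delta_1)
  next
    case 2 then show ?thesis using that[of "-1"] by simp
  qed
  have \<beta>0: "\<beta> (\<kappa> i) * cis (pi / 6) \<noteq> 0" by simp
  have "spin_act ?h' (\<beta> (\<kappa> (Suc i))) = spin_act (?h \<otimes>\<^bsub>GLt\<^esub> g) (spin_act (\<delta> (of_int \<theta>)) (\<beta> (\<kappa> (Suc i))))"
    unfolding \<theta>(2) by (rule spin_act_mult[OF hg sign_delta_in[OF \<theta>(1)] beta_nonzero])
  also have "spin_act (\<delta> (of_int \<theta>)) (\<beta> (\<kappa> (Suc i))) = of_int \<theta> * \<beta> (\<kappa> (Suc i))" using \<theta>(1) by (auto simp: spin_act_delta)
  also have "spin_act (?h \<otimes>\<^bsub>GLt\<^esub> g) (of_int \<theta> * \<beta> (\<kappa> (Suc i))) = of_int \<theta> * spin_act ?h (spin_act g (\<beta> (\<kappa> (Suc i))))"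
    unfolding spin_act_sign[OF hg beta_nonzero \<theta>(1)] spin_act_mult[OF f(4) g(1) beta_nonzero] ..
  also have "spin_act ?h (spin_act g (\<beta> (\<kappa> (Suc i)))) = of_int (wsgn i) * hL i t"
    unfolding sg spin_act_sign[OF f(4) \<beta>0 wsgn_cases] hL_def ..
  finally have "hR i t = of_int \<theta> * (of_int (wsgn i) * hL i t)" by (simp add: hR_def)
  then have "of_int (\<rho> i) * hL i t = of_int (\<theta> * wsgn i) * hL i t" using rho[of t i] t by simp
  moreover have "hL i t \<noteq> 0" unfolding hL_def by (rule spin_act_nonzero[OF f(4) \<beta>0])
  ultimately have "(of_int (\<rho> i) :: complex) = of_int (\<theta> * wsgn i)" by (simp del: of_int_mult)
  then have "\<rho> i = \<theta> * wsgn i" unfolding of_int_eq_iff .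
  then have th: "\<theta> = hol i" using wsgn_cases[of i] by (auto simp: hol_def)
  have 1: "(1 :: int) \<in> {1, -1}" by simp
  have d: "\<delta> (of_int (hol i)) \<in> carrier GLt" by (rule sign_delta_in[OF hol_cases])
  have dd: "\<delta> (of_int (hol i)) \<otimes>\<^bsub>GLt\<^esub> \<delta> (of_int (hol i)) = \<one>\<^bsub>GLt\<^esub>"
    using hol_cases[of i] sign_delta_mult[OF hol_cases hol_cases, of i i] by (auto simp: delta_1)
  have "piece (Suc i) 1 ?z' = act P ?u' (inv\<^bsub>GLt\<^esub> ?h')"
    using lift_act[OF tau(1) f'(1), of "inv\<^bsub>GLt\<^esub> ?h'"] f'(4) by (simp add: piece_def delta_1)
  also have "\<dots> = act P ?u (g \<otimes>\<^bsub>GLt\<^esub> inv\<^bsub>GLt\<^esub> ?h')"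
    unfolding g(2)[symmetric] using PB.act_act[OF u(1) g(1), of "inv\<^bsub>GLt\<^esub> ?h'"] f'(4) by simp
  \<comment> \<open>A computation with a central element of order at most two:
    \<open>H (Suc i)\<close> is replaced by \<open>H i\<close> times \<open>g\<close> times the
    sign, and the sign is its own inverse.\<close>
  also have "g \<otimes>\<^bsub>GLt\<^esub> inv\<^bsub>GLt\<^esub> ?h' = inv\<^bsub>GLt\<^esub> ?h \<otimes>\<^bsub>GLt\<^esub> \<delta> (of_int (hol i))"
  proof (rule GLt.Units_l_cancel[of ?h, THEN iffD1])
    have "?h \<otimes>\<^bsub>GLt\<^esub> (g \<otimes>\<^bsub>GLt\<^esub> inv\<^bsub>GLt\<^esub> ?h') = \<delta> (of_int (hol i)) \<otimes>\<^bsub>GLt\<^esub> \<delta> (of_int (hol i)) \<otimes>\<^bsub>GLt\<^esub> (?h \<otimes>\<^bsub>GLt\<^esub> g) \<otimes>\<^bsub>GLt\<^esub> inv\<^bsub>GLt\<^esub> ?h'"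
      unfolding dd using f(4) f'(4) g(1) by (simp add: GLt.m_assoc)
    also have "\<dots> = \<delta> (of_int (hol i)) \<otimes>\<^bsub>GLt\<^esub> ?h' \<otimes>\<^bsub>GLt\<^esub> inv\<^bsub>GLt\<^esub> ?h'"
    proof -
      have "\<delta> (of_int (hol i)) \<otimes>\<^bsub>GLt\<^esub> (?h \<otimes>\<^bsub>GLt\<^esub> g) = ?h'"
        unfolding sign_delta_central[OF hg hol_cases] \<theta>(2) th ..
      then show ?thesis using d hg f'(4) GLt.m_assoc[OF d d hg] by simp
    qed
    also have "\<dots> = \<delta> (of_int (hol i))" using d f'(4) by (simp add: GLt.m_assoc)
    also have "\<dots> = ?h \<otimes>\<^bsub>GLt\<^esub> (inv\<^bsub>GLt\<^esub> ?h \<otimes>\<^bsub>GLt\<^esub> \<delta> (of_int (hol i)))"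
      using d f(4) GLt.m_assoc[OF f(4) GLt.inv_closed[OF f(4)] d] by simp
    finally show "?h \<otimes>\<^bsub>GLt\<^esub> (g \<otimes>\<^bsub>GLt\<^esub> inv\<^bsub>GLt\<^esub> ?h') = ?h \<otimes>\<^bsub>GLt\<^esub> (inv\<^bsub>GLt\<^esub> ?h \<otimes>\<^bsub>GLt\<^esub> \<delta> (of_int (hol i)))" .
  qed (use f(4) f'(4) g(1) d in \<open>simp_all add: GLt.Units_eq\<close>)
  also have "act P ?u (inv\<^bsub>GLt\<^esub> ?h \<otimes>\<^bsub>GLt\<^esub> \<delta> (of_int (hol i))) = piece i (hol i) ?z"
    unfolding piece_def by (rule lift_act[OF tau(1) f(1), symmetric]) (use f(4) d in simp)
  finally have p1: "piece (Suc i) 1 ?z' = piece i (hol i) ?z" .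
  have "piece (Suc i) \<epsilon> ?z' = act P (piece (Suc i) 1 ?z') (\<delta> (of_int \<epsilon>))" using piece_facts(4)[OF z' 1 e] by simp
  also have "\<dots> = piece i (hol i * \<epsilon>) ?z" unfolding p1 by (rule piece_facts(4)[OF z hol_cases e, symmetric])
  finally show ?thesis by (simp only: mult.commute)
qed

end

subsection \<open>The extension criterion\<close>

context spin_star_lift
begin

sublocale CC: center_chart "plus_atlas T" "pc c" by (rule center_chart_pc[OF c(1)])

lemma CC_img: "CC.img = Oc c" by (simp add: CC.img_def pc_img)

lemma CC_psi: "z \<in> Oc c \<Longrightarrow> CC.\<psi> z = Inl (cinv c z)"
  unfolding CC.\<psi>_def by (rule pc_inv[OF c(1)])

lemma z0_facts: "z0 \<in> Oc c" "cinv c z0 = xv" "CC.\<psi> z0 = plus_vertex T v"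
proof -
  show z: "z0 \<in> Oc c" using c(2) xv_not_bdy by (simp add: Oc_def z0_def)
  show e: "cinv c z0 = xv" unfolding z0_def by (rule cinv[OF c])
  show "CC.\<psi> z0 = plus_vertex T v" unfolding CC_psi[OF z] e by (simp add: plus_vertex_def xv_def)
qed

text \<open>Barycentric coordinates read in the chart: \<open>K z w\<close> is the weight at the
  vertex \<open>w\<close> of the point with coordinate \<open>z\<close>.\<close>

definition "K z = inv_into (realisation T) (homeo T) (cinv c z)"

lemma K_facts: "z \<in> snd c ` fst c \<Longrightarrow> K z \<in> realisation T" "z \<in> snd c ` fst c \<Longrightarrow> homeo T (K z) = cinv c z"
proof -
  have im: "cinv c z \<in> homeo T ` realisation T" if "z \<in> snd c ` fst c"
  proof -
    have "cinv c z \<in> surf_carrier A" using cinv_in[OF that] c(1) by (auto simp: surf_carrier_def)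
    then show ?thesis using homeomorphic_imp_surjective_map[OF homeo] by simp
  qed
  show "z \<in> snd c ` fst c \<Longrightarrow> K z \<in> realisation T" unfolding K_def by (rule inv_into_into[OF im])
  show "z \<in> snd c ` fst c \<Longrightarrow> homeo T (K z) = cinv c z" unfolding K_def by (rule f_inv_into_f[OF im])
qed

lemma K_homeo: "y \<in> realisation T \<Longrightarrow> homeo T y \<in> fst c \<Longrightarrow> K (snd c (homeo T y)) = y"
  unfolding K_def using cinv[OF c(1)] homeo_inj by simp

lemma Oc_sub: "Oc c \<subseteq> snd c ` fst c" by (auto simp: Oc_def)

lemma K_continuous: "continuous_on (snd c ` fst c) (\<lambda>z. K z w)"
proof -
  let ?C = "snd c ` fst c"
  have 1: "continuous_map (top_of_set ?C) (surf_top A) (cinv c)"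
    unfolding continuous_map_def
  proof (intro conjI allI impI)
    show "cinv c \<in> topspace (top_of_set ?C) \<rightarrow> topspace (surf_top A)"
      using cinv_in[of _ c] c(1) by (auto simp: surf_carrier_def)
    show "openin (top_of_set ?C) {z \<in> topspace (top_of_set ?C). cinv c z \<in> W}" if "openin (surf_top A) W" for W
      using chart_preimage_open[OF c(1) that] by simp
  qed
  obtain g where g: "homeomorphic_maps (top_of_set (realisation T)) (surf_top A) (homeo T) g"
    using homeo unfolding homeomorphic_map_maps by blast
  have gK: "g (cinv c z) = K z" if "z \<in> ?C" for z
    using g K_facts[OF that] unfolding homeomorphic_maps_def by (metis topspace_euclidean_subtopology)
  have "continuous_map (surf_top A) (top_of_set (realisation T)) g" using g by (simp add: homeomorphic_maps_def)
  from continuous_map_compose[OF 1 this] have "continuous_on ?C (g \<circ> cinv c)" by (simp add: continuous_map_in_subtopology)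
  then have "continuous_on ?C K" by (rule continuous_on_eq) (simp add: gK)
  then show ?thesis by (rule continuous_on_product_then_coordinatewise)
qed

text \<open>A neighbourhood of \<open>z0\<close> cut out by the weight at \<open>v\<close> instead
  of a round disc, so that each of its points lies in the image of a sector.\<close>

definition "ball_v = {z \<in> Oc c. 1 - \<eta> < K z v}"

lemma K_z0: "K z0 = vertex_point v"
  using K_homeo[OF vertex_realisation] c(2) by (simp add: z0_def xv_def)

lemma ball_v: "open ball_v" "z0 \<in> ball_v" "ball_v \<subseteq> Oc c"
proof -
  have "open (Oc c \<inter> (\<lambda>z. K z v) -` {1 - \<eta><..})"
    by (rule continuous_open_preimage[OF continuous_on_subset[OF K_continuous Oc_sub] open_Oc[OF c(1)]]) simp
  then show "open ball_v" by (simp add: ball_v_def Int_def vimage_def)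
  show "z0 \<in> ball_v" using z0_facts(1) eta by (simp add: ball_v_def K_z0 vertex_point_def)
  show "ball_v \<subseteq> Oc c" by (auto simp: ball_v_def)
qed

lemma vertex_point_realisation: assumes "w \<in> vertices T" shows "vertex_point w \<in> realisation T"
proof -
  obtain s where s: "s \<in> simplices T" "w \<in> s" using assms by (auto simp: vertices_def)
  have "{w} \<in> simplices T" by (rule subsimplex[OF s(1)]) (use s(2) in auto)
  moreover have "{u. vertex_point w u \<noteq> 0} = {w}" by (auto simp: vertex_point_def)
  ultimately show ?thesis by (simp add: realisation_def) (simp add: vertex_point_def)
qed

lemma K_inj: "z \<in> Oc c \<Longrightarrow> K z = vertex_point v \<Longrightarrow> z = z0"
  using K_facts(2)[of z] Oc_sub Oc_cinv[OF c(1), of z] by (auto simp: z0_def xv_def)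

lemma v_vertex: "v \<in> vertices T" using v by (simp add: inner_vertices_def)

lemma psi_z0: "CC.\<psi> z0 \<notin> punctured_plus T"
  unfolding z0_facts(3) using v_vertex by (auto simp: punctured_plus_def)

text \<open>The weight at \<open>v\<close> is positive on this neighbourhood, which excludes all
  other vertices, and the only point of weight 1 is the centre.\<close>

lemma psi_ball: "CC.\<psi> ` (ball_v - {z0}) \<subseteq> punctured_plus T"
proof
  fix u assume "u \<in> CC.\<psi> ` (ball_v - {z0})"
  then obtain z where z: "z \<in> ball_v" "z \<noteq> z0" "u = CC.\<psi> z" by blast
  have zO: "z \<in> Oc c" "z \<in> CC.img" using z(1) ball_v(3) by (auto simp: CC_img)
  have zi: "z \<in> snd c ` fst c" using zO(1) Oc_sub by blast
  have "u \<in> surf_carrier (plus_atlas T)" using CC.psi_in[OF zO(2)] CC.CA z(3) by (auto simp: surf_carrier_def)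
  moreover have "u \<noteq> plus_vertex T w" if w: "w \<in> vertices T" for w
  proof
    assume "u = plus_vertex T w"
    then have "homeo T (K z) = homeo T (vertex_point w)"
      using z(3) CC_psi[OF zO(1)] K_facts(2)[OF zi] by (simp add: plus_vertex_def)
    then have k: "K z = vertex_point w" by (rule inj_onD[OF homeo_inj _ K_facts(1)[OF zi] vertex_point_realisation[OF w]])
    then have "w = v" using z(1) eta by (auto simp: ball_v_def vertex_point_def split: if_splits)
    then show False using K_inj[OF zO(1)] k z(2) by simp
  qed
  ultimately show "u \<in> punctured_plus T" by (auto simp: punctured_plus_def)
qed

text \<open>An extension provides one framed section around \<open>v\<close>. On each punctured
  sector, which is connected, it coincides with the piece for some sign \<open>\<epsilon> i\<close>.
  By \<open>piece_transition\<close> and \<open>piece_inj\<close> these signs satisfy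
  \<open>\<epsilon> (Suc i) * hol i = \<epsilon> i\<close>, and their periodicity forces the product
  of all \<open>hol i\<close> to be 1.\<close>

theorem prod_hol_if_extends:
  assumes "extends_to_vertex T v" shows "(\<Prod>i<N. hol i) = 1"
proof -
  obtain B s where s: "CC.has_framed_section P z0 B s" and B: "B \<subseteq> ball_v"
    by (rule CC.extends_imp_section[OF spin psi_z0 _ ball_v(1,2) ball_v(3)[folded CC_img] psi_ball])
      (use assms in \<open>simp add: extends_to_vertex_def z0_facts(3)\<close>)
  note h = s[unfolded CC.has_framed_section_def]
  have sB: "open B" "z0 \<in> B" "continuous_map (top_of_set (B - {z0})) (total_space P) s"
    by (rule h[THEN conjunct1] h[THEN conjunct2, THEN conjunct1] h[THEN conjunct2, THEN conjunct2, THEN conjunct2, THEN conjunct1])+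
  note h' = h[THEN conjunct2, THEN conjunct2, THEN conjunct2, THEN conjunct2, THEN bspec]
  have sp: "\<And>z. z \<in> B - {z0} \<Longrightarrow> proj P (s z) = CC.\<psi> z" by (rule h'[THEN conjunct1])
  have sf: "\<And>z. z \<in> B - {z0} \<Longrightarrow> framing P (s z) (pc c) = mat 1" by (rule h'[THEN conjunct2])
  have "openin (surf_top A) (fst c \<inter> snd c -` B)" by (rule openin_surf_top[OF c(1) sB(1)])
  moreover have "xv \<in> fst c \<inter> snd c -` B" using c(2) sB(2) by (simp add: z0_def)
  ultimately obtain r' where r': "0 < r'" "\<And>i z. z \<in> sec i r' \<Longrightarrow> tri_param T (\<tau> i) z \<in> fst c \<inter> snd c -` B"
    by (rule good_radius) blast
  define r where "r = min r' \<eta>"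
  have r: "0 < r" "r \<le> \<eta>" using r'(1) eta by (auto simp: r_def)
  have sub: "sec i r \<subseteq> sec i \<eta>" "sec i r \<subseteq> sec i r'" for i by (auto simp: sec_def r_def)
  let ?S = "\<lambda>i. sec i r - {p0 i}" let ?f = "\<lambda>i z. snd c (tri_param T (\<tau> i) z)"
  have S: "z \<in> sec i \<eta> - {p0 i}" if "z \<in> ?S i" for i z using that sub by blast
  have fB: "?f i z \<in> B - {z0}" if z: "z \<in> ?S i" for i z
  proof -
    have x: "tri_param T (\<tau> i) z \<in> fst c" "?f i z \<in> B" using r'(2)[of z i] z sub by auto
    have "?f i z \<noteq> z0"
    proof
      assume "?f i z = z0"
      then have "tri_param T (\<tau> i) z = tri_param T (\<tau> i) (p0 i)"
        unfolding z0_def tri_param_p0 using inj_chart[OF c(1)] x(1) c(2) by (auto dest: inj_onD)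
      then have "z = p0 i" by (rule inj_onD[OF tri_param_inj[OF tau(1)] _ sec_facts(2)[OF S[OF z]] p0_std])
      then show False using z by blast
    qed
    then show ?thesis using x by blast
  qed
  have stot: "s (?f i z) \<in> PB.tot" if z: "z \<in> ?S i" for i z
    using continuous_map_image_subset_topspace[OF sB(3)] fB[OF z] by auto
  have one: "(1 :: int) \<in> {1, -1}" by simp
  have ps: "proj P (piece i 1 z) = proj P (s (?f i z))" if z: "z \<in> ?S i" for i z
  proof -
    note f = sec_facts[OF S[OF z]]
    have "?f i z \<in> Oc c" unfolding Oc_def by (rule imageI[OF f(3)])
    moreover have "cinv c (?f i z) = tri_param T (\<tau> i) z" using cinv[OF c(1)] f(3) by simp
    ultimately show ?thesis unfolding piece_facts(2)[OF S[OF z] one] sp[OF fB[OF z]] by (simp add: CC_psi)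
  qed
  have "\<exists>\<epsilon>\<in>{1, -1 :: int}. \<forall>z\<in>?S i. s (?f i z) = piece i \<epsilon> z" for i
  proof -
    define g where "g z = PB.transl (piece i 1 z) (s (?f i z))" for z
    have g: "g z \<in> carrier GLt" "act P (piece i 1 z) (g z) = s (?f i z)" if z: "z \<in> ?S i" for z
      unfolding g_def using PB.transl[OF piece_facts(1)[OF S[OF z] one] stot[OF z] ps[OF z]] by simp_all
    have "continuous_on (?S i) (?f i)"
    proof -
      have "continuous_on (tdom c (\<tau> i)) (?f i)"
        using smooth_map_on_continuous[OF tri_smooth(1)[OF tau(1) c(1)]] by (simp add: o_def)
      then show ?thesis by (rule continuous_on_subset) (use sec_facts(2,3) S in \<open>fastforce simp: tdom_def\<close>)
    qed
    then have cf: "continuous_map (top_of_set (?S i)) (top_of_set (B - {z0})) (?f i)"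
      using fB[of _ i] by (auto simp: continuous_map_in_subtopology)
    have c1: "continuous_map (top_of_set (?S i)) (total_space P) (\<lambda>z. s (?f i z))"
      using continuous_map_compose[OF cf sB(3)] by (simp add: o_def)
    have c2: "continuous_map (top_of_set (?S i)) (total_space P) (piece i 1)"
      using piece_continuous[OF one, of i] by (rule continuous_map_from_subtopology_mono) (use S in blast)
    have cg: "continuous_map (top_of_set (?S i)) GLt_top g"
      unfolding g_def[abs_def] by (rule PB.continuous_transl[OF c2 c1]) (simp add: ps)
    have "fst (g z) = mat 1" if z: "z \<in> ?S i" for z
      using framing_act[OF piece_facts(1)[OF S[OF z] one] g(1)[OF z], of "pc c"] g(2)[OF z] sf[OF fB[OF z]]
        piece_facts(3)[OF S[OF z] one] by simp
    then obtain \<epsilon> :: int where e: "\<epsilon> \<in> {1, -1}" "\<And>z. z \<in> ?S i \<Longrightarrow> g z = \<delta> (of_int \<epsilon>)"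
      using constant_kernel_sign[OF cg convex_connected[OF convex_sec_punct[OF r(1)]]] by blast
    have "s (?f i z) = piece i \<epsilon> z" if z: "z \<in> ?S i" for z
      using g(2)[OF z] e(2)[OF z] piece_facts(4)[OF S[OF z] one e(1)] by simp
    then show ?thesis using e(1) by blast
  qed
  then obtain \<epsilon>' where e': "\<And>i. \<epsilon>' i \<in> {1, -1 :: int}" "\<And>i z. z \<in> ?S i \<Longrightarrow> s (?f i z) = piece i (\<epsilon>' i) z" by metis
  \<comment> \<open>The signs have been chosen separately for each natural number. Reducing the
    index makes them periodic, and they remain valid because the triangles, sectors and lifts are
    periodic.\<close>
  define \<epsilon> where "\<epsilon> i = \<epsilon>' (i mod N)" for i
  have e1: "\<epsilon> i \<in> {1, -1}" for i using e'(1) by (simp only: \<epsilon>_def)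
  have e2: "s (?f i z) = piece i (\<epsilon> i) z" if z: "z \<in> ?S i" for i z
  proof -
    have m: "i mod N mod N = i mod N" by simp
    have t: "\<tau> (i mod N) = \<tau> i" by (simp add: \<tau>_def)
    then have k: "\<kappa> (i mod N) = \<kappa> i" by (simp add: \<kappa>_def)
    have "H (j + m * N) = H j" for j m
      by (induction m) (simp_all add: H_per add.assoc[symmetric] add.left_commute add.commute[of N])
    from this[of "i mod N" "i div N"] have h: "H (i mod N) = H i" by (simp add: add.commute)
    have "z \<in> ?S (i mod N)" using z by (simp add: sec_def p0_def k)
    from e'(2)[OF this] show ?thesis by (simp add: t piece_def h \<epsilon>_def)
  qed
  have step: "\<epsilon> (Suc i) * hol i = \<epsilon> i" for i
  proof -
    define t where "t = r / 2"
    have t: "0 < t" "t < r" "t < \<eta>" using r by (auto simp: t_def)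
    have z: "pt i 0 t \<in> ?S i" and z': "pt (Suc i) t 0 \<in> ?S (Suc i)"
      using pt_not_p0[of 0 t i] pt_not_p0[of t 0 "Suc i"] sec_tri_pt[of 0 t r i] sec_tri_pt[of t 0 r "Suc i"] t r eta by auto
    have "?f (Suc i) (pt (Suc i) t 0) = ?f i (pt i 0 t)" by (simp only: tri_param_Y Y_edge)
    then have "piece i (\<epsilon> i) (pt i 0 t) = piece (Suc i) (\<epsilon> (Suc i)) (pt (Suc i) t 0)"
      using e2[OF z] e2[OF z'] by simp
    also have "\<dots> = piece i (\<epsilon> (Suc i) * hol i) (pt i 0 t)" by (rule piece_transition[OF t(1,3) e1])
    finally show ?thesis
      by (intro piece_inj[OF S[OF z], symmetric] e1) (use e1[of "Suc i"] hol_cases[of i] in auto)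
  qed
  have "\<epsilon> m * (\<Prod>i<m. hol i) = \<epsilon> 0" for m
  proof (induction m)
    case (Suc m)
    have "\<epsilon> (Suc m) * (\<Prod>i<Suc m. hol i) = (\<epsilon> (Suc m) * hol m) * (\<Prod>i<m. hol i)" by (simp add: mult_ac)
    then show ?case using Suc by (simp only: step)
  qed simp
  from this[of N] have "\<epsilon> 0 * (\<Prod>i<N. hol i) = \<epsilon> 0" by (simp add: \<epsilon>_def)
  then show ?thesis using e1[of 0] by auto
qed

text \<open>With suitable signs the pieces of consecutive triangles agree on the common edge, and
  the condition on the product closes the last piece up with the first. The triangles cut the
  punctured neighbourhood into finitely many relatively closed sets, so the pieces paste to a
  continuous section.\<close>

theorem extends_if_prod_hol:
  assumes pr: "(\<Prod>i<N. hol i) = 1" shows "extends_to_vertex T v"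
proof -
  \<comment> \<open>This solves \<open>\<epsilon> (Suc i) * hol i = \<epsilon> i\<close>, since each
    \<open>hol i\<close> is its own inverse.\<close>
  define \<epsilon> where "\<epsilon> i = (\<Prod>j<i. hol j)" for i
  have e: "\<epsilon> i \<in> {1, -1}" for i unfolding \<epsilon>_def by (rule sign_prod[OF hol_cases])
  let ?X = "ball_v - {z0}"
  define q where "q i z = pt i (K z (n i)) (K z (n (Suc i)))" for i z
  define S where "S i = {z \<in> ?X. K z = Y i (K z (n i)) (K z (n (Suc i)))}" for i
  have XC: "?X \<subseteq> snd c ` fst c" using ball_v(3) Oc_sub by blast
  have Kc: "continuous_on ?X (\<lambda>z. K z w)" for w by (rule continuous_on_subset[OF K_continuous XC])
  have K0: "0 \<le> K z w" if "z \<in> ?X" for z w using K_facts(1)[of z] XC that by (auto simp: realisation_def)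
  have Kv: "K z v = 1 - K z (n i) - K z (n (Suc i))" if "z \<in> S i" for z i
    using that Y_vals(1)[of i "K z (n i)" "K z (n (Suc i))"] by (simp add: S_def)
  have SX: "S i \<subseteq> ?X" for i by (auto simp: S_def)
  have q: "q i z \<in> sec i \<eta> - {p0 i}" "tri_param T (\<tau> i) (q i z) = cinv c z" if z: "z \<in> S i" for i z
  proof -
    have zX: "z \<in> ?X" using z SX by blast
    have zO: "z \<in> Oc c" using zX ball_v(3) by blast
    have KY: "K z = Y i (K z (n i)) (K z (n (Suc i)))" using z by (simp add: S_def)
    have "(K z (n i), K z (n (Suc i))) \<noteq> (0, 0)"
    proof
      assume "(K z (n i), K z (n (Suc i))) = (0, 0)"
      then have "K z = vertex_point v" using KY by (simp add: Y_0)
      then show False using K_inj[OF zO] zX by blast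
    qed
    moreover have "K z (n i) + K z (n (Suc i)) < \<eta>" using zX Kv[OF z] by (simp add: ball_v_def)
    ultimately show "q i z \<in> sec i \<eta> - {p0 i}" unfolding q_def by (intro pt_not_p0 K0[OF zX])
    show "tri_param T (\<tau> i) (q i z) = cinv c z"
      unfolding q_def tri_param_Y KY[symmetric] by (rule K_facts(2)) (use zX XC in blast)
  qed
  have cover: "topspace (top_of_set ?X) \<subseteq> \<Union> (S ` {..<N})"
  proof
    fix z assume "z \<in> topspace (top_of_set ?X)"
    then have zX: "z \<in> ?X" by simp
    have "K z \<in> realisation T" using K_facts(1) zX XC by blast
    moreover have "0 < K z v" using zX eta by (simp add: ball_v_def)
    ultimately obtain i where "i < N" "K z = Y i (K z (n i)) (K z (n (Suc i)))" by (rule realisation_Y)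
    then show "z \<in> \<Union> (S ` {..<N})" using zX by (auto simp: S_def)
  qed
  have closed: "closedin (top_of_set ?X) (S i)" for i
  proof -
    have "S i = (\<Inter>w. {z \<in> ?X. K z w - Y i (K z (n i)) (K z (n (Suc i))) w = 0})" by (auto simp: S_def fun_eq_iff)
    moreover have "closedin (top_of_set ?X) {z \<in> ?X. K z w - Y i (K z (n i)) (K z (n (Suc i))) w = 0}" for w
      by (rule continuous_closedin_preimage_constant) (unfold Y_def tri_bary_def, intro continuous_intros Kc)
    ultimately show ?thesis by (auto intro!: closedin_Inter)
  qed
  have cont: "continuous_map (subtopology (top_of_set ?X) (S i)) (total_space P) (\<lambda>z. piece i (\<epsilon> i) (q i z))" for i
  proof -
    have "continuous_on (S i) (q i)" unfolding q_def tri_pt_def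
      by (intro continuous_intros continuous_on_subset[OF Kc SX])
    then have "continuous_map (top_of_set (S i)) (top_of_set (sec i \<eta> - {p0 i})) (q i)"
      using q(1)[of _ i] by (auto simp: continuous_map_in_subtopology)
    from continuous_map_compose[OF this piece_continuous[OF e]]
    have "continuous_map (top_of_set (S i)) (total_space P) (\<lambda>z. piece i (\<epsilon> i) (q i z))" by (simp add: o_def)
    moreover have "subtopology (top_of_set ?X) (S i) = top_of_set (S i)"
      using SX[of i] by (simp add: subtopology_subtopology Int_absorb1)
    ultimately show ?thesis by simp
  qed
  have next_eq: "piece i (\<epsilon> i) (q i z) = piece j (\<epsilon> j) (q j z)"
    if ij: "i < N" "j = Suc i mod N" and z: "z \<in> S i" "z \<in> S j" for i j z
  proof -
    have tj: "\<tau> j = \<tau> (Suc i)" using ij(2) by (simp add: \<tau>_def)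
    have nj1: "n j = n (Suc i)" by (simp add: n_def tj)
    have nj2: "n (Suc j) = n (Suc (Suc i))" unfolding n_Suc[of j] n_Suc[of "Suc i"] tj nj1 ..
    have zX: "z \<in> ?X" using z SX by blast
    have Ki: "K z = Y i (K z (n i)) (K z (n (Suc i)))" and Kj: "K z = Y j (K z (n j)) (K z (n (Suc j)))" using z by (simp_all add: S_def)
    \<comment> \<open>A point of both triangles has weight only at \<open>v\<close> and at the
      shared vertex \<open>n (Suc i)\<close>: its weight at \<open>n i\<close> vanishes as seen from
      \<open>\<tau> j\<close>, and its weight at the third vertex of \<open>\<tau> j\<close>
      vanishes as seen from \<open>\<tau> i\<close>. So it lies on the common edge.\<close>
    have ni: "n i \<notin> \<tau> j" using n_neq[of i] n_neq(3)[of i, symmetric] n_neq2[of i] by (simp add: tj mem_tau)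
    have 1: "K z (n i) = 0" by (rule trans[OF fun_cong[OF Kj] Y_vals(4)[OF ni]])
    have ni': "n (Suc (Suc i)) \<notin> \<tau> i" using n_neq[of "Suc i"] n_neq2[of i, symmetric] by (simp add: mem_tau)
    have 2: "K z (n (Suc j)) = 0" unfolding nj2 by (rule trans[OF fun_cong[OF Ki] Y_vals(4)[OF ni']])
    define t where "t = K z (n (Suc i))"
    have qi: "q i z = pt i 0 t" unfolding q_def 1 t_def ..
    have "\<kappa> j = \<kappa> (Suc i)" using tj by (simp add: \<kappa>_def)
    then have qj: "q j z = pt (Suc i) t 0" unfolding q_def 2 nj1 t_def by simp
    have "K z v = 1 - t" using Kv[OF z(1)] 1 by (simp add: t_def)
    then have t\<eta>: "t < \<eta>" using zX by (simp add: ball_v_def)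
    have "t \<noteq> 0" using q(1)[OF z(1)] by (auto simp: qi p0_def tri_pt_0)
    then have t: "0 < t" using K0[OF zX, of "n (Suc i)"] by (simp add: t_def)
    have tr: "piece (Suc i) (\<epsilon> (Suc i)) (pt (Suc i) t 0) = piece i (\<epsilon> i) (pt i 0 t)"
    proof -
      have "\<epsilon> (Suc i) * hol i = \<epsilon> i" using hol_cases[of i] by (auto simp: \<epsilon>_def)
      then show ?thesis using piece_transition[OF t t\<eta> e[of "Suc i"]] by simp
    qed
    \<comment> \<open>The assumption on the product enters here: for \<open>Suc i = N\<close> the
      accumulated sign has to be that of index 0, namely 1.\<close>
    have "piece (Suc i) (\<epsilon> (Suc i)) = piece j (\<epsilon> j)"
    proof (cases "Suc i = N")
      case True
      then have "j = 0" "\<epsilon> (Suc i) = 1" "\<epsilon> j = 1" using ij pr by (simp_all add: \<epsilon>_def)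
      then show ?thesis using piece_per(1)[of 0] True by simp
    next
      case False then show ?thesis using ij by simp
    qed
    then show ?thesis unfolding qi qj using tr by simp
  qed
  have agree: "piece i (\<epsilon> i) (q i z) = piece j (\<epsilon> j) (q j z)"
    if ij: "i \<in> {..<N}" "j \<in> {..<N}" and z: "z \<in> topspace (top_of_set ?X) \<inter> S i \<inter> S j" for i j z
  proof (cases "i = j")
    case False
    have zS: "z \<in> S i" "z \<in> S j" using z by auto
    have "(K z (n i), K z (n (Suc i))) \<noteq> (0, 0)" using q(1)[OF zS(1)] by (auto simp: q_def p0_def tri_pt_0)
    then obtain w where w: "w \<in> {n i, n (Suc i)}" "K z w \<noteq> 0" by auto
    have wv: "w \<noteq> v" using w(1) n_neq[of i] by auto
    have wi: "w \<in> \<tau> i" using w(1) by (auto simp: mem_tau)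
    have wj: "w \<in> \<tau> j"
    proof (rule ccontr)
      assume nw: "w \<notin> \<tau> j"
      have Kj: "K z = Y j (K z (n j)) (K z (n (Suc j)))" using zS(2) by (simp add: S_def)
      have "K z w = 0" by (rule trans[OF fun_cong[OF Kj] Y_vals(4)[OF nw]])
      then show False using w(2) by simp
    qed
    have ijN: "i < N" "j < N" using ij by simp_all
    show ?thesis
    proof (rule shared[OF ijN False wi wj wv])
      show ?thesis if "j = Suc i mod N" by (rule next_eq[OF ijN(1) that zS])
      show ?thesis if "i = Suc j mod N" by (rule next_eq[OF ijN(2) that zS(2,1), symmetric])
    qed
  qed simp
  obtain s where s: "continuous_map (top_of_set ?X) (total_space P) s"
    "\<And>z i. i \<in> {..<N} \<Longrightarrow> z \<in> topspace (top_of_set ?X) \<inter> S i \<Longrightarrow> s z = piece i (\<epsilon> i) (q i z)"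
    by (rule pasting_lemma_exists_closed[of "{..<N}" "top_of_set ?X" S "total_space P" "\<lambda>i z. piece i (\<epsilon> i) (q i z)"])
      (use cover closed cont agree in \<open>blast+\<close>)
  have "CC.has_framed_section P z0 ball_v s"
    unfolding CC.has_framed_section_def
  proof (intro conjI ballI ball_v(1,2) ball_v(3)[folded CC_img] s(1))
    fix z assume zX: "z \<in> ?X"
    then obtain i where i: "i < N" "z \<in> S i" using cover by auto
    have sz: "s z = piece i (\<epsilon> i) (q i z)" using s(2)[of i z] i zX by simp
    show "proj P (s z) = CC.\<psi> z"
      unfolding sz piece_facts(2)[OF q(1)[OF i(2)] e] q(2)[OF i(2)] using zX ball_v(3) by (subst CC_psi) auto
    show "framing P (s z) (pc c) = mat 1" unfolding sz by (rule piece_facts(3)[OF q(1)[OF i(2)] e])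
  qed
  from CC.section_imp_extends[OF spin this psi_z0] show ?thesis
    by (simp add: extends_to_vertex_def z0_facts(3))
qed

text \<open>By \<open>prod_rho\<close> the products of all \<open>hol i\<close> and of all
  \<open>wsgn i\<close> differ by the factor -1, which becomes the summand 1 in the
  exponent.\<close>

theorem extends_iff_prod_wsgn: "extends_to_vertex T v \<longleftrightarrow> (\<Prod>i<N. wsgn i) = -1"
proof -
  have "(\<Prod>i<N. hol i) = - (\<Prod>i<N. wsgn i)" by (simp add: hol_def prod.distrib prod_rho)
  then show ?thesis using prod_hol_if_extends extends_if_prod_hol by force
qed

end

context spin_star
begin

text \<open>The statement is free of the chart, the sector size and the lifts; the proof shows that
  they can be chosen. Sectors are convex, so lifts exist on them, and taking the lift with index
  \<open>i mod N\<close> makes the family periodic.\<close>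

theorem extends_iff_prod_edge_sign:
  "extends_to_vertex T v \<longleftrightarrow> (\<Prod>i<N. (if edge_start T {v, n (Suc i)} = v then -1 else 1) * (if \<kappa> i = 0 then -1 else 1) * edge_sign T {v, n (Suc i)}) = -1"
proof -
  obtain c where c: "c \<in> A" "xv \<in> fst c" using chart_exists[OF xv_in] by blast
  obtain \<eta> where eta: "0 < \<eta>" "\<eta> \<le> 1/2" "\<And>i z. z \<in> sec i \<eta> \<Longrightarrow> tri_param T (\<tau> i) z \<in> fst c"
    using good_radius[OF openin_chart_domain[OF c(1)] c(2)] by blast
  have sub: "sec i \<eta> \<subseteq> tdom c (\<tau> i)" for i using eta(3) by (auto simp: tdom_def sec_def)
  have "\<exists>H. continuous_map (top_of_set (sec i \<eta>)) GLt_top H \<and> (\<forall>z\<in>sec i \<eta>. fst (H z) = J c (\<tau> i) z)" for i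
  proof -
    obtain H where "continuous_map (top_of_set (sec i \<eta>)) GLt_top H" "\<And>z. z \<in> sec i \<eta> \<Longrightarrow> fst (H z) = J c (\<tau> i) z"
    proof (rule lift_exists)
      show "contractible (sec i \<eta>)" by (rule convex_imp_contractible[OF convex_sec])
      show "continuous_on (sec i \<eta>) (J c (\<tau> i))" by (rule continuous_on_subset[OF J_continuous[OF tau(1) c(1)] sub])
      show "0 < det (J c (\<tau> i) z)" if "z \<in> sec i \<eta>" for z using tri_smooth(2)[OF tau(1) c(1)] sub that by blast
    qed blast
    then show ?thesis by blast
  qed
  then obtain H0 where H0: "\<And>i. continuous_map (top_of_set (sec i \<eta>)) GLt_top (H0 i)"
    "\<And>i z. z \<in> sec i \<eta> \<Longrightarrow> fst (H0 i z) = J c (\<tau> i) z" by metis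
  have m: "\<tau> (i mod N) = \<tau> i" "sec (i mod N) r = sec i r" for i r by (simp_all add: \<tau>_def \<kappa>_def sec_def)
  have H1: "continuous_map (top_of_set (sec i \<eta>)) GLt_top (H0 (i mod N))" for i
    using H0(1)[of "i mod N"] by (simp add: m)
  have H2: "z \<in> sec i \<eta> \<Longrightarrow> fst (H0 (i mod N) z) = J c (\<tau> i) z" for i z
    using H0(2)[of z "i mod N"] by (simp add: m)
  interpret spin_star_lift T v \<sigma> N c \<eta> "\<lambda>i. H0 (i mod N)"
    by unfold_locales (use c eta H1 H2 in simp_all)
  show ?thesis using extends_iff_prod_wsgn unfolding wsgn_def .
qed

text \<open>\<open>\<kappa> i = 0\<close> says that \<open>v\<close> is the start of the preferred
  edge of its triangle in counterclockwise direction. The edge of \<open>\<sigma> i\<close> that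
  starts at \<open>v\<close> is the one shared with the preceding triangle, so the two families of
  signs count D and K.\<close>

theorem extends_iff_edge_signs:
  assumes e: "\<And>i. i < N \<Longrightarrow> e i = \<sigma> i \<inter> \<sigma> (Suc i mod N)"
    and D: "D = card {i. i < N \<and> d2 T 0 (\<sigma> i) = e ((i + N - 1) mod N)}"
    and K: "K = card {i. i < N \<and> edge_start T (e i) = v}"
  shows "extends_to_vertex T v \<longleftrightarrow> (\<Prod>i<N. edge_sign T (e i)) = (-1) ^ (D + K + 1)"
proof -
  have ei: "e i = {v, n (Suc i)}" if "i < N" for i
    using e[OF that] edge_eq[of i] that by (simp add: \<tau>_def)
  have d2: "d2 T 0 (\<sigma> i) = e ((i + N - 1) mod N) \<longleftrightarrow> \<kappa> i = 0" if i: "i < N" for i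
  proof -
    \<comment> \<open>The index before \<open>i\<close> in the cyclic order; adding N first keeps
      the subtraction of natural numbers from truncating at \<open>i = 0\<close>.\<close>
    define j where "j = (i + N - 1) mod N"
    have j: "j < N" using N_pos by (simp add: j_def)
    have "Suc (i + N - 1) = i + N" using N_pos by simp
    then have "Suc j mod N = i" using i by (simp add: j_def mod_Suc_eq)
    then have tj: "\<tau> (Suc j) = \<tau> i" using i by (simp add: \<tau>_def)
    have "e j = {v, nxt T (\<tau> i) v}" unfolding ei[OF j] by (simp add: n_def tj)
    moreover have "\<sigma> i = \<tau> i" using i by (simp add: \<tau>_def)
    ultimately have "d2 T 0 (\<sigma> i) = e j \<longleftrightarrow> vtx (\<tau> i) 0 = v" using d2_iff[OF tau, of 0 i] by simp
    also have "\<dots> \<longleftrightarrow> \<kappa> i = 0"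
      using kappa[of i] vtx_inj[OF tau(1), of 0 "\<kappa> i" i] by auto
    finally show ?thesis unfolding j_def .
  qed
  have sgn: "(\<Prod>i<N. if Q i then -1 else 1 :: int) = (-1) ^ card {i. i < N \<and> Q i}" for Q
  proof -
    have "(\<Prod>i<N. if Q i then -1 else 1 :: int) = (\<Prod>i\<in>{i \<in> {..<N}. Q i}. -1)"
      by (rule prod.inter_filter[symmetric]) simp
    then show ?thesis by simp
  qed
  have "(\<Prod>i<N. (if edge_start T {v, n (Suc i)} = v then -1 else 1) * (if \<kappa> i = 0 then -1 else 1) * edge_sign T {v, n (Suc i)}) =
    (\<Prod>i<N. (if edge_start T (e i) = v then -1 else 1) * (if d2 T 0 (\<sigma> i) = e ((i + N - 1) mod N) then -1 else 1) * edge_sign T (e i))"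
  proof (rule prod.cong[OF refl])
    fix i assume "i \<in> {..<N}"
    then have i: "i < N" by simp
    show "(if edge_start T {v, n (Suc i)} = v then -1 else 1) * (if \<kappa> i = 0 then -1 else 1) * edge_sign T {v, n (Suc i)} =
      (if edge_start T (e i) = v then -1 else 1) * (if d2 T 0 (\<sigma> i) = e ((i + N - 1) mod N) then -1 else 1) * edge_sign T (e i)"
      unfolding d2[OF i] ei[OF i] ..
  qed
  also have "\<dots> = (-1) ^ K * (-1) ^ D * (\<Prod>i<N. edge_sign T (e i))"
    unfolding prod.distrib sgn D K ..
  finally show ?thesis unfolding extends_iff_prod_edge_sign
    by (cases "even D"; cases "even K") (auto simp: minus_equation_iff)
qed

end

theorem corollary3p14:
  fixes T :: "('a, 'v, 'p) spin_surface"
    and v :: 'v and \<sigma> :: "nat \<Rightarrow> 'v set" and e :: "nat \<Rightarrow> 'v set" and N D K :: nat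
  assumes "punctured_spin_triangulated_surface T"
    and "v \<in> inner_vertices T"
    and "ccw_star T v \<sigma> N"
    and "\<And>i. i < N \<Longrightarrow> e i = \<sigma> i \<inter> \<sigma> (Suc i mod N)"
    and "D = card {i. i < N \<and> d2 T 0 (\<sigma> i) = e ((i + N - 1) mod N)}"
    and "K = card {i. i < N \<and> edge_start T (e i) = v}"
  shows "extends_to_vertex T v \<longleftrightarrow> (\<Prod>i<N. edge_sign T (e i)) = (-1) ^ (D + K + 1)"
proof -
  interpret spin_star T v \<sigma> N
    by unfold_locales (use assms(1-3) in simp_all)
  show ?thesis by (rule extends_iff_edge_signs[OF assms(4-6)])
qed

end
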